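(* Let $c\in\mathbb{R}$ be fixed and let $m=n(\log n+c)$. Let $\mathcal{D}(n,m)$ be a digraph chosen uniformly at random from all digraphs on vertex set $[n]$ with exactly $m$ edges, and let each of its edges independently be assigned a colour uniformly at random from a set of $(1+50\varepsilon)n$ colours, where $\varepsilon=\varepsilon(n)=\frac{\log\log n}{\log n}$. Then, as $n\to\infty$, $$\mathbb{P}\big(\mathcal{D}(n,m)\text{ has a rainbow arborescence}\big)=\left(1+e^{-c}+o(1)\right)e^{-e^{-c}}.$$
   Context: Digraphs on $[n]=\{1,\dots,n\}$ have edges that are ordered pairs $(u,v)$ with $u\ne v$ (no loops, no repeated edges; both $(u,v)$ and $(v,u)$ may be present). A digraph on $[n]$ "has a rainbow arborescence" if it contains as a subgraph a spanning arborescence (a directed rooted tree on all $n$ vertices in which all edges point away from the root) whose edges have pairwise different colours. The edge colours are independent of the digraph. $\log$ is the natural logarithm. Quantities such as $n(\log n+c)$ and $(1+50\varepsilon)n$ that must be integers are rounded up or down (either choice). *)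

theory Defs
  imports "HOL-Probability.Probability" "Graph_Theory.Digraph_Component"
begin

text \<open>
  Whether the underlying undirected graph is a tree.  Graph_Theory's \<open>tree\<close> only forbids
  directed cycles, so it is not usable here.  In the symmetric digraph \<open>mk_symmetric G\<close> each
  undirected edge yields a directed cycle of length 2, whereas the cycles of the
  underlying simple undirected graph are the directed cycles of length at least 3.
\<close>

definition underlying_tree :: "'a pair_pre_digraph \<Rightarrow> bool" where
  "underlying_tree G \<longleftrightarrow>
     Digraph_Component.connected (with_proj G) \<and>
     \<not> (\<exists>p. pre_digraph.cycle (with_proj (mk_symmetric (with_proj G))) p \<and> length p \<ge> 3)"

text \<open>
  An edge of a rooted tree points away from the root if the path of the underlying tree from
  the root to the head of the edge traverses the edge in its direction.  This also excludes
  loops and pairs of antiparallel edges, neither of which is visible to \<open>underlying_tree\<close>.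
\<close>

definition arborescence :: "'a pair_pre_digraph \<Rightarrow> 'a \<Rightarrow> bool" where
  "arborescence T r \<longleftrightarrow>
     underlying_tree T \<and> r \<in> pverts T \<and>
     (\<forall>e\<in>parcs T. \<forall>p.
        pre_digraph.apath (with_proj (mk_symmetric (with_proj T))) r p (snd e) \<longrightarrow> e \<in> set p)"

definition has_rainbow_arborescence :: "'a pair_pre_digraph \<Rightarrow> ('a \<times> 'a \<Rightarrow> 'c) \<Rightarrow> bool" where
  "has_rainbow_arborescence G col \<longleftrightarrow>
     (\<exists>T r. spanning (with_proj T) (with_proj G) \<and> arborescence T r \<and> inj_on col (parcs T))"

definition digraphs :: "nat \<Rightarrow> nat \<Rightarrow> nat pair_pre_digraph set" where
  "digraphs n m = {G. pair_digraph G \<and> pverts G = {1..n} \<and> card (parcs G) = m}"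

text \<open>
  The colour of a pair that is not an edge is the irrelevant default value 0.  If there is
  no digraph with \<open>m\<close> edges (\<open>m > n * (n - 1)\<close>) or no colour (\<open>q = 0\<close>), then the distribution
  is unspecified.
\<close>

definition random_coloured_digraph ::
    "nat \<Rightarrow> nat \<Rightarrow> nat \<Rightarrow> (nat pair_pre_digraph \<times> (nat \<times> nat \<Rightarrow> nat)) pmf" where
  "random_coloured_digraph n m q = do {
     G \<leftarrow> pmf_of_set (digraphs n m);
     col \<leftarrow> Pi_pmf (parcs G) 0 (\<lambda>_. pmf_of_set {1..q});
     return_pmf (G, col)
   }"

definition eps :: "nat \<Rightarrow> real" where
  "eps n = ln (ln (real n)) / ln (real n)"

end

(*
  A digraph with two vertices without incoming arc has no arborescence, and the number of such
  vertices is asymptotically Poisson with mean e^-c; this gives the upper bound.  By monotonicity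
  the uniform model can be replaced by the model in which every arc is present independently with
  probability p, (n-1) p = log n + c + o(1).

  For the lower bound the colours are split into a large class Q0 and two small classes U1, U2 of
  about 10 eps n colours each, and the digraph is a superposition of three independent layers
  coloured by Q0, U1 and U2.  The arcs of the Q0-layer are counted for Hall's condition: since Q0
  has about (1 + 30 eps) n colours, every vertex v which is not bare (has an incoming arc of this
  layer) can choose an arc (M v, v) such that the colours are distinct.  This step does not depend
  on the tails of the arcs: the in-neighbourhood of each v is subsequently permuted by a random
  member of a regular family of involutions, so the tails become independent and uniform, and
  v |-> tail is a random mapping.  The U1-layer provides a rainbow tree S of size about n / log n.
  Following the random mapping, all but polylogarithmically many vertices reach S; these
  exceptional vertices and the few bare vertices are attached by arcs of the U1- and U2-layers
  with distinct colours.
*)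
theory Submission
  imports Defs "HOL-Real_Asymp.Real_Asymp"
begin

section \<open>Arborescences and parent functions\<close>

text \<open>The obstacle is that Hall's theorem picks \<open>M v\<close> by looking at arcs and
  colours, so the tails \<open>M v\<close> have no usable law. For each fixed \<open>s\<close> the
  map \<open>shift s\<close> preserves the law of the layer, whereas for fixed \<open>M\<close> a
  uniform \<open>s v\<close> makes the new tail uniform; this resolves the conflict. The event to
  exclude is that there is no rainbow tree although at most one vertex lacks an incoming arc. A
  vertex bare in the \<open>Q0\<close>-layer may owe its only arc to either small layer, so both are
  exposed on bare heads first. Origin of the constants, with L = log n and M = log log n: each small
  layer has in-degree about 10 M, so the \<open>Q0\<close>-layer keeps about L - 20 M and has about
  L^20 bare vertices. A tree of n / L vertices is hit after about L steps of the random mapping, and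
  a path fails with probability of order L^2 / n, as in the birthday problem. About L^2 vertices are
  thus exceptional, and each misses the second small layer with probability at most L^(-6.3). For
  large sets Hall's condition gains a factor (n / |Q0|)^(L / 50), roughly L^(-0.6), per vertex, so a
  surplus of order eps n colours suffices.\<close>

text \<open>
  A coloured digraph on \<open>V\<close> is encoded as a partial colouring \<open>w\<close> of the pairs, where \<open>None\<close>
  marks an absent arc; the arborescence is given by the parent function of its non-root vertices.
\<close>

definition rainbow_tree :: "'a set \<Rightarrow> ('a \<times> 'a \<Rightarrow> 'c option) \<Rightarrow> bool" where
  "rainbow_tree V w \<longleftrightarrow> (\<exists>r\<in>V. \<exists>par.
     (\<forall>v\<in>V - {r}. par v \<in> V \<and> w (par v, v) \<noteq> None) \<and>
     inj_on (\<lambda>v. w (par v, v)) (V - {r}) \<and>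
     (\<forall>v\<in>V. \<exists>k. (par ^^ k) v = r))"

definition no_in_arc :: "'a set \<Rightarrow> ('a \<times> 'a \<Rightarrow> 'c option) \<Rightarrow> 'a set" where
  "no_in_arc V w = {v\<in>V. \<forall>u\<in>V - {v}. w (u, v) = None}"

lemma pcas_append: "pcas u (p @ q) v \<longleftrightarrow> (\<exists>w. pcas u p w \<and> pcas w q v)"
  by (induction p arbitrary: u) auto

text \<open>A walk ending in \<open>D\<close> has a first arc into \<open>D\<close>. It is applied
  to sets of descendants and their complements, whose boundary is a single tree edge.\<close>

lemma pcas_crossing:
  assumes "pcas u p v" "u \<notin> D" "v \<in> D"
  shows "\<exists>p1 a b p2. p = p1 @ (a, b) # p2 \<and> a \<notin> D \<and> b \<in> D"
  using assms
proof (induction p arbitrary: u)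
  case (Cons e p)
  show ?case
  proof (cases "snd e \<in> D")
    case True
    then show ?thesis using Cons.prems
      by (intro exI[of _ "[]"] exI[of _ "fst e"] exI[of _ "snd e"] exI[of _ p]) auto
  next
    case False
    then obtain p1 a b p2 where "p = p1 @ (a, b) # p2 \<and> a \<notin> D \<and> b \<in> D"
      using Cons.IH[of "snd e"] Cons.prems by auto
    then show ?thesis by (intro exI[of _ "e # p1"] exI[of _ a] exI[of _ b] exI[of _ p2]) auto
  qed
qed auto

lemma pawalk_verts_conv:
  "pcas u p v \<Longrightarrow> pawalk_verts u p = u # map snd p"
  by (induction p arbitrary: u) auto

lemma pawalk_verts_conv2:
  "pcas u p v \<Longrightarrow> pawalk_verts u p = map fst p @ [v]"
  by (induction p arbitrary: u) auto

lemma pcas_last: "pcas u p v \<Longrightarrow> p \<noteq> [] \<Longrightarrow> snd (last p) = v"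
  by (induction p arbitrary: u) auto

lemma sym_arcs:
  "parcs (mk_symmetric (with_proj T)) = {(a, b). (a, b) \<in> parcs T \<or> (b, a) \<in> parcs T}"
  by (auto simp: mk_symmetric_def)

lemma sym_verts: "pverts (mk_symmetric (with_proj T)) = pverts T"
  by (auto simp: mk_symmetric_def)

lemma awalk_sym:
  "pre_digraph.awalk (with_proj (mk_symmetric (with_proj T))) u p v \<longleftrightarrow>
     u \<in> pverts T \<and> set p \<subseteq> {(a, b). (a, b) \<in> parcs T \<or> (b, a) \<in> parcs T} \<and> pcas u p v"
  by (simp add: pre_digraph.awalk_def cas_with_proj_eq sym_arcs sym_verts)

text \<open>Each tree edge is the only edge between a set of descendants and the rest. Acyclicity
  and orientation thus become statements about walks crossing one cut: a cycle would have to return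
  through the same edge, and a path from the root must traverse it downwards.\<close>

lemma arborescence_of_parent:
  fixes par :: "'a \<Rightarrow> 'a"
  assumes r: "r \<in> V" and parV: "\<And>v. v \<in> V - {r} \<Longrightarrow> par v \<in> V"
    and reach: "\<And>v. v \<in> V \<Longrightarrow> \<exists>k. (par ^^ k) v = r"
  defines "T \<equiv> \<lparr>pverts = V, parcs = (\<lambda>v. (par v, v)) ` (V - {r})\<rparr>"
  shows "arborescence T r"
proof -
  \<comment> \<open>The value of \<open>par\<close> at the root is arbitrary; making
    \<open>r\<close> a fixed point lets every orbit end there.\<close>
  define f where "f = par(r := r)"
  have fr: "(f ^^ k) r = r" for k
    by (induction k) (auto simp: f_def)
  have reachf: "\<exists>k. (f ^^ k) v = r" if "(par ^^ k) v = r" for k v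
    using that
  proof (induction k arbitrary: v)
    case 0
    then show ?case by (intro exI[of _ 0]) auto
  next
    case (Suc k)
    show ?case
    proof (cases "v = r")
      case True
      then show ?thesis by (intro exI[of _ 0]) auto
    next
      case False
      have "(par ^^ k) (f v) = r" using Suc.prems False
        by (simp add: f_def funpow_swap1)
      then obtain j where "(f ^^ j) (f v) = r" using Suc.IH by blast
      then have "(f ^^ Suc j) v = r" by (simp add: funpow_swap1)
      then show ?thesis by blast
    qed
  qed
  let ?S = "mk_symmetric (with_proj T)"
  let ?A = "{(a, b). (a, b) \<in> parcs T \<or> (b, a) \<in> parcs T}"
  have arcsf: "(a, b) \<in> parcs T \<longleftrightarrow> b \<in> V - {r} \<and> a = f b" for a b
    by (auto simp: T_def f_def)
  have fV: "f v \<in> V" if "v \<in> V" for v using that parV r by (auto simp: f_def)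
  \<comment> \<open>\<open>D v\<close> is the set of descendants of \<open>v\<close>. By
    \<open>cross\<close> and \<open>cross'\<close> below, its only boundary edge joins
    \<open>v\<close> and \<open>f v\<close>.\<close>
  define D where "D v = {x. \<exists>j. (f ^^ j) x = v}" for v
  have DI: "v \<in> D v" for v unfolding D_def by (auto intro: exI[of _ 0])
  have Dstep: "a \<in> D v \<longleftrightarrow> a = v \<or> f a \<in> D v" for a v
  proof
    assume "a \<in> D v"
    then obtain j where "(f ^^ j) a = v" by (auto simp: D_def)
    then show "a = v \<or> f a \<in> D v"
      by (cases j) (auto simp: D_def funpow_swap1)
  next
    assume "a = v \<or> f a \<in> D v"
    then show "a \<in> D v"
    proof
      assume "f a \<in> D v"
      then obtain j where "(f ^^ j) (f a) = v" by (auto simp: D_def)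
      then have "(f ^^ Suc j) a = v" by (simp add: funpow_swap1)
      then show ?thesis unfolding D_def by blast
    qed (auto simp: DI)
  qed
  have rD: "r \<notin> D v" if "v \<noteq> r" for v
    using that fr by (auto simp: D_def)
  \<comment> \<open>Otherwise \<open>v\<close> is periodic under \<open>f\<close>, while its orbit
    is absorbed by the fixed point \<open>r\<close> after \<open>k\<close> steps;
    \<open>Suc j * k\<close> is a multiple of the period and at least \<open>k\<close>.\<close>
  have parD: "f v \<notin> D v" if v: "v \<in> V" "v \<noteq> r" for v
  proof
    assume "f v \<in> D v"
    then obtain j where "(f ^^ j) (f v) = v" by (auto simp: D_def)
    then have per: "(f ^^ Suc j) v = v" by (simp add: funpow_swap1)
    obtain k where k: "(f ^^ k) v = r" using reach reachf v by blast
    have e0: "((f ^^ Suc j) ^^ i) v = v" for i by (induction i) (use per in auto)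
    have e: "(f ^^ (Suc j * i)) v = v" for i using e0[of i] by (metis funpow_mult mult.commute)
    have "Suc j * k = (Suc j * k - k) + k" by simp
    then have "(f ^^ (Suc j * k)) v = (f ^^ (Suc j * k - k)) ((f ^^ k) v)"
      by (metis funpow_add comp_apply)
    then have "(f ^^ (Suc j * k)) v = r" unfolding k fr .
    then show False using e[of k] v(2) by metis
  qed
  have cross: "a = f v \<and> b = v" if "(a, b) \<in> ?A" "a \<notin> D v" "b \<in> D v" for a b v
    using that arcsf Dstep[of a v] Dstep[of b v] by auto
  have cross': "a = v \<and> b = f v" if "(a, b) \<in> ?A" "a \<in> D v" "b \<notin> D v" for a b v
    using that arcsf Dstep[of a v] Dstep[of b v] by auto
  have conn: "Digraph_Component.connected (with_proj T)"
    unfolding connected_def strongly_connected_def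
  proof (intro conjI ballI)
    show "verts (with_proj ?S) \<noteq> {}" using r by (auto simp: sym_verts T_def)
  next
    have A: "(x, r) \<in> rtrancl_on V ?A" "(r, x) \<in> rtrancl_on V ?A" if x: "x \<in> V" for x
    proof -
      obtain k where "(f ^^ k) x = r" using reach reachf x by blast
      then have "(x, r) \<in> rtrancl_on V ?A \<and> (r, x) \<in> rtrancl_on V ?A" using x
      proof (induction k arbitrary: x)
        case 0
        then show ?case using r by (auto intro: rtrancl_on_refl)
      next
        case (Suc k)
        show ?case
        proof (cases "x = r")
          case False
          have ih: "(f x, r) \<in> rtrancl_on V ?A \<and> (r, f x) \<in> rtrancl_on V ?A"
            using Suc fV by (simp add: funpow_swap1)
          have "(x, f x) \<in> ?A" "(f x, x) \<in> ?A" using False Suc.prems arcsf by auto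
          then show ?thesis using ih Suc.prems fV
            by (meson rtrancl_on_trans converse_rtrancl_on_into_rtrancl_on rtrancl_on_into_rtrancl_on)
        qed (use r in \<open>auto intro: rtrancl_on_refl\<close>)
      qed
      then show "(x, r) \<in> rtrancl_on V ?A" "(r, x) \<in> rtrancl_on V ?A" by auto
    qed
    fix u v assume "u \<in> verts (with_proj ?S)" "v \<in> verts (with_proj ?S)"
    then have "u \<in> V" "v \<in> V" by (auto simp: sym_verts T_def)
    then have "(u, v) \<in> rtrancl_on V ?A" using A by (meson rtrancl_on_trans)
    then show "u \<rightarrow>\<^sup>*\<^bsub>with_proj ?S\<^esub> v"
      unfolding reachable_def by (simp add: sym_verts sym_arcs T_def)
  qed
  have nocyc: False
    if cyc: "pre_digraph.cycle (with_proj ?S) p" and len: "length p \<ge> 3" for p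
  proof -
    obtain u where w: "set p \<subseteq> ?A" "pcas u p u" and d: "distinct (tl (pawalk_verts u p))"
      using cyc unfolding pre_digraph.cycle_def awalk_sym awalk_verts_with_proj_eq by blast
    obtain e p' where p: "p = e # p'" using len by (cases p) auto
    then obtain v where e: "e = (u, v)" and pv: "pcas v p' u" using w by (cases e) auto
    have dist: "distinct (v # map snd p')" using d p e pawalk_verts_conv[OF pv] by simp
    have eA: "(u, v) \<in> ?A" using w p e by auto
    have p'A: "set p' \<subseteq> ?A" using w p by auto
    \<comment> \<open>The first arc (u, v) of the cycle crosses the boundary of the descendant set
      of its child endpoint. The rest of the cycle must cross back, and only (u, v) and (v, u) lie
      on that boundary.\<close>
    have "\<exists>p1 p2. p' = p1 @ (v, u) # p2 \<or> p' = p1 @ (u, v) # p2"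
    proof (cases "(u, v) \<in> parcs T")
      case True
      then have uv: "u = f v" "v \<in> V" "v \<noteq> r" using arcsf by auto
      have "v \<notin> - D v" "u \<in> - D v" using uv parD DI by auto
      from pcas_crossing[OF pv this] obtain p1 a b p2
        where x: "p' = p1 @ (a, b) # p2" "a \<in> D v" "b \<notin> D v" by auto
      have "(a, b) \<in> ?A" using p'A unfolding x(1) by simp
      then have "a = v \<and> b = u" using cross' x uv by blast
      then show ?thesis using x(1) by blast
    next
      case False
      then have uv: "v = f u" "u \<in> V" "u \<noteq> r" using arcsf eA by auto
      have "v \<notin> D u" "u \<in> D u" using uv parD DI by auto
      from pcas_crossing[OF pv this] obtain p1 a b p2
        where x: "p' = p1 @ (a, b) # p2" "a \<notin> D u" "b \<in> D u" by auto
      have "(a, b) \<in> ?A" using p'A unfolding x(1) by simp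
      then have "a = v \<and> b = u" using cross x uv by blast
      then show ?thesis using x(1) by blast
    qed
    then obtain p1 a b p2 where x: "p' = p1 @ (a, b) # p2" and ab: "(a = v \<and> b = u) \<or> (a = u \<and> b = v)"
      by blast
    \<comment> \<open>Distinctness of the visited vertices excludes a second visit to
      \<open>v\<close>, and then leaves nothing before or after (v, u), so the cycle has length
      2.\<close>
    have b: "b \<noteq> v" using dist x by auto
    then have ab: "a = v" "b = u" using ab by auto
    have "pcas v p1 a" using pv x by (auto simp: pcas_append)
    then have "p1 = []" using dist x ab pcas_last[of v p1 a] by (cases p1 rule: rev_cases) auto
    moreover have "pcas b p2 u" using pv x by (auto simp: pcas_append)
    then have "p2 = []" using dist x ab pcas_last[of b p2 u] by (cases p2 rule: rev_cases) auto
    ultimately show False using x p len by simp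
  qed
  have away: "e \<in> set p" if ep: "e \<in> parcs T" "pre_digraph.apath (with_proj ?S) r p (snd e)" for e p
  proof -
    obtain v where e: "e = (f v, v)" "v \<in> V - {r}" using ep(1) arcsf by (cases e) auto
    have w: "set p \<subseteq> ?A" "pcas r p v"
      using ep(2) e unfolding pre_digraph.apath_def awalk_sym by auto
    from pcas_crossing[OF w(2), of "D v"] obtain p1 a b p2
      where "p = p1 @ (a, b) # p2 \<and> a \<notin> D v \<and> b \<in> D v" using rD DI e by auto
    then show ?thesis using w cross[of a b v] e by auto
  qed
  show ?thesis unfolding arborescence_def underlying_tree_def
    using conn nocyc away r by (auto simp: T_def)
qed

text \<open>Without an arc into \<open>v\<close>, a path from \<open>r\<close> to \<open>v\<close>
  in the symmetric digraph ends by reversing an arc (v, x). Dropping this step gives a path to the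
  head \<open>x\<close> of that arc, which must traverse (v, x) and hence visits \<open>v\<close>
  too early.\<close>

lemma arborescence_head_unique:
  assumes arb: "arborescence T r" and wf: "\<And>a b. (a, b) \<in> parcs T \<Longrightarrow> a \<in> pverts T \<and> b \<in> pverts T"
    and v: "v \<in> pverts T" "v \<noteq> r"
  shows "\<exists>u. (u, v) \<in> parcs T"
proof (rule ccontr)
  assume no: "\<not> (\<exists>u. (u, v) \<in> parcs T)"
  let ?S = "mk_symmetric (with_proj T)"
  let ?A = "{(a, b). (a, b) \<in> parcs T \<or> (b, a) \<in> parcs T}"
  interpret S: wf_digraph "with_proj ?S"
    using wf by unfold_locales (auto simp: sym_arcs sym_verts)
  have "r \<in> pverts T" using arb by (simp add: arborescence_def)
  moreover have "Digraph_Component.connected (with_proj T)"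
    using arb by (simp add: arborescence_def underlying_tree_def)
  ultimately have "r \<rightarrow>\<^sup>*\<^bsub>with_proj ?S\<^esub> v" using v
    by (auto simp: connected_def strongly_connected_def sym_verts)
  then obtain p where "pre_digraph.apath (with_proj ?S) r p v"
    using S.reachable_apath by blast
  then have w: "set p \<subseteq> ?A" "pcas r p v" "distinct (pawalk_verts r p)" "r \<in> pverts T"
    unfolding pre_digraph.apath_def awalk_sym awalk_verts_with_proj_eq by auto
  obtain p' e where p: "p = p' @ [e]" using w v by (cases p rule: rev_cases) auto
  obtain x where e: "e = (x, v)" and p': "pcas r p' x" using w p by (cases e) (auto simp: pcas_append)
  have xv: "(v, x) \<in> parcs T" using w p e no by auto
  have "distinct (map fst p @ [v])" using w pawalk_verts_conv2 by metis
  then have nv: "v \<notin> fst ` set p'" and dist: "distinct (map fst p' @ [x])"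
    using p e by auto
  have "pre_digraph.apath (with_proj ?S) r p' x"
    unfolding pre_digraph.apath_def awalk_sym awalk_verts_with_proj_eq
    using w p p' dist pawalk_verts_conv2[OF p'] by auto
  then have "(v, x) \<in> set p'" using arb xv unfolding arborescence_def by (metis snd_conv)
  then show False using nv by force
qed

lemma has_rainbow_arborescence_if_rainbow_tree:
  assumes G: "pair_wf_digraph G"
    and rt: "rainbow_tree (pverts G) (\<lambda>a. if a \<in> parcs G then Some (col a) else None)"
  shows "has_rainbow_arborescence G col"
proof -
  interpret pair_wf_digraph G by fact
  obtain r par where r: "r \<in> pverts G" and p: "\<And>v. v \<in> pverts G - {r} \<Longrightarrow> par v \<in> pverts G"
    "\<And>v. v \<in> pverts G - {r} \<Longrightarrow> (par v, v) \<in> parcs G"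
    and inj: "inj_on (\<lambda>v. if (par v, v) \<in> parcs G then Some (col (par v, v)) else None) (pverts G - {r})"
    and k: "\<And>v. v \<in> pverts G \<Longrightarrow> \<exists>k. (par ^^ k) v = r"
  proof -
    obtain r par where *: "r \<in> pverts G"
      "\<forall>v\<in>pverts G - {r}. par v \<in> pverts G \<and> (if (par v, v) \<in> parcs G then Some (col (par v, v)) else None) \<noteq> None"
      "inj_on (\<lambda>v. if (par v, v) \<in> parcs G then Some (col (par v, v)) else None) (pverts G - {r})"
      "\<forall>v\<in>pverts G. \<exists>k. (par ^^ k) v = r"
      using rt unfolding rainbow_tree_def by blast
    show thesis
      by (rule that[of r par]) (use * in \<open>auto split: if_splits\<close>)
  qed
  define T where "T = \<lparr>pverts = pverts G, parcs = (\<lambda>v. (par v, v)) ` (pverts G - {r})\<rparr>"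
  have "arborescence T r" unfolding T_def by (rule arborescence_of_parent) (use r p k in auto)
  moreover have "spanning (with_proj T) (with_proj G)"
    unfolding spanning_def subgraph_def compatible_def wf_digraph_def
    using p wellformed' by (auto simp: T_def)
  moreover have "inj_on col (parcs T)"
    using inj p by (auto simp: T_def inj_on_def)
  ultimately show ?thesis unfolding has_rainbow_arborescence_def by blast
qed

text \<open>Only the root can lack an incoming arc. This necessary condition yields the upper bound
  for the probability.\<close>

lemma card_no_in_arc_le_1:
  assumes G: "pair_digraph G" and h: "has_rainbow_arborescence G col"
  shows "card (no_in_arc (pverts G) (\<lambda>a. if a \<in> parcs G then Some (col a) else None)) \<le> 1"
proof -
  interpret pair_digraph G by fact
  obtain T r where T: "spanning (with_proj T) (with_proj G)" "arborescence T r"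
    using h unfolding has_rainbow_arborescence_def by blast
  have sub: "pverts T = pverts G" "parcs T \<subseteq> parcs G"
    using T(1) by (auto simp: spanning_def subgraph_def)
  have "no_in_arc (pverts G) (\<lambda>a. if a \<in> parcs G then Some (col a) else None) \<subseteq> {r}"
  proof
    fix v assume v: "v \<in> no_in_arc (pverts G) (\<lambda>a. if a \<in> parcs G then Some (col a) else None)"
    show "v \<in> {r}"
    proof (rule ccontr)
      assume "v \<notin> {r}"
      then obtain u where u: "(u, v) \<in> parcs T"
        using arborescence_head_unique[OF T(2), of v] sub v wellformed'
        unfolding no_in_arc_def by (metis (no_types, lifting) mem_Collect_eq singletonI subsetD)
      then have uv: "(u, v) \<in> parcs G" using sub by blast
      then have "u \<in> pverts G" "u \<noteq> v" using wellformed' no_loops' by blast+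
      moreover have "\<forall>u\<in>pverts G - {v}. (u, v) \<notin> parcs G"
        using v unfolding no_in_arc_def by (auto split: if_splits)
      ultimately show False using uv by blast
    qed
  qed
  then show ?thesis using card_mono[of "{r}"] by simp
qed

section \<open>Probability tools\<close>

text \<open>Hall's theorem by the Halmos-Vaughan induction: either a proper nonempty subset is tight
  and the problem splits there, or every such subset has a spare element and the choice for one
  index may be fixed arbitrarily.\<close>

theorem hall:
  fixes A :: "'a \<Rightarrow> 'b set"
  assumes "finite I" "\<And>i. i \<in> I \<Longrightarrow> finite (A i)"
    and "\<And>S. S \<subseteq> I \<Longrightarrow> card S \<le> card (\<Union>(A ` S))"
  shows "\<exists>f. inj_on f I \<and> (\<forall>i\<in>I. f i \<in> A i)"
  using assms
proof (induction "card I" arbitrary: I A rule: less_induct)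
  case less
  show ?case
  proof (cases "I = {}")
    case False
    then obtain i where i: "i \<in> I" by blast
    show ?thesis
    proof (cases "\<exists>S. S \<subset> I \<and> S \<noteq> {} \<and> card (\<Union>(A ` S)) \<le> card S")
      case True
      then obtain S where S: "S \<subset> I" "S \<noteq> {}" "card (\<Union>(A ` S)) \<le> card S" by blast
      have finS: "finite S" using S less.prems(1) by (meson finite_subset psubset_imp_subset)
      have finU: "finite (\<Union>(A ` T))" if "T \<subseteq> I" for T
        using that less.prems by (meson finite_UN_I finite_subset subsetD)
      have "\<exists>f. inj_on f S \<and> (\<forall>i\<in>S. f i \<in> A i)"
      proof (rule less.hyps)
        show "card S < card I" using S less.prems(1) by (simp add: psubset_card_mono)
      qed (use S less.prems finS in auto)
      then obtain f where f: "inj_on f S" "\<forall>i\<in>S. f i \<in> A i" by blast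
      \<comment> \<open>Deleting the values available to \<open>S\<close> preserves Hall's
        condition: apply it to \<open>T \<union> S\<close> and use that \<open>S\<close> is
        tight.\<close>
      have "\<exists>g. inj_on g (I - S) \<and> (\<forall>i\<in>I - S. g i \<in> A i - \<Union>(A ` S))"
      proof (rule less.hyps)
        have "I - S \<subset> I" using S by auto
        then show "card (I - S) < card I" using less.prems(1) by (rule psubset_card_mono[rotated])
        fix T assume T: "T \<subseteq> I - S"
        have finT: "finite T" using T less.prems(1) finite_subset by blast
        have "card T + card S = card (T \<union> S)"
          using T finS finT by (subst card_Un_disjoint) auto
        also have "\<dots> \<le> card (\<Union>(A ` (T \<union> S)))" using T S by (intro less.prems) auto
        also have "\<Union>(A ` (T \<union> S)) = (\<Union>i\<in>T. A i - \<Union>(A ` S)) \<union> \<Union>(A ` S)" by auto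
        also have "card \<dots> \<le> card (\<Union>i\<in>T. A i - \<Union>(A ` S)) + card (\<Union>(A ` S))"
          by (rule card_Un_le)
        finally show "card T \<le> card (\<Union>i\<in>T. A i - \<Union>(A ` S))" using S by linarith
      qed (use less.prems in auto)
      then obtain g where g: "inj_on g (I - S)" "\<forall>i\<in>I - S. g i \<in> A i - \<Union>(A ` S)" by blast
      define h where "h i = (if i \<in> S then f i else g i)" for i
      have ne: "f a \<noteq> g b" if "a \<in> S" "b \<in> I - S" for a b
        using f g that by (metis Diff_iff UN_I)
      have "inj_on h I"
      proof (rule inj_onI)
        fix x y assume "x \<in> I" "y \<in> I" "h x = h y"
        then show "x = y" using f(1) g(1) ne[of x y] ne[of y x] unfolding h_def
          by (cases "x \<in> S"; cases "y \<in> S") (auto dest: inj_onD)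
      qed
      then show ?thesis using f g by (intro exI[of _ h]) (auto simp: h_def)
    next
      case noS: False
      have "card {i} \<le> card (\<Union>(A ` {i}))" using i by (intro less.prems) auto
      then obtain x where x: "x \<in> A i" by fastforce
      have "\<exists>f. inj_on f (I - {i}) \<and> (\<forall>j\<in>I - {i}. f j \<in> A j - {x})"
      proof (rule less.hyps)
        show "card (I - {i}) < card I" using i less.prems(1) by (rule card_Diff1_less[rotated])
        fix T assume T: "T \<subseteq> I - {i}"
        show "card T \<le> card (\<Union>j\<in>T. A j - {x})"
        proof (cases "T = {}")
          case False
          then have "card T < card (\<Union>(A ` T))" using noS T i by (auto simp: not_le)
          moreover have "(\<Union>j\<in>T. A j - {x}) = \<Union>(A ` T) - {x}" by auto
          ultimately show ?thesis by (auto simp: card_Diff_singleton_if)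
        qed auto
      qed (use less.prems in auto)
      then obtain f where f: "inj_on f (I - {i})" "\<forall>j\<in>I - {i}. f j \<in> A j - {x}" by blast
      have "inj_on (f(i := x)) I"
        using f by (intro inj_onI) (auto simp: inj_on_def split: if_splits)
      then show ?thesis using f x by (intro exI[of _ "f(i := x)"]) auto
    qed
  qed auto
qed

lemma prob_bind_pmf:
  "measure_pmf.prob (bind_pmf p F) E = (\<integral>x. measure_pmf.prob (F x) E \<partial>measure_pmf p)"
proof -
  have "ennreal (measure_pmf.prob (bind_pmf p F) E) = (\<integral>\<^sup>+x. ennreal (measure_pmf.prob (F x) E) \<partial>measure_pmf p)"
    by (simp flip: measure_pmf.emeasure_eq_measure)
  also have "\<dots> = ennreal (\<integral>x. measure_pmf.prob (F x) E \<partial>measure_pmf p)"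
    by (intro nn_integral_eq_integral measure_pmf.integrable_const_bound[where B = 1]) auto
  finally show ?thesis by (simp add: integral_nonneg_AE)
qed

text \<open>Exposure in stages: the failure probability of one stage is added to a bound that is
  uniform over its good outcomes. The lower bound iterates this rule.\<close>

lemma prob_bind_le:
  assumes "\<And>x. x \<in> set_pmf p \<Longrightarrow> \<not> B x \<Longrightarrow> measure_pmf.prob (F x) E \<le> c" "c \<ge> 0"
  shows "measure_pmf.prob (bind_pmf p F) E \<le> measure_pmf.prob p {x. B x} + c"
proof -
  have "measure_pmf.prob (bind_pmf p F) E = (\<integral>x. measure_pmf.prob (F x) E \<partial>measure_pmf p)"
    by (rule prob_bind_pmf)
  also have "\<dots> \<le> (\<integral>x. indicator {x. B x} x + c \<partial>measure_pmf p)"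
  proof (rule integral_mono_AE)
    show "integrable (measure_pmf p) (\<lambda>x. measure_pmf.prob (F x) E)"
      by (rule measure_pmf.integrable_const_bound[where B = 1]) auto
    show "integrable (measure_pmf p) (\<lambda>x. indicator {x. B x} x + c)"
      by (rule measure_pmf.integrable_const_bound[where B = "1 + c"])
         (use assms(2) in \<open>auto simp: indicator_def\<close>)
    show "AE x in measure_pmf p. measure_pmf.prob (F x) E \<le> indicator {x. B x} x + c"
    proof (rule AE_pmfI)
      fix x assume "x \<in> set_pmf p"
      then show "measure_pmf.prob (F x) E \<le> indicator {x. B x} x + c"
        using assms measure_pmf.prob_le_1[of "F x" E] by (cases "B x") (auto simp: indicator_def add_increasing2)
    qed
  qed
  also have "\<dots> = measure_pmf.prob p {x. B x} + c"
    by (subst Bochner_Integration.integral_add) (auto simp: measure_pmf.emeasure_eq_measure)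
  finally show ?thesis .
qed

lemma prob_union_le:
  assumes "finite I"
  shows "measure_pmf.prob p {x. \<exists>i\<in>I. Q i x} \<le> (\<Sum>i\<in>I. measure_pmf.prob p {x. Q i x})"
proof -
  have "{x. \<exists>i\<in>I. Q i x} = (\<Union>i\<in>I. {x. Q i x})" by auto
  then show ?thesis using measure_pmf.finite_measure_subadditive_finite[OF assms, of "\<lambda>i. {x. Q i x}" p] by simp
qed

lemma prob_disj_le:
  "measure_pmf.prob p {x. Q x \<or> R x} \<le> measure_pmf.prob p {x. Q x} + measure_pmf.prob p {x. R x}"
  using measure_Un_le[of "{x. Q x}" "measure_pmf p" "{x. R x}"] by (simp add: Collect_disj_eq)

lemma prob_mono:
  assumes "\<And>x. x \<in> set_pmf p \<Longrightarrow> Q x \<Longrightarrow> R x"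
  shows "measure_pmf.prob p {x. Q x} \<le> measure_pmf.prob p {x. R x}"
  by (rule measure_pmf.finite_measure_mono_AE) (use assms in \<open>auto intro!: AE_pmfI\<close>)

lemma prob_card_markov:
  assumes "finite V" "t > 0"
  shows "measure_pmf.prob p {x. real (card {v\<in>V. Q v x}) \<ge> t}
    \<le> (\<Sum>v\<in>V. measure_pmf.prob p {x. Q v x}) / t"
proof -
  have bd: "real (card {v\<in>V. Q v x}) = (\<Sum>v\<in>V. indicator {x. Q v x} x)" for x
  proof -
    have "real (card {v\<in>V. Q v x}) = (\<Sum>v\<in>{v\<in>V. Q v x}. 1)" by simp
    also have "\<dots> = (\<Sum>v\<in>V. if Q v x then 1 else 0)" by (rule sum.inter_filter[OF assms(1)])
    also have "\<dots> = (\<Sum>v\<in>V. indicator {x. Q v x} x)" by (intro sum.cong) (auto simp: indicator_def)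
    finally show ?thesis .
  qed
  have int: "integrable (measure_pmf p) (\<lambda>x. (\<Sum>v\<in>V. indicator {x. Q v x} x) :: real)"
    by (intro Bochner_Integration.integrable_sum) (auto simp: measure_pmf.emeasure_eq_measure)
  have "measure_pmf.prob p {x \<in> space (measure_pmf p). (\<Sum>v\<in>V. indicator {x. Q v x} x) \<ge> t}
     \<le> (\<integral>x. (\<Sum>v\<in>V. indicator {x. Q v x} x) \<partial>measure_pmf p) / t"
    by (rule integral_Markov_inequality_measure[where A = "{}"])
       (use int assms in \<open>auto intro!: sum_nonneg\<close>)
  also have "(\<integral>x. (\<Sum>v\<in>V. indicator {x. Q v x} x) \<partial>measure_pmf p) = (\<Sum>v\<in>V. measure_pmf.prob p {x. Q v x})"
    by (subst Bochner_Integration.integral_sum) (auto simp: measure_pmf.emeasure_eq_measure)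
  finally show ?thesis by (simp add: bd)
qed

lemma prob_pair_pmf_times:
  "measure_pmf.prob (pair_pmf M N) {(x, y). Q x \<and> R y} = measure_pmf.prob M {x. Q x} * measure_pmf.prob N {y. R y}"
proof -
  have "measure_pmf.prob (pair_pmf M N) {(x, y). Q x \<and> R y}
      = measure_pmf.prob (pair_pmf M N) (({x. Q x} \<inter> set_pmf M) \<times> ({y. R y} \<inter> set_pmf N))"
    by (rule measure_pmf.finite_measure_eq_AE) (auto intro!: AE_pmfI)
  also have "\<dots> = measure_pmf.prob M ({x. Q x} \<inter> set_pmf M) * measure_pmf.prob N ({y. R y} \<inter> set_pmf N)"
    by (rule measure_pmf_prob_product) auto
  finally show ?thesis by (simp add: measure_Int_set_pmf)
qed

lemma prob_Pi_pmf_subset: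
  assumes "finite A" "B \<subseteq> A" "\<And>f g. (\<forall>x\<in>B. f x = g x) \<Longrightarrow> Q f = Q g"
  shows "measure_pmf.prob (Pi_pmf A d p) {f. Q f} = measure_pmf.prob (Pi_pmf B d p) {f. Q f}"
proof -
  have "Q (\<lambda>x. if x \<in> B then f x else d) = Q f" for f by (rule assms(3)) auto
  then show ?thesis
    by (subst Pi_pmf_subset[OF assms(1,2)]) (simp add: vimage_def)
qed

lemma prob_Pi_pmf_Un:
  assumes "finite A" "finite B" "A \<inter> B = {}"
    "\<And>f g. (\<forall>x\<in>A. f x = g x) \<Longrightarrow> Q f = Q g" "\<And>f g. (\<forall>x\<in>B. f x = g x) \<Longrightarrow> R f = R g"
  shows "measure_pmf.prob (Pi_pmf (A \<union> B) d p) {f. Q f \<and> R f}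
    = measure_pmf.prob (Pi_pmf A d p) {f. Q f} * measure_pmf.prob (Pi_pmf B d p) {f. R f}"
proof -
  have 1: "Q (\<lambda>x. if x \<in> A then f x else g x) = Q f" for f g by (rule assms(4)) auto
  have 2: "R (\<lambda>x. if x \<in> A then f x else g x) = R g" for f g by (rule assms(5)) (use assms(3) in auto)
  have "measure_pmf.prob (Pi_pmf (A \<union> B) d p) {f. Q f \<and> R f}
     = measure_pmf.prob (pair_pmf (Pi_pmf A d p) (Pi_pmf B d p)) {(f, g). Q f \<and> R g}"
    by (subst Pi_pmf_union[OF assms(1-3)]) (auto simp: vimage_def 1 2 case_prod_unfold)
  also note prob_pair_pmf_times
  finally show ?thesis .
qed

lemma prob_Pi_pmf_blocks:
  assumes "finite I" "\<And>i. i \<in> I \<Longrightarrow> finite (C i)" "disjoint_family_on C I"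
    "\<And>i f g. i \<in> I \<Longrightarrow> (\<forall>x\<in>C i. f x = g x) \<Longrightarrow> Q i f = Q i g"
  shows "measure_pmf.prob (Pi_pmf (\<Union>i\<in>I. C i) d p) {f. \<forall>i\<in>I. Q i f}
    = (\<Prod>i\<in>I. measure_pmf.prob (Pi_pmf (C i) d p) {f. Q i f})"
  using assms
proof (induction I rule: finite_induct)
  case empty
  show ?case by simp
next
  case (insert i I)
  have d: "C i \<inter> (\<Union>i\<in>I. C i) = {}" using insert by (force simp: disjoint_family_on_def)
  have "measure_pmf.prob (Pi_pmf (\<Union>i\<in>insert i I. C i) d p) {f. \<forall>i\<in>insert i I. Q i f}
     = measure_pmf.prob (Pi_pmf (C i \<union> (\<Union>i\<in>I. C i)) d p) {f. Q i f \<and> (\<forall>i\<in>I. Q i f)}" by simp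
  also have "\<dots> = measure_pmf.prob (Pi_pmf (C i) d p) {f. Q i f} * measure_pmf.prob (Pi_pmf (\<Union>i\<in>I. C i) d p) {f. \<forall>i\<in>I. Q i f}"
  proof (rule prob_Pi_pmf_Un[where Q = "Q i" and R = "\<lambda>f. \<forall>i\<in>I. Q i f", OF _ _ d])
    show "(\<forall>i\<in>I. Q i f) = (\<forall>i\<in>I. Q i g)" if "\<forall>x\<in>\<Union> (C ` I). f x = g x" for f g
    proof -
      have "Q j f = Q j g" if "j \<in> I" for j
        by (rule insert.prems(3)) (use that \<open>\<forall>x\<in>\<Union> (C ` I). f x = g x\<close> in auto)
      then show ?thesis by blast
    qed
    show "Q i f = Q i g" if "\<forall>x\<in>C i. f x = g x" for f g
      by (rule insert.prems(3)) (use that in auto)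
  qed (use insert.prems(1) insert.hyps in auto)
  also have "measure_pmf.prob (Pi_pmf (\<Union>i\<in>I. C i) d p) {f. \<forall>i\<in>I. Q i f} = (\<Prod>i\<in>I. measure_pmf.prob (Pi_pmf (C i) d p) {f. Q i f})"
  proof (rule insert.IH)
    show "Q j f = Q j g" if "j \<in> I" "\<forall>x\<in>C j. f x = g x" for j f g
      by (rule insert.prems(3)) (use that in auto)
  qed (use insert.prems(1,2) in \<open>auto simp: disjoint_family_on_def\<close>)
  finally show ?case using insert.hyps by simp
qed

lemma prob_Pi_pmf_all:
  assumes "finite A" "B \<subseteq> A"
  shows "measure_pmf.prob (Pi_pmf A d p) {f. \<forall>x\<in>B. R x (f x)} = (\<Prod>x\<in>B. measure_pmf.prob (p x) {y. R x y})"
proof -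
  have "measure_pmf.prob (Pi_pmf A d p) {f. \<forall>x\<in>B. R x (f x)} = measure_pmf.prob (Pi_pmf B d p) {f. \<forall>x\<in>B. R x (f x)}"
    by (rule prob_Pi_pmf_subset) (use assms in auto)
  moreover have "{f. \<forall>x\<in>B. R x (f x)} = Pi B (\<lambda>x. {y. R x y})" by auto
  moreover have "measure_pmf.prob (Pi_pmf B d p) (Pi B (\<lambda>x. {y. R x y})) = (\<Prod>x\<in>B. measure_pmf.prob (p x) {y. R x y})"
    by (rule measure_Pi_pmf_Pi) (use assms finite_subset in blast)
  ultimately show ?thesis by simp
qed

lemma prob_Pi_pmf_component:
  assumes "finite A" "a \<in> A"
  shows "measure_pmf.prob (Pi_pmf A d p) {f. R (f a)} = measure_pmf.prob (p a) {y. R y}"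
  using prob_Pi_pmf_all[OF assms(1), of "{a}" d p "\<lambda>_. R"] assms by simp

lemma prob_Pi_pmf_two:
  assumes "finite A" "a \<in> A" "b \<in> A" "a \<noteq> b"
  shows "measure_pmf.prob (Pi_pmf A d p) {f. Q (f a) \<and> R (f b)}
    = measure_pmf.prob (p a) {y. Q y} * measure_pmf.prob (p b) {y. R y}"
proof -
  let ?S = "\<lambda>x. if x = a then Q else R"
  have "{f. Q (f a) \<and> R (f b)} = {f. \<forall>x\<in>{a, b}. ?S x (f x)}"
    by (rule Collect_cong) (use assms(4) in simp)
  also have "measure_pmf.prob (Pi_pmf A d p) \<dots> = (\<Prod>x\<in>{a, b}. measure_pmf.prob (p x) {y. ?S x y})"
    by (rule prob_Pi_pmf_all) (use assms in auto)
  also have "\<dots> = measure_pmf.prob (p a) {y. Q y} * measure_pmf.prob (p b) {y. R y}"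
    using assms(4) by simp
  finally show ?thesis .
qed

text \<open>Moment generating function of a binomial count, written with the base
  \<open>\<theta>\<close> instead of its logarithm.\<close>

lemma expectation_power_card:
  assumes "finite A" "C \<subseteq> A" "\<theta> \<ge> 0"
  shows "measure_pmf.expectation (Pi_pmf A d (\<lambda>_. \<mu>)) (\<lambda>f. \<theta> ^ card {a\<in>C. R (f a)})
    = (1 + measure_pmf.prob \<mu> {y. R y} * (\<theta> - 1)) ^ card C" (is "?L = _")
    and "integrable (Pi_pmf A d (\<lambda>_. \<mu>)) (\<lambda>f. \<theta> ^ card {a\<in>C. R (f a)})"
proof -
  let ?g = "\<lambda>x y. if x \<in> C \<and> R y then \<theta> else 1"
  have finC: "finite C" using assms finite_subset by blast
  have eq: "(\<Prod>x\<in>A. ?g x (f x)) = \<theta> ^ card {a\<in>C. R (f a)}" for f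
  proof -
    have "(\<Prod>x\<in>A. ?g x (f x)) = (\<Prod>x\<in>{a\<in>C. R (f a)}. \<theta>)"
      using assms by (intro prod.mono_neutral_cong_right) auto
    then show ?thesis by simp
  qed
  have bd: "integrable (measure_pmf \<mu>) (?g x)" for x
    by (rule measure_pmf.integrable_const_bound[where B = "max \<theta> 1"]) (use assms in auto)
  have ex: "measure_pmf.expectation \<mu> (\<lambda>y. if R y then \<theta> else 1) = 1 + measure_pmf.prob \<mu> {y. R y} * (\<theta> - 1)"
  proof -
    have "(\<lambda>y. if R y then \<theta> else 1) = (\<lambda>y. 1 + indicator {y. R y} y * (\<theta> - 1))"
      by (auto simp: indicator_def)
    then show ?thesis by (simp add: measure_pmf.emeasure_eq_measure)
  qed
  have "?L = measure_pmf.expectation (Pi_pmf A d (\<lambda>_. \<mu>)) (\<lambda>f. \<Prod>x\<in>A. ?g x (f x))" by (simp only: eq)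
  also have "\<dots> = (\<Prod>x\<in>A. measure_pmf.expectation \<mu> (?g x))"
    by (rule expectation_prod_Pi_pmf) (use assms bd in auto)
  also have "\<dots> = (\<Prod>x\<in>C. 1 + measure_pmf.prob \<mu> {y. R y} * (\<theta> - 1))"
    using assms by (intro prod.mono_neutral_cong_right) (auto simp: ex[symmetric])
  finally show "?L = (1 + measure_pmf.prob \<mu> {y. R y} * (\<theta> - 1)) ^ card C" by simp
  show "integrable (Pi_pmf A d (\<lambda>_. \<mu>)) (\<lambda>f. \<theta> ^ card {a\<in>C. R (f a)})"
  proof (rule measure_pmf.integrable_const_bound[where B = "(max \<theta> 1) ^ card C"])
    have "\<theta> ^ card {a\<in>C. R (f a)} \<le> (max \<theta> 1) ^ card C" for f
    proof -
      have "\<theta> ^ card {a\<in>C. R (f a)} \<le> (max \<theta> 1) ^ card {a\<in>C. R (f a)}"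
        using assms by (intro power_mono) auto
      also have "\<dots> \<le> (max \<theta> 1) ^ card C"
        by (intro power_increasing card_mono finC) auto
      finally show ?thesis .
    qed
    then show "AE f in measure_pmf (Pi_pmf A d (\<lambda>_. \<mu>)). norm (\<theta> ^ card {a\<in>C. R (f a)}) \<le> (max \<theta> 1) ^ card C"
      using assms by (intro AE_pmfI) simp
  qed auto
qed

text \<open>One statement serves both tails: \<open>\<theta> > 1\<close> for upper and
  \<open>\<theta> < 1\<close> for lower ones. The event \<open>P\<close> enters only through a lower
  bound for \<open>\<theta> ^ k\<close>.\<close>

lemma chernoff_card:
  fixes \<theta> :: real
  assumes "finite A" "C \<subseteq> A" "\<theta> > 0" "\<And>k. P k \<Longrightarrow> \<theta> ^ k \<ge> t" "t > 0"
  shows "measure_pmf.prob (Pi_pmf A d (\<lambda>_. \<mu>)) {f. P (card {a\<in>C. R (f a)})}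
    \<le> exp (measure_pmf.prob \<mu> {y. R y} * (\<theta> - 1) * card C) / t"
proof -
  let ?M = "Pi_pmf A d (\<lambda>_. \<mu>)" and ?p = "measure_pmf.prob \<mu> {y. R y}"
  note E = expectation_power_card[OF assms(1,2), of \<theta> d \<mu> R]
  have "measure_pmf.prob ?M {f. P (card {a\<in>C. R (f a)})}
    \<le> measure_pmf.prob ?M {f \<in> space (measure_pmf ?M). \<theta> ^ card {a\<in>C. R (f a)} \<ge> t}"
    by (rule measure_pmf.finite_measure_mono) (use assms in auto)
  also have "\<dots> \<le> measure_pmf.expectation ?M (\<lambda>f. \<theta> ^ card {a\<in>C. R (f a)}) / t"
    by (rule integral_Markov_inequality_measure[where A = "{}"]) (use E assms in auto)
  also have "\<dots> = (1 + ?p * (\<theta> - 1)) ^ card C / t" using E assms by simp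
  also have "\<dots> \<le> exp (?p * (\<theta> - 1)) ^ card C / t"
  proof (intro divide_right_mono power_mono)
    have "?p * (1 - \<theta>) \<le> 1 * 1" if "\<theta> \<le> 1" using that assms by (intro mult_mono) auto
    moreover have "?p * (\<theta> - 1) \<ge> 0" if "\<theta> \<ge> 1" using that by simp
    ultimately show "0 \<le> 1 + ?p * (\<theta> - 1)" by (smt (verit) minus_mult_right)
  qed (use assms exp_ge_add_one_self in auto)
  also have "exp (?p * (\<theta> - 1)) ^ card C = exp (?p * (\<theta> - 1) * card C)"
    by (simp add: exp_of_nat_mult[symmetric] mult.commute)
  finally show ?thesis .
qed

section \<open>Uniform and binomial random digraphs\<close>

definition all_arcs :: "'a set \<Rightarrow> ('a \<times> 'a) set" where
  "all_arcs V = {(u, v). u \<in> V \<and> v \<in> V \<and> u \<noteq> v}"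

lemma finite_all_arcs [simp]: "finite V \<Longrightarrow> finite (all_arcs V)"
  by (rule finite_subset[of _ "V \<times> V"]) (auto simp: all_arcs_def)

lemma card_all_arcs:
  assumes "finite V"
  shows "card (all_arcs V) = card V * (card V - 1)"
proof -
  have "all_arcs V = (SIGMA u:V. V - {u})" by (auto simp: all_arcs_def)
  then show ?thesis using assms by (simp add: card_SigmaI)
qed

definition opt_pmf :: "real \<Rightarrow> 'c set \<Rightarrow> 'c option pmf" where
  "opt_pmf p U = do {b \<leftarrow> bernoulli_pmf p; if b then map_pmf Some (pmf_of_set U) else return_pmf None}"

lemma rainbow_tree_mono:
  assumes "rainbow_tree V w" "\<And>a. w a \<noteq> None \<Longrightarrow> w' a = w a"
  shows "rainbow_tree V w'"
proof -
  from assms(1) obtain r par where *: "r \<in> V" "\<forall>v\<in>V - {r}. par v \<in> V \<and> w (par v, v) \<noteq> None"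
     "inj_on (\<lambda>v. w (par v, v)) (V - {r})" "\<forall>v\<in>V. \<exists>k. (par ^^ k) v = r"
    unfolding rainbow_tree_def by blast
  have "w' (par v, v) = w (par v, v)" if "v \<in> V - {r}" for v using * assms(2) that by blast
  then show ?thesis unfolding rainbow_tree_def using *
    by (intro bexI[of _ r] exI[of _ par]) (auto simp: inj_on_def)
qed

lemma card_no_in_arc_mono:
  assumes "finite V" "card (no_in_arc V w) \<le> 1" "\<And>a. w a \<noteq> None \<Longrightarrow> w' a = w a"
  shows "card (no_in_arc V w') \<le> 1"
proof -
  have "w a = None" if "w' a = None" for a using assms(3)[of a] that by (cases "w a") auto
  then have "no_in_arc V w' \<subseteq> no_in_arc V w" unfolding no_in_arc_def by blast
  moreover have "finite (no_in_arc V w)" using assms(1) by (simp add: no_in_arc_def)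
  ultimately show ?thesis using assms(2) card_mono[of "no_in_arc V w" "no_in_arc V w'"] by linarith
qed

lemma Pi_opt_pmf:
  assumes "finite A"
  shows "Pi_pmf A None (\<lambda>_. opt_pmf p U) =
    do {b \<leftarrow> Pi_pmf A False (\<lambda>_. bernoulli_pmf p); Pi_pmf {a\<in>A. b a} None (\<lambda>_. map_pmf Some (pmf_of_set U))}"
  unfolding opt_pmf_def
  by (subst Pi_pmf_bind[OF assms, where d' = False])
     (intro bind_pmf_cong refl, rule Pi_pmf_if_set[OF assms])

lemma Pi_map_Some:
  assumes "finite B"
  shows "Pi_pmf B None (\<lambda>_. map_pmf Some \<mu>) =
    map_pmf (\<lambda>f a. if a \<in> B then Some (f a) else None) (Pi_pmf B d (\<lambda>_. \<mu>))"
  unfolding map_pmf_def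
  by (subst Pi_pmf_bind[OF assms, where d' = d]) (use assms in simp)

text \<open>In both models the arc set comes first and the colours, with law \<open>\<mu>\<close>,
  afterwards. Below, \<open>h Q B\<close> is the probability of \<open>Q\<close> given the arc set
  \<open>B\<close>, and \<open>avg\<close> takes its mean over the arc sets of a given size; the
  models differ only in how the size is distributed.\<close>

locale subset_prob =
  fixes A :: "'a set" and \<mu> :: "'b pmf"
  assumes fin: "finite A"
begin

definition h :: "(('a \<Rightarrow> 'b option) \<Rightarrow> bool) \<Rightarrow> 'a set \<Rightarrow> real" where
  "h Q B = measure_pmf.prob (Pi_pmf B None (\<lambda>_. map_pmf Some \<mu>)) {w. Q w}"

definition avg :: "('a set \<Rightarrow> real) \<Rightarrow> nat \<Rightarrow> real" where
  "avg g k = (\<Sum>B | B \<subseteq> A \<and> card B = k. g B) / (card A choose k)"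

lemma h_mono:
  assumes "finite B'" "B \<subseteq> B'" "\<And>w w'. Q w \<Longrightarrow> (\<And>a. w a \<noteq> None \<Longrightarrow> w' a = w a) \<Longrightarrow> Q w'"
  shows "h Q B \<le> h Q B'"
proof -
  have "h Q B = measure_pmf.prob (Pi_pmf B' None (\<lambda>_. map_pmf Some \<mu>)) {f. Q (\<lambda>x. if x \<in> B then f x else None)}"
    unfolding h_def by (subst Pi_pmf_subset[OF assms(1,2)]) (simp add: vimage_def)
  also have "\<dots> \<le> h Q B'" unfolding h_def
    by (rule prob_mono) (erule assms(3), auto split: if_splits)
  finally show ?thesis .
qed

text \<open>A random (k + 1)-set is a random k-set plus a random further element. Formally, the
  pairs of a k-set and an element outside it are counted in two ways.\<close>

lemma avg_mono_Suc:
  assumes "\<And>B a. B \<subseteq> A \<Longrightarrow> a \<in> A \<Longrightarrow> g B \<le> g (insert a B)" "k < card A"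
  shows "avg g k \<le> avg g (Suc k)"
proof -
  let ?N = "card A"
  let ?P = "{(B, a). B \<subseteq> A \<and> card B = k \<and> a \<in> A - B}"
  have finS: "finite {B. B \<subseteq> A \<and> card B = j}" for j using fin by simp
  have bij: "bij_betw (\<lambda>(B, a). (insert a B, a)) ?P {(C, a). C \<subseteq> A \<and> card C = Suc k \<and> a \<in> C}"
  proof (rule bij_betwI[where g = "\<lambda>(C, a). (C - {a}, a)"])
    show "(\<lambda>(B, a). (insert a B, a)) \<in> ?P \<rightarrow> {(C, a). C \<subseteq> A \<and> card C = Suc k \<and> a \<in> C}"
      using fin finite_subset by fastforce
    show "(\<lambda>(C, a). (C - {a}, a)) \<in> {(C, a). C \<subseteq> A \<and> card C = Suc k \<and> a \<in> C} \<rightarrow> ?P"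
      by auto
  qed auto
  have "real (?N - k) * (\<Sum>B | B \<subseteq> A \<and> card B = k. g B) = (\<Sum>B | B \<subseteq> A \<and> card B = k. \<Sum>a\<in>A - B. g B)"
    unfolding sum_distrib_left
  proof (intro sum.cong refl)
    fix B assume "B \<in> {B. B \<subseteq> A \<and> card B = k}"
    then have "card (A - B) = ?N - k" using finite_subset[OF _ fin, of B] by (auto simp: card_Diff_subset)
    then show "real (?N - k) * g B = (\<Sum>a\<in>A - B. g B)" by simp
  qed
  also have "\<dots> \<le> (\<Sum>B | B \<subseteq> A \<and> card B = k. \<Sum>a\<in>A - B. g (insert a B))"
    by (intro sum_mono assms(1)) auto
  also have "\<dots> = (\<Sum>(B, a)\<in>?P. g (insert a B))"
    by (subst sum.Sigma) (use fin finS in \<open>auto intro!: sum.cong\<close>)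
  also have "\<dots> = (\<Sum>(C, a)\<in>{(C, a). C \<subseteq> A \<and> card C = Suc k \<and> a \<in> C}. g C)"
    by (subst sum.reindex_bij_betw[OF bij, symmetric]) (auto intro!: sum.cong)
  also have "\<dots> = (\<Sum>C | C \<subseteq> A \<and> card C = Suc k. \<Sum>a\<in>C. g C)"
    by (subst sum.Sigma) (use fin finS finite_subset in \<open>auto intro!: sum.cong\<close>)
  also have "\<dots> = real (Suc k) * (\<Sum>C | C \<subseteq> A \<and> card C = Suc k. g C)"
    unfolding sum_distrib_left by (intro sum.cong) auto
  finally have main: "real (?N - k) * (\<Sum>B | B \<subseteq> A \<and> card B = k. g B) \<le> real (Suc k) * (\<Sum>C | C \<subseteq> A \<and> card C = Suc k. g C)" .
  have "Suc k * (?N choose Suc k) = (?N - k) * (?N choose k)"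
    by (simp only: binomial_absorption binomial_absorb_comp)
  then have e: "real (Suc k) * real (?N choose Suc k) = real (?N - k) * real (?N choose k)"
    by (metis of_nat_mult)
  have pos: "real (?N choose k) > 0" "real (?N choose Suc k) > 0" "real (?N - k) > 0" using assms(2) by auto
  have "avg g k = (real (?N - k) * (\<Sum>B | B \<subseteq> A \<and> card B = k. g B)) / (real (?N - k) * real (?N choose k))"
    using pos by (simp add: avg_def)
  also have "\<dots> \<le> (real (Suc k) * (\<Sum>C | C \<subseteq> A \<and> card C = Suc k. g C)) / (real (?N - k) * real (?N choose k))"
    using main pos by (intro divide_right_mono) auto
  also have "\<dots> = avg g (Suc k)" unfolding e[symmetric] avg_def using pos by simp
  finally show ?thesis .
qed

lemma avg_mono:
  assumes "\<And>B a. B \<subseteq> A \<Longrightarrow> a \<in> A \<Longrightarrow> g B \<le> g (insert a B)" "k \<le> l" "l \<le> card A"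
  shows "avg g k \<le> avg g l"
  using assms(2,3)
proof (induction l rule: dec_induct)
  case (step j)
  have "avg g j \<le> avg g (Suc j)" by (rule avg_mono_Suc) (use assms(1) step in auto)
  then show ?case using step by simp
qed simp

definition sub_pmf :: "real \<Rightarrow> 'a set pmf" where
  "sub_pmf p = map_pmf (\<lambda>b. {a\<in>A. b a}) (Pi_pmf A False (\<lambda>_. bernoulli_pmf p))"

lemma set_sub_pmf: "B \<in> set_pmf (sub_pmf p) \<Longrightarrow> B \<subseteq> A"
  by (auto simp: sub_pmf_def)

lemma pmf_sub_pmf:
  fixes p :: real
  assumes "0 < p" "p < 1" "B \<subseteq> A"
  shows "pmf (sub_pmf p) B = p ^ card B * (1 - p) ^ (card A - card B)"
proof -
  let ?M = "Pi_pmf A False (\<lambda>_. bernoulli_pmf p)"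
  have sM: "f \<in> set_pmf ?M \<longleftrightarrow> (\<forall>x. x \<notin> A \<longrightarrow> \<not> f x)" for f
    using assms fin by (subst set_Pi_pmf) (auto simp: PiE_dflt_def set_pmf_bernoulli)
  have "pmf (sub_pmf p) ((\<lambda>b. {a\<in>A. b a}) (\<lambda>a. a \<in> B)) = pmf ?M (\<lambda>a. a \<in> B)"
    unfolding sub_pmf_def
  proof (rule pmf_map_inj)
    show "inj_on (\<lambda>b. {a\<in>A. b a}) (set_pmf ?M)"
    proof (rule inj_onI)
      fix f g assume "f \<in> set_pmf ?M" "g \<in> set_pmf ?M" "{a \<in> A. f a} = {a \<in> A. g a}"
      then show "f = g" unfolding sM by (intro ext) blast
    qed
    show "(\<lambda>a. a \<in> B) \<in> set_pmf ?M" using assms unfolding sM by auto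
  qed
  also have "(\<lambda>b. {a\<in>A. b a}) (\<lambda>a. a \<in> B) = B" using assms by auto
  also have "pmf ?M (\<lambda>a. a \<in> B) = (\<Prod>a\<in>A. pmf (bernoulli_pmf p) (a \<in> B))"
    using assms fin by (subst pmf_Pi') auto
  also have "\<dots> = (\<Prod>a\<in>A. if a \<in> B then p else 1 - p)"
    using assms by (intro prod.cong) auto
  also have "\<dots> = p ^ card B * (1 - p) ^ (card A - card B)"
    using assms fin finite_subset[OF assms(3) fin]
    by (subst prod.If_cases) (auto simp: Int_absorb1 card_Diff_subset[symmetric] Diff_eq[symmetric])
  finally show ?thesis .
qed

text \<open>Given its size, the binomial random set is uniform, so the expectation is a binomial
  mixture of the averages.\<close>

lemma expectation_sub_pmf:
  fixes p :: real
  assumes "0 < p" "p < 1"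
  shows "measure_pmf.expectation (sub_pmf p) g =
    (\<Sum>k\<le>card A. (card A choose k) * p ^ k * (1 - p) ^ (card A - k) * avg g k)"
proof -
  have "measure_pmf.expectation (sub_pmf p) g = (\<Sum>B\<in>Pow A. pmf (sub_pmf p) B *\<^sub>R g B)"
    by (rule integral_measure_pmf) (use fin set_sub_pmf in \<open>auto simp: set_pmf_iff\<close>)
  also have "\<dots> = (\<Sum>B\<in>Pow A. p ^ card B * (1 - p) ^ (card A - card B) * g B)"
    by (intro sum.cong) (auto simp: pmf_sub_pmf assms)
  also have "\<dots> = (\<Sum>k\<le>card A. \<Sum>B | B \<in> Pow A \<and> card B = k. p ^ card B * (1 - p) ^ (card A - card B) * g B)"
    by (rule sum.group[symmetric]) (use fin card_mono in auto)
  also have "\<dots> = (\<Sum>k\<le>card A. (card A choose k) * p ^ k * (1 - p) ^ (card A - k) * avg g k)"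
  proof (intro sum.cong refl)
    fix k assume k: "k \<in> {..card A}"
    have "(\<Sum>B | B \<in> Pow A \<and> card B = k. p ^ card B * (1 - p) ^ (card A - card B) * g B)
      = p ^ k * (1 - p) ^ (card A - k) * (\<Sum>B | B \<in> Pow A \<and> card B = k. g B)"
      unfolding sum_distrib_left by (intro sum.cong) auto
    also have "(\<Sum>B | B \<in> Pow A \<and> card B = k. g B) = (card A choose k) * avg g k"
      using k by (simp add: avg_def)
    finally show "(\<Sum>B | B \<in> Pow A \<and> card B = k. p ^ card B * (1 - p) ^ (card A - card B) * g B)
       = (card A choose k) * p ^ k * (1 - p) ^ (card A - k) * avg g k" by simp
  qed
  finally show ?thesis .
qed

lemma expectation_sub_pmf_mono:
  fixes p :: real
  assumes "0 < p" "p < 1" "\<And>k. k \<le> card A \<Longrightarrow> avg f k \<le> avg g k"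
  shows "measure_pmf.expectation (sub_pmf p) f \<le> measure_pmf.expectation (sub_pmf p) g"
  unfolding expectation_sub_pmf[OF assms(1,2)]
  using assms by (intro sum_mono mult_left_mono) auto

lemma avg_const: "k \<le> card A \<Longrightarrow> avg (\<lambda>B. g (card B)) k = g k"
  using n_subsets[OF fin, of k] by (simp add: avg_def)

lemma avg_le_1: 
  assumes "\<And>B. g B \<le> 1"
  shows "avg g k \<le> 1"
proof -
  have "(\<Sum>B | B \<subseteq> A \<and> card B = k. g B) \<le> (\<Sum>B | B \<subseteq> A \<and> card B = k. 1)"
    by (intro sum_mono assms)
  also have "\<dots> = card A choose k" using n_subsets[OF fin, of k] by simp
  finally show ?thesis unfolding avg_def
    by (cases "card A choose k = 0") (simp_all add: divide_le_eq_1)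
qed

lemma avg_ge_0: "(\<And>B. g B \<ge> 0) \<Longrightarrow> avg g k \<ge> 0"
  unfolding avg_def by (intro divide_nonneg_nonneg sum_nonneg) auto

lemma prob_card_sub_pmf:
  "measure_pmf.expectation (sub_pmf p) (\<lambda>B. of_bool (P (card B))) =
   measure_pmf.prob (Pi_pmf A False (\<lambda>_. bernoulli_pmf p)) {b. P (card {a\<in>A. b a})}"
proof -
  have "measure_pmf.expectation (sub_pmf p) (\<lambda>B. of_bool (P (card B)))
    = measure_pmf.expectation (sub_pmf p) (indicator {B. P (card B)})"
    by (rule arg_cong[where f = "measure_pmf.expectation (sub_pmf p)"]) (auto simp: indicator_def fun_eq_iff)
  also have "\<dots> = measure_pmf.prob (sub_pmf p) {B. P (card B)}" by simp
  finally show ?thesis by (simp add: sub_pmf_def vimage_def)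
qed

lemma prob_Pi_opt:
  assumes "\<mu> = pmf_of_set U"
  shows "measure_pmf.prob (Pi_pmf A None (\<lambda>_. opt_pmf p U)) {w. Q w} = measure_pmf.expectation (sub_pmf p) (h Q)"
  unfolding Pi_opt_pmf[OF fin] prob_bind_pmf h_def sub_pmf_def assms[symmetric] by simp

text \<open>For \<open>k \<le> m\<close> the average at \<open>k\<close> is at most that at
  \<open>m\<close> by monotonicity. For larger \<open>k\<close> it is at most 1, which costs the
  upper tail of the number of arcs.\<close>

lemma transfer_lower:
  assumes p: "0 < p" "p < 1" and m: "m \<le> card A"
    and Q: "\<And>w w'. Q w \<Longrightarrow> (\<And>a. w a \<noteq> None \<Longrightarrow> w' a = w a) \<Longrightarrow> Q w'"
  shows "measure_pmf.expectation (sub_pmf p) (h Q) \<le> avg (h Q) m +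
     measure_pmf.prob (Pi_pmf A False (\<lambda>_. bernoulli_pmf p)) {b. card {a\<in>A. b a} > m}"
proof -
  define c where "c = avg (h Q) m"
  have "measure_pmf.expectation (sub_pmf p) (h Q) \<le> measure_pmf.expectation (sub_pmf p) (\<lambda>B. c + of_bool (card B > m))"
  proof (rule expectation_sub_pmf_mono[OF p])
    fix k assume k: "k \<le> card A"
    have "avg (h Q) k \<le> c + of_bool (k > m)"
    proof (cases "k > m")
      case True
      have "avg (h Q) k \<le> 1" by (rule avg_le_1) (simp add: h_def)
      moreover have "c \<ge> 0" unfolding c_def by (rule avg_ge_0) (simp add: h_def)
      ultimately show ?thesis using True by simp
    next
      case False
      have "avg (h Q) k \<le> c" unfolding c_def
        by (rule avg_mono) (use False m fin finite_subset in \<open>auto intro!: h_mono[OF _ _ Q]\<close>)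
      then show ?thesis by simp
    qed
    then show "avg (h Q) k \<le> avg (\<lambda>B. c + of_bool (card B > m)) k"
      using avg_const[OF k, of "\<lambda>j. c + of_bool (j > m)"] by simp
  qed
  also have "\<dots> = c + measure_pmf.expectation (sub_pmf p) (\<lambda>B. of_bool (card B > m))"
    by (subst Bochner_Integration.integral_add)
       (auto intro!: measure_pmf.integrable_const_bound[where B = 1])
  finally show ?thesis unfolding prob_card_sub_pmf[of p "\<lambda>k. k > m"] c_def .
qed

lemma transfer_upper:
  assumes p: "0 < p" "p < 1" and m: "m \<le> card A"
    and Q: "\<And>w w'. Q w \<Longrightarrow> (\<And>a. w a \<noteq> None \<Longrightarrow> w' a = w a) \<Longrightarrow> Q w'"
  shows "avg (h Q) m \<le> measure_pmf.expectation (sub_pmf p) (h Q) +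
     measure_pmf.prob (Pi_pmf A False (\<lambda>_. bernoulli_pmf p)) {b. card {a\<in>A. b a} < m}"
proof -
  define c where "c = avg (h Q) m"
  have "measure_pmf.expectation (sub_pmf p) (\<lambda>B. c - of_bool (card B < m)) \<le> measure_pmf.expectation (sub_pmf p) (h Q)"
  proof (rule expectation_sub_pmf_mono[OF p])
    fix k assume k: "k \<le> card A"
    have "c - of_bool (k < m) \<le> avg (h Q) k"
    proof (cases "k < m")
      case True
      have "c \<le> 1" unfolding c_def by (rule avg_le_1) (simp add: h_def)
      moreover have "avg (h Q) k \<ge> 0" by (rule avg_ge_0) (simp add: h_def)
      ultimately show ?thesis using True by simp
    next
      case False
      have "c \<le> avg (h Q) k" unfolding c_def
        by (rule avg_mono) (use False k fin finite_subset in \<open>auto intro!: h_mono[OF _ _ Q]\<close>)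
      then show ?thesis using False by simp
    qed
    then show "avg (\<lambda>B. c - of_bool (card B < m)) k \<le> avg (h Q) k"
      using avg_const[OF k, of "\<lambda>j. c - of_bool (j < m)"] by simp
  qed
  moreover have "measure_pmf.expectation (sub_pmf p) (\<lambda>B. c - of_bool (card B < m))
     = c - measure_pmf.expectation (sub_pmf p) (\<lambda>B. of_bool (card B < m))"
    by (subst Bochner_Integration.integral_diff)
       (auto intro!: measure_pmf.integrable_const_bound[where B = 1])
  ultimately show ?thesis unfolding prob_card_sub_pmf[of p "\<lambda>k. k < m"] c_def by simp
qed

end

lemma prob_random_coloured_digraph:
  fixes n m q :: nat
  defines "V \<equiv> {1..n}"
  assumes m: "m \<le> card (all_arcs V)"
  shows "measure_pmf.prob (random_coloured_digraph n m q) {(G, col). R G col} =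
    subset_prob.avg (all_arcs V) (\<lambda>B. measure_pmf.prob (Pi_pmf B 0 (\<lambda>_. pmf_of_set {1..q})) {col. R \<lparr>pverts = V, parcs = B\<rparr> col}) m"
proof -
  let ?mk = "\<lambda>B. \<lparr>pverts = V, parcs = B\<rparr> :: nat pair_pre_digraph"
  let ?S = "{B. B \<subseteq> all_arcs V \<and> card B = m}"
  interpret subset_prob "all_arcs V" "pmf_of_set {1..q}" by unfold_locales (simp add: V_def)
  have D: "digraphs n m = ?mk ` ?S"
  proof (intro equalityI subsetI)
    fix G assume "G \<in> digraphs n m"
    then have G: "pair_digraph G" "pverts G = V" "card (parcs G) = m" by (auto simp: digraphs_def V_def)
    interpret pair_digraph G by fact
    have "parcs G \<subseteq> all_arcs V"
      using wellformed' no_loops' G(2) by (fastforce simp: all_arcs_def)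
    then show "G \<in> ?mk ` ?S" using G by (intro image_eqI[of _ _ "parcs G"]) auto
  next
    fix G assume "G \<in> ?mk ` ?S"
    then obtain B where B: "G = ?mk B" "B \<subseteq> all_arcs V" "card B = m" by blast
    have "finite B" using B(2) fin finite_subset by blast
    then have "pair_digraph G" using B by unfold_locales (auto simp: V_def all_arcs_def)
    then show "G \<in> digraphs n m" using B by (auto simp: digraphs_def V_def)
  qed
  have finS: "finite ?S" using fin by simp
  have cS: "card ?S = card (all_arcs V) choose m" using n_subsets[OF fin] by simp
  have neS: "?S \<noteq> {}" using cS m by (metis binomial_eq_0_iff card.empty not_le)
  have inj: "inj_on ?mk ?S" by (auto simp: inj_on_def)
  have "pmf_of_set (digraphs n m) = map_pmf ?mk (pmf_of_set ?S)"
    unfolding D by (rule map_pmf_of_set_inj[symmetric, OF inj neS finS])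
  then have "measure_pmf.prob (random_coloured_digraph n m q) {(G, col). R G col} =
    (\<integral>B. measure_pmf.prob (Pi_pmf B 0 (\<lambda>_. pmf_of_set {1..q})) {col. R (?mk B) col} \<partial>measure_pmf (pmf_of_set ?S))"
    unfolding random_coloured_digraph_def
    by (simp add: bind_map_pmf prob_bind_pmf map_pmf_def[symmetric] vimage_def)
  also have "\<dots> = (\<Sum>B\<in>?S. measure_pmf.prob (Pi_pmf B 0 (\<lambda>_. pmf_of_set {1..q})) {col. R (?mk B) col}) / card ?S"
    by (rule integral_pmf_of_set[OF neS finS])
  finally show ?thesis unfolding avg_def cS .
qed

section \<open>Vertices without incoming arc in the binomial model\<close>

definition col_arcs :: "'a set \<Rightarrow> 'a \<Rightarrow> ('a \<times> 'a) set" where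
  "col_arcs V v = (\<lambda>u. (u, v)) ` (V - {v})"

lemma col_arcs_Un: "all_arcs V = (\<Union>v\<in>V. col_arcs V v)"
  by (auto simp: all_arcs_def col_arcs_def)

lemma finite_col_arcs [simp]: "finite V \<Longrightarrow> finite (col_arcs V v)"
  by (simp add: col_arcs_def)

lemma card_col_arcs: "finite V \<Longrightarrow> v \<in> V \<Longrightarrow> card (col_arcs V v) = card V - 1"
  unfolding col_arcs_def by (subst card_image) (auto simp: inj_on_def)

lemma disjoint_col_arcs: "disjoint_family_on (col_arcs V) I"
  by (auto simp: disjoint_family_on_def col_arcs_def)

lemma prob_opt_None:
  assumes "0 \<le> p" "p \<le> 1" "finite U" "U \<noteq> {}"
  shows "measure_pmf.prob (opt_pmf p U) {y. y = None} = 1 - p"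
    and "measure_pmf.prob (opt_pmf p U) {y. y \<noteq> None} = p"
proof -
  show 1: "measure_pmf.prob (opt_pmf p U) {y. y = None} = 1 - p"
    unfolding opt_pmf_def prob_bind_pmf
    using assms by (simp add: vimage_def)
  have "measure_pmf.prob (opt_pmf p U) {y. y \<noteq> None} = 1 - measure_pmf.prob (opt_pmf p U) {y. y = None}"
    using measure_pmf.prob_compl[of "{y. y = None}" "opt_pmf p U"]
    by (simp add: Collect_neg_eq Compl_eq_Diff_UNIV del: not_None_eq)
  then show "measure_pmf.prob (opt_pmf p U) {y. y \<noteq> None} = p" using 1 by simp
qed

lemma prob_opt_Some:
  assumes "0 \<le> p" "p \<le> 1" "finite U" "U \<noteq> {}"
  shows "measure_pmf.prob (opt_pmf p U) {y. \<exists>c\<in>C. y = Some c} = p * card (C \<inter> U) / card U"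
proof -
  have "measure_pmf.prob (map_pmf Some (pmf_of_set U)) {y. \<exists>c\<in>C. y = Some c} = card (C \<inter> U) / card U"
  proof -
    have "Some -` {y. \<exists>c\<in>C. y = Some c} = C" by auto
    then show ?thesis using assms by (simp add: measure_pmf_of_set Int_commute)
  qed
  then show ?thesis
    unfolding opt_pmf_def prob_bind_pmf using assms by simp
qed

text \<open>The sets of arcs into different vertices are disjoint, so the vertices without incoming
  arc form a binomial random set with parameter \<open>q\<close>. The two summands belong to zero
  and to one such vertex.\<close>

lemma prob_empties:
  fixes p q :: real and V :: "'a set" and U :: "'c set"
  assumes V: "finite V" and p: "0 \<le> p" "p \<le> 1" and U: "finite U" "U \<noteq> {}"
  defines "q \<equiv> (1 - p) ^ (card V - 1)"
  shows "measure_pmf.prob (Pi_pmf (all_arcs V) None (\<lambda>_. opt_pmf p U)) {w. card (no_in_arc V w) \<le> 1}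
    = (1 - q) ^ card V + card V * q * (1 - q) ^ (card V - 1)"
proof -
  let ?M = "Pi_pmf (all_arcs V) None (\<lambda>_. opt_pmf p U)"
  let ?N = "\<lambda>w :: 'a \<times> 'a \<Rightarrow> 'c option. no_in_arc V w"
  let ?E = "\<lambda>v w. \<forall>a\<in>col_arcs V v. w a = None"
  have colE: "measure_pmf.prob (Pi_pmf (col_arcs V v) None (\<lambda>_. opt_pmf p U)) {w. ?E v w} = q" if "v \<in> V" for v
    using prob_Pi_pmf_all[of "col_arcs V v" "col_arcs V v" None "\<lambda>_. opt_pmf p U" "\<lambda>_ y. y = None"]
      V that prob_opt_None(1)[OF p U] by (simp add: q_def card_col_arcs)
  have colE': "measure_pmf.prob (Pi_pmf (col_arcs V v) None (\<lambda>_. opt_pmf p U)) {w. \<not> ?E v w} = 1 - q" if "v \<in> V" for v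
    using colE[OF that] measure_pmf.prob_compl[of "{w. ?E v w}" "Pi_pmf (col_arcs V v) None (\<lambda>_. opt_pmf p U)"]
    by (simp add: Collect_neg_eq[symmetric] Compl_eq_Diff_UNIV[symmetric])
  have set: "?N w = {v\<in>V. ?E v w}" for w :: "'a \<times> 'a \<Rightarrow> 'c option" by (auto simp: no_in_arc_def col_arcs_def)
  have pS: "measure_pmf.prob ?M {w. ?N w = S} = q ^ card S * (1 - q) ^ (card V - card S)" if S: "S \<subseteq> V" for S
  proof -
    have "{w. ?N w = S} = {w. \<forall>v\<in>V. ?E v w \<longleftrightarrow> v \<in> S}" using S unfolding set by blast
    also have "measure_pmf.prob ?M \<dots> = (\<Prod>v\<in>V. measure_pmf.prob (Pi_pmf (col_arcs V v) None (\<lambda>_. opt_pmf p U)) {w. ?E v w \<longleftrightarrow> v \<in> S})"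
      unfolding col_arcs_Un by (rule prob_Pi_pmf_blocks) (use V disjoint_col_arcs in auto)
    also have "\<dots> = (\<Prod>v\<in>V. if v \<in> S then q else 1 - q)"
    proof (intro prod.cong refl)
      fix v assume v: "v \<in> V"
      show "measure_pmf.prob (Pi_pmf (col_arcs V v) None (\<lambda>_. opt_pmf p U)) {w. ?E v w \<longleftrightarrow> v \<in> S} = (if v \<in> S then q else 1 - q)"
        using colE[OF v] colE'[OF v] by (cases "v \<in> S") (simp_all del: not_None_eq ball_simps)
    qed
    also have "\<dots> = q ^ card S * (1 - q) ^ (card V - card S)"
      using S V finite_subset[OF S V]
      by (subst prod.If_cases) (auto simp: Int_absorb1 card_Diff_subset[symmetric] Diff_eq[symmetric])
    finally show ?thesis .
  qed
  have "{w. card (?N w) \<le> 1} = {w. ?N w = {}} \<union> (\<Union>v\<in>V. {w. ?N w = {v}})"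
  proof (intro equalityI subsetI)
    fix w assume "w \<in> {w. card (?N w) \<le> 1}"
    then have c: "card (?N w) \<le> 1" by simp
    have fw: "finite (?N w)" "?N w \<subseteq> V" using V by (auto simp: no_in_arc_def)
    have "card (?N w) = 0 \<or> card (?N w) = 1" using c by linarith
    then show "w \<in> {w. ?N w = {}} \<union> (\<Union>v\<in>V. {w. ?N w = {v}})"
      using fw by (auto simp: card_1_singleton_iff)
  qed auto
  then have "measure_pmf.prob ?M {w. card (?N w) \<le> 1}
    = measure_pmf.prob ?M {w. ?N w = {}} + measure_pmf.prob ?M (\<Union>v\<in>V. {w. ?N w = {v}})"
    by (simp, subst measure_pmf.finite_measure_Union) auto
  also have "measure_pmf.prob ?M (\<Union>v\<in>V. {w. ?N w = {v}}) = (\<Sum>v\<in>V. measure_pmf.prob ?M {w. ?N w = {v}})"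
    by (rule measure_pmf.finite_measure_finite_Union) (use V in \<open>auto simp: disjoint_family_on_def\<close>)
  also have "\<dots> = (\<Sum>v\<in>V. q * (1 - q) ^ (card V - 1))"
    by (intro sum.cong refl, subst pS) auto
  finally show ?thesis by (subst (asm) pS) auto
qed

section \<open>Superposition of coloured layers\<close>

text \<open>The first argument wins: an arc present in several layers keeps the colour of the
  earliest. This order decides which arcs are spoiled for use with a later layer's colour.\<close>

definition merge_opt :: "'c option \<Rightarrow> 'c option \<Rightarrow> 'c option" where
  "merge_opt x y = (case x of None \<Rightarrow> y | Some c \<Rightarrow> Some c)"

lemma merge_opt_simps [simp]: "merge_opt None y = y" "merge_opt (Some c) y = Some c"
  by (simp_all add: merge_opt_def)

lemma pmf_map_Some_pmf_of_set:
  assumes "finite U" "U \<noteq> {}"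
  shows "pmf (map_pmf Some (pmf_of_set U)) y = (case y of None \<Rightarrow> 0 | Some c \<Rightarrow> indicator U c / card U)"
proof (cases y)
  case None
  then show ?thesis by (auto simp: pmf_eq_0_set_pmf)
next
  case (Some c)
  then show ?thesis using assms pmf_map_inj'[of Some "pmf_of_set U" c] by simp
qed

lemma pmf_opt_pmf:
  assumes "0 \<le> p" "p \<le> 1" "finite U" "U \<noteq> {}"
  shows "pmf (opt_pmf p U) y = (case y of None \<Rightarrow> 1 - p | Some c \<Rightarrow> p * indicator U c / card U)"
  unfolding opt_pmf_def pmf_bind using assms
  by (auto simp: pmf_map_Some_pmf_of_set split: option.split)

text \<open>The second layer is visible only where the first is absent, so its density is divided by
  \<open>1 - p1\<close>. With this correction all colours of the union get the same weight.\<close>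

lemma opt_pmf_merge:
  fixes p p1 p2 :: real and U W :: "'c set"
  assumes U: "finite U" "U \<noteq> {}" and W: "finite W" "W \<noteq> {}" and dis: "U \<inter> W = {}"
    and p: "0 \<le> p" "p \<le> 1" "0 \<le> p1" "p1 < 1" "0 \<le> p2" "p2 \<le> 1"
    and p1: "p1 = p * card U / card (U \<union> W)" and p2: "(1 - p1) * p2 = p * card W / card (U \<union> W)"
  shows "(do {x \<leftarrow> opt_pmf p1 U; y \<leftarrow> opt_pmf p2 W; return_pmf (merge_opt x y)} :: 'c option pmf) = opt_pmf p (U \<union> W)"
proof -
  have "(do {x \<leftarrow> opt_pmf p1 U; y \<leftarrow> opt_pmf p2 W; return_pmf (merge_opt x y)} :: 'c option pmf)
     = do {b \<leftarrow> bernoulli_pmf p1; if b then map_pmf Some (pmf_of_set U) else opt_pmf p2 W}"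
    unfolding opt_pmf_def[of p1] bind_assoc_pmf
    by (intro bind_pmf_cong refl) (auto simp: bind_map_pmf bind_return_pmf bind_return_pmf' map_pmf_def bind_assoc_pmf)
  also have "\<dots> = opt_pmf p (U \<union> W)"
  proof (rule pmf_eqI)
    fix y
    have c: "real (card (U \<union> W)) > 0" "real (card U) > 0" "real (card W) > 0"
      using U W by (auto simp: card_gt_0_iff)
    have cs: "real (card (U \<union> W)) = card U + card W" using U W dis by (simp add: card_Un_disjoint)
    have "p1 + (1 - p1) * p2 = p" 
      unfolding p2 unfolding p1 add_divide_distrib[symmetric] distrib_left[symmetric]
      using c cs by simp
    then have N: "(1 - p1) * (1 - p2) = 1 - p" by (simp add: algebra_simps)
    show "pmf (do {b \<leftarrow> bernoulli_pmf p1; if b then map_pmf Some (pmf_of_set U) else opt_pmf p2 W}) y = pmf (opt_pmf p (U \<union> W)) y"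
    proof (cases y)
      case None
      then show ?thesis using p U W N
        by (simp add: pmf_bind pmf_map_Some_pmf_of_set pmf_opt_pmf mult.commute)
    next
      case (Some a)
      have "p1 * (indicator U a / card U) + (1 - p1) * (p2 * indicator W a / card W) = p * indicator (U \<union> W) a / card (U \<union> W)"
      proof (cases "a \<in> U")
        case True
        then have "a \<notin> W" using dis by auto
        then show ?thesis using True c by (simp add: p1)
      next
        case False
        have "(1 - p1) * (p2 * indicator W a / card W) = ((1 - p1) * p2) * indicator W a / card W" by simp
        also have "\<dots> = p * indicator W a / card (U \<union> W)" unfolding p2 using c by simp
        finally show ?thesis using False by (simp add: indicator_def)
      qed
      then show ?thesis using p U W Some
        by (simp add: pmf_bind pmf_map_Some_pmf_of_set pmf_opt_pmf ac_simps)
    qed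
  qed
  finally show ?thesis .
qed

lemma Pi_pmf_merge:
  fixes \<mu> \<nu> \<xi> :: "'c option pmf"
  assumes "finite A" "bind_pmf \<mu> (\<lambda>x. bind_pmf \<nu> (\<lambda>y. return_pmf (merge_opt x y))) = \<xi>"
  shows "do {f \<leftarrow> Pi_pmf A None (\<lambda>_. \<mu>); g \<leftarrow> Pi_pmf A None (\<lambda>_. \<nu>); return_pmf (\<lambda>a. merge_opt (f a) (g a))}
    = Pi_pmf A None (\<lambda>_. \<xi>)"
proof -
  have "Pi_pmf A None (\<lambda>_. \<xi>) = do {f \<leftarrow> Pi_pmf A None (\<lambda>_. \<mu>); g \<leftarrow> Pi_pmf A None (\<lambda>_. \<nu>);
      Pi_pmf A None (\<lambda>a. return_pmf (merge_opt (f a) (g a)))}"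
    unfolding assms(2)[symmetric]
    by (subst Pi_pmf_bind[OF assms(1), where d' = None], intro bind_pmf_cong refl,
        subst Pi_pmf_bind[OF assms(1), where d' = None], rule refl)
  also have "\<dots> = do {f \<leftarrow> Pi_pmf A None (\<lambda>_. \<mu>); g \<leftarrow> Pi_pmf A None (\<lambda>_. \<nu>); return_pmf (\<lambda>a. merge_opt (f a) (g a))}"
  proof (intro bind_pmf_cong refl)
    fix f g assume f: "f \<in> set_pmf (Pi_pmf A None (\<lambda>_. \<mu>))" and g: "g \<in> set_pmf (Pi_pmf A None (\<lambda>_. \<nu>))"
    have "f a = None \<and> g a = None" if "a \<notin> A" for a
      using f g that assms(1) set_Pi_pmf_subset[of A None] by blast
    then show "Pi_pmf A None (\<lambda>a. return_pmf (merge_opt (f a) (g a))) = return_pmf (\<lambda>a. merge_opt (f a) (g a))"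
      using assms(1) by (auto simp: fun_eq_iff)
  qed
  finally show ?thesis by simp
qed

text \<open>Colours are drawn for absent arcs too. This makes arc set and colouring independent, so
  that the colouring can be exposed after the arc set.\<close>

lemma Pi_opt_pmf_colours:
  assumes "finite A"
  shows "do {b \<leftarrow> Pi_pmf A False (\<lambda>_. bernoulli_pmf p); c \<leftarrow> Pi_pmf A d (\<lambda>_. pmf_of_set U);
     return_pmf (\<lambda>a. if b a then Some (c a) else None)} = Pi_pmf A None (\<lambda>_. opt_pmf p U)"
proof -
  have o: "opt_pmf p U = do {b \<leftarrow> bernoulli_pmf p; c \<leftarrow> pmf_of_set U; return_pmf (if b then Some c else None)}"
    unfolding opt_pmf_def by (intro bind_pmf_cong refl) (auto simp: map_pmf_def)
  have "Pi_pmf A None (\<lambda>_. opt_pmf p U) = do {b \<leftarrow> Pi_pmf A False (\<lambda>_. bernoulli_pmf p); c \<leftarrow> Pi_pmf A d (\<lambda>_. pmf_of_set U);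
      Pi_pmf A None (\<lambda>a. return_pmf (if b a then Some (c a) else None))}"
    unfolding o
    by (subst Pi_pmf_bind[OF assms(1), where d' = False], intro bind_pmf_cong refl,
        subst Pi_pmf_bind[OF assms(1), where d' = d], rule refl)
  also have "\<dots> = do {b \<leftarrow> Pi_pmf A False (\<lambda>_. bernoulli_pmf p); c \<leftarrow> Pi_pmf A d (\<lambda>_. pmf_of_set U);
     return_pmf (\<lambda>a. if b a then Some (c a) else None)}"
  proof (intro bind_pmf_cong refl)
    fix b c assume b: "b \<in> set_pmf (Pi_pmf A False (\<lambda>_. bernoulli_pmf p))"
    have "\<not> b a" if "a \<notin> A" for a
      using b that assms(1) set_Pi_pmf_subset[of A False] by blast
    then show "Pi_pmf A None (\<lambda>a. return_pmf (if b a then Some (c a) else None)) = return_pmf (\<lambda>a. if b a then Some (c a) else None)"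
      using assms(1) by (auto simp: fun_eq_iff)
  qed
  finally show ?thesis by simp
qed

lemma Pi_pmf_split:
  assumes "finite A" "B \<subseteq> A"
  shows "Pi_pmf A d p = do {f \<leftarrow> Pi_pmf B d p; g \<leftarrow> Pi_pmf (A - B) d p; return_pmf (\<lambda>a. if a \<in> B then f a else g a)}"
proof -
  have "A = B \<union> (A - B)" using assms by auto
  then have "Pi_pmf A d p = Pi_pmf (B \<union> (A - B)) d p" by simp
  also have "\<dots> = map_pmf (\<lambda>(f, g) a. if a \<in> B then f a else g a) (pair_pmf (Pi_pmf B d p) (Pi_pmf (A - B) d p))"
    by (rule Pi_pmf_union) (use assms finite_subset in auto)
  finally show ?thesis by (simp add: map_pmf_def pair_pmf_def bind_assoc_pmf bind_return_pmf)
qed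

text \<open>The map \<open>\<rho> v s\<close> permutes the possible tails of arcs into
  \<open>v\<close>, and its seed \<open>s\<close> is taken from the same set \<open>V - {v}\<close>.
  The values \<open>d0\<close> and \<open>cd\<close> are only defaults of product measures.\<close>

locale layers =
  fixes V :: "'a set" and d0 :: 'a and cd :: "'c" and p0 p1 p2 :: real and Q0 U1 U2 :: "'c set" and \<rho> :: "'a \<Rightarrow> 'a \<Rightarrow> 'a \<Rightarrow> 'a"
  assumes finV: "finite V"
    and \<rho>: "\<And>v s. v \<in> V \<Longrightarrow> s \<in> V - {v} \<Longrightarrow> bij_betw (\<rho> v s) (V - {v}) (V - {v})"
    and cardV: "card V \<ge> 2"
begin

abbreviation "A \<equiv> all_arcs V"

lemma finA: "finite A" using finV by simp

text \<open>
  \<open>gen\<close> samples the \<open>Q0\<close>-layer as arc set \<open>b\<close> and colouring \<open>c\<close>, permutes its columns by the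
  random \<open>s\<close>, and splits each of the layers \<open>U1\<close> and \<open>U2\<close> according to whether the head of the
  arc is bare (\<open>eX\<close>, \<open>zX\<close>) or not (\<open>eN\<close>, \<open>zN\<close>), so that these parts can be exposed separately.
\<close>

definition bare :: "('a \<times> 'a \<Rightarrow> bool) \<Rightarrow> 'a set" where
  "bare b = {v\<in>V. \<forall>u\<in>V - {v}. \<not> b (u, v)}"

definition arcs_into :: "'a set \<Rightarrow> ('a \<times> 'a) set" where
  "arcs_into X = {a\<in>A. snd a \<in> X}"

lemma arcs_into: "arcs_into X \<subseteq> A" "finite (arcs_into X)"
  using finA by (auto simp: arcs_into_def)

text \<open>Heads are kept, so the bare vertices are the same before and after the shift. Off
  \<open>A\<close> the map is the identity, which keeps the default values of the product measure in
  place.\<close>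

definition shift :: "('a \<Rightarrow> 'a) \<Rightarrow> 'a \<times> 'a \<Rightarrow> 'a \<times> 'a" where
  "shift s a = (if a \<in> A then (\<rho> (snd a) (s (snd a)) (fst a), snd a) else a)"

definition assemble where
  "assemble b c eX zX eN s zN = (\<lambda>a.
     merge_opt (if a \<in> arcs_into (bare b) then eX a else eN a)
      (merge_opt (if b (shift s a) then Some (c (shift s a)) else None)
        (if a \<in> arcs_into (bare b) then zX a else zN a)))"

definition gen :: "('a \<times> 'a \<Rightarrow> 'c option) pmf" where
  "gen = do {
     b \<leftarrow> Pi_pmf A False (\<lambda>_. bernoulli_pmf p0);
     c \<leftarrow> Pi_pmf A cd (\<lambda>_. pmf_of_set Q0);
     eX \<leftarrow> Pi_pmf (arcs_into (bare b)) None (\<lambda>_. opt_pmf p1 U1);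
     zX \<leftarrow> Pi_pmf (arcs_into (bare b)) None (\<lambda>_. opt_pmf p2 U2);
     eN \<leftarrow> Pi_pmf (A - arcs_into (bare b)) None (\<lambda>_. opt_pmf p1 U1);
     s \<leftarrow> Pi_pmf V d0 (\<lambda>v. pmf_of_set (V - {v}));
     zN \<leftarrow> Pi_pmf (A - arcs_into (bare b)) None (\<lambda>_. opt_pmf p2 U2);
     return_pmf (assemble b c eX zX eN s zN)}"

lemma shift_bij:
  assumes "\<And>v. v \<in> V \<Longrightarrow> s v \<in> V - {v}"
  shows "bij_betw (shift s) A A"
proof (rule bij_betwI')
  have r: "bij_betw (\<rho> v (s v)) (V - {v}) (V - {v})" if "v \<in> V" for v using \<rho> assms that by blast
  show "(shift s x = shift s y) = (x = y)" if "x \<in> A" "y \<in> A" for x y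
  proof
    assume eq: "shift s x = shift s y"
    then have s: "snd x = snd y" using that by (auto simp: shift_def)
    have "fst x \<in> V - {snd x}" "fst y \<in> V - {snd x}" "snd x \<in> V" using that s by (auto simp: all_arcs_def)
    then have "fst x = fst y" using r[of "snd x"] eq that s
      by (auto simp: shift_def bij_betw_def dest: inj_onD)
    then show "x = y" using s by (simp add: prod_eq_iff)
  qed simp
  show "shift s x \<in> A" if "x \<in> A" for x
    using r[of "snd x"] that by (fastforce simp: shift_def all_arcs_def bij_betw_def)
  show "\<exists>x\<in>A. y = shift s x" if "y \<in> A" for y
  proof -
    have v: "snd y \<in> V" "fst y \<in> V - {snd y}" using that by (auto simp: all_arcs_def)
    then obtain u where u: "u \<in> V - {snd y}" "fst y = \<rho> (snd y) (s (snd y)) u"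
      using r[of "snd y"] by (auto simp: bij_betw_def)
    then have "(u, snd y) \<in> A" using v by (auto simp: all_arcs_def)
    then show ?thesis using u by (intro bexI[of _ "(u, snd y)"]) (auto simp: shift_def prod_eq_iff)
  qed
qed

lemma shift_notin: "a \<notin> A \<Longrightarrow> shift s a \<notin> A"
  by (simp add: shift_def)

text \<open>For each fixed \<open>s\<close> the shift permutes the arcs, and relabelling leaves an
  i.i.d. family unchanged in law. Averaging over \<open>s\<close> therefore changes nothing,
  although \<open>s\<close> is what makes the tails uniform once the layer has been exposed.\<close>

lemma gen_eq:
  assumes 1: "do {x \<leftarrow> opt_pmf p1 U1; y \<leftarrow> \<xi>; return_pmf (merge_opt x y)} = \<zeta>"
    and 2: "do {x \<leftarrow> opt_pmf p0 Q0; y \<leftarrow> opt_pmf p2 U2; return_pmf (merge_opt x y)} = \<xi>"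
  shows "gen = Pi_pmf A None (\<lambda>_. \<zeta>)"
proof -
  let ?B = "Pi_pmf A False (\<lambda>_. bernoulli_pmf p0)" and ?C = "Pi_pmf A cd (\<lambda>_. pmf_of_set Q0)"
  let ?E = "\<lambda>D. Pi_pmf D None (\<lambda>_. opt_pmf p1 U1)" and ?Z = "\<lambda>D. Pi_pmf D None (\<lambda>_. opt_pmf p2 U2)"
  let ?S = "Pi_pmf V d0 (\<lambda>v. pmf_of_set (V - {v}))"
  let ?Y = "Pi_pmf A None (\<lambda>_. opt_pmf p0 Q0)"
  \<comment> \<open>Undoes the exposure order of \<open>gen\<close>: products split at the bare
    heads are put together again and independent draws exchanged, for an arbitrary function
    \<open>F\<close> of the results.\<close>
  have inner: "do {eX \<leftarrow> ?E D; zX \<leftarrow> ?Z D; eN \<leftarrow> ?E (A - D); s \<leftarrow> ?S; zN \<leftarrow> ?Z (A - D);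
       return_pmf (F (\<lambda>a. if a \<in> D then eX a else eN a) s (\<lambda>a. if a \<in> D then zX a else zN a))}
     = do {s \<leftarrow> ?S; e \<leftarrow> ?E A; z \<leftarrow> ?Z A; return_pmf (F e s z)}"
    if D: "D \<subseteq> A" for D and F :: "('a \<times> 'a \<Rightarrow> 'c option) \<Rightarrow> ('a \<Rightarrow> 'a) \<Rightarrow> ('a \<times> 'a \<Rightarrow> 'c option) \<Rightarrow> ('a \<times> 'a \<Rightarrow> 'c option)"
  proof -
    let ?K = "\<lambda>eX zX eN s zN. return_pmf (F (\<lambda>a. if a \<in> D then eX a else eN a) s (\<lambda>a. if a \<in> D then zX a else zN a))"
    have "do {s \<leftarrow> ?S; e \<leftarrow> ?E A; z \<leftarrow> ?Z A; return_pmf (F e s z)} =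
       do {s \<leftarrow> ?S; eX \<leftarrow> ?E D; eN \<leftarrow> ?E (A - D); zX \<leftarrow> ?Z D; zN \<leftarrow> ?Z (A - D); ?K eX zX eN s zN}"
      unfolding Pi_pmf_split[OF finA D] by (simp add: bind_assoc_pmf bind_return_pmf)
    also have "\<dots> = do {eX \<leftarrow> ?E D; s \<leftarrow> ?S; eN \<leftarrow> ?E (A - D); zX \<leftarrow> ?Z D; zN \<leftarrow> ?Z (A - D); ?K eX zX eN s zN}"
      by (rule bind_commute_pmf)
    also have "\<dots> = do {eX \<leftarrow> ?E D; eN \<leftarrow> ?E (A - D); s \<leftarrow> ?S; zX \<leftarrow> ?Z D; zN \<leftarrow> ?Z (A - D); ?K eX zX eN s zN}"
      by (intro bind_pmf_cong refl bind_commute_pmf)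
    also have "\<dots> = do {eX \<leftarrow> ?E D; eN \<leftarrow> ?E (A - D); zX \<leftarrow> ?Z D; s \<leftarrow> ?S; zN \<leftarrow> ?Z (A - D); ?K eX zX eN s zN}"
      by (intro bind_pmf_cong[OF refl]) (rule bind_commute_pmf)
    also have "\<dots> = do {eX \<leftarrow> ?E D; zX \<leftarrow> ?Z D; eN \<leftarrow> ?E (A - D); s \<leftarrow> ?S; zN \<leftarrow> ?Z (A - D); ?K eX zX eN s zN}"
      by (intro bind_pmf_cong[OF refl]) (rule bind_commute_pmf)
    finally show ?thesis by simp
  qed
  have "gen = do {b \<leftarrow> ?B; c \<leftarrow> ?C; s \<leftarrow> ?S; e \<leftarrow> ?E A; z \<leftarrow> ?Z A;
     return_pmf (\<lambda>a. merge_opt (e a) (merge_opt (if b (shift s a) then Some (c (shift s a)) else None) (z a)))}"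
    unfolding gen_def assemble_def
  proof (rule bind_pmf_cong[OF refl], rule bind_pmf_cong[OF refl])
    fix b c
    show "do {eX \<leftarrow> ?E (arcs_into (bare b)); zX \<leftarrow> ?Z (arcs_into (bare b)); eN \<leftarrow> ?E (A - arcs_into (bare b)); s \<leftarrow> ?S; zN \<leftarrow> ?Z (A - arcs_into (bare b));
       return_pmf (\<lambda>a. merge_opt (if a \<in> arcs_into (bare b) then eX a else eN a)
          (merge_opt (if b (shift s a) then Some (c (shift s a)) else None) (if a \<in> arcs_into (bare b) then zX a else zN a)))}
     = do {s \<leftarrow> ?S; e \<leftarrow> ?E A; z \<leftarrow> ?Z A;
       return_pmf (\<lambda>a. merge_opt (e a) (merge_opt (if b (shift s a) then Some (c (shift s a)) else None) (z a)))}"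
      using inner[OF arcs_into(1)[of "bare b"],
        of "\<lambda>e s z a. merge_opt (e a) (merge_opt (if b (shift s a) then Some (c (shift s a)) else None) (z a))"] .
  qed
  also have "\<dots> = do {s \<leftarrow> ?S; b \<leftarrow> ?B; c \<leftarrow> ?C; e \<leftarrow> ?E A; z \<leftarrow> ?Z A;
     return_pmf (\<lambda>a. merge_opt (e a) (merge_opt (if b (shift s a) then Some (c (shift s a)) else None) (z a)))}"
    by (subst bind_commute_pmf[of ?S], intro bind_pmf_cong refl bind_commute_pmf)
  also have "\<dots> = do {s \<leftarrow> ?S; y \<leftarrow> ?Y; e \<leftarrow> ?E A; z \<leftarrow> ?Z A;
     return_pmf (\<lambda>a. merge_opt (e a) (merge_opt (y (shift s a)) (z a)))}"
    unfolding Pi_opt_pmf_colours[OF finA, where d = cd, symmetric] by (simp add: bind_assoc_pmf bind_return_pmf)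
  also have "\<dots> = do {s \<leftarrow> ?S; y \<leftarrow> ?Y; e \<leftarrow> ?E A; z \<leftarrow> ?Z A;
     return_pmf (\<lambda>a. merge_opt (e a) (merge_opt (y a) (z a)))}"
  proof (rule bind_pmf_cong[OF refl])
    fix s assume s: "s \<in> set_pmf ?S"
    have "s v \<in> V - {v}" if v: "v \<in> V" for v
    proof -
      have "V \<noteq> {v}" using cardV by auto
      then have "V - {v} \<noteq> {}" using v by auto
      moreover have "s v \<in> set_pmf (pmf_of_set (V - {v}))"
        using s v finV by (subst (asm) set_Pi_pmf) (auto simp: PiE_dflt_def)
      ultimately show ?thesis using finV by (metis finite_Diff set_pmf_of_set)
    qed
    from shift_bij[OF this] have "?Y = map_pmf (\<lambda>g. g \<circ> shift s) ?Y"
      by (intro Pi_pmf_bij_betw finA shift_notin) auto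
    then have "?Y \<bind> (\<lambda>y. do {e \<leftarrow> ?E A; z \<leftarrow> ?Z A; return_pmf (\<lambda>a. merge_opt (e a) (merge_opt (y a) (z a)))})
       = map_pmf (\<lambda>g. g \<circ> shift s) ?Y \<bind> (\<lambda>y. do {e \<leftarrow> ?E A; z \<leftarrow> ?Z A; return_pmf (\<lambda>a. merge_opt (e a) (merge_opt (y a) (z a)))})"
      by simp
    then show "do {y \<leftarrow> ?Y; e \<leftarrow> ?E A; z \<leftarrow> ?Z A; return_pmf (\<lambda>a. merge_opt (e a) (merge_opt (y (shift s a)) (z a)))}
       = do {y \<leftarrow> ?Y; e \<leftarrow> ?E A; z \<leftarrow> ?Z A; return_pmf (\<lambda>a. merge_opt (e a) (merge_opt (y a) (z a)))}"
      by (simp add: bind_map_pmf)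
  qed
  also have "\<dots> = do {y \<leftarrow> ?Y; e \<leftarrow> ?E A; z \<leftarrow> ?Z A; return_pmf (\<lambda>a. merge_opt (e a) (merge_opt (y a) (z a)))}"
    by simp
  also have "\<dots> = do {e \<leftarrow> ?E A; y \<leftarrow> ?Y; z \<leftarrow> ?Z A; return_pmf (\<lambda>a. merge_opt (e a) (merge_opt (y a) (z a)))}"
    by (rule bind_commute_pmf)
  also have "\<dots> = do {e \<leftarrow> ?E A; w \<leftarrow> do {y \<leftarrow> ?Y; z \<leftarrow> ?Z A; return_pmf (\<lambda>a. merge_opt (y a) (z a))}; return_pmf (\<lambda>a. merge_opt (e a) (w a))}"
    by (simp add: bind_assoc_pmf bind_return_pmf)
  also have "\<dots> = Pi_pmf A None (\<lambda>_. \<zeta>)"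
    unfolding Pi_pmf_merge[OF finA 2] by (rule Pi_pmf_merge[OF finA 1])
  finally show ?thesis .
qed

end

section \<open>Rainbow transversals\<close>

lemma prob_unif:
  assumes "finite Q" "Q \<noteq> {}"
  shows "measure_pmf.prob (pmf_of_set Q) {y. y \<in> C} = card (Q \<inter> C) / card Q"
  using assms by (simp add: measure_pmf_of_set)

lemma prob_collision:
  fixes L :: "'a set"
  assumes "finite A" "finite L" "inj_on a L" "a ` L \<subseteq> A" "finite Q" "Q \<noteq> {}"
  shows "measure_pmf.prob (Pi_pmf A d (\<lambda>_. pmf_of_set Q)) {f. \<not> inj_on (\<lambda>v. f (a v)) L} \<le> (real (card L))\<^sup>2 / real (card Q)"
proof -
  let ?M = "Pi_pmf A d (\<lambda>_. pmf_of_set Q)"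
  let ?P = "{(v, w). v \<in> L \<and> w \<in> L \<and> v \<noteq> w}"
  have fP: "finite ?P" by (rule finite_subset[of _ "L \<times> L"]) (use assms in auto)
  have cP: "card ?P \<le> (card L)\<^sup>2"
  proof -
    have "card ?P \<le> card (L \<times> L)" by (rule card_mono) (use assms in auto)
    then show ?thesis by (simp add: card_cartesian_product power2_eq_square)
  qed
  have one: "measure_pmf.prob ?M {f. f (a (fst x)) = f (a (snd x))} \<le> 1 / card Q" if x: "x \<in> ?P" for x
  proof -
    have ne: "a (fst x) \<noteq> a (snd x)" "a (fst x) \<in> A" "a (snd x) \<in> A"
      using x assms(3,4) by (auto dest: inj_onD)
    have "measure_pmf.prob ?M {f. f (a (fst x)) = f (a (snd x))}
       \<le> measure_pmf.prob ?M {f. \<exists>c\<in>Q. f (a (fst x)) = c \<and> f (a (snd x)) = c}"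
      by (rule prob_mono) (use assms ne in \<open>auto simp: set_Pi_pmf PiE_dflt_def\<close>)
    also have "\<dots> \<le> (\<Sum>c\<in>Q. measure_pmf.prob ?M {f. f (a (fst x)) = c \<and> f (a (snd x)) = c})"
      by (rule prob_union_le) (use assms in auto)
    also have "\<dots> = (\<Sum>c\<in>Q. 1 / card Q * (1 / card Q))"
    proof (intro sum.cong refl)
      fix c assume c: "c \<in> Q"
      have "measure_pmf.prob (pmf_of_set Q) {y. y = c} = 1 / card Q"
        using prob_unif[OF assms(5,6), of "{c}"] c by simp
      then show "measure_pmf.prob ?M {f. f (a (fst x)) = c \<and> f (a (snd x)) = c} = 1 / card Q * (1 / card Q)"
        using prob_Pi_pmf_two[OF assms(1) ne(2,3,1), of d "\<lambda>_. pmf_of_set Q" "\<lambda>y. y = c" "\<lambda>y. y = c"] by simp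
    qed
    also have "\<dots> = 1 / card Q" using assms by simp
    finally show ?thesis .
  qed
  have "measure_pmf.prob ?M {f. \<not> inj_on (\<lambda>v. f (a v)) L} \<le> measure_pmf.prob ?M {f. \<exists>x\<in>?P. f (a (fst x)) = f (a (snd x))}"
    by (rule prob_mono) (auto simp: inj_on_def)
  also have "\<dots> \<le> (\<Sum>x\<in>?P. measure_pmf.prob ?M {f. f (a (fst x)) = f (a (snd x))})"
    by (rule prob_union_le[OF fP])
  also have "\<dots> \<le> (\<Sum>x\<in>?P. 1 / card Q)" by (intro sum_mono one)
  also have "\<dots> = card ?P / card Q" by simp
  also have "\<dots> \<le> (real (card L))\<^sup>2 / real (card Q)" using cP by (intro divide_right_mono) (auto simp flip: of_nat_power)
  finally show ?thesis .
qed

text \<open>The target \<open>G f\<close> is determined by the coordinates in \<open>E\<close>. Once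
  these are exposed, the coordinates in \<open>D\<close> are independent of it.\<close>

lemma prob_all_in_random_set:
  assumes "finite A" "finite D" "D \<subseteq> A" "E \<subseteq> A" "D \<inter> E = {}" "finite Q" "Q \<noteq> {}"
    and G: "\<And>f g. (\<forall>x\<in>E. f x = g x) \<Longrightarrow> G f = G g" and c: "\<And>f. card (Q \<inter> G f) \<le> k"
    and d: "card D \<ge> d"
  shows "measure_pmf.prob (Pi_pmf A z (\<lambda>_. pmf_of_set Q)) {f. \<forall>x\<in>D. f x \<in> G f} \<le> (k / card Q) ^ d"
\<comment> \<open>Here the bound is at least 1. In the other case the base is below 1, as is needed
  to pass from \<open>card D\<close> to the smaller exponent \<open>d\<close>.\<close>
proof (cases "k \<ge> card Q")
  case True
  have "1 \<le> (k / card Q) ^ d" using True assms(6,7) by (intro one_le_power) (simp add: le_divide_eq card_gt_0_iff)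
  then show ?thesis using measure_pmf.prob_le_1 order_trans by blast
next
  case False
  have fE: "finite E" using assms(1,4) finite_subset by blast
  have GU: "G (\<lambda>x. if x \<in> E then f x else g x) = G f" for f g by (rule G) auto
  have "measure_pmf.prob (Pi_pmf A z (\<lambda>_. pmf_of_set Q)) {f. \<forall>x\<in>D. f x \<in> G f}
     = measure_pmf.prob (Pi_pmf (E \<union> D) z (\<lambda>_. pmf_of_set Q)) {f. \<forall>x\<in>D. f x \<in> G f}"
  proof (rule prob_Pi_pmf_subset)
    fix f g :: "'a \<Rightarrow> 'b" assume "\<forall>x\<in>E \<union> D. f x = g x"
    then have "G f = G g" "\<forall>x\<in>D. f x = g x" using G by auto
    then show "(\<forall>x\<in>D. f x \<in> G f) = (\<forall>x\<in>D. g x \<in> G g)" by simp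
  qed (use assms(1,3,4) in auto)
  also have "\<dots> = measure_pmf.prob (do {f \<leftarrow> Pi_pmf E z (\<lambda>_. pmf_of_set Q); g \<leftarrow> Pi_pmf D z (\<lambda>_. pmf_of_set Q);
      return_pmf (\<lambda>x. if x \<in> E then f x else g x)}) {f. \<forall>x\<in>D. f x \<in> G f}"
  proof -
    have "E \<union> D - E = D" using assms(5) by auto
    then show ?thesis using Pi_pmf_split[of "E \<union> D" E z "\<lambda>_. pmf_of_set Q"] fE assms(2) by simp
  qed
  also have "\<dots> \<le> measure_pmf.prob (Pi_pmf E z (\<lambda>_. pmf_of_set Q)) {f. False} + (k / card Q) ^ d"
  proof (rule prob_bind_le)
    fix f
    have "measure_pmf.prob (do {g \<leftarrow> Pi_pmf D z (\<lambda>_. pmf_of_set Q); return_pmf (\<lambda>x. if x \<in> E then f x else g x)}) {f. \<forall>x\<in>D. f x \<in> G f}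
      = measure_pmf.prob (Pi_pmf D z (\<lambda>_. pmf_of_set Q)) {g. \<forall>x\<in>D. g x \<in> G f}"
    proof -
      have "(if x \<in> E then f x else g x) = g x" if "x \<in> D" for x g using assms(5) that by auto
      then have "(\<lambda>g x. if x \<in> E then f x else g x) -` {f. \<forall>x\<in>D. f x \<in> G f} = {g. \<forall>x\<in>D. g x \<in> G f}"
        unfolding vimage_def mem_Collect_eq GU by (intro Collect_cong ball_cong refl) simp
      then show ?thesis unfolding map_pmf_def[symmetric] by simp
    qed
    also have "\<dots> = (\<Prod>x\<in>D. measure_pmf.prob (pmf_of_set Q) {y. y \<in> G f})"
      by (rule prob_Pi_pmf_all) (use assms(2,3) in auto)
    also have "\<dots> = (card (Q \<inter> G f) / card Q) ^ card D" using prob_unif[OF assms(6,7), of "G f"] by simp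
    also have "\<dots> \<le> (k / card Q) ^ card D" using c[of f] by (intro power_mono divide_right_mono) auto
    also have "\<dots> \<le> (k / card Q) ^ d" using d False by (intro power_decreasing) (auto simp: divide_le_eq_1)
    finally show "measure_pmf.prob (do {g \<leftarrow> Pi_pmf D z (\<lambda>_. pmf_of_set Q); return_pmf (\<lambda>x. if x \<in> E then f x else g x)}) {f. \<forall>x\<in>D. f x \<in> G f} \<le> (k / card Q) ^ d" .
  qed simp
  finally show ?thesis by simp
qed

text \<open>The vertices in \<open>L\<close> have too few arcs for a union bound. Each receives one
  designated arc, whose colours are distinct by the birthday bound, and Hall's theorem serves the
  others with these colours removed. A violating set of size \<open>k\<close> confines at least
  \<open>k * d\<close> arcs to \<open>k\<close> colours and the at most \<open>l\<close> colours
  spent on \<open>L\<close>.\<close>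

lemma prob_no_rainbow_transversal:
  fixes D :: "'v \<Rightarrow> 'a set"
  assumes fA: "finite A" and fI: "finite I" and DA: "\<And>v. v \<in> I \<Longrightarrow> D v \<subseteq> A" and D0: "\<And>v. v \<in> I \<Longrightarrow> D v \<noteq> {}"
    and disj: "disjoint_family_on D I" and L: "L \<subseteq> I" "card L \<le> l" and d: "\<And>v. v \<in> I - L \<Longrightarrow> card (D v) \<ge> d"
    and Q: "finite Q" "card I \<le> card Q" "Q \<noteq> {}"
  shows "measure_pmf.prob (Pi_pmf A z (\<lambda>_. pmf_of_set Q)) {f. \<not> (\<exists>M. (\<forall>v\<in>I. M v \<in> D v) \<and> inj_on (\<lambda>v. f (M v)) I)}
    \<le> (real l)\<^sup>2 / real (card Q) + (\<Sum>k=1..card I. real (card I choose k) * real (card Q choose k) * (real (k + l) / real (card Q)) ^ (k * d))"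
proof -
  let ?M = "Pi_pmf A z (\<lambda>_. pmf_of_set Q)"
  define a where "a v = (SOME x. x \<in> D v)" for v
  have a: "a v \<in> D v" if "v \<in> I" for v using D0[OF that] unfolding a_def by (simp add: some_in_eq)
  have fL: "finite L" using L fI finite_subset by blast
  have fD: "finite (D v)" if "v \<in> I" for v using DA[OF that] fA finite_subset by blast
  have disj': "v = w" if "x \<in> D v" "x \<in> D w" "v \<in> I" "w \<in> I" for x v w
    using disj that by (auto simp: disjoint_family_on_def)
  have inja: "inj_on a L"
  proof (rule inj_onI)
    fix x y assume xy: "x \<in> L" "y \<in> L" "a x = a y"
    then have "x \<in> I" "y \<in> I" using L(1) by auto
    then show "x = y" using disj'[of "a x" x y] a[of x] a[of y] xy(3) by simp
  qed
  define CL where "CL f = (\<lambda>v. f (a v)) ` L" for f :: "'a \<Rightarrow> 'b"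
  have cCL: "card (CL f) \<le> l" for f unfolding CL_def using L(2) card_image_le[OF fL] le_trans by blast
  let ?bad = "\<lambda>S T f. \<forall>x\<in>(\<Union>v\<in>S. D v). f x \<in> T \<union> CL f"
  let ?SS = "\<lambda>k. {S. S \<subseteq> I - L \<and> card S = k}"
  let ?TT = "\<lambda>k. {T. T \<subseteq> Q \<and> card T = k}"
  have imp: "\<exists>k\<in>{1..card I}. \<exists>S\<in>?SS k. \<exists>T\<in>?TT k. ?bad S T f"
    if f: "f \<in> set_pmf ?M" and inj: "inj_on (\<lambda>v. f (a v)) L"
      and no: "\<not> (\<exists>M. (\<forall>v\<in>I. M v \<in> D v) \<and> inj_on (\<lambda>v. f (M v)) I)" for f
  proof -
    have fQ: "f x \<in> Q" if "x \<in> A" for x using f that fA Q by (auto simp: set_Pi_pmf PiE_dflt_def)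
    let ?N = "\<lambda>v. f ` D v - CL f"
    have "\<exists>S. S \<subseteq> I - L \<and> \<not> card S \<le> card (\<Union>(?N ` S))"
    proof (rule ccontr)
      assume "\<nexists>S. S \<subseteq> I - L \<and> \<not> card S \<le> card (\<Union> (?N ` S))"
      then have "\<exists>g. inj_on g (I - L) \<and> (\<forall>i\<in>I - L. g i \<in> ?N i)"
        by (intro hall) (use fI fD in auto)
      then obtain g where g: "inj_on g (I - L)" "\<forall>i\<in>I - L. g i \<in> ?N i" by blast
      have "\<forall>v\<in>I - L. \<exists>x\<in>D v. f x = g v" using g(2) by (metis DiffD1 imageE)
      then obtain m where m: "\<forall>v\<in>I - L. m v \<in> D v \<and> f (m v) = g v" by metis
      define M where "M v = (if v \<in> L then a v else m v)" for v
      have "inj_on (\<lambda>v. f (M v)) I"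
      proof (rule inj_onI)
        fix x y assume xy: "x \<in> I" "y \<in> I" "f (M x) = f (M y)"
        have ne: "f (a v) \<noteq> f (m w)" if "v \<in> L" "w \<in> I - L" for v w
          using that m g(2) unfolding CL_def by (metis Diff_iff imageI)
        show "x = y"
        proof (cases "x \<in> L"; cases "y \<in> L")
          assume "x \<in> L" "y \<in> L" then show ?thesis using xy inj by (auto simp: M_def dest: inj_onD)
        next
          assume "x \<notin> L" "y \<notin> L" then show ?thesis using xy m g(1) by (auto simp: M_def dest: inj_onD)
        next
          assume "x \<in> L" "y \<notin> L" then show ?thesis using xy ne[of x y] by (auto simp: M_def)
        next
          assume "x \<notin> L" "y \<in> L" then show ?thesis using xy ne[of y x] by (auto simp: M_def)
        qed
      qed
      moreover have "\<forall>v\<in>I. M v \<in> D v" using a m by (auto simp: M_def)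
      ultimately show False using no by blast
    qed
    then obtain S where S: "S \<subseteq> I - L" "card (\<Union>(?N ` S)) < card S" by (auto simp: not_le)
    have SI: "S \<subseteq> I" using S by auto
    have fS: "finite S" using SI fI finite_subset by blast
    have UQ: "\<Union>(?N ` S) \<subseteq> Q"
    proof
      fix y assume "y \<in> \<Union>(?N ` S)"
      then obtain v x where "v \<in> S" "x \<in> D v" "y = f x" by blast
      then show "y \<in> Q" using SI DA[of v] fQ by auto
    qed
    have cS: "card S \<le> card I" by (rule card_mono[OF fI SI])
    \<comment> \<open>A violating set sees fewer than \<open>card S\<close> new colours; padding to
      exactly \<open>card S\<close> gives the binomial coefficient of the union bound.\<close>
    obtain T where T: "\<Union>(?N ` S) \<subseteq> T" "T \<subseteq> Q" "card T = card S"
      using exists_subset_between[of "\<Union>(?N ` S)" "card S" Q] S(2) UQ Q cS by auto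
    have "f x \<in> T \<union> CL f" if "v \<in> S" "x \<in> D v" for v x using T(1) that by blast
    then have "?bad S T f" by blast
    moreover have "card S \<in> {1..card I}" using S(2) cS by auto
    ultimately show ?thesis using S(1) T(2,3) by blast
  qed
  have pST: "measure_pmf.prob ?M {f. ?bad S T f} \<le> (real (k + l) / real (card Q)) ^ (k * d)"
    if S: "S \<in> ?SS k" and T: "T \<in> ?TT k" for S T k
  proof (rule prob_all_in_random_set[where E = "a ` L"])
    have fS: "finite S" by (rule finite_subset[OF _ fI]) (use S in auto)
    show "finite (\<Union>v\<in>S. D v)" using fS S fD by auto
    show "(\<Union>v\<in>S. D v) \<subseteq> A" using S DA by blast
    show "a ` L \<subseteq> A" using a DA L by blast
    show "(\<Union>v\<in>S. D v) \<inter> a ` L = {}"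
    proof (rule ccontr)
      assume "(\<Union>v\<in>S. D v) \<inter> a ` L \<noteq> {}"
      then obtain v w where vw: "v \<in> S" "w \<in> L" "a w \<in> D v" by auto
      then have "v \<in> I" "w \<in> I" "v \<notin> L" using S L by auto
      then show False using disj'[of "a w" v w] vw a by auto
    qed
    show "T \<union> CL f = T \<union> CL g" if "\<forall>x\<in>a ` L. f x = g x" for f g
      using that by (auto simp: CL_def)
    show "card (Q \<inter> (T \<union> CL f)) \<le> k + l" for f
    proof -
      have "finite (CL f)" "finite T" using fL T Q finite_subset by (auto simp: CL_def)
      then have "card (Q \<inter> (T \<union> CL f)) \<le> card (T \<union> CL f)" by (intro card_mono) auto
      also have "\<dots> \<le> card T + card (CL f)" by (rule card_Un_le)
      also have "\<dots> \<le> k + l" using T cCL[of f] by auto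
      finally show ?thesis .
    qed
    have "k * d = (\<Sum>v\<in>S. d)" using S by simp
    also have "\<dots> \<le> (\<Sum>v\<in>S. card (D v))" using S d by (intro sum_mono) auto
    also have "\<dots> = card (\<Union>v\<in>S. D v)"
      by (rule card_UN_disjoint[symmetric]) (use fS S fD disj in \<open>auto simp: disjoint_family_on_def\<close>)
    finally show "k * d \<le> card (\<Union>v\<in>S. D v)" .
  qed (use fA Q in auto)
  have fSS: "finite (?SS k)" "finite (?TT k)" for k using fI Q by auto
  have cSS: "card (?SS k) \<le> card I choose k" for k
  proof -
    have "card (?SS k) \<le> card {S. S \<subseteq> I \<and> card S = k}" using fI by (intro card_mono) auto
    then show ?thesis using n_subsets[OF fI] by simp
  qed
  have "measure_pmf.prob ?M {f. \<exists>k\<in>{1..card I}. \<exists>S\<in>?SS k. \<exists>T\<in>?TT k. ?bad S T f}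
    \<le> (\<Sum>k=1..card I. measure_pmf.prob ?M {f. \<exists>S\<in>?SS k. \<exists>T\<in>?TT k. ?bad S T f})"
    by (rule prob_union_le) auto
  also have "\<dots> \<le> (\<Sum>k=1..card I. \<Sum>S\<in>?SS k. measure_pmf.prob ?M {f. \<exists>T\<in>?TT k. ?bad S T f})"
    by (intro sum_mono prob_union_le fSS)
  also have "\<dots> \<le> (\<Sum>k=1..card I. \<Sum>S\<in>?SS k. \<Sum>T\<in>?TT k. measure_pmf.prob ?M {f. ?bad S T f})"
    by (intro sum_mono prob_union_le fSS)
  also have "\<dots> \<le> (\<Sum>k=1..card I. \<Sum>S\<in>?SS k. \<Sum>T\<in>?TT k. (real (k + l) / real (card Q)) ^ (k * d))"
    by (intro sum_mono pST)
  also have "\<dots> = (\<Sum>k=1..card I. real (card (?SS k)) * real (card Q choose k) * (real (k + l) / real (card Q)) ^ (k * d))"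
    using n_subsets[OF Q(1)] by (simp add: mult.assoc)
  also have "\<dots> \<le> (\<Sum>k=1..card I. real (card I choose k) * real (card Q choose k) * (real (k + l) / real (card Q)) ^ (k * d))"
    by (intro sum_mono mult_right_mono of_nat_mono cSS) auto
  finally have B: "measure_pmf.prob ?M {f. \<exists>k\<in>{1..card I}. \<exists>S\<in>?SS k. \<exists>T\<in>?TT k. ?bad S T f}
     \<le> (\<Sum>k=1..card I. real (card I choose k) * real (card Q choose k) * (real (k + l) / real (card Q)) ^ (k * d))" .
  have "measure_pmf.prob ?M {f. \<not> inj_on (\<lambda>v. f (a v)) L} \<le> (real (card L))\<^sup>2 / real (card Q)"
  proof (rule prob_collision[OF fA fL inja _ Q(1,3)])
    show "a ` L \<subseteq> A" using a DA L by blast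
  qed
  also have "\<dots> \<le> (real l)\<^sup>2 / real (card Q)" using L by (intro divide_right_mono power_mono) auto
  finally have C: "measure_pmf.prob ?M {f. \<not> inj_on (\<lambda>v. f (a v)) L} \<le> (real l)\<^sup>2 / real (card Q)" .
  have "measure_pmf.prob ?M {f. \<not> (\<exists>M. (\<forall>v\<in>I. M v \<in> D v) \<and> inj_on (\<lambda>v. f (M v)) I)}
    \<le> measure_pmf.prob ?M {f. \<not> inj_on (\<lambda>v. f (a v)) L \<or> (\<exists>k\<in>{1..card I}. \<exists>S\<in>?SS k. \<exists>T\<in>?TT k. ?bad S T f)}"
    by (rule prob_mono) (use imp in blast)
  also note prob_disj_le
  finally show ?thesis using B C by linarith
qed

text \<open>A product bound although the condition \<open>R\<close> on the second block depends on
  the first: after exposing \<open>B\<close>, each coordinate in \<open>D\<close> satisfies it with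
  probability at most \<open>c\<close>.\<close>

lemma prob_two_blocks_le:
  assumes fA: "finite A" and BA: "B \<subseteq> A" and DA: "D \<subseteq> A" and BD: "B \<inter> D = {}"
    and Q: "\<And>f g. (\<forall>x\<in>B. f x = g x) \<Longrightarrow> Q f = Q g" and R: "\<And>f g. (\<forall>x\<in>B. f x = g x) \<Longrightarrow> R f = R g"
    and c: "\<And>f x. Q f \<Longrightarrow> x \<in> D \<Longrightarrow> measure_pmf.prob (p x) {y. R f x y} \<le> c" "0 \<le> c"
  shows "measure_pmf.prob (Pi_pmf A z p) {f. Q f \<and> (\<forall>x\<in>D. R f x (f x))} \<le> measure_pmf.prob (Pi_pmf B z p) {f. Q f} * c ^ card D"
proof -
  have fB: "finite B" and fD: "finite D" using fA BA DA finite_subset by blast+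
  have QU: "Q (\<lambda>x. if x \<in> B then f x else g x) = Q f" for f g by (rule Q) simp
  have RU: "R (\<lambda>x. if x \<in> B then f x else g x) = R f" for f g by (rule R) simp
  have gD: "(if x \<in> B then f x else g x) = g x" if "x \<in> D" for x and f g :: "'a \<Rightarrow> 'b" using BD that by auto
  have "measure_pmf.prob (Pi_pmf A z p) {f. Q f \<and> (\<forall>x\<in>D. R f x (f x))}
    = measure_pmf.prob (Pi_pmf (B \<union> D) z p) {f. Q f \<and> (\<forall>x\<in>D. R f x (f x))}"
  proof (rule prob_Pi_pmf_subset[OF fA])
    fix f g :: "'a \<Rightarrow> 'b" assume fg: "\<forall>x\<in>B \<union> D. f x = g x"
    then have "Q f = Q g" "R f = R g" using Q[of f g] R[of f g] by simp_all
    then show "(Q f \<and> (\<forall>x\<in>D. R f x (f x))) = (Q g \<and> (\<forall>x\<in>D. R g x (g x)))" using fg by simp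
  qed (use BA DA in simp)
  also have "Pi_pmf (B \<union> D) z p = do {f \<leftarrow> Pi_pmf B z p; g \<leftarrow> Pi_pmf D z p; return_pmf (\<lambda>x. if x \<in> B then f x else g x)}"
  proof -
    have "B \<union> D - B = D" using BD by auto
    then show ?thesis using Pi_pmf_split[of "B \<union> D" B z p] fB fD by simp
  qed
  also have "measure_pmf.prob \<dots> {f. Q f \<and> (\<forall>x\<in>D. R f x (f x))} =
     (\<integral>f. measure_pmf.prob (do {g \<leftarrow> Pi_pmf D z p; return_pmf (\<lambda>x. if x \<in> B then f x else g x)}) {f. Q f \<and> (\<forall>x\<in>D. R f x (f x))} \<partial>measure_pmf (Pi_pmf B z p))"
    by (rule prob_bind_pmf)
  also have "\<dots> \<le> (\<integral>f. indicator {f. Q f} f * c ^ card D \<partial>measure_pmf (Pi_pmf B z p))"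
  proof (rule integral_mono)
    fix f
    have "measure_pmf.prob (do {g \<leftarrow> Pi_pmf D z p; return_pmf (\<lambda>x. if x \<in> B then f x else g x)}) {f. Q f \<and> (\<forall>x\<in>D. R f x (f x))}
      = measure_pmf.prob (Pi_pmf D z p) {g. Q f \<and> (\<forall>x\<in>D. R f x (g x))}"
    proof -
      have "(\<lambda>g x. if x \<in> B then f x else g x) -` {f. Q f \<and> (\<forall>x\<in>D. R f x (f x))} = {g. Q f \<and> (\<forall>x\<in>D. R f x (g x))}"
        unfolding vimage_def mem_Collect_eq QU RU by (intro Collect_cong conj_cong ball_cong refl) (simp add: gD)
      then show ?thesis unfolding map_pmf_def[symmetric] by simp
    qed
    also have "\<dots> \<le> indicator {f. Q f} f * c ^ card D"
    proof (cases "Q f")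
      case True
      have "measure_pmf.prob (Pi_pmf D z p) {g. \<forall>x\<in>D. R f x (g x)} = (\<Prod>x\<in>D. measure_pmf.prob (p x) {y. R f x y})"
        by (rule prob_Pi_pmf_all[OF fD]) simp
      also have "\<dots> \<le> (\<Prod>x\<in>D. c)" using c(1)[OF True] by (intro prod_mono) simp
      finally show ?thesis using True by simp
    qed simp
    finally show "measure_pmf.prob (do {g \<leftarrow> Pi_pmf D z p; return_pmf (\<lambda>x. if x \<in> B then f x else g x)}) {f. Q f \<and> (\<forall>x\<in>D. R f x (f x))}
       \<le> indicator {f. Q f} f * c ^ card D" .
  next
    show "integrable (measure_pmf (Pi_pmf B z p)) (\<lambda>f. indicator {f. Q f} f * c ^ card D)"
      by (rule measure_pmf.integrable_const_bound[where B = "c ^ card D"]) (auto simp: c(2) indicator_def)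
    show "integrable (measure_pmf (Pi_pmf B z p)) (\<lambda>f. measure_pmf.prob (do {g \<leftarrow> Pi_pmf D z p; return_pmf (\<lambda>x. if x \<in> B then f x else g x)}) {f. Q f \<and> (\<forall>x\<in>D. R f x (f x))})"
      by (rule measure_pmf.integrable_const_bound[where B = 1]) auto
  qed
  also have "\<dots> = measure_pmf.prob (Pi_pmf B z p) {f. Q f} * c ^ card D"
    unfolding integral_mult_left_zero by simp
  finally show ?thesis .
qed

text \<open>An orbit inside \<open>S\<close> does not notice changes of the parent function
  elsewhere. This is used when the tree grows and when it is put into the final
  arborescence.\<close>

lemma funpow_reach_cong:
  assumes "(g ^^ k) w = r" "w \<in> S" "\<And>w. w \<in> S - {r} \<Longrightarrow> g w \<in> S \<and> g' w = g w"
  shows "\<exists>k. (g' ^^ k) w = r"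
  using assms(1,2)
proof (induction k arbitrary: w)
  case 0
  then show ?case by (intro exI[of _ 0]) simp
next
  case (Suc k)
  show ?case
  proof (cases "w = r")
    case True
    then show ?thesis by (intro exI[of _ 0]) simp
  next
    case False
    then have *: "g w \<in> S" "g' w = g w" using assms(3)[of w] Suc.prems by auto
    have "(g ^^ k) (g w) = r" using Suc.prems by (simp add: funpow_swap1)
    then obtain j where "(g' ^^ j) (g w) = r" using Suc.IH * by blast
    then have "(g' ^^ Suc j) w = r" using * by (simp add: funpow_swap1)
    then show ?thesis by blast
  qed
qed

section \<open>Growing a rainbow tree\<close>

text \<open>
  The tree with root \<open>r\<close>, vertex set \<open>S\<close> and parent function \<open>g\<close> avoids the bare vertices \<open>X\<close>
  and the colours \<open>C\<close>, which are reserved for attaching them.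
\<close>

definition good_tree :: "'a set \<Rightarrow> 'a set \<Rightarrow> 'a \<Rightarrow> 'c set \<Rightarrow> ('a \<times> 'a \<Rightarrow> 'c option) \<Rightarrow> 'a set \<Rightarrow> ('a \<Rightarrow> 'a) \<Rightarrow> bool" where
  "good_tree V X r C e S g \<longleftrightarrow> r \<in> S \<and> S \<subseteq> V \<and> S - {r} \<subseteq> V - X \<and>
     (\<forall>v\<in>S - {r}. g v \<in> S \<and> g v \<noteq> v \<and> e (g v, v) \<noteq> None \<and> e (g v, v) \<notin> Some ` C) \<and>
     inj_on (\<lambda>v. e (g v, v)) (S - {r}) \<and> (\<forall>v\<in>S. \<exists>k. (g ^^ k) v = r)"

definition stuck :: "'a set \<Rightarrow> 'a set \<Rightarrow> 'a \<Rightarrow> 'c set \<Rightarrow> ('a \<times> 'a \<Rightarrow> 'c option) \<Rightarrow> 'a set \<Rightarrow> ('a \<Rightarrow> 'a) \<Rightarrow> bool" where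
  "stuck V X r C e S g \<longleftrightarrow> (\<forall>u\<in>S. \<forall>v\<in>V - S - X. e (u, v) = None \<or> e (u, v) \<in> Some ` C \<or> e (u, v) \<in> (\<lambda>w. e (g w, w)) ` (S - {r}))"

lemma good_tree_extend:
  assumes "good_tree V X r C e S g" "\<not> stuck V X r C e S g"
  shows "\<exists>v g'. v \<in> V - S \<and> good_tree V X r C e (insert v S) g'"
proof -
  obtain u v where uv: "u \<in> S" "v \<in> V - S - X" "e (u, v) \<noteq> None" "e (u, v) \<notin> Some ` C"
    "e (u, v) \<notin> (\<lambda>w. e (g w, w)) ` (S - {r})"
    using assms(2) unfolding stuck_def by blast
  note G = assms(1)[unfolded good_tree_def]
  let ?g = "g(v := u)"
  have vr: "v \<noteq> r" using G uv by auto
  have gS: "?g w = g w" if "w \<in> S" for w using that uv by auto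
  have S': "insert v S - {r} = insert v (S - {r})" using vr by auto
  have reachS: "\<exists>k. (?g ^^ k) w = r" if w: "w \<in> S" for w
  proof -
    obtain k where "(g ^^ k) w = r" using G w by blast
    then show ?thesis by (rule funpow_reach_cong[where S = S]) (use w G gS in auto)
  qed
  obtain k where "(?g ^^ k) u = r" using reachS uv by blast
  then have "(?g ^^ Suc k) v = r" by (simp add: funpow_swap1)
  then have reachv: "\<exists>k. (?g ^^ k) v = r" by blast
  have inj: "inj_on (\<lambda>w. e (?g w, w)) (insert v S - {r})"
    unfolding S'
  proof (rule inj_on_insert[THEN iffD2], intro conjI)
    have "inj_on (\<lambda>w. e (g w, w)) (S - {r})" using G by simp
    moreover have "e (?g w, w) = e (g w, w)" if "w \<in> S - {r}" for w using gS that by simp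
    ultimately show "inj_on (\<lambda>w. e (?g w, w)) (S - {r})"
      using inj_on_cong[of "S - {r}" "\<lambda>w. e (?g w, w)" "\<lambda>w. e (g w, w)"] by blast
    show "e (?g v, v) \<notin> (\<lambda>w. e (?g w, w)) ` (S - {r} - {v})"
      using uv gS by (auto simp: image_iff)
  qed
  have "good_tree V X r C e (insert v S) ?g"
    unfolding good_tree_def
  proof (intro conjI)
    show "\<forall>w\<in>insert v S - {r}. ?g w \<in> insert v S \<and> ?g w \<noteq> w \<and> e (?g w, w) \<noteq> None \<and> e (?g w, w) \<notin> Some ` C"
    proof
      fix w assume w: "w \<in> insert v S - {r}"
      show "?g w \<in> insert v S \<and> ?g w \<noteq> w \<and> e (?g w, w) \<noteq> None \<and> e (?g w, w) \<notin> Some ` C"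
      proof (cases "w = v")
        case True
        then show ?thesis using uv by auto
      next
        case False
        then have "w \<in> S - {r}" using w by auto
        then show ?thesis using G gS[of w] by auto
      qed
    qed
    show "r \<in> insert v S" "insert v S \<subseteq> V" "insert v S - {r} \<subseteq> V - X" using G uv by blast+
    show "inj_on (\<lambda>w. e (?g w, w)) (insert v S - {r})" by (rule inj)
    show "\<forall>w\<in>insert v S. \<exists>k. (?g ^^ k) w = r" using reachS reachv by blast
  qed
  then show ?thesis using uv by blast
qed

lemma good_tree_grow:
  assumes "r \<in> V" "finite V" "1 \<le> K" "\<And>S g. good_tree V X r C e S g \<Longrightarrow> card S < K \<Longrightarrow> \<not> stuck V X r C e S g"
  shows "\<exists>S g. good_tree V X r C e S g \<and> card S = K"
proof -
  have "\<exists>S g. good_tree V X r C e S g \<and> card S = k" if "1 \<le> k" "k \<le> K" for k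
    using that
  proof (induction k rule: dec_induct)
    case base
    have "good_tree V X r C e {r} (\<lambda>_. r)" unfolding good_tree_def
      using assms(1) by (auto intro: exI[of _ 0])
    then show ?case by (intro exI[of _ "{r}"] exI[of _ "\<lambda>_. r"]) simp
  next
    case (step k)
    then obtain S g where S: "good_tree V X r C e S g" "card S = k" by auto
    then obtain v g' where v: "v \<in> V - S" "good_tree V X r C e (insert v S) g'"
      using good_tree_extend[OF S(1)] assms(4)[OF S(1)] step by auto
    have "finite S" using S(1) assms(2) finite_subset unfolding good_tree_def by blast
    then have "card (insert v S) = Suc k" using v(1) S(2) by simp
    then show ?case using v(2) by blast
  qed
  then show ?thesis using assms(3) by blast
qed

text \<open>Growth can only fail at a stuck tree of some size \<open>s < K\<close>. The union bound
  runs over its vertex set and parent function: \<open>s - 1\<close> arcs are present, and each of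
  at least \<open>s * (card V div 2)\<close> boundary arcs is useless with probability at most
  \<open>1 - p / 2\<close>, since at least half of the colours are still free.\<close>

lemma prob_growth:
  fixes p :: real
  assumes fV: "finite V" and r: "r \<in> V" and U: "finite U" "U \<noteq> {}" and p: "0 \<le> p" "p \<le> 1"
    and C: "card (C \<inter> U) \<le> c" "2 * (K + c) \<le> card U" and K: "1 \<le> K" "2 * (K + card X) \<le> card V" and X: "X \<subseteq> V"
  shows "measure_pmf.prob (Pi_pmf {a\<in>all_arcs V. snd a \<notin> X} None (\<lambda>_. opt_pmf p U))
      {e. \<not> (\<exists>S g. good_tree V X r C e S g \<and> card S = K)}
    \<le> (\<Sum>s=1..<K. real (card V choose (s - 1)) * real s ^ (s - 1) * p ^ (s - 1) * (1 - p / 2) ^ (s * (card V div 2)))"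
proof -
  let ?A = "{a\<in>all_arcs V. snd a \<notin> X}"
  let ?M = "Pi_pmf ?A None (\<lambda>_. opt_pmf p U)"
  have fA: "finite ?A" using fV by simp
  let ?SS = "\<lambda>s. {S. S \<subseteq> V \<and> r \<in> S \<and> S - {r} \<subseteq> V - X \<and> card S = s}"
  \<comment> \<open>Parent functions are taken extensional on \<open>S - {r}\<close> to have
    finitely many of them; hence \<open>restrict\<close> below.\<close>
  let ?GG = "\<lambda>S. {g \<in> (S - {r}) \<rightarrow>\<^sub>E S. \<forall>v\<in>S - {r}. g v \<noteq> v}"
  let ?ev = "\<lambda>S g e. (\<forall>v\<in>S - {r}. e (g v, v) \<noteq> None) \<and> stuck V X r C e S g"
  have imp: "\<exists>s\<in>{1..<K}. \<exists>S\<in>?SS s. \<exists>g\<in>?GG S. ?ev S g e"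
    if no: "\<not> (\<exists>S g. good_tree V X r C e S g \<and> card S = K)" for e
  proof -
    have "\<not> (\<forall>S g. good_tree V X r C e S g \<longrightarrow> card S < K \<longrightarrow> \<not> stuck V X r C e S g)"
    proof
      assume a: "\<forall>S g. good_tree V X r C e S g \<longrightarrow> card S < K \<longrightarrow> \<not> stuck V X r C e S g"
      have "\<exists>S g. good_tree V X r C e S g \<and> card S = K"
        by (rule good_tree_grow[OF r fV K(1)]) (use a in simp)
      then show False using no by contradiction
    qed
    then obtain S g where Sg: "good_tree V X r C e S g" "card S < K" "stuck V X r C e S g" by blast
    note G = Sg(1)[unfolded good_tree_def]
    have "finite S" by (rule finite_subset[OF _ fV]) (use G in simp)
    moreover have "S \<noteq> {}" using G by auto
    ultimately    have "card S \<ge> 1" by (simp add: Suc_le_eq card_gt_0_iff)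
    then have 1: "card S \<in> {1..<K}" using Sg(2) by simp
    have 2: "S \<in> ?SS (card S)" using G by auto
    have 3: "restrict g (S - {r}) \<in> ?GG S" using G by auto
    have im: "(\<lambda>w. e (restrict g (S - {r}) w, w)) ` (S - {r}) = (\<lambda>w. e (g w, w)) ` (S - {r})"
      by (intro image_cong) auto
    have 4: "?ev S (restrict g (S - {r})) e"
      using G Sg(3) unfolding stuck_def im by auto
    show ?thesis by (rule bexI[OF _ 1], rule bexI[OF _ 2], rule bexI[OF _ 3], rule 4)
  qed
  have pev: "measure_pmf.prob ?M {e. ?ev S g e} \<le> p ^ (s - 1) * (1 - p / 2) ^ (s * (card V div 2))"
    if s: "s \<in> {1..<K}" and S: "S \<in> ?SS s" and g: "g \<in> ?GG S" for s S g
  proof -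
    have fS: "finite S" using S fV finite_subset by blast
    \<comment> \<open>Tree arcs and boundary arcs are disjoint, and the colours to be avoided depend
      on the tree arcs only.\<close>
    let ?B = "(\<lambda>v. (g v, v)) ` (S - {r})" and ?D = "S \<times> (V - S - X)"
    let ?Q = "\<lambda>e. \<forall>v\<in>S - {r}. e (g v, v) \<noteq> None"
    let ?R = "\<lambda>e (x::'a \<times> 'a) y. y = None \<or> y \<in> Some ` C \<or> y \<in> (\<lambda>w. e (g w, w)) ` (S - {r})"
    have cS1: "card (S - {r}) = s - 1" using S fS by simp
    have "stuck V X r C e S g = (\<forall>x\<in>?D. ?R e x (e x))" for e
      unfolding stuck_def by simp
    then have "measure_pmf.prob ?M {e. ?ev S g e} = measure_pmf.prob ?M {e. ?Q e \<and> (\<forall>x\<in>?D. ?R e x (e x))}"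
      by simp
    also have "\<dots> \<le> measure_pmf.prob (Pi_pmf ?B None (\<lambda>_. opt_pmf p U)) {e. ?Q e} * (1 - p / 2) ^ card ?D"
    proof (rule prob_two_blocks_le[where Q = ?Q and R = ?R, OF fA])
      show "?B \<subseteq> ?A" using S g X by (auto simp: all_arcs_def PiE_def Pi_def)
      show "?D \<subseteq> ?A" using S by (auto simp: all_arcs_def)
      show "?B \<inter> ?D = {}" by auto
      show "?Q e = ?Q e'" if "\<forall>x\<in>?B. e x = e' x" for e e' using that by auto
      show "?R e = ?R e'" if "\<forall>x\<in>?B. e x = e' x" for e e'
      proof -
        have "(\<lambda>w. e (g w, w)) ` (S - {r}) = (\<lambda>w. e' (g w, w)) ` (S - {r})"
          using that by (intro image_cong) auto
        then show ?thesis by simp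
      qed
      show "measure_pmf.prob (opt_pmf p U) {y. ?R e x y} \<le> 1 - p / 2" for e and x :: "'a \<times> 'a"
      proof -
        let ?C = "{c. Some c \<in> (\<lambda>w. e (g w, w)) ` (S - {r})} \<union> C"
        have "card (?C \<inter> U) \<le> card ({c. Some c \<in> (\<lambda>w. e (g w, w)) ` (S - {r})} \<inter> U) + card (C \<inter> U)"
          unfolding Int_Un_distrib2 by (rule card_Un_le)
        also have "card ({c. Some c \<in> (\<lambda>w. e (g w, w)) ` (S - {r})} \<inter> U) \<le> card ((\<lambda>w. e (g w, w)) ` (S - {r}))"
          by (rule card_inj_on_le[of Some]) (use fS in auto)
        also have "\<dots> \<le> s - 1" using card_image_le[of "S - {r}"] fS cS1 by simp
        finally have "card (?C \<inter> U) \<le> s - 1 + card (C \<inter> U)" by simp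
        moreover have "s - 1 + card (C \<inter> U) \<le> K + c" using C s by auto
        ultimately have "card (?C \<inter> U) \<le> K + c" by (rule order.trans)
        then have "2 * card (?C \<inter> U) \<le> 2 * (K + c)" by (rule mult_le_mono2)
        then have "2 * card (?C \<inter> U) \<le> card U" using C(2) by (rule order.trans)
        then have half: "2 * real (card (?C \<inter> U)) \<le> card U" by linarith
        have "card ((U - ?C) \<inter> U) = card U - card (?C \<inter> U)"
        proof -
          have "(U - ?C) \<inter> U = U - (?C \<inter> U)" by blast
          then show ?thesis using U(1) card_Diff_subset[of "?C \<inter> U" U] by simp
        qed
        moreover have "card (?C \<inter> U) \<le> card U" using U(1) by (intro card_mono) auto
        ultimately have cc: "real (card ((U - ?C) \<inter> U)) \<ge> card U / 2" using half by (simp add: of_nat_diff)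
        have "measure_pmf.prob (opt_pmf p U) {y. ?R e x y} \<le> measure_pmf.prob (opt_pmf p U) (UNIV - {y. \<exists>c\<in>U - ?C. y = Some c})"
          by (rule measure_pmf.finite_measure_mono) auto
        also have "\<dots> = 1 - measure_pmf.prob (opt_pmf p U) {y. \<exists>c\<in>U - ?C. y = Some c}"
          using measure_pmf.prob_compl[of "{y. \<exists>c\<in>U - ?C. y = Some c}" "opt_pmf p U"] by simp
        also have "\<dots> = 1 - p * card ((U - ?C) \<inter> U) / card U"
          by (simp only: prob_opt_Some[OF p U])
        also have "\<dots> \<le> 1 - p * (card U / 2) / card U"
          using cc p U by (intro diff_left_mono divide_right_mono mult_left_mono) auto
        also have "\<dots> = 1 - p / 2" using U by simp
        finally show ?thesis .
      qed
      show "0 \<le> 1 - p / 2" using p by simp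
    qed
    finally have a: "measure_pmf.prob ?M {e. ?ev S g e} \<le> measure_pmf.prob (Pi_pmf ?B None (\<lambda>_. opt_pmf p U)) {e. ?Q e} * (1 - p / 2) ^ card ?D" .
    have b: "measure_pmf.prob (Pi_pmf ?B None (\<lambda>_. opt_pmf p U)) {e. ?Q e} = p ^ (s - 1)"
    proof -
      have "measure_pmf.prob (Pi_pmf ?B None (\<lambda>_. opt_pmf p U)) {e. \<forall>x\<in>?B. e x \<noteq> None} = (\<Prod>x\<in>?B. measure_pmf.prob (opt_pmf p U) {y. y \<noteq> None})"
        by (rule prob_Pi_pmf_all[where R = "\<lambda>_ y. y \<noteq> None"]) (use fS in auto)
      also have "\<dots> = p ^ card ?B" by (simp only: prob_opt_None(2)[OF p U] prod_constant)
      also have "card ?B = s - 1" using cS1 by (subst card_image) (auto simp: inj_on_def)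
      finally show ?thesis by simp
    qed
    have c: "(1 - p / 2) ^ card ?D \<le> (1 - p / 2) ^ (s * (card V div 2))"
    proof (rule power_decreasing)
      have fX: "finite X" using X fV finite_subset by blast
      have "card (V - S - X) \<ge> card (V - S) - card X" by (rule diff_card_le_card_Diff[OF fX])
      moreover have "card (V - S) \<ge> card V - card S" by (rule diff_card_le_card_Diff[OF fS])
      ultimately have "card (V - S - X) \<ge> card V div 2" using S s K by auto
      then show "s * (card V div 2) \<le> card ?D" using S by (simp add: card_cartesian_product)
    qed (use p in auto)
    have "p ^ (s - 1) * (1 - p / 2) ^ card ?D \<le> p ^ (s - 1) * (1 - p / 2) ^ (s * (card V div 2))"
      by (rule mult_left_mono[OF c]) (use p in simp)
    then show ?thesis using a unfolding b by (rule order.trans[rotated])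
  qed
  have fSS: "finite (?SS s)" for s using fV by simp
  have fGG: "finite (?GG S)" if "S \<in> ?SS s" for S s
  proof -
    have "finite S" using that fV finite_subset by blast
    then show ?thesis 
      by (intro finite_subset[OF _ finite_PiE[of "S - {r}" "\<lambda>_. S"]]) auto
  qed
  have cGG: "card (?GG S) \<le> s ^ (s - 1)" if S: "S \<in> ?SS s" for S s
  proof -
    have fS: "finite S" using S fV finite_subset by blast
    have "card (?GG S) \<le> card ((S - {r}) \<rightarrow>\<^sub>E S)" using fS by (intro card_mono finite_PiE) auto
    also have "\<dots> = s ^ (s - 1)" using S fS by (simp add: card_PiE)
    finally show ?thesis .
  qed
  \<comment> \<open>The root lies in every tree, so only \<open>s - 1\<close> vertices are
    chosen.\<close>
  have cSS: "card (?SS s) \<le> card V choose (s - 1)" if "s \<ge> 1" for s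
  proof -
    have "card (?SS s) \<le> card {T. T \<subseteq> V \<and> card T = s - 1}"
    proof (rule card_inj_on_le[where f = "\<lambda>S. S - {r}"])
      show "inj_on (\<lambda>S. S - {r}) (?SS s)" by (auto simp: inj_on_def)
      show "(\<lambda>S. S - {r}) ` ?SS s \<subseteq> {T. T \<subseteq> V \<and> card T = s - 1}"
        using fV finite_subset by auto
    qed (use fV in simp)
    then show ?thesis using n_subsets[OF fV] by simp
  qed
  let ?b = "\<lambda>s. p ^ (s - 1) * (1 - p / 2) ^ (s * (card V div 2))"
  have b0: "?b s \<ge> 0" for s using p by simp
  have "measure_pmf.prob ?M {e. \<not> (\<exists>S g. good_tree V X r C e S g \<and> card S = K)}
     \<le> measure_pmf.prob ?M {e. \<exists>s\<in>{1..<K}. \<exists>S\<in>?SS s. \<exists>g\<in>?GG S. ?ev S g e}"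
    by (rule prob_mono) (use imp in blast)
  also have "\<dots> \<le> (\<Sum>s=1..<K. measure_pmf.prob ?M {e. \<exists>S\<in>?SS s. \<exists>g\<in>?GG S. ?ev S g e})"
    by (rule prob_union_le) simp
  also have "\<dots> \<le> (\<Sum>s=1..<K. \<Sum>S\<in>?SS s. measure_pmf.prob ?M {e. \<exists>g\<in>?GG S. ?ev S g e})"
    by (intro sum_mono prob_union_le fSS)
  also have "\<dots> \<le> (\<Sum>s=1..<K. \<Sum>S\<in>?SS s. \<Sum>g\<in>?GG S. measure_pmf.prob ?M {e. ?ev S g e})"
    by (intro sum_mono prob_union_le fGG)
  also have "\<dots> \<le> (\<Sum>s=1..<K. \<Sum>S\<in>?SS s. \<Sum>g\<in>?GG S. ?b s)"
    by (intro sum_mono pev)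
  also have "\<dots> \<le> (\<Sum>s=1..<K. \<Sum>S\<in>?SS s. real (s ^ (s - 1)) * ?b s)"
  proof (intro sum_mono)
    fix s S assume "S \<in> ?SS s"
    then show "(\<Sum>g\<in>?GG S. ?b s) \<le> real (s ^ (s - 1)) * ?b s"
      unfolding sum_constant by (intro mult_right_mono b0 of_nat_mono cGG)
  qed
  also have "\<dots> \<le> (\<Sum>s=1..<K. real (card V choose (s - 1)) * (real (s ^ (s - 1)) * ?b s))"
    unfolding sum_constant by (intro sum_mono mult_right_mono of_nat_mono cSS mult_nonneg_nonneg b0) auto
  finally show ?thesis by (simp add: mult.assoc)
qed

section \<open>Paths of a random mapping\<close>

text \<open>
  The path from a vertex following \<open>f\<close> until it leaves \<open>W\<close>, without using a forbidden arc; the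
  inductive definition excludes cycles.
\<close>

inductive good_path :: "('a \<Rightarrow> 'a) \<Rightarrow> 'a set \<Rightarrow> ('a \<Rightarrow> 'a set) \<Rightarrow> 'a \<Rightarrow> bool" for f W Bad where
  "x \<in> W \<Longrightarrow> f x \<notin> Bad x \<Longrightarrow> f x \<in> W \<Longrightarrow> good_path f W Bad (f x) \<Longrightarrow> good_path f W Bad x"
| "x \<in> W \<Longrightarrow> f x \<notin> Bad x \<Longrightarrow> f x \<notin> W \<Longrightarrow> good_path f W Bad x"

lemma good_path_cong_imp:
  assumes "good_path f W Bad x" and eq: "\<And>y. y \<in> W \<Longrightarrow> f y = g y"
  shows "good_path g W Bad x"
  using assms(1)
proof (induction rule: good_path.induct)
  case (1 x)
  have e: "f x = g x" using eq[OF 1(1)] .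
  show ?case using 1(1) 1(2)[unfolded e] 1(3)[unfolded e] 1(5)[unfolded e] by (rule good_path.intros(1))
next
  case (2 x)
  have e: "f x = g x" using eq[OF 2(1)] .
  show ?case using 2(1) 2(2)[unfolded e] 2(3)[unfolded e] by (rule good_path.intros(2))
qed

lemma good_path_cong:
  assumes "\<And>y. y \<in> W \<Longrightarrow> f y = g y"
  shows "good_path f W Bad x = good_path g W Bad x"
  by (rule iffI) (erule good_path_cong_imp, simp add: assms)+

lemma good_path_mono:
  assumes "good_path f (W - {x}) (\<lambda>y. insert x (Bad y)) y"
  shows "good_path f W Bad y"
  using assms
proof (induction rule: good_path.induct)
  case (1 y)
  show ?case by (rule good_path.intros(1)) (use 1 in simp_all)
next
  case (2 y)
  show ?case by (rule good_path.intros(2)) (use 2 in simp_all)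
qed

text \<open>After the first step \<open>x\<close> moves from \<open>W\<close> to the forbidden
  vertices. A path that is good under these stricter rules is good, so a bad path either hits a
  forbidden vertex at once or is bad from its next vertex on under the new rules.\<close>

lemma bad_path_step:
  assumes "x \<in> W" "\<not> good_path f W Bad x"
  shows "f x \<in> insert x (Bad x) \<or> (\<exists>y\<in>W - {x}. f x = y \<and> \<not> good_path f (W - {x}) (\<lambda>y. insert x (Bad y)) y)"
proof (rule ccontr)
  assume "\<not> ?thesis"
  then have *: "f x \<noteq> x" "f x \<notin> Bad x" "f x \<in> W - {x} \<Longrightarrow> good_path f (W - {x}) (\<lambda>y. insert x (Bad y)) (f x)" by auto
  show False
  proof (cases "f x \<in> W")
    case True
    then have "good_path f W Bad (f x)" using * by (intro good_path_mono[of f W x]) simp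
    then show False using * True assms good_path.intros(1)[of x W f Bad] by auto
  next
    case False
    then show False using * assms good_path.intros(2)[of x W f Bad] by auto
  qed
qed

text \<open>
  Exposing the path from \<open>x\<close> vertex by vertex, each step leaves \<open>W\<close> with probability at least
  \<open>1 / \<lambda>\<close> and hits \<open>Bad\<close> or the past of the path with probability at most \<open>(D + i) / N\<close> in step
  \<open>i\<close>; vertices already visited are moved from \<open>W\<close> to \<open>Bad\<close> in the induction.
\<close>

lemma prob_bad_path:
  fixes N lam :: real
  assumes "finite W" "x \<in> W" "\<And>y. y \<in> W \<Longrightarrow> finite (Bad y) \<and> card (Bad y) \<le> D"
    and \<mu>: "\<And>y B. y \<in> W \<Longrightarrow> finite B \<Longrightarrow> measure_pmf.prob (\<mu> y) {s. \<phi> y s \<in> B} \<le> card B / N"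
    and N: "N > 0" "lam \<ge> 1" "real (card W) - 1 \<le> (1 - 1 / lam) * N"
  shows "measure_pmf.prob (Pi_pmf W d \<mu>) {s. \<not> good_path (\<lambda>v. \<phi> v (s v)) W Bad x} \<le> lam * (D + 1 + lam) / N"
  using assms(1-4,7)
proof (induction "card W" arbitrary: W x Bad D rule: less_induct)
  case less
  let ?M = "Pi_pmf W d \<mu>" and ?f = "\<lambda>s v. \<phi> v (s v)"
  let ?W = "W - {x}" and ?Bad = "\<lambda>y. insert x (Bad y)"
  have "W \<noteq> {}" using less.prems(2) by auto
  then have cW: "card W \<ge> 1" using less.prems(1) by (simp add: Suc_le_eq card_gt_0_iff)
  have cW': "card ?W = card W - 1" using less.prems(2) by simp
  have first: "measure_pmf.prob ?M {s. ?f s x \<in> insert x (Bad x)} \<le> (real D + 1) / N"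
  proof -
    have "measure_pmf.prob ?M {s. ?f s x \<in> insert x (Bad x)} = measure_pmf.prob (\<mu> x) {s. \<phi> x s \<in> insert x (Bad x)}"
      by (rule prob_Pi_pmf_component[where R = "\<lambda>s. \<phi> x s \<in> insert x (Bad x)", OF less.prems(1,2)])
    also have "\<dots> \<le> card (insert x (Bad x)) / N"
      using less.prems(3)[OF less.prems(2)] by (intro less.prems(4)[OF less.prems(2)]) simp
    also have "\<dots> \<le> (real D + 1) / N"
    proof -
      have "card (insert x (Bad x)) \<le> D + 1" using less.prems(3)[OF less.prems(2)] by (simp add: card_insert_if)
      then have "real (card (insert x (Bad x))) \<le> real D + 1" by linarith
      then show ?thesis using N(1) by (intro divide_right_mono) auto
    qed
    finally show ?thesis .
  qed
  have second: "measure_pmf.prob ?M {s. ?f s x = y \<and> \<not> good_path (?f s) ?W ?Bad y} \<le> 1 / N * (lam * (real D + 2 + lam) / N)"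
    if y: "y \<in> ?W" for y
  proof -
    have "measure_pmf.prob ?M {s. ?f s x = y \<and> \<not> good_path (?f s) ?W ?Bad y}
      = measure_pmf.prob (Pi_pmf ({x} \<union> ?W) d \<mu>) {s. ?f s x = y \<and> \<not> good_path (?f s) ?W ?Bad y}"
      using less.prems(2) by (simp add: insert_absorb)
    also have "\<dots> = measure_pmf.prob (Pi_pmf {x} d \<mu>) {s. ?f s x = y} * measure_pmf.prob (Pi_pmf ?W d \<mu>) {s. \<not> good_path (?f s) ?W ?Bad y}"
    proof (rule prob_Pi_pmf_Un)
      show "(\<not> good_path (?f s) ?W ?Bad y) = (\<not> good_path (?f t) ?W ?Bad y)" if "\<forall>v\<in>?W. s v = t v" for s t
        using good_path_cong[of ?W "?f s" "?f t" ?Bad y] that by simp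
      show "finite ?W" using less.prems(1) by simp
    qed auto
    also have "\<dots> \<le> 1 / N * (lam * (real (Suc D) + 1 + lam) / N)"
    proof (rule mult_mono)
      have "measure_pmf.prob (Pi_pmf {x} d \<mu>) {s. ?f s x = y} = measure_pmf.prob (\<mu> x) {s. \<phi> x s = y}"
        by (rule prob_Pi_pmf_component[where R = "\<lambda>s. \<phi> x s = y"]) auto
      also have "\<dots> \<le> 1 / N" using less.prems(4)[OF less.prems(2), of "{y}"] by simp
      finally show "measure_pmf.prob (Pi_pmf {x} d \<mu>) {s. ?f s x = y} \<le> 1 / N" .
      show "measure_pmf.prob (Pi_pmf ?W d \<mu>) {s. \<not> good_path (?f s) ?W ?Bad y} \<le> lam * (real (Suc D) + 1 + lam) / N"
      proof (rule less.hyps)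
        show "card ?W < card W" using cW cW' by simp
        show "finite (?Bad z) \<and> card (?Bad z) \<le> Suc D" if "z \<in> ?W" for z
          using less.prems(3)[of z] that by (auto simp: card_insert_if)
        have "real (card ?W) - 1 \<le> real (card W) - 1" using cW' by simp
        then show "real (card ?W) - 1 \<le> (1 - 1 / lam) * N" using less.prems(5) by linarith
        show "finite ?W" using less.prems(1) by simp
        show "measure_pmf.prob (\<mu> z) {s. \<phi> z s \<in> B} \<le> card B / N" if "z \<in> ?W" "finite B" for z B
          by (rule less.prems(4)) (use that in auto)
      qed (rule y)
    qed (use N in auto)
    finally show ?thesis by (simp add: add.commute)
  qed
  have "measure_pmf.prob ?M {s. \<not> good_path (?f s) W Bad x}
     \<le> measure_pmf.prob ?M {s. ?f s x \<in> insert x (Bad x) \<or> (\<exists>y\<in>?W. ?f s x = y \<and> \<not> good_path (?f s) ?W ?Bad y)}"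
    using bad_path_step[OF less.prems(2)] by (intro prob_mono) blast
  also have "\<dots> \<le> measure_pmf.prob ?M {s. ?f s x \<in> insert x (Bad x)} + measure_pmf.prob ?M {s. \<exists>y\<in>?W. ?f s x = y \<and> \<not> good_path (?f s) ?W ?Bad y}"
    by (rule prob_disj_le)
  finally have split: "measure_pmf.prob ?M {s. \<not> good_path (?f s) W Bad x} \<le> measure_pmf.prob ?M {s. ?f s x \<in> insert x (Bad x)}
     + measure_pmf.prob ?M {s. \<exists>y\<in>?W. ?f s x = y \<and> \<not> good_path (?f s) ?W ?Bad y}" .
  have "measure_pmf.prob ?M {s. \<exists>y\<in>?W. ?f s x = y \<and> \<not> good_path (?f s) ?W ?Bad y}
     \<le> (\<Sum>y\<in>?W. measure_pmf.prob ?M {s. ?f s x = y \<and> \<not> good_path (?f s) ?W ?Bad y})"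
    by (rule prob_union_le) (use less.prems(1) in simp)
  also have "\<dots> \<le> (\<Sum>y\<in>?W. 1 / N * (lam * (real D + 2 + lam) / N))" by (intro sum_mono second)
  also have "\<dots> = (real (card W) - 1) * (1 / N * (lam * (real D + 2 + lam) / N))" using cW cW' by (simp add: of_nat_diff)
  also have "\<dots> \<le> ((1 - 1 / lam) * N) * (1 / N * (lam * (real D + 2 + lam) / N))"
    using less.prems(5) N by (intro mult_right_mono) auto
  also have "\<dots> = ((1 - 1 / lam) * lam) * (real D + 2 + lam) / N" using N by simp
  also have "(1 - 1 / lam) * lam = lam - 1" using N by (simp add: left_diff_distrib)
  finally have sec: "measure_pmf.prob ?M {s. \<exists>y\<in>?W. ?f s x = y \<and> \<not> good_path (?f s) ?W ?Bad y} \<le> ((lam - 1) * (real D + 2 + lam)) / N" .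
  \<comment> \<open>The induction closes because
    \<open>D + 1 + (lam - 1) * (D + 2 + lam) = lam * (D + 1 + lam) - 1\<close>: the bound for
    \<open>D + 1\<close> enters with weight at most \<open>1 - 1 / lam\<close>.\<close>
  have "measure_pmf.prob ?M {s. \<not> good_path (?f s) W Bad x} \<le> (real D + 1) / N + ((lam - 1) * (real D + 2 + lam)) / N"
    by (rule order.trans[OF split add_mono[OF first sec]])
  also have "\<dots> = (lam * (real D + 1 + lam) - 1) / N"
    by (simp add: add_divide_distrib[symmetric] algebra_simps)
  also have "\<dots> \<le> lam * (real D + 1 + lam) / N" using N by (intro divide_right_mono) auto
  finally show ?case by simp
qed

text \<open>Identify \<open>B\<close> with the integers modulo \<open>card B\<close> and reflect:
  \<open>\<rho> s u = s - u\<close>. A reflection is its own inverse, so the same map leads from a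
  new tail back to the exposed arc; and \<open>s = u + w\<close> is the only seed taking
  \<open>u\<close> to \<open>w\<close>.\<close>

lemma ex_transitive_involutions:
  assumes "finite B"
  shows "\<exists>\<rho>. (\<forall>s\<in>B. \<forall>u\<in>B. \<rho> s u \<in> B \<and> \<rho> s (\<rho> s u) = u) \<and> (\<forall>u\<in>B. \<forall>w\<in>B. \<exists>!s. s \<in> B \<and> \<rho> s u = w)"
proof (cases "B = {}")
  case False
  define N where "N = int (card B)"
  have N: "N > 0" using False assms by (simp add: N_def card_gt_0_iff)
  obtain h0 where h0: "bij_betw h0 B {0..<card B}" using ex_bij_betw_finite_nat[OF assms] by blast
  define h where "h x = int (h0 x)" for x
  have hr: "0 \<le> h x \<and> h x < N" if "x \<in> B" for x
    using bij_betw_apply[OF h0 that] by (simp add: h_def N_def)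
  have hi: "x = y" if "x \<in> B" "y \<in> B" "h x = h y" for x y
    by (rule inj_onD[OF bij_betw_imp_inj_on[OF h0]]) (use that in \<open>simp_all add: h_def\<close>)
  have hs: "\<exists>x\<in>B. h x = i" if "0 \<le> i" "i < N" for i
  proof -
    have "nat i \<in> h0 ` B" unfolding bij_betw_imp_surj_on[OF h0] using that by (simp add: N_def)
    then obtain x where "x \<in> B" "nat i = h0 x" by blast
    then show ?thesis using that by (intro bexI[of _ x]) (simp_all add: h_def flip: \<open>nat i = h0 x\<close>)
  qed
  define \<rho> where "\<rho> s u = (SOME x. x \<in> B \<and> h x = (h s - h u) mod N)" for s u
  have \<rho>: "\<rho> s u \<in> B \<and> h (\<rho> s u) = (h s - h u) mod N" for s u
    unfolding \<rho>_def by (rule someI_ex) (use hs[of "(h s - h u) mod N"] N in auto)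
  have "\<rho> s (\<rho> s u) = u" if "s \<in> B" "u \<in> B" for s u
  proof (rule hi)
    have "h (\<rho> s (\<rho> s u)) = (h s - (h s - h u) mod N) mod N" using \<rho> by simp
    also have "\<dots> = h u mod N" by (simp add: mod_diff_right_eq)
    also have "\<dots> = h u" using hr[OF that(2)] by simp
    finally show "h (\<rho> s (\<rho> s u)) = h u" .
  qed (use \<rho> that in auto)
  moreover have "\<exists>!s. s \<in> B \<and> \<rho> s u = w" if "u \<in> B" "w \<in> B" for u w
  proof -
    obtain s where s: "s \<in> B" "h s = (h u + h w) mod N" using hs[of "(h u + h w) mod N"] N by auto
    have "h (\<rho> s u) = ((h u + h w) mod N - h u) mod N" using \<rho>[of s u] s by simp
    also have "\<dots> = h w mod N" by (simp add: mod_diff_left_eq)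
    also have "\<dots> = h w" using hr[OF that(2)] by simp
    finally have "\<rho> s u = w" by (intro hi) (use \<rho>[of s u] that in auto)
    moreover have "t = s" if t: "t \<in> B" "\<rho> t u = w" for t
    proof -
      have "h w = (h t - h u) mod N" using \<rho>[of t u] t by simp
      then have "(h u + h w) mod N = (h u + (h t - h u)) mod N" by (simp add: mod_add_right_eq)
      also have "\<dots> = h t" using hr[OF t(1)] by simp
      finally show "t = s" by (intro hi) (use s t in auto)
    qed
    ultimately show ?thesis using s by blast
  qed
  ultimately show ?thesis using \<rho> by (intro exI[of _ \<rho>]) auto
qed auto

lemma good_path_Bad_mono:
  assumes "good_path f W Bad x" "\<And>y. y \<in> W \<Longrightarrow> Bad' y \<subseteq> Bad y"
  shows "good_path f W Bad' x"
  using assms(1)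
proof (induction rule: good_path.induct)
  case (1 x)
  show ?case by (rule good_path.intros(1)) (use 1 assms(2)[OF 1(1)] in auto)
next
  case (2 x)
  show ?case by (rule good_path.intros(2)) (use 2 assms(2)[OF 2(1)] in auto)
qed

section \<open>Assembling the tree\<close>

text \<open>By \<open>trans\<close>, a uniform seed sends any fixed tail to a uniform one.
  Disjointness of the colour sets lets rainbowness be checked layer by layer.\<close>

locale layers_inv = layers +
  assumes inv: "\<And>v s u. v \<in> V \<Longrightarrow> s \<in> V - {v} \<Longrightarrow> u \<in> V - {v} \<Longrightarrow> \<rho> v s u \<in> V - {v} \<and> \<rho> v s (\<rho> v s u) = u"
    and trans: "\<And>v u w. v \<in> V \<Longrightarrow> u \<in> V - {v} \<Longrightarrow> w \<in> V - {v} \<Longrightarrow> \<exists>!s. s \<in> V - {v} \<and> \<rho> v s u = w"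
    and disj: "Q0 \<inter> U1 = {}" "Q0 \<inter> U2 = {}" "U1 \<inter> U2 = {}"
begin

text \<open>The deterministic part. Vertices of \<open>S\<close> use the tree, bare vertices the
  arcs \<open>aX\<close>, exceptional vertices in \<open>Z\<close> the arcs \<open>bz\<close>, all
  others the mapping \<open>f\<close>. Arcs \<open>aX\<close> and \<open>bz\<close> start in
  \<open>T\<close>, the vertices whose route to \<open>S\<close> avoids bare vertices; this rules
  out circular routes. \<open>Bad1 v\<close> holds the tails of \<open>U1\<close>-arcs into
  \<open>v\<close>: on such an arc the earlier layer would override the colour given by Hall's
  theorem.\<close>

lemma rainbow_tree_assemble:
  fixes b c eX zX eN s zN M aX bz S g r
  defines "w \<equiv> assemble b c eX zX eN s zN" and "X \<equiv> bare b"
  defines "f \<equiv> \<lambda>v. \<rho> v (s v) (M v)" and "W \<equiv> V - S - X"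
  defines "Bad1 \<equiv> \<lambda>v. {u\<in>V. eN (u, v) \<noteq> None}"
  defines "Z \<equiv> {v\<in>W. \<not> good_path f W Bad1 v}"
  defines "T \<equiv> S \<union> {v\<in>W. good_path f W (\<lambda>v. Bad1 v \<union> X) v}"
  defines "C0 \<equiv> {k. \<exists>v\<in>X - {r}. eX (aX v, v) = Some k}" and "CX \<equiv> {k. \<exists>v\<in>X - {r}. zX (aX v, v) = Some k}"
  assumes r: "r \<in> V"
    and M: "\<And>v. v \<in> V - X \<Longrightarrow> M v \<in> V - {v} \<and> b (M v, v)" "inj_on (\<lambda>v. c (M v, v)) (V - X)"
    and col: "\<And>a. a \<in> A \<Longrightarrow> c a \<in> Q0" "\<And>a k. eX a = Some k \<Longrightarrow> k \<in> U1" "\<And>a k. eN a = Some k \<Longrightarrow> k \<in> U1"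
      "\<And>a k. zX a = Some k \<Longrightarrow> k \<in> U2" "\<And>a k. zN a = Some k \<Longrightarrow> k \<in> U2"
    and s: "\<And>v. v \<in> V \<Longrightarrow> s v \<in> V - {v}"
    and aX: "\<And>v. v \<in> X - {r} \<Longrightarrow> aX v \<in> V - {v} \<and> (eX (aX v, v) \<noteq> None \<or> zX (aX v, v) \<noteq> None) \<and> aX v \<in> T"
    and injX: "\<And>v v'. v \<in> X - {r} \<Longrightarrow> v' \<in> X - {r} \<Longrightarrow> v \<noteq> v' \<Longrightarrow> eX (aX v, v) \<noteq> None \<Longrightarrow> eX (aX v, v) \<noteq> eX (aX v', v')"
      "\<And>v v'. v \<in> X - {r} \<Longrightarrow> v' \<in> X - {r} \<Longrightarrow> v \<noteq> v' \<Longrightarrow> zX (aX v, v) \<noteq> None \<Longrightarrow> zX (aX v, v) \<noteq> zX (aX v', v')"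
    and S: "good_tree V X r C0 eN S g"
    and bz: "\<And>v. v \<in> Z \<Longrightarrow> bz v \<in> T \<and> bz v \<noteq> v \<and> eN (bz v, v) = None \<and> \<not> b (shift s (bz v, v)) \<and> zN (bz v, v) \<noteq> None"
    and injZ: "\<And>v v'. v \<in> Z \<Longrightarrow> v' \<in> Z \<Longrightarrow> v \<noteq> v' \<Longrightarrow> zN (bz v, v) \<noteq> zN (bz v', v')"
      "\<And>v. v \<in> Z \<Longrightarrow> zN (bz v, v) \<notin> Some ` CX"
  shows "rainbow_tree V w"
proof -
  note G = S[unfolded good_tree_def]
  have XV: "X \<subseteq> V" by (auto simp: X_def bare_def)
  have SV: "S \<subseteq> V" using G by simp
  have TV: "T \<subseteq> V" using SV by (auto simp: T_def W_def)
  define par where "par v = (if v \<in> S then g v else if v \<in> X then aX v else if v \<in> Z then bz v else f v)" for v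
  have rS: "r \<in> S" using G by simp
  have into: "a \<in> arcs_into X \<longleftrightarrow> a \<in> A \<and> snd a \<in> X" for a by (auto simp: arcs_into_def)
  have A: "(u, v) \<in> A \<longleftrightarrow> u \<in> V \<and> v \<in> V \<and> u \<noteq> v" for u v by (auto simp: all_arcs_def)
  have fV: "f v \<in> V - {v}" "shift s (f v, v) = (M v, v)" if v: "v \<in> V - X" for v
  proof -
    have *: "\<rho> v (s v) (M v) \<in> V - {v} \<and> \<rho> v (s v) (\<rho> v (s v) (M v)) = M v"
      by (rule inv) (use v s[of v] M(1)[OF v] in auto)
    then show "f v \<in> V - {v}" by (simp add: f_def)
    then have "(f v, v) \<in> A" using v by (auto simp: A)
    then show "shift s (f v, v) = (M v, v)" using * by (simp add: shift_def f_def)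
  qed
  have wdef: "w (u, v) = merge_opt (if (u, v) \<in> arcs_into X then eX (u, v) else eN (u, v))
      (merge_opt (if b (shift s (u, v)) then Some (c (shift s (u, v))) else None)
        (if (u, v) \<in> arcs_into X then zX (u, v) else zN (u, v)))" for u v
    by (simp add: w_def assemble_def X_def)
  have nob: "\<not> b (shift s (u, v))" if "v \<in> X" "u \<in> V - {v}" for u v
  proof -
    have v: "v \<in> V" using that XV by auto
    have "(u, v) \<in> A" using that v by (auto simp: A)
    then have "shift s (u, v) = (\<rho> v (s v) u, v)" by (simp add: shift_def)
    moreover have "\<rho> v (s v) u \<in> V - {v}" using inv[OF v s[OF v] that(2)] by simp
    ultimately show ?thesis using that(1) by (auto simp: X_def bare_def)
  qed
  have w1: "w (par v, v) = eN (g v, v)" "par v = g v" "par v \<in> V" "\<exists>k\<in>U1 - C0. w (par v, v) = Some k"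
    if v: "v \<in> S - {r}" for v
  proof -
    show p: "par v = g v" using v by (simp add: par_def)
    have gv: "g v \<in> S" "eN (g v, v) \<noteq> None" "eN (g v, v) \<notin> Some ` C0" "v \<notin> X" using G v by auto
    then show "par v \<in> V" using p SV by auto
    obtain k where k: "eN (g v, v) = Some k" using gv by auto
    show "w (par v, v) = eN (g v, v)" unfolding wdef p using gv k by (simp add: into)
    then show "\<exists>k\<in>U1 - C0. w (par v, v) = Some k" using k col(3)[OF k] gv(3) by (intro bexI[of _ k]) auto
  qed
  have w2: "par v = aX v" "par v \<in> V" "(w (par v, v) = eX (aX v, v) \<and> (\<exists>k\<in>C0. w (par v, v) = Some k \<and> k \<in> U1)) \<or>
      (w (par v, v) = zX (aX v, v) \<and> (\<exists>k\<in>CX. w (par v, v) = Some k \<and> k \<in> U2))"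
    if v: "v \<in> X - {r}" for v
  proof -
    have vS: "v \<notin> S" using v G by auto
    then show p: "par v = aX v" using v by (simp add: par_def)
    have a: "aX v \<in> V - {v}" "eX (aX v, v) \<noteq> None \<or> zX (aX v, v) \<noteq> None" using aX[OF v] by auto
    then show "par v \<in> V" using p by simp
    have ain: "(aX v, v) \<in> arcs_into X" using a v XV by (auto simp: into A)
    have nb: "\<not> b (shift s (aX v, v))" by (rule nob) (use v a in auto)
    show "(w (par v, v) = eX (aX v, v) \<and> (\<exists>k\<in>C0. w (par v, v) = Some k \<and> k \<in> U1)) \<or>
      (w (par v, v) = zX (aX v, v) \<and> (\<exists>k\<in>CX. w (par v, v) = Some k \<and> k \<in> U2))"
    proof (cases "eX (aX v, v)")
      case (Some k)
      then have "w (par v, v) = eX (aX v, v)" unfolding wdef p using ain by simp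
      moreover have "k \<in> C0" using Some v by (auto simp: C0_def)
      ultimately show ?thesis using Some col(2)[OF Some] by auto
    next
      case None
      then obtain k where k: "zX (aX v, v) = Some k" using a by auto
      have "w (par v, v) = zX (aX v, v)" unfolding wdef p using ain nb None by simp
      moreover have "k \<in> CX" using k v by (auto simp: CX_def)
      ultimately show ?thesis using k col(4)[OF k] by auto
    qed
  qed
  have w3: "par v = bz v" "par v \<in> V" "w (par v, v) = zN (bz v, v)" "\<exists>k\<in>U2 - CX. w (par v, v) = Some k"
    if v: "v \<in> Z" for v
  proof -
    have vW: "v \<notin> S" "v \<notin> X" using v by (auto simp: Z_def W_def)
    then show p: "par v = bz v" using v by (simp add: par_def)
    note B = bz[OF v]
    then show "par v \<in> V" using p TV by auto
    obtain k where k: "zN (bz v, v) = Some k" using B by auto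
    show "w (par v, v) = zN (bz v, v)" unfolding wdef p using B vW by (simp add: into)
    then show "\<exists>k\<in>U2 - CX. w (par v, v) = Some k" using k col(5)[OF k] injZ(2)[OF v] by (intro bexI[of _ k]) auto
  qed
  have w4: "par v = f v" "par v \<in> V" "w (par v, v) = Some (c (M v, v))" "c (M v, v) \<in> Q0"
    if v: "v \<in> W - Z" for v
  proof -
    have vW: "v \<notin> S" "v \<notin> X" "v \<in> V" using v by (auto simp: W_def)
    then show p: "par v = f v" using v by (simp add: par_def)
    have F: "f v \<in> V - {v}" "shift s (f v, v) = (M v, v)" using fV vW by auto
    show "par v \<in> V" using F p by simp
    have "good_path f W Bad1 v" using v by (simp add: Z_def)
    then have "f v \<notin> Bad1 v" by (rule good_path.cases) auto
    then have "eN (f v, v) = None" using F by (simp add: Bad1_def)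
    moreover have "b (M v, v)" using M(1) vW by auto
    ultimately show "w (par v, v) = Some (c (M v, v))" unfolding wdef p using vW F by (simp add: into)
    show "c (M v, v) \<in> Q0" by (rule col(1)) (use M(1)[of v] vW in \<open>auto simp: A\<close>)
  qed
  have cover: "v \<in> S - {r} \<or> v \<in> X - {r} \<or> v \<in> Z \<or> v \<in> W - Z" if "v \<in> V - {r}" for v
    using that by (auto simp: W_def Z_def)
  have par_w: "par v \<in> V \<and> w (par v, v) \<noteq> None" if v: "v \<in> V - {r}" for v
    using cover[OF v] w1(3,4)[of v] w2(2,3)[of v] w3(2,4)[of v] w4(2,3)[of v] by auto
  have inj: "inj_on (\<lambda>v. w (par v, v)) (V - {r})"
  proof (rule inj_onI)
    fix x y assume xy: "x \<in> V - {r}" "y \<in> V - {r}" "w (par x, x) = w (par y, y)"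
    \<comment> \<open>The class of a vertex can be read off the colour of its parent arc, so equal
      colours imply equal classes and injectivity is checked within each of the five classes. The
      value 0 does not occur on \<open>V - {r}\<close>.\<close>
    define cls where "cls v = (case w (par v, v) of None \<Rightarrow> 0 | Some k \<Rightarrow>
      if k \<in> U1 then if k \<in> C0 then 2 else 1 else if k \<in> U2 then if k \<in> CX then 3 else 4 else (5::nat))" for v
    have K: "(cls v = 1 \<and> v \<in> S - {r}) \<or> (cls v = 2 \<and> v \<in> X - {r} \<and> w (par v, v) = eX (aX v, v)) \<or>
         (cls v = 3 \<and> v \<in> X - {r} \<and> w (par v, v) = zX (aX v, v)) \<or> (cls v = 4 \<and> v \<in> Z) \<or> (cls v = 5 \<and> v \<in> W - Z)"
      if v: "v \<in> V - {r}" for v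
      using cover[OF v]
    proof (elim disjE)
      assume x: "v \<in> S - {r}"
      then obtain k where "k \<in> U1 - C0" "w (par v, v) = Some k" using w1(4) by blast
      then show ?thesis using x by (simp add: cls_def)
    next
      assume x: "v \<in> X - {r}"
      from w2(3)[OF x] show ?thesis
      proof (elim disjE conjE bexE)
        fix k assume k: "w (par v, v) = eX (aX v, v)" "k \<in> C0" "w (par v, v) = Some k" "k \<in> U1"
        have "cls v = 2" using k(2,3,4) by (simp add: cls_def)
        then show ?thesis using x k(1) by simp
      next
        fix k assume k: "w (par v, v) = zX (aX v, v)" "k \<in> CX" "w (par v, v) = Some k" "k \<in> U2"
        then have "k \<notin> U1" using disj(3) by auto
        then have "cls v = 3" using k(2,3,4) by (simp add: cls_def)
        then show ?thesis using x k(1) by simp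
      qed
    next
      assume x: "v \<in> Z"
      then obtain k where k: "k \<in> U2 - CX" "w (par v, v) = Some k" using w3(4) by blast
      then have "k \<notin> U1" using disj(3) by auto
      then show ?thesis using k x by (simp add: cls_def)
    next
      assume x: "v \<in> W - Z"
      have "c (M v, v) \<notin> U1" "c (M v, v) \<notin> U2" using w4(4)[OF x] disj by auto
      then have "cls v = 5" using w4(3)[OF x] by (simp add: cls_def)
      then show ?thesis using x by simp
    qed
    have "cls x = cls y" using xy(3) by (simp add: cls_def)
    then consider "x \<in> S - {r}" "y \<in> S - {r}" | "x \<in> X - {r}" "y \<in> X - {r}" "w (par x, x) = eX (aX x, x)" "w (par y, y) = eX (aX y, y)"
      | "x \<in> X - {r}" "y \<in> X - {r}" "w (par x, x) = zX (aX x, x)" "w (par y, y) = zX (aX y, y)"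
      | "x \<in> Z" "y \<in> Z" | "x \<in> W - Z" "y \<in> W - Z"
      using K[OF xy(1)] K[OF xy(2)] by (elim disjE) simp_all
    then show "x = y"
    proof cases
      case 1
      have "inj_on (\<lambda>v. eN (g v, v)) (S - {r})" using G by simp
      moreover have "eN (g x, x) = eN (g y, y)" using xy(3) w1(1)[OF 1(1)] w1(1)[OF 1(2)] by simp
      ultimately show ?thesis using 1 by (simp add: inj_on_def)
    next
      case 2
      then show ?thesis using injX(1)[of x y] xy(3) par_w[OF xy(1)] by auto
    next
      case 3
      then show ?thesis using injX(2)[of x y] xy(3) par_w[OF xy(1)] by auto
    next
      case 4
      then show ?thesis using injZ(1)[of x y] xy(3) w3(3) by auto
    next
      case 5
      then have "x \<in> V - X" "y \<in> V - X" by (auto simp: W_def)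
      moreover have "c (M x, x) = c (M y, y)" using xy(3) w4(3)[OF 5(1)] w4(3)[OF 5(2)] by simp
      ultimately show ?thesis using M(2) by (simp add: inj_on_def)
    qed
  qed
  \<comment> \<open>Reachability of the root is shown for \<open>S\<close>, then \<open>T\<close>,
    then bare vertices, then good paths ending in \<open>S\<close> or at a bare vertex, and last for
    \<open>Z\<close>; each step uses only earlier ones.\<close>
  define reaches where "reaches v \<longleftrightarrow> (\<exists>k. (par ^^ k) v = r)" for v
  have step: "reaches v" if r: "reaches (par v)" for v
  proof -
    obtain k where "(par ^^ k) (par v) = r" using r by (auto simp: reaches_def)
    then have "(par ^^ Suc k) v = r" by (simp add: funpow_swap1)
    then show ?thesis unfolding reaches_def by blast
  qed
  have rS': "reaches v" if v: "v \<in> S" for v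
  proof -
    obtain k where "(g ^^ k) v = r" using G v by blast
    then show ?thesis unfolding reaches_def
      by (rule funpow_reach_cong[where S = S]) (use v G w1(2) in auto)
  qed
  have rT: "reaches v" if v: "good_path f W (\<lambda>v. Bad1 v \<union> X) v" for v
    using v
  proof (induction rule: good_path.induct)
    case (1 v)
    have "good_path f W (\<lambda>v. Bad1 v \<union> X) v" by (rule good_path.intros(1)) (use 1 in auto)
    then have "good_path f W Bad1 v" by (rule good_path_Bad_mono) auto
    then have "par v = f v" using 1(1) by (intro w4(1)) (simp add: Z_def)
    then show ?case using 1 step by simp
  next
    case (2 v)
    have "good_path f W (\<lambda>v. Bad1 v \<union> X) v" by (rule good_path.intros(2)) (use 2 in auto)
    then have "good_path f W Bad1 v" by (rule good_path_Bad_mono) auto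
    then have p: "par v = f v" using 2(1) by (intro w4(1)) (simp add: Z_def)
    have "v \<in> V - X" using 2(1) by (auto simp: W_def)
    then have "f v \<in> V" using fV(1) by auto
    then have "f v \<in> S" using 2 by (auto simp: W_def)
    then show ?case using p step rS' by simp
  qed
  have rTT: "reaches v" if "v \<in> T" for v using that rS' rT by (auto simp: T_def)
  have rX: "reaches v" if v: "v \<in> X" for v
  proof (cases "v = r")
    case True
    then show ?thesis using rS' rS by simp
  next
    case False
    then have "v \<in> X - {r}" using v by simp
    then show ?thesis using w2(1)[of v] aX[of v] rTT step by simp
  qed
  have rW: "reaches v" if v: "good_path f W Bad1 v" for v
    using v
  proof (induction rule: good_path.induct)
    case (1 v)
    have "good_path f W Bad1 v" by (rule good_path.intros(1)) (use 1 in auto)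
    then have "par v = f v" using 1(1) by (intro w4(1)) (simp add: Z_def)
    then show ?case using 1 step by simp
  next
    case (2 v)
    have "good_path f W Bad1 v" by (rule good_path.intros(2)) (use 2 in auto)
    then have p: "par v = f v" using 2(1) by (intro w4(1)) (simp add: Z_def)
    have "v \<in> V - X" using 2(1) by (auto simp: W_def)
    then have "f v \<in> V" using fV(1) by auto
    then have "f v \<in> S \<or> f v \<in> X" using 2 by (auto simp: W_def)
    then show ?case using p step rS' rX by auto
  qed
  have "reaches v" if v: "v \<in> V" for v
  proof -
    consider "v \<in> S" | "v \<in> X" | "v \<in> Z" | "good_path f W Bad1 v"
      using v by (auto simp: W_def Z_def)
    then show ?thesis
    proof cases
      case 3
      then show ?thesis using w3(1)[of v] bz[of v] rTT step by simp
    qed (use rS' rX rW in auto)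
  qed
  then show ?thesis unfolding rainbow_tree_def reaches_def
    using r par_w inj by (intro bexI[of _ r] exI[of _ par]) auto
qed

end

section \<open>First-moment bounds for one coloured layer\<close>

lemma set_Pi_opt:
  assumes "finite A" "finite U" "U \<noteq> {}" "e \<in> set_pmf (Pi_pmf A None (\<lambda>_. opt_pmf p U))" "e a = Some k"
  shows "k \<in> U" "a \<in> A"
proof -
  have e: "e \<in> PiE_dflt A None (set_pmf \<circ> (\<lambda>_. opt_pmf p U))" 
    using subsetD[OF set_Pi_pmf_subset'[OF assms(1)] assms(4)] .
  then show a: "a \<in> A" using assms(5) by (cases "a \<in> A") (auto simp: PiE_dflt_def)
  have "e a \<in> set_pmf (opt_pmf p U)" using e a by (simp add: PiE_dflt_def)
  then have "Some k \<in> set_pmf (opt_pmf p U)" using assms(5) by simp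
  then show "k \<in> U" using assms(2,3) by (auto simp: opt_pmf_def split: if_splits)
qed

context
  fixes p :: real and U :: "'c set" and A B :: "'a set"
  assumes p: "0 \<le> p" "p \<le> 1" and U: "finite U" "U \<noteq> {}" and A: "finite A" and B: "B \<subseteq> A"
begin

lemma finB: "finite B"
  by (rule finite_subset[OF B A])

lemma prob_opt_presence:
  "measure_pmf.prob (Pi_pmf A None (\<lambda>_. opt_pmf p U)) {f. \<exists>a\<in>B. f a \<noteq> None} \<le> card B * p"
proof -
  have "measure_pmf.prob (Pi_pmf A None (\<lambda>_. opt_pmf p U)) {f. \<exists>a\<in>B. f a \<noteq> None}
     \<le> (\<Sum>a\<in>B. measure_pmf.prob (Pi_pmf A None (\<lambda>_. opt_pmf p U)) {f. f a \<noteq> None})"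
    by (rule prob_union_le[OF finB])
  also have "\<dots> = (\<Sum>a\<in>B. p)"
    by (intro sum.cong refl, subst prob_Pi_pmf_component[where R = "\<lambda>y. y \<noteq> None"])
       (use A B in \<open>auto simp only: prob_opt_None[OF p U]\<close>)
  finally show ?thesis by simp
qed

lemma prob_opt_absence:
  "measure_pmf.prob (Pi_pmf A None (\<lambda>_. opt_pmf p U)) {f. \<forall>a\<in>B. f a = None} = (1 - p) ^ card B"
  using prob_Pi_pmf_all[OF A B, of None "\<lambda>_. opt_pmf p U" "\<lambda>_ y. y = None"]
  by (simp only: prob_opt_None[OF p U] prod_constant)

lemma prob_opt_hit:
  "measure_pmf.prob (Pi_pmf A None (\<lambda>_. opt_pmf p U)) {f. \<exists>a\<in>B. f a \<in> Some ` C} \<le> card B * (p * card (C \<inter> U) / card U)"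
proof -
  have "measure_pmf.prob (Pi_pmf A None (\<lambda>_. opt_pmf p U)) {f. \<exists>a\<in>B. f a \<in> Some ` C}
     \<le> (\<Sum>a\<in>B. measure_pmf.prob (Pi_pmf A None (\<lambda>_. opt_pmf p U)) {f. f a \<in> Some ` C})"
    by (rule prob_union_le[OF finB])
  also have "\<dots> = (\<Sum>a\<in>B. p * card (C \<inter> U) / card U)"
  proof (intro sum.cong refl)
    fix a assume "a \<in> B"
    then have "measure_pmf.prob (Pi_pmf A None (\<lambda>_. opt_pmf p U)) {f. f a \<in> Some ` C} = measure_pmf.prob (opt_pmf p U) {y. y \<in> Some ` C}"
      using B by (intro prob_Pi_pmf_component[where R = "\<lambda>y. y \<in> Some ` C"] A) auto
    also have "{y. y \<in> Some ` C} = {y. \<exists>c\<in>C. y = Some c}" by auto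
    finally show "measure_pmf.prob (Pi_pmf A None (\<lambda>_. opt_pmf p U)) {f. f a \<in> Some ` C} = p * card (C \<inter> U) / card U"
      by (simp only: prob_opt_Some[OF p U])
  qed
  finally show ?thesis by simp
qed

lemma prob_opt_collision:
  "measure_pmf.prob (Pi_pmf A None (\<lambda>_. opt_pmf p U)) {f. \<exists>a\<in>B. \<exists>b\<in>B. a \<noteq> b \<and> f a \<noteq> None \<and> f a = f b} \<le> (real (card B) * p)\<^sup>2 / card U"
proof -
  let ?M = "Pi_pmf A None (\<lambda>_. opt_pmf p U)"
  have cU: "real (card U) > 0" using U by (simp add: card_gt_0_iff)
  have pair: "measure_pmf.prob ?M {f. a \<noteq> b \<and> f a \<noteq> None \<and> f a = f b} \<le> p\<^sup>2 / card U" if ab: "a \<in> B" "b \<in> B" for a b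
  proof (cases "a = b")
    case False
    have "measure_pmf.prob ?M {f. a \<noteq> b \<and> f a \<noteq> None \<and> f a = f b} \<le> measure_pmf.prob ?M {f. \<exists>k\<in>U. f a = Some k \<and> f b = Some k}"
    proof (rule prob_mono)
      fix f assume f: "f \<in> set_pmf ?M" and eq: "a \<noteq> b \<and> f a \<noteq> None \<and> f a = f b"
      have "f a \<noteq> None" using eq by blast
      then obtain k where k: "f a = Some k" by blast
      then have k: "f a = Some k" "f b = Some k" using eq by simp_all
      then show "\<exists>k\<in>U. f a = Some k \<and> f b = Some k" using set_Pi_opt(1)[OF A U f k(1)] by auto
    qed
    also have "\<dots> \<le> (\<Sum>k\<in>U. measure_pmf.prob ?M {f. f a = Some k \<and> f b = Some k})"
      by (rule prob_union_le[OF U(1)])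
    also have "\<dots> = (\<Sum>k\<in>U. (p / card U) * (p / card U))"
    proof (intro sum.cong refl)
      fix k assume k: "k \<in> U"
      have "measure_pmf.prob (opt_pmf p U) {y. y = Some k} = p / card U"
        using prob_opt_Some[OF p U, of "{k}"] k by simp
      then show "measure_pmf.prob ?M {f. f a = Some k \<and> f b = Some k} = (p / card U) * (p / card U)"
        using prob_Pi_pmf_two[OF A, of a b None "\<lambda>_. opt_pmf p U" "\<lambda>y. y = Some k" "\<lambda>y. y = Some k"] ab B False by auto
    qed
    also have "\<dots> = p\<^sup>2 / card U" using cU by (simp add: power2_eq_square)
    finally show ?thesis .
  qed simp
  have "measure_pmf.prob ?M {f. \<exists>a\<in>B. \<exists>b\<in>B. a \<noteq> b \<and> f a \<noteq> None \<and> f a = f b}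
    \<le> (\<Sum>a\<in>B. measure_pmf.prob ?M {f. \<exists>b\<in>B. a \<noteq> b \<and> f a \<noteq> None \<and> f a = f b})"
    by (rule prob_union_le[OF finB])
  moreover have "measure_pmf.prob ?M {f. \<exists>b\<in>B. a \<noteq> b \<and> f a \<noteq> None \<and> f a = f b} \<le> card B * (p\<^sup>2 / card U)" if "a \<in> B" for a
  proof -
    have "measure_pmf.prob ?M {f. \<exists>b\<in>B. a \<noteq> b \<and> f a \<noteq> None \<and> f a = f b}
      \<le> (\<Sum>b\<in>B. measure_pmf.prob ?M {f. a \<noteq> b \<and> f a \<noteq> None \<and> f a = f b})"
      by (rule prob_union_le[OF finB])
    moreover have "\<dots> \<le> card B * (p\<^sup>2 / card U)" by (rule sum_bounded_above) (rule pair[OF that])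
    ultimately show ?thesis by linarith
  qed
  then have "(\<Sum>a\<in>B. measure_pmf.prob ?M {f. \<exists>b\<in>B. a \<noteq> b \<and> f a \<noteq> None \<and> f a = f b}) \<le> card B * (card B * (p\<^sup>2 / card U))"
    by (rule sum_bounded_above)
  moreover have "card B * (card B * (p\<^sup>2 / card U)) = (real (card B) * p)\<^sup>2 / card U" by (simp add: power2_eq_square)
  ultimately show ?thesis by linarith
qed

end

section \<open>Failure probabilities of the exposure stages\<close>

context layers_inv
begin

lemma card_arcs_into: "X \<subseteq> V \<Longrightarrow> card (arcs_into X) \<le> card X * card V"
proof -
  assume X: "X \<subseteq> V"
  have "card (arcs_into X) \<le> card (V \<times> X)"
    by (rule card_mono) (use X finV finite_subset in \<open>auto simp: arcs_into_def all_arcs_def\<close>)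
  then show ?thesis by (simp add: card_cartesian_product mult.commute)
qed

lemma set_shifts:
  assumes "s \<in> set_pmf (Pi_pmf V d0 (\<lambda>v. pmf_of_set (V - {v})))" "v \<in> V"
  shows "s v \<in> V - {v}"
proof -
  have "V \<noteq> {v}" using cardV by auto
  then have "V - {v} \<noteq> {}" using assms(2) by auto
  moreover have "s v \<in> set_pmf (pmf_of_set (V - {v}))"
    using assms finV by (subst (asm) set_Pi_pmf) (auto simp: PiE_dflt_def)
  ultimately show ?thesis using set_pmf_of_set[of "V - {v}"] finV by simp
qed

text \<open>The shift permutes the empty column of a bare vertex, so the \<open>Q0\<close>-layer
  contributes nothing there.\<close>

lemma assemble_bare:
  assumes "v \<in> bare b" "u \<in> V - {v}" "s v \<in> V - {v}"
  shows "assemble b c eX zX eN s zN (u, v) = merge_opt (eX (u, v)) (zX (u, v))"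
proof -
  have v: "v \<in> V" using assms by (auto simp: bare_def)
  then have A: "(u, v) \<in> A" using assms by (auto simp: all_arcs_def)
  have "\<rho> v (s v) u \<in> V - {v}" using inv[OF v assms(3,2)] by simp
  then have "\<not> b (shift s (u, v))" using assms(1) A by (auto simp: shift_def bare_def)
  then show ?thesis using A assms(1) by (simp add: assemble_def arcs_into_def)
qed

text \<open>Whatever \<open>M v\<close> is, the new tail takes each value with probability at most
  \<open>1 / (card V - 1)\<close>, because distinct seeds give distinct tails. So
  \<open>prob_bad_path\<close> applies to the mapping built from the tails chosen by Hall's
  theorem.\<close>

lemma prob_stage_path:
  fixes lam :: real
  assumes W: "W \<subseteq> V" "x \<in> W" "\<And>v. v \<in> W \<Longrightarrow> M v \<in> V - {v}" "\<And>v. v \<in> W \<Longrightarrow> finite (Bad v) \<and> card (Bad v) \<le> D"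
    and lam: "lam \<ge> 1" "real (card W) - 1 \<le> (1 - 1 / lam) * real (card V - 1)"
  shows "measure_pmf.prob (Pi_pmf V d0 (\<lambda>v. pmf_of_set (V - {v}))) {s. \<not> good_path (\<lambda>v. \<rho> v (s v) (M v)) W Bad x}
    \<le> lam * (real D + 1 + lam) / real (card V - 1)"
proof -
  have "measure_pmf.prob (Pi_pmf V d0 (\<lambda>v. pmf_of_set (V - {v}))) {s. \<not> good_path (\<lambda>v. \<rho> v (s v) (M v)) W Bad x}
    = measure_pmf.prob (Pi_pmf W d0 (\<lambda>v. pmf_of_set (V - {v}))) {s. \<not> good_path (\<lambda>v. \<rho> v (s v) (M v)) W Bad x}"
  proof (rule prob_Pi_pmf_subset[OF finV W(1)])
    fix s t :: "'a \<Rightarrow> 'a" assume "\<forall>v\<in>W. s v = t v"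
    then show "(\<not> good_path (\<lambda>v. \<rho> v (s v) (M v)) W Bad x) = (\<not> good_path (\<lambda>v. \<rho> v (t v) (M v)) W Bad x)"
      using good_path_cong[of W "\<lambda>v. \<rho> v (s v) (M v)" "\<lambda>v. \<rho> v (t v) (M v)" Bad x] by simp
  qed
  also have "\<dots> \<le> lam * (real D + 1 + lam) / real (card V - 1)"
  proof (rule prob_bad_path[where \<phi> = "\<lambda>v s. \<rho> v s (M v)"])
    show "finite W" using W(1) finV finite_subset by blast
    show "real (card V - 1) > 0" using cardV by simp
    show "measure_pmf.prob (pmf_of_set (V - {v})) {s. \<rho> v s (M v) \<in> B} \<le> card B / real (card V - 1)"
      if v: "v \<in> W" and B: "finite B" for v B
    proof -
      have vV: "v \<in> V" using v W by auto
      have "V \<noteq> {v}" using cardV by auto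
      then have ne: "V - {v} \<noteq> {}" using vV by auto
      have "card ((V - {v}) \<inter> {s. \<rho> v s (M v) \<in> B}) \<le> card B"
      proof (rule card_inj_on_le[where f = "\<lambda>s. \<rho> v s (M v)"])
        show "inj_on (\<lambda>s. \<rho> v s (M v)) ((V - {v}) \<inter> {s. \<rho> v s (M v) \<in> B})"
        proof (rule inj_onI)
          fix s t assume st: "s \<in> (V - {v}) \<inter> {s. \<rho> v s (M v) \<in> B}" "t \<in> (V - {v}) \<inter> {s. \<rho> v s (M v) \<in> B}"
            and eq: "\<rho> v s (M v) = \<rho> v t (M v)"
          have Mv: "M v \<in> V - {v}" using W(3)[OF v] .
          have "\<rho> v s (M v) \<in> V - {v}" using inv[OF vV _ Mv, of s] st by auto
          from trans[OF vV Mv this] obtain a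
            where a: "\<And>y. y \<in> V - {v} \<Longrightarrow> \<rho> v y (M v) = \<rho> v s (M v) \<Longrightarrow> y = a"
            by (auto simp: Ex1_def)
          have "s = a" "t = a" using st eq by (auto intro!: a)
          then show "s = t" by simp
        qed
      qed (use B in auto)
      moreover have "card (V - {v}) = card V - 1" using vV by simp
      ultimately show ?thesis using measure_pmf_of_set[OF ne, of "{s. \<rho> v s (M v) \<in> B}"] finV
        by (simp add: divide_right_mono)
    qed
  qed (use W lam in auto)
  finally show ?thesis .
qed

end

context layers_inv
begin

text \<open>Attaching all of \<open>Z\<close> at once succeeds if every vertex finds some arc from
  \<open>Y v\<close>, no two arcs into \<open>Z\<close> share a colour and none has a colour in
  \<open>CX\<close>. Since \<open>Z\<close> will be polylogarithmic, the last two can be demanded of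
  all arcs into \<open>Z\<close> rather than of chosen ones.\<close>

lemma prob_stage_z:
  assumes p2: "0 \<le> p2" "p2 \<le> 1" and U2: "finite U2" "U2 \<noteq> {}"
    and Z: "Z \<subseteq> V - X" "card Z \<le> z" and Y: "\<And>v. v \<in> Z \<Longrightarrow> Y v \<subseteq> V - {v} \<and> card (Y v) \<ge> m" and CX: "card (CX \<inter> U2) \<le> x"
  shows "measure_pmf.prob (Pi_pmf (A - arcs_into X) None (\<lambda>_. opt_pmf p2 U2))
     {e. \<not> (\<exists>bz. (\<forall>v\<in>Z. bz v \<in> Y v \<and> e (bz v, v) \<noteq> None \<and> e (bz v, v) \<notin> Some ` CX) \<and> (\<forall>v\<in>Z. \<forall>v'\<in>Z. v \<noteq> v' \<longrightarrow> e (bz v, v) \<noteq> e (bz v', v')))}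
    \<le> z * (1 - p2) ^ m + (real z * card V * p2)\<^sup>2 / card U2 + real z * card V * (p2 * x / card U2)"
proof -
  let ?A = "A - arcs_into X" and ?M = "Pi_pmf (A - arcs_into X) None (\<lambda>_. opt_pmf p2 U2)"
  let ?B = "arcs_into Z"
  have fA: "finite ?A" using finA by simp
  have BA: "?B \<subseteq> ?A" using Z by (auto simp: arcs_into_def)
  have fZ: "finite Z" using Z finV finite_subset by (metis finite_Diff)
  have "card ?B \<le> card Z * card V" by (rule card_arcs_into) (use Z in auto)
  also have "\<dots> \<le> z * card V" using Z by simp
  finally have cB: "card ?B \<le> z * card V" .
  then have cB': "real (card ?B) \<le> real z * card V" by (metis of_nat_le_iff of_nat_mult)
  let ?E1 = "\<lambda>e. \<exists>v\<in>Z. \<forall>u\<in>Y v. e (u, v) = None"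
  let ?E2 = "\<lambda>e. \<exists>a\<in>?B. \<exists>b\<in>?B. a \<noteq> b \<and> e a \<noteq> None \<and> e a = e b"
  let ?E3 = "\<lambda>e. \<exists>a\<in>?B. e a \<in> Some ` CX"
  have YB: "(u, v) \<in> ?B" if "v \<in> Z" "u \<in> Y v" for u v
    using Y[OF that(1)] that Z by (auto simp: arcs_into_def all_arcs_def)
  have "measure_pmf.prob ?M {e. \<not> (\<exists>bz. (\<forall>v\<in>Z. bz v \<in> Y v \<and> e (bz v, v) \<noteq> None \<and> e (bz v, v) \<notin> Some ` CX) \<and> (\<forall>v\<in>Z. \<forall>v'\<in>Z. v \<noteq> v' \<longrightarrow> e (bz v, v) \<noteq> e (bz v', v')))}
     \<le> measure_pmf.prob ?M {e. ?E1 e \<or> (?E2 e \<or> ?E3 e)}"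
  proof (rule prob_mono, rule ccontr)
    fix e assume no: "\<not> (\<exists>bz. (\<forall>v\<in>Z. bz v \<in> Y v \<and> e (bz v, v) \<noteq> None \<and> e (bz v, v) \<notin> Some ` CX) \<and> (\<forall>v\<in>Z. \<forall>v'\<in>Z. v \<noteq> v' \<longrightarrow> e (bz v, v) \<noteq> e (bz v', v')))"
      and "\<not> (?E1 e \<or> (?E2 e \<or> ?E3 e))"
    then have e: "\<forall>v\<in>Z. \<exists>u\<in>Y v. e (u, v) \<noteq> None" "\<not> ?E2 e" "\<not> ?E3 e" by auto
    from e(1) obtain bz where bz: "\<forall>v\<in>Z. bz v \<in> Y v \<and> e (bz v, v) \<noteq> None" by metis
    have m1: "\<forall>v\<in>Z. bz v \<in> Y v \<and> e (bz v, v) \<noteq> None \<and> e (bz v, v) \<notin> Some ` CX"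
    proof
      fix v assume v: "v \<in> Z"
      then have "(bz v, v) \<in> ?B" using bz YB by simp
      then show "bz v \<in> Y v \<and> e (bz v, v) \<noteq> None \<and> e (bz v, v) \<notin> Some ` CX" using bz v e(3) by simp
    qed
    have m2: "e (bz v, v) \<noteq> e (bz v', v')" if "v \<in> Z" "v' \<in> Z" "v \<noteq> v'" for v v'
    proof
      assume "e (bz v, v) = e (bz v', v')"
      moreover have "(bz v, v) \<in> ?B" "(bz v', v') \<in> ?B" "e (bz v, v) \<noteq> None" "(bz v, v) \<noteq> (bz v', v')" using bz YB that by auto
      ultimately have "?E2 e" by (intro bexI[of _ "(bz v, v)"] bexI[of _ "(bz v', v')"] conjI) simp_all
      then show False using e(2) by contradiction
    qed
    have m3: "\<forall>v\<in>Z. \<forall>v'\<in>Z. v \<noteq> v' \<longrightarrow> e (bz v, v) \<noteq> e (bz v', v')" using m2 by simp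
    show False by (rule notE[OF no], rule exI[of _ bz], rule conjI[OF m1 m3])
  qed
  also have "\<dots> \<le> measure_pmf.prob ?M {e. ?E1 e} + measure_pmf.prob ?M {e. ?E2 e \<or> ?E3 e}" by (rule prob_disj_le)
  finally have 0: "measure_pmf.prob ?M {e. \<not> (\<exists>bz. (\<forall>v\<in>Z. bz v \<in> Y v \<and> e (bz v, v) \<noteq> None \<and> e (bz v, v) \<notin> Some ` CX) \<and> (\<forall>v\<in>Z. \<forall>v'\<in>Z. v \<noteq> v' \<longrightarrow> e (bz v, v) \<noteq> e (bz v', v')))}
     \<le> measure_pmf.prob ?M {e. ?E1 e} + measure_pmf.prob ?M {e. ?E2 e \<or> ?E3 e}" .
  have 1: "measure_pmf.prob ?M {e. ?E1 e} \<le> z * (1 - p2) ^ m"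
  proof -
    have "measure_pmf.prob ?M {e. ?E1 e} \<le> (\<Sum>v\<in>Z. measure_pmf.prob ?M {e. \<forall>u\<in>Y v. e (u, v) = None})"
      by (rule prob_union_le[OF fZ])
    also have "\<dots> \<le> (\<Sum>v\<in>Z. (1 - p2) ^ m)"
    proof (rule sum_mono)
      fix v assume v: "v \<in> Z"
      have "measure_pmf.prob ?M {e. \<forall>u\<in>Y v. e (u, v) = None} = measure_pmf.prob ?M {e. \<forall>a\<in>(\<lambda>u. (u, v)) ` Y v. e a = None}" by simp
      also have "\<dots> = (1 - p2) ^ card ((\<lambda>u. (u, v)) ` Y v)"
      proof (rule prob_opt_absence[OF p2 U2 fA])
        show "(\<lambda>u. (u, v)) ` Y v \<subseteq> ?A" using YB[OF v] BA by blast
      qed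
      finally have e: "measure_pmf.prob ?M {e. \<forall>u\<in>Y v. e (u, v) = None} = (1 - p2) ^ card ((\<lambda>u. (u, v)) ` Y v)" .
      have c: "card ((\<lambda>u. (u, v)) ` Y v) = card (Y v)" by (rule card_image) (simp add: inj_on_def)
      have "(1 - p2) ^ card (Y v) \<le> (1 - p2) ^ m" using Y[OF v] p2 by (intro power_decreasing) auto
      then show "measure_pmf.prob ?M {e. \<forall>u\<in>Y v. e (u, v) = None} \<le> (1 - p2) ^ m"
        unfolding e c .
    qed
    also have "\<dots> \<le> z * (1 - p2) ^ m" using Z p2 by (simp add: mult_right_mono)
    finally show ?thesis .
  qed
  have 2: "measure_pmf.prob ?M {e. ?E2 e} \<le> (real z * card V * p2)\<^sup>2 / card U2"
  proof -
    have a: "measure_pmf.prob ?M {e. ?E2 e} \<le> (real (card ?B) * p2)\<^sup>2 / card U2"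
      by (rule prob_opt_collision[OF p2 U2 fA BA])
    have b: "(real (card ?B) * p2)\<^sup>2 / card U2 \<le> (real z * card V * p2)\<^sup>2 / card U2"
      using cB' p2 by (intro divide_right_mono power_mono mult_right_mono) auto
    show ?thesis by (rule order.trans[OF a b])
  qed
  have 3: "measure_pmf.prob ?M {e. ?E3 e} \<le> real z * card V * (p2 * x / card U2)"
  proof -
    have a: "measure_pmf.prob ?M {e. ?E3 e} \<le> card ?B * (p2 * card (CX \<inter> U2) / card U2)"
      by (rule prob_opt_hit[OF p2 U2 fA BA])
    have b: "card ?B * (p2 * card (CX \<inter> U2) / card U2) \<le> (real z * card V) * (p2 * x / card U2)"
      using cB' p2 CX by (intro mult_mono divide_right_mono mult_left_mono) auto
    show ?thesis by (rule order.trans[OF a b])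
  qed
  have 23: "measure_pmf.prob ?M {e. ?E2 e \<or> ?E3 e} \<le> measure_pmf.prob ?M {e. ?E2 e} + measure_pmf.prob ?M {e. ?E3 e}"
    by (rule prob_disj_le)
  show ?thesis unfolding add.assoc
    by (rule order.trans[OF 0 add_mono[OF 1 order.trans[OF 23 add_mono[OF 2 3]]]])
qed

end

context layers_inv
begin

text \<open>What is asked of the arc set alone: few bare vertices, few vertices of low in-degree for
  the separate treatment in Hall's condition, and a crude cap on in-degrees that keeps
  \<open>Q0\<close>-arcs from using up the candidate tails of exceptional vertices.\<close>

definition typical_b where
  "typical_b x l d dm b \<longleftrightarrow> card (bare b) \<le> x \<and> card {v\<in>V - bare b. card {a\<in>col_arcs V v. b a} < d} \<le> l \<and>
     (\<forall>v\<in>V. card {a\<in>col_arcs V v. b a} \<le> dm)"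

lemma bare_V: "bare b \<subseteq> V"
  by (auto simp: bare_def)

lemma prob_stage_c:
  assumes b: "typical_b x l d dm b" and Q0: "finite Q0" "Q0 \<noteq> {}" "card V \<le> card Q0"
  shows "measure_pmf.prob (Pi_pmf A cd (\<lambda>_. pmf_of_set Q0))
     {c. \<not> (\<exists>M. (\<forall>v\<in>V - bare b. M v \<in> V - {v} \<and> b (M v, v)) \<and> inj_on (\<lambda>v. c (M v, v)) (V - bare b))}
    \<le> (real l)\<^sup>2 / card Q0 + (\<Sum>k=1..card V. real (card V choose k) * real (card Q0 choose k) * (real (k + l) / real (card Q0)) ^ (k * d))"
proof -
  let ?I = "V - bare b" and ?D = "\<lambda>v. {a\<in>col_arcs V v. b a}" and ?L = "{v\<in>V - bare b. card {a\<in>col_arcs V v. b a} < d}"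
  let ?M = "Pi_pmf A cd (\<lambda>_. pmf_of_set Q0)"
  have fI: "finite ?I" using finV by simp
  have cI: "card ?I \<le> card V" by (rule card_mono[OF finV]) auto
  have bound: "measure_pmf.prob ?M {c. \<not> (\<exists>M. (\<forall>v\<in>?I. M v \<in> ?D v) \<and> inj_on (\<lambda>v. c (M v)) ?I)}
    \<le> (real l)\<^sup>2 / card Q0 + (\<Sum>k=1..card ?I. real (card ?I choose k) * real (card Q0 choose k) * (real (k + l) / real (card Q0)) ^ (k * d))"
  proof (rule prob_no_rainbow_transversal[where L = ?L])
    show "finite A" by (rule finA)
    show "finite ?I" by (rule fI)
    show "?D v \<subseteq> A" if "v \<in> ?I" for v using that by (auto simp: col_arcs_def all_arcs_def)
    show "?D v \<noteq> {}" if "v \<in> ?I" for v using that by (auto simp: bare_def col_arcs_def)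
    show "disjoint_family_on ?D ?I" by (auto simp: disjoint_family_on_def col_arcs_def)
    show "card ?L \<le> l" using b by (simp add: typical_b_def)
    show "card ?I \<le> card Q0" using cI Q0 by linarith
    show "d \<le> card (?D v)" if "v \<in> ?I - ?L" for v using that by auto
  qed (use Q0 in auto)
  have imp: "\<exists>M. (\<forall>v\<in>?I. M v \<in> V - {v} \<and> b (M v, v)) \<and> inj_on (\<lambda>v. c (M v, v)) ?I"
    if ex: "\<exists>M. (\<forall>v\<in>?I. M v \<in> ?D v) \<and> inj_on (\<lambda>v. c (M v)) ?I" for c :: "'a \<times> 'a \<Rightarrow> 'c"
  proof -
    obtain M where M: "\<forall>v\<in>?I. M v \<in> ?D v" "inj_on (\<lambda>v. c (M v)) ?I" using ex by blast
    have e: "M v = (fst (M v), v)" "fst (M v) \<in> V - {v}" "b (M v)" if v: "v \<in> ?I" for v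
    proof -
      have "M v \<in> ?D v" using M(1) v by blast
      then show "M v = (fst (M v), v)" "fst (M v) \<in> V - {v}" "b (M v)" by (auto simp: col_arcs_def)
    qed
    have "\<forall>v\<in>?I. fst (M v) \<in> V - {v} \<and> b (fst (M v), v)"
      using e(1)[symmetric] e(2,3) by simp
    moreover have "inj_on (\<lambda>v. c (fst (M v), v)) ?I"
    proof -
      have "c (fst (M v), v) = c (M v)" if "v \<in> ?I" for v using e(1)[OF that] by simp
      then show ?thesis using M(2) inj_on_cong[of ?I "\<lambda>v. c (fst (M v), v)" "\<lambda>v. c (M v)"] by blast
    qed
    ultimately show ?thesis by (intro exI[of _ "\<lambda>v. fst (M v)"] conjI)
  qed
  have mono: "measure_pmf.prob ?M {c. \<not> (\<exists>M. (\<forall>v\<in>?I. M v \<in> V - {v} \<and> b (M v, v)) \<and> inj_on (\<lambda>v. c (M v, v)) ?I)}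
     \<le> measure_pmf.prob ?M {c. \<not> (\<exists>M. (\<forall>v\<in>?I. M v \<in> ?D v) \<and> inj_on (\<lambda>v. c (M v)) ?I)}"
    by (rule prob_mono, erule contrapos_nn, rule imp)
  have "(\<Sum>k=1..card ?I. real (card ?I choose k) * real (card Q0 choose k) * (real (k + l) / real (card Q0)) ^ (k * d))
    \<le> (\<Sum>k=1..card ?I. real (card V choose k) * real (card Q0 choose k) * (real (k + l) / real (card Q0)) ^ (k * d))"
    using cI by (intro sum_mono mult_right_mono of_nat_mono binomial_right_mono) auto
  also have "\<dots> \<le> (\<Sum>k=1..card V. real (card V choose k) * real (card Q0 choose k) * (real (k + l) / real (card Q0)) ^ (k * d))"
    using cI by (intro sum_mono2) auto
  finally have s: "(\<Sum>k=1..card ?I. real (card ?I choose k) * real (card Q0 choose k) * (real (k + l) / real (card Q0)) ^ (k * d))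
    \<le> (\<Sum>k=1..card V. real (card V choose k) * real (card Q0 choose k) * (real (k + l) / real (card Q0)) ^ (k * d))" .
  show ?thesis by (rule order.trans[OF mono order.trans[OF bound add_left_mono[OF s]]])
qed

text \<open>If all arcs into bare vertices within one small layer have different colours, then any
  choice among them is rainbow. Arcs inside \<open>X\<close> are excluded so that the tail of a
  chosen arc lies in \<open>S\<close> or on the random mapping.\<close>

lemma prob_stage_X:
  fixes p :: real
  assumes p: "0 \<le> p" "p \<le> 1" and U: "finite U" "U \<noteq> {}" and X: "X \<subseteq> V" "card X \<le> x"
  shows "measure_pmf.prob (Pi_pmf (arcs_into X) None (\<lambda>_. opt_pmf p U))
     {e. (\<exists>a\<in>arcs_into X. \<exists>b\<in>arcs_into X. a \<noteq> b \<and> e a \<noteq> None \<and> e a = e b) \<or> (\<exists>a\<in>{a\<in>arcs_into X. fst a \<in> X}. e a \<noteq> None)}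
    \<le> (real x * card V * p)\<^sup>2 / card U + (real x)\<^sup>2 * p"
proof -
  let ?M = "Pi_pmf (arcs_into X) None (\<lambda>_. opt_pmf p U)"
  have "card (arcs_into X) \<le> x * card V" using card_arcs_into[OF X(1)] X(2) by (meson mult_le_mono1 order.trans)
  then have c: "real (card (arcs_into X)) \<le> real x * card V" by (metis of_nat_le_iff of_nat_mult)
  have fX: "finite X" using X finV finite_subset by blast
  have "card {a\<in>arcs_into X. fst a \<in> X} \<le> card (X \<times> X)"
    by (rule card_mono) (use fX in \<open>auto simp: arcs_into_def\<close>)
  also have "\<dots> \<le> x * x" using X(2) by (simp add: card_cartesian_product mult_le_mono)
  finally have c2: "real (card {a\<in>arcs_into X. fst a \<in> X}) \<le> (real x)\<^sup>2" by (metis of_nat_le_iff of_nat_mult power2_eq_square)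
  have 1: "measure_pmf.prob ?M {e. \<exists>a\<in>arcs_into X. \<exists>b\<in>arcs_into X. a \<noteq> b \<and> e a \<noteq> None \<and> e a = e b} \<le> (real (card (arcs_into X)) * p)\<^sup>2 / card U"
    by (rule prob_opt_collision[OF p U arcs_into(2)]) simp
  have b1: "(real (card (arcs_into X)) * p)\<^sup>2 / card U \<le> (real x * card V * p)\<^sup>2 / card U"
    using c p by (intro divide_right_mono power_mono mult_right_mono) auto
  have 2: "measure_pmf.prob ?M {e. \<exists>a\<in>{a\<in>arcs_into X. fst a \<in> X}. e a \<noteq> None} \<le> card {a\<in>arcs_into X. fst a \<in> X} * p"
    by (rule prob_opt_presence[OF p U arcs_into(2)]) auto
  have b2: "card {a\<in>arcs_into X. fst a \<in> X} * p \<le> (real x)\<^sup>2 * p" using c2 p by (intro mult_right_mono)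
  show ?thesis
    by (rule order.trans[OF prob_disj_le add_mono[OF order.trans[OF 1 b1] order.trans[OF 2 b2]]])
qed

text \<open>Besides the tree, the \<open>U1\<close>-layer must supply a cap \<open>D\<close> on its
  in-degrees, which keeps the forbidden sets of the random mapping small.\<close>

lemma prob_stage_N:
  fixes \<theta> :: real
  assumes p1: "0 \<le> p1" "p1 \<le> 1" and U1: "finite U1" "U1 \<noteq> {}" and X: "X \<subseteq> V" "card X \<le> x" and r: "r \<in> V"
    and C: "card (C \<inter> U1) \<le> x" "2 * (K + x) \<le> card U1" and K: "1 \<le> K" "2 * (K + x) \<le> card V" and \<theta>: "\<theta> \<ge> 1"
  shows "measure_pmf.prob (Pi_pmf (A - arcs_into X) None (\<lambda>_. opt_pmf p1 U1))
     {e. \<not> (\<exists>S g. good_tree V X r C e S g \<and> card S = K) \<or> (\<exists>v\<in>V. D < card {u\<in>V. e (u, v) \<noteq> None})}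
    \<le> (\<Sum>s=1..<K. real (card V choose (s - 1)) * real s ^ (s - 1) * p1 ^ (s - 1) * (1 - p1 / 2) ^ (s * (card V div 2)))
      + card V * (exp (p1 * (\<theta> - 1) * card V) / \<theta> ^ D)"
proof -
  let ?A = "A - arcs_into X"
  let ?M = "Pi_pmf ?A None (\<lambda>_. opt_pmf p1 U1)"
  have A: "?A = {a\<in>all_arcs V. snd a \<notin> X}" by (auto simp: arcs_into_def)
  have fA: "finite ?A" using finA by simp
  have 1: "measure_pmf.prob ?M {e. \<not> (\<exists>S g. good_tree V X r C e S g \<and> card S = K)}
    \<le> (\<Sum>s=1..<K. real (card V choose (s - 1)) * real s ^ (s - 1) * p1 ^ (s - 1) * (1 - p1 / 2) ^ (s * (card V div 2)))"
    unfolding A by (rule prob_growth[OF finV r U1 p1 C K(1) _ X(1)]) (use X K in auto)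
  have one: "measure_pmf.prob ?M {e. D < card {u\<in>V. e (u, v) \<noteq> None}} \<le> exp (p1 * (\<theta> - 1) * card V) / \<theta> ^ D" if v: "v \<in> V" for v
  proof -
    let ?C = "{a\<in>?A. snd a = v}"
    have "measure_pmf.prob ?M {e. D < card {u\<in>V. e (u, v) \<noteq> None}} \<le> measure_pmf.prob ?M {e. D < card {a\<in>?C. e a \<noteq> None}}"
    proof (rule prob_mono)
      fix e assume e: "e \<in> set_pmf ?M" and D: "D < card {u\<in>V. e (u, v) \<noteq> None}"
      have "card {u\<in>V. e (u, v) \<noteq> None} \<le> card {a\<in>?C. e a \<noteq> None}"
      proof (rule card_inj_on_le[where f = "\<lambda>u. (u, v)"])
        show "(\<lambda>u. (u, v)) ` {u\<in>V. e (u, v) \<noteq> None} \<subseteq> {a\<in>?C. e a \<noteq> None}"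
          using set_Pi_opt(2)[OF fA U1 e] by auto
        show "finite {a\<in>?C. e a \<noteq> None}" by (rule finite_subset[OF _ fA]) auto
      qed (simp add: inj_on_def)
      then show "D < card {a\<in>?C. e a \<noteq> None}" using D by linarith
    qed
    also have "\<dots> \<le> exp (measure_pmf.prob (opt_pmf p1 U1) {y. y \<noteq> None} * (\<theta> - 1) * card ?C) / \<theta> ^ D"
      by (rule chernoff_card[where R = "\<lambda>y. y \<noteq> None"]) (use fA \<theta> in \<open>auto intro: power_increasing\<close>)
    also have "\<dots> \<le> exp (p1 * (\<theta> - 1) * card V) / \<theta> ^ D"
    proof -
      have "card ?C \<le> card V"
        by (rule card_inj_on_le[where f = fst]) (use finV in \<open>auto simp: inj_on_def all_arcs_def\<close>)
      then have "p1 * (\<theta> - 1) * card ?C \<le> p1 * (\<theta> - 1) * card V" using p1 \<theta> by (intro mult_left_mono) auto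
      then show ?thesis using \<theta> unfolding prob_opt_None(2)[OF p1 U1] by (intro divide_right_mono) auto
    qed
    finally show ?thesis .
  qed
  have 2: "measure_pmf.prob ?M {e. \<exists>v\<in>V. D < card {u\<in>V. e (u, v) \<noteq> None}} \<le> (\<Sum>v\<in>V. measure_pmf.prob ?M {e. D < card {u\<in>V. e (u, v) \<noteq> None}})"
    by (rule prob_union_le[OF finV])
  have 3: "(\<Sum>v\<in>V. measure_pmf.prob ?M {e. D < card {u\<in>V. e (u, v) \<noteq> None}}) \<le> card V * (exp (p1 * (\<theta> - 1) * card V) / \<theta> ^ D)"
    by (rule sum_bounded_above) (rule one)
  show ?thesis by (rule order.trans[OF prob_disj_le add_mono[OF 1 order.trans[OF 2 3]]])
qed

text \<open>Three first-moment bounds: for paths that may end at a bare vertex, for paths that may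
  not, and for the at most \<open>x\<close> tails in \<open>H\<close> serving the bare vertices. The
  first is kept separate because its forbidden sets do not contain \<open>X\<close>: only so is the
  number \<open>z\<close> of exceptional vertices a small power of log n.\<close>

lemma prob_stage_S:
  fixes lam z t :: real
  assumes W: "W \<subseteq> V - X" and M: "\<And>v. v \<in> V - X \<Longrightarrow> M v \<in> V - {v}" and Bad: "\<And>v. v \<in> W \<Longrightarrow> finite (Bad v) \<and> card (Bad v) \<le> D"
    and X: "finite X" "card X \<le> x" and lam: "lam \<ge> 1" "real (card W) - 1 \<le> (1 - 1 / lam) * real (card V - 1)"
    and zt: "z > 0" "t > 0" and H: "finite H" "card H \<le> x"
  shows "measure_pmf.prob (Pi_pmf V d0 (\<lambda>v. pmf_of_set (V - {v})))
     {s. z \<le> card {v\<in>W. \<not> good_path (\<lambda>v. \<rho> v (s v) (M v)) W Bad v} \<or>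
         (t \<le> card {v\<in>W. \<not> good_path (\<lambda>v. \<rho> v (s v) (M v)) W (\<lambda>v. Bad v \<union> X) v} \<or>
         (\<exists>u\<in>H \<inter> W. \<not> good_path (\<lambda>v. \<rho> v (s v) (M v)) W (\<lambda>v. Bad v \<union> X) u))}
    \<le> card V * (lam * (real D + 1 + lam) / real (card V - 1)) / z
      + (card V * (lam * (real (D + x) + 1 + lam) / real (card V - 1)) / t + x * (lam * (real (D + x) + 1 + lam) / real (card V - 1)))"
proof -
  let ?M = "Pi_pmf V d0 (\<lambda>v. pmf_of_set (V - {v}))"
  let ?f = "\<lambda>s v. \<rho> v (s v) (M v)"
  let ?b1 = "lam * (real D + 1 + lam) / real (card V - 1)" and ?b2 = "lam * (real (D + x) + 1 + lam) / real (card V - 1)"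
  have WV: "W \<subseteq> V" using W by auto
  have fW: "finite W" using WV finV finite_subset by blast
  have cW: "real (card W) \<le> card V" using card_mono[OF finV WV] by simp
  have p1: "measure_pmf.prob ?M {s. \<not> good_path (?f s) W Bad v} \<le> ?b1" if "v \<in> W" for v
    by (rule prob_stage_path[OF WV that _ _ lam]) (use M W Bad in auto)
  have p2: "measure_pmf.prob ?M {s. \<not> good_path (?f s) W (\<lambda>v. Bad v \<union> X) v} \<le> ?b2" if "v \<in> W" for v
  proof (rule prob_stage_path[OF WV that _ _ lam])
    show "finite (Bad v \<union> X) \<and> card (Bad v \<union> X) \<le> D + x" if "v \<in> W" for v
      using Bad[OF that] X card_Un_le[of "Bad v" X] by simp
  qed (use M W in auto)
  have b0: "?b1 \<ge> 0" "?b2 \<ge> 0" using lam by auto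
  have 1: "measure_pmf.prob ?M {s. z \<le> card {v\<in>W. \<not> good_path (?f s) W Bad v}} \<le> card V * ?b1 / z"
  proof -
    have "(\<Sum>v\<in>W. measure_pmf.prob ?M {s. \<not> good_path (?f s) W Bad v}) \<le> card W * ?b1"
      by (rule sum_bounded_above) (rule p1)
    moreover have "card W * ?b1 \<le> card V * ?b1" using cW b0 by (intro mult_right_mono) auto
    ultimately have "(\<Sum>v\<in>W. measure_pmf.prob ?M {s. \<not> good_path (?f s) W Bad v}) / z \<le> card V * ?b1 / z"
      using zt by (intro divide_right_mono) auto
    then show ?thesis using prob_card_markov[OF fW zt(1), of ?M "\<lambda>v s. \<not> good_path (?f s) W Bad v"] by (rule order.trans[rotated])
  qed
  have 2: "measure_pmf.prob ?M {s. t \<le> card {v\<in>W. \<not> good_path (?f s) W (\<lambda>v. Bad v \<union> X) v}} \<le> card V * ?b2 / t"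
  proof -
    have "(\<Sum>v\<in>W. measure_pmf.prob ?M {s. \<not> good_path (?f s) W (\<lambda>v. Bad v \<union> X) v}) \<le> card W * ?b2"
      by (rule sum_bounded_above) (rule p2)
    moreover have "card W * ?b2 \<le> card V * ?b2" using cW b0 by (intro mult_right_mono) auto
    ultimately have "(\<Sum>v\<in>W. measure_pmf.prob ?M {s. \<not> good_path (?f s) W (\<lambda>v. Bad v \<union> X) v}) / t \<le> card V * ?b2 / t"
      using zt by (intro divide_right_mono) auto
    then show ?thesis using prob_card_markov[OF fW zt(2), of ?M "\<lambda>v s. \<not> good_path (?f s) W (\<lambda>v. Bad v \<union> X) v"] by (rule order.trans[rotated])
  qed
  have 3: "measure_pmf.prob ?M {s. \<exists>u\<in>H \<inter> W. \<not> good_path (?f s) W (\<lambda>v. Bad v \<union> X) u} \<le> x * ?b2"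
  proof -
    have a: "measure_pmf.prob ?M {s. \<exists>u\<in>H \<inter> W. \<not> good_path (?f s) W (\<lambda>v. Bad v \<union> X) u}
       \<le> (\<Sum>u\<in>H \<inter> W. measure_pmf.prob ?M {s. \<not> good_path (?f s) W (\<lambda>v. Bad v \<union> X) u})"
      by (rule prob_union_le) (use H in simp)
    have b: "(\<Sum>u\<in>H \<inter> W. measure_pmf.prob ?M {s. \<not> good_path (?f s) W (\<lambda>v. Bad v \<union> X) u}) \<le> card (H \<inter> W) * ?b2"
      by (rule sum_bounded_above) (use p2 in simp)
    have "card (H \<inter> W) \<le> card H" by (rule card_mono) (use H in auto)
    then have c: "card (H \<inter> W) * ?b2 \<le> x * ?b2" using H b0 by (intro mult_right_mono) auto
    show ?thesis by (rule order.trans[OF a order.trans[OF b c]])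
  qed
  show ?thesis
    by (rule order.trans[OF prob_disj_le add_mono[OF 1 order.trans[OF prob_disj_le add_mono[OF 2 3]]]])
qed

end

context layers_inv
begin

text \<open>Only the \<open>U2\<close>-layer on heads that are not bare is still random. If some
  bare vertex other than \<open>r\<close> has no arc in the small layers, then neither has
  \<open>r\<close>, and two vertices lack incoming arcs. Otherwise the deterministic assembly works
  unless the attachment of exceptional vertices fails.\<close>

lemma prob_stage_final:
  fixes eX zX eN :: "'a \<times> 'a \<Rightarrow> 'b option" and b c s M S g r x t z D dm
  defines "X \<equiv> bare b"
  defines "noarc \<equiv> \<lambda>v. \<forall>u\<in>V - {v}. eX (u, v) = None \<and> zX (u, v) = None"
  defines "aX \<equiv> \<lambda>v. SOME u. u \<in> V - {v} \<and> (eX (u, v) \<noteq> None \<or> zX (u, v) \<noteq> None)"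
  defines "live \<equiv> {v\<in>X - {r}. \<not> noarc v}"
  defines "C0 \<equiv> {k. \<exists>v\<in>X - {r}. eX (aX v, v) = Some k}" and "CX \<equiv> {k. \<exists>v\<in>X - {r}. zX (aX v, v) = Some k}"
  defines "W \<equiv> V - S - X" and "Bad \<equiv> \<lambda>v. {u\<in>V. eN (u, v) \<noteq> None}" and "f \<equiv> \<lambda>v. \<rho> v (s v) (M v)"
  assumes p2: "0 \<le> p2" "p2 \<le> 1" and fin: "finite Q0" "Q0 \<noteq> {}" "finite U1" "U1 \<noteq> {}" "finite U2" "U2 \<noteq> {}"
    and b: "typical_b x l d dm b"
    and c: "c \<in> set_pmf (Pi_pmf A cd (\<lambda>_. pmf_of_set Q0))"
    and M: "\<forall>v\<in>V - X. M v \<in> V - {v} \<and> b (M v, v)" "inj_on (\<lambda>v. c (M v, v)) (V - X)"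
    and eX: "eX \<in> set_pmf (Pi_pmf (arcs_into X) None (\<lambda>_. opt_pmf p1 U1))"
      "\<not> (\<exists>a\<in>arcs_into X. \<exists>b\<in>arcs_into X. a \<noteq> b \<and> eX a \<noteq> None \<and> eX a = eX b)"
      "\<not> (\<exists>a\<in>{a\<in>arcs_into X. fst a \<in> X}. eX a \<noteq> None)"
    and zX: "zX \<in> set_pmf (Pi_pmf (arcs_into X) None (\<lambda>_. opt_pmf p2 U2))"
      "\<not> (\<exists>a\<in>arcs_into X. \<exists>b\<in>arcs_into X. a \<noteq> b \<and> zX a \<noteq> None \<and> zX a = zX b)"
      "\<not> (\<exists>a\<in>{a\<in>arcs_into X. fst a \<in> X}. zX a \<noteq> None)"
    and r: "r \<in> V" "\<And>v. v \<in> X \<Longrightarrow> noarc v \<Longrightarrow> r \<in> X \<and> noarc r"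
    and eN: "eN \<in> set_pmf (Pi_pmf (A - arcs_into X) None (\<lambda>_. opt_pmf p1 U1))"
      "good_tree V X r C0 eN S g" "\<And>v. v \<in> V \<Longrightarrow> card (Bad v) \<le> D"
    and s: "s \<in> set_pmf (Pi_pmf V d0 (\<lambda>v. pmf_of_set (V - {v})))"
      "card {v\<in>W. \<not> good_path f W Bad v} \<le> z"
      "card {v\<in>W. \<not> good_path f W (\<lambda>v. Bad v \<union> X) v} \<le> t"
      "\<And>u. u \<in> aX ` live \<inter> W \<Longrightarrow> good_path f W (\<lambda>v. Bad v \<union> X) u"
  shows "measure_pmf.prob (Pi_pmf (A - arcs_into X) None (\<lambda>_. opt_pmf p2 U2))
     {zN. \<not> rainbow_tree V (assemble b c eX zX eN s zN) \<and> card (no_in_arc V (assemble b c eX zX eN s zN)) \<le> 1}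
    \<le> z * (1 - p2) ^ (card V - (x + t + 1 + D + dm)) + (real z * card V * p2)\<^sup>2 / card U2 + real z * card V * (p2 * x / card U2)"
proof -
  let ?P = "Pi_pmf (A - arcs_into X) None (\<lambda>_. opt_pmf p2 U2)"
  have XV: "X \<subseteq> V" by (auto simp: X_def bare_def)
  have fX: "finite X" using XV finV finite_subset by blast
  have cX: "card X \<le> x" using b by (simp add: typical_b_def X_def)
  note G = eN(2)[unfolded good_tree_def]
  have SV: "S \<subseteq> V" using G by simp
  have sV: "s v \<in> V - {v}" if "v \<in> V" for v using set_shifts[OF s(1) that] .
  have fAN: "finite (A - arcs_into X)" using finA by simp
  define Z where "Z = {v\<in>W. \<not> good_path f W Bad v}"
  define T where "T = S \<union> {v\<in>W. good_path f W (\<lambda>v. Bad v \<union> X) v}"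
  define Y where "Y v = {u\<in>T. u \<noteq> v \<and> eN (u, v) = None \<and> \<not> b (shift s (u, v))}" for v
  have TV: "T \<subseteq> V" using SV by (auto simp: T_def W_def)
  have ZV: "Z \<subseteq> V - X" by (auto simp: Z_def W_def)
  have aXp: "aX v \<in> V - {v} \<and> (eX (aX v, v) \<noteq> None \<or> zX (aX v, v) \<noteq> None)" if v: "v \<in> live" for v
  proof -
    have "\<exists>u. u \<in> V - {v} \<and> (eX (u, v) \<noteq> None \<or> zX (u, v) \<noteq> None)" using v by (auto simp: live_def noarc_def)
    then show ?thesis unfolding aX_def by (rule someI_ex)
  qed
  have into: "(u, v) \<in> arcs_into X \<longleftrightarrow> u \<in> V \<and> v \<in> X \<and> u \<noteq> v" for u v
    using XV by (auto simp: arcs_into_def all_arcs_def)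
  have aXT: "aX v \<in> T" if v: "v \<in> live" for v
  proof -
    have vX: "v \<in> X" using v by (simp add: live_def)
    have a: "(aX v, v) \<in> arcs_into X" using aXp[OF v] vX into by auto
    have "aX v \<notin> X"
    proof
      assume "aX v \<in> X"
      then have "(aX v, v) \<in> {a\<in>arcs_into X. fst a \<in> X}" using a by simp
      then have "eX (aX v, v) = None" "zX (aX v, v) = None" using eX(3) zX(3) by blast+
      then show False using aXp[OF v] by simp
    qed
    then have "aX v \<in> S \<or> aX v \<in> W" using aXp[OF v] by (auto simp: W_def)
    moreover have "good_path f W (\<lambda>v. Bad v \<union> X) (aX v)" if "aX v \<in> W"
      by (rule s(4)) (use that v in simp)
    ultimately show ?thesis unfolding T_def by blast
  qed
  have cCX: "card (CX \<inter> U2) \<le> x"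
  proof -
    have "CX \<subseteq> (\<lambda>v. the (zX (aX v, v))) ` X" by (force simp: CX_def)
    then have "card (CX \<inter> U2) \<le> card ((\<lambda>v. the (zX (aX v, v))) ` X)" using fX by (intro card_mono) auto
    also have "\<dots> \<le> card X" by (rule card_image_le[OF fX])
    finally show ?thesis using cX by linarith
  qed
  have cY: "Y v \<subseteq> V - {v} \<and> card (Y v) \<ge> card V - (x + t + 1 + D + dm)" if v: "v \<in> Z" for v
  proof
    show "Y v \<subseteq> V - {v}" using TV by (auto simp: Y_def)
    have vV: "v \<in> V" using v ZV by auto
    let ?B1 = "{v\<in>W. \<not> good_path f W (\<lambda>v. Bad v \<union> X) v}" and ?B2 = "{u\<in>V - {v}. b (shift s (u, v))}"
    have B2: "card ?B2 \<le> dm"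
    proof -
      have "card ?B2 \<le> card {a\<in>col_arcs V v. b a}"
      proof (rule card_inj_on_le[where f = "\<lambda>u. shift s (u, v)"])
        have sh: "shift s (u, v) = (\<rho> v (s v) u, v)" if "u \<in> V - {v}" for u
          using that vV by (simp add: shift_def all_arcs_def)
        have bij: "bij_betw (\<rho> v (s v)) (V - {v}) (V - {v})" by (rule \<rho>[OF vV sV[OF vV]])
        show "inj_on (\<lambda>u. shift s (u, v)) ?B2"
        proof (rule inj_onI)
          fix x y assume "x \<in> ?B2" "y \<in> ?B2" "shift s (x, v) = shift s (y, v)"
          then show "x = y" using sh[of x] sh[of y] inj_onD[OF bij_betw_imp_inj_on[OF bij], of x y] by simp
        qed
        show "(\<lambda>u. shift s (u, v)) ` ?B2 \<subseteq> {a\<in>col_arcs V v. b a}"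
        proof
          fix a assume "a \<in> (\<lambda>u. shift s (u, v)) ` ?B2"
          then obtain u where u: "u \<in> V - {v}" "b (shift s (u, v))" "a = shift s (u, v)" by blast
          have "\<rho> v (s v) u \<in> V - {v}" using inv[OF vV sV[OF vV] u(1)] by simp
          then show "a \<in> {a\<in>col_arcs V v. b a}" using u sh[OF u(1)] by (auto simp: col_arcs_def)
        qed
        show "finite {a\<in>col_arcs V v. b a}" using finV by simp
      qed
      also have "\<dots> \<le> dm" using b vV by (simp add: typical_b_def)
      finally show ?thesis .
    qed
    \<comment> \<open>All that disqualifies a tail for \<open>v\<close>: being bare, not reaching
      \<open>S\<close> without bare vertices, being \<open>v\<close> itself, or sending an arc of an
      earlier layer to \<open>v\<close>, whose colour would override that of
      \<open>U2\<close>.\<close>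
    have "V \<subseteq> Y v \<union> (X \<union> (?B1 \<union> ({v} \<union> (Bad v \<union> ?B2))))"
      by (auto simp: Y_def T_def W_def Bad_def)
    then have "card V \<le> card (Y v \<union> (X \<union> (?B1 \<union> ({v} \<union> (Bad v \<union> ?B2)))))"
    proof (rule card_mono[rotated])
      show "finite (Y v \<union> (X \<union> (?B1 \<union> ({v} \<union> (Bad v \<union> ?B2)))))"
        using finV TV fX finite_subset[OF TV finV] by (auto simp: Y_def W_def Bad_def)
    qed
    moreover have "card (Y v \<union> (X \<union> (?B1 \<union> ({v} \<union> (Bad v \<union> ?B2))))) \<le> card (Y v) + card (X \<union> (?B1 \<union> ({v} \<union> (Bad v \<union> ?B2))))" by (rule card_Un_le)
    moreover have "card (X \<union> (?B1 \<union> ({v} \<union> (Bad v \<union> ?B2)))) \<le> card X + card (?B1 \<union> ({v} \<union> (Bad v \<union> ?B2)))" by (rule card_Un_le)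
    moreover have "card (?B1 \<union> ({v} \<union> (Bad v \<union> ?B2))) \<le> card ?B1 + card ({v} \<union> (Bad v \<union> ?B2))" by (rule card_Un_le)
    moreover have "card ({v} \<union> (Bad v \<union> ?B2)) \<le> card {v} + card (Bad v \<union> ?B2)" by (rule card_Un_le)
    moreover have "card (Bad v \<union> ?B2) \<le> card (Bad v) + card ?B2" by (rule card_Un_le)
    moreover have "card {v} = 1" by simp
    moreover note B2 cX s(3) eN(3)[OF vV]
    ultimately show "card V - (x + t + 1 + D + dm) \<le> card (Y v)" by linarith
  qed
  have cZ: "card Z \<le> z" using s(2) by (simp add: Z_def)
  define E where "E zN \<longleftrightarrow> (\<exists>bz. (\<forall>v\<in>Z. bz v \<in> Y v \<and> zN (bz v, v) \<noteq> None \<and> zN (bz v, v) \<notin> Some ` CX) \<and> (\<forall>v\<in>Z. \<forall>v'\<in>Z. v \<noteq> v' \<longrightarrow> zN (bz v, v) \<noteq> zN (bz v', v')))" for zN :: "'a \<times> 'a \<Rightarrow> 'b option"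
  define F where "F zN \<longleftrightarrow> \<not> rainbow_tree V (assemble b c eX zX eN s zN) \<and> card (no_in_arc V (assemble b c eX zX eN s zN)) \<le> 1" for zN
  note pz = prob_stage_z[OF p2 fin(5,6) ZV cZ cY cCX, folded E_def]
  have sub: "\<not> E zN" if zN: "zN \<in> set_pmf ?P" and "F zN" for zN
  proof
    have bad: "\<not> rainbow_tree V (assemble b c eX zX eN s zN) \<and> card (no_in_arc V (assemble b c eX zX eN s zN)) \<le> 1"
      using \<open>F zN\<close> by (simp add: F_def)
    assume "E zN"
    then have "\<exists>bz. (\<forall>v\<in>Z. bz v \<in> Y v \<and> zN (bz v, v) \<noteq> None \<and> zN (bz v, v) \<notin> Some ` CX) \<and> (\<forall>v\<in>Z. \<forall>v'\<in>Z. v \<noteq> v' \<longrightarrow> zN (bz v, v) \<noteq> zN (bz v', v'))"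
      unfolding E_def .
    then obtain bz where bz: "\<forall>v\<in>Z. bz v \<in> Y v \<and> zN (bz v, v) \<noteq> None \<and> zN (bz v, v) \<notin> Some ` CX"
      "\<forall>v\<in>Z. \<forall>v'\<in>Z. v \<noteq> v' \<longrightarrow> zN (bz v, v) \<noteq> zN (bz v', v')" by (elim exE conjE)
    let ?w = "assemble b c eX zX eN s zN"
    \<comment> \<open>The condition of at most one vertex without incoming arc is used here.\<close>
    have alive: "v \<in> live" if v: "v \<in> X - {r}" for v
    proof (rule ccontr)
      assume "v \<notin> live"
      then have nv: "noarc v" using v by (simp add: live_def)
      then have nr: "r \<in> X" "noarc r" using r(2)[of v] v by auto
      have none: "u \<in> no_in_arc V ?w" if u: "u \<in> X" "noarc u" for u
      proof -
        have uV: "u \<in> V" using u XV by auto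
        have "?w (y, u) = None" if y: "y \<in> V - {u}" for y
        proof -
          have "eX (y, u) = None" "zX (y, u) = None" using u(2) y unfolding noarc_def by blast+
          moreover have "?w (y, u) = merge_opt (eX (y, u)) (zX (y, u))"
            by (rule assemble_bare) (use u(1) y sV[OF uV] in \<open>simp_all add: X_def\<close>)
          ultimately show ?thesis by simp
        qed
        then show ?thesis using uV by (simp add: no_in_arc_def)
      qed
      have "{v, r} \<subseteq> no_in_arc V ?w" using none[of v] none[of r] v nv nr by simp
      moreover have "finite (no_in_arc V ?w)" using finV by (simp add: no_in_arc_def)
      ultimately have "card {v, r} \<le> card (no_in_arc V ?w)" by (rule card_mono[rotated])
      then show False using bad v by simp
    qed
    have "rainbow_tree V ?w"
    proof (rule rainbow_tree_assemble[where r = r and M = M and aX = aX and bz = bz and S = S and g = g])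
      show "r \<in> V" by (rule r(1))
      show "M v \<in> V - {v} \<and> b (M v, v)" if "v \<in> V - bare b" for v using M(1) that by (simp add: X_def)
      show "inj_on (\<lambda>v. c (M v, v)) (V - bare b)" using M(2) by (simp add: X_def)
      have cQ: "c \<in> PiE_dflt A cd (\<lambda>_. Q0)" using c fin(1,2) finA by (simp add: set_Pi_pmf o_def)
      show "c a \<in> Q0" if "a \<in> A" for a using cQ that unfolding PiE_dflt_def by blast
      show "k \<in> U1" if "eX a = Some k" for a k by (rule set_Pi_opt(1)[OF arcs_into(2) fin(3,4) eX(1) that])
      show "k \<in> U1" if "eN a = Some k" for a k by (rule set_Pi_opt(1)[OF fAN fin(3,4) eN(1) that])
      show "k \<in> U2" if "zX a = Some k" for a k by (rule set_Pi_opt(1)[OF arcs_into(2) fin(5,6) zX(1) that])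
      show "k \<in> U2" if "zN a = Some k" for a k by (rule set_Pi_opt(1)[OF fAN fin(5,6) zN that])
      show "s v \<in> V - {v}" if "v \<in> V" for v by (rule sV[OF that])
      show "aX v \<in> V - {v} \<and> (eX (aX v, v) \<noteq> None \<or> zX (aX v, v) \<noteq> None) \<and>
          aX v \<in> S \<union> {v \<in> V - S - bare b. good_path (\<lambda>v. \<rho> v (s v) (M v)) (V - S - bare b) (\<lambda>v. {u \<in> V. eN (u, v) \<noteq> None} \<union> bare b) v}"
        if "v \<in> bare b - {r}" for v
      proof -
        have "v \<in> live" using alive that by (simp add: X_def)
        then show ?thesis using aXp[of v] aXT[of v] unfolding T_def W_def Bad_def f_def X_def by simp
      qed
      have inX: "(aX v, v) \<in> arcs_into X" if "v \<in> bare b - {r}" for v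
        using aXp[OF alive[of v]] that into by (auto simp: X_def)
      show "eX (aX v, v) \<noteq> eX (aX v', v')"
        if v: "v \<in> bare b - {r}" "v' \<in> bare b - {r}" "v \<noteq> v'" "eX (aX v, v) \<noteq> None" for v v'
      proof
        assume e: "eX (aX v, v) = eX (aX v', v')"
        have "\<exists>a\<in>arcs_into X. \<exists>b\<in>arcs_into X. a \<noteq> b \<and> eX a \<noteq> None \<and> eX a = eX b"
          by (rule bexI[OF _ inX[OF v(1)]], rule bexI[OF _ inX[OF v(2)]]) (use e v in simp)
        then show False using eX(2) by contradiction
      qed
      show "zX (aX v, v) \<noteq> zX (aX v', v')"
        if v: "v \<in> bare b - {r}" "v' \<in> bare b - {r}" "v \<noteq> v'" "zX (aX v, v) \<noteq> None" for v v'
      proof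
        assume e: "zX (aX v, v) = zX (aX v', v')"
        have "\<exists>a\<in>arcs_into X. \<exists>b\<in>arcs_into X. a \<noteq> b \<and> zX a \<noteq> None \<and> zX a = zX b"
          by (rule bexI[OF _ inX[OF v(1)]], rule bexI[OF _ inX[OF v(2)]]) (use e v in simp)
        then show False using zX(2) by contradiction
      qed
      show "good_tree V (bare b) r {k. \<exists>v\<in>bare b - {r}. eX (aX v, v) = Some k} eN S g"
        using eN(2) by (simp add: C0_def X_def)
      have Zeq: "{v \<in> V - S - bare b. \<not> good_path (\<lambda>v. \<rho> v (s v) (M v)) (V - S - bare b) (\<lambda>v. {u \<in> V. eN (u, v) \<noteq> None}) v} = Z"
        unfolding Z_def W_def Bad_def f_def X_def by (rule refl)
      show "bz v \<in> S \<union> {v \<in> V - S - bare b. good_path (\<lambda>v. \<rho> v (s v) (M v)) (V - S - bare b) (\<lambda>v. {u \<in> V. eN (u, v) \<noteq> None} \<union> bare b) v} \<and>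
          bz v \<noteq> v \<and> eN (bz v, v) = None \<and> \<not> b (shift s (bz v, v)) \<and> zN (bz v, v) \<noteq> None"
        if "v \<in> {v \<in> V - S - bare b. \<not> good_path (\<lambda>v. \<rho> v (s v) (M v)) (V - S - bare b) (\<lambda>v. {u \<in> V. eN (u, v) \<noteq> None}) v}" for v
      proof -
        have "v \<in> Z" using that unfolding Zeq .
        then have "bz v \<in> Y v" "zN (bz v, v) \<noteq> None" using bz(1) by blast+
        then show ?thesis unfolding Y_def T_def W_def Bad_def f_def X_def by simp
      qed
      show "zN (bz v, v) \<noteq> zN (bz v', v')"
        if "v \<in> {v \<in> V - S - bare b. \<not> good_path (\<lambda>v. \<rho> v (s v) (M v)) (V - S - bare b) (\<lambda>v. {u \<in> V. eN (u, v) \<noteq> None}) v}"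
          "v' \<in> {v \<in> V - S - bare b. \<not> good_path (\<lambda>v. \<rho> v (s v) (M v)) (V - S - bare b) (\<lambda>v. {u \<in> V. eN (u, v) \<noteq> None}) v}" "v \<noteq> v'" for v v'
        using bz(2) that unfolding Zeq by blast
      show "zN (bz v, v) \<notin> Some ` {k. \<exists>v\<in>bare b - {r}. zX (aX v, v) = Some k}"
        if "v \<in> {v \<in> V - S - bare b. \<not> good_path (\<lambda>v. \<rho> v (s v) (M v)) (V - S - bare b) (\<lambda>v. {u \<in> V. eN (u, v) \<noteq> None}) v}" for v
        using bz(1) that unfolding Zeq CX_def X_def by blast
    qed
    then show False using bad by blast
  qed
  have "measure_pmf.prob ?P {zN. F zN} \<le> measure_pmf.prob ?P {zN. \<not> E zN}"
    by (rule prob_mono[where Q = F and R = "\<lambda>zN. \<not> E zN"]) (rule sub)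
  from order.trans[OF this pz] show ?thesis unfolding F_def .
qed

end

lemma prob_bind_le_add:
  assumes "measure_pmf.prob p {x. B x} \<le> \<epsilon>" "\<And>x. x \<in> set_pmf p \<Longrightarrow> \<not> B x \<Longrightarrow> measure_pmf.prob (F x) E \<le> c" "c \<ge> 0"
  shows "measure_pmf.prob (bind_pmf p F) E \<le> \<epsilon> + c"
  by (rule order.trans[OF prob_bind_le[where B = B, OF assms(2,3)] add_right_mono[OF assms(1)]])

context layers_inv
begin

text \<open>Each summand bounds the failure of one stage, in the order of \<open>gen\<close>, given
  that all earlier ones succeeded. The root is determined as soon as the arcs into bare vertices are
  exposed, before the tree is grown from it.\<close>

lemma prob_gen_bad:
  fixes lam \<theta> :: real
  assumes p1: "0 \<le> p1" "p1 \<le> 1" and p2: "0 \<le> p2" "p2 \<le> 1"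
    and fin: "finite Q0" "Q0 \<noteq> {}" "finite U1" "U1 \<noteq> {}" "finite U2" "U2 \<noteq> {}"
    and Q: "card V \<le> card Q0" and Kx: "2 * (K + x) \<le> card U1" "1 \<le> K" "2 * (K + x) \<le> card V" and \<theta>: "\<theta> \<ge> 1"
    and lam: "lam \<ge> 1" "real (card V - 1) \<le> lam * real K"
  shows "measure_pmf.prob gen {w. \<not> rainbow_tree V w \<and> card (no_in_arc V w) \<le> 1} \<le>
    measure_pmf.prob (Pi_pmf A False (\<lambda>_. bernoulli_pmf p0)) {b. \<not> typical_b x l d dm b} +
    ((real l)\<^sup>2 / card Q0 + (\<Sum>k=1..card V. real (card V choose k) * real (card Q0 choose k) * (real (k + l) / real (card Q0)) ^ (k * d)) +
    ((real x * card V * p1)\<^sup>2 / card U1 + (real x)\<^sup>2 * p1 +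
    ((real x * card V * p2)\<^sup>2 / card U2 + (real x)\<^sup>2 * p2 +
    ((\<Sum>s=1..<K. real (card V choose (s - 1)) * real s ^ (s - 1) * p1 ^ (s - 1) * (1 - p1 / 2) ^ (s * (card V div 2)))
      + card V * (exp (p1 * (\<theta> - 1) * card V) / \<theta> ^ D) +
    (card V * (lam * (real D + 1 + lam) / real (card V - 1)) / real (z + 1)
      + (card V * (lam * (real (D + x) + 1 + lam) / real (card V - 1)) / real (t + 1) + x * (lam * (real (D + x) + 1 + lam) / real (card V - 1))) +
    (z * (1 - p2) ^ (card V - (x + t + 1 + D + dm)) + (real z * card V * p2)\<^sup>2 / card U2 + real z * card V * (p2 * x / card U2)))))))"
    (is "_ \<le> ?Eb + (?Ec + (?EX1 + (?EX2 + (?EN + (?ES + ?Ez)))))")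
proof -
  define E where "E = {w. \<not> rainbow_tree V w \<and> card (no_in_arc V (w :: 'a \<times> 'a \<Rightarrow> 'b option)) \<le> 1}"
  let ?PE = "\<lambda>b. Pi_pmf (arcs_into (bare b)) None (\<lambda>_. opt_pmf p1 U1)" and ?PZ = "\<lambda>b. Pi_pmf (arcs_into (bare b)) None (\<lambda>_. opt_pmf p2 U2)"
  let ?NE = "\<lambda>b. Pi_pmf (A - arcs_into (bare b)) None (\<lambda>_. opt_pmf p1 U1)" and ?NZ = "\<lambda>b. Pi_pmf (A - arcs_into (bare b)) None (\<lambda>_. opt_pmf p2 U2)"
  let ?S = "Pi_pmf V d0 (\<lambda>v. pmf_of_set (V - {v}))" and ?C = "Pi_pmf A cd (\<lambda>_. pmf_of_set Q0)"
  define F6 where "F6 b c eX zX eN s = bind_pmf (?NZ b) (\<lambda>zN. return_pmf (assemble b c eX zX eN s zN))" for b c eX zX eN s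
  define F5 where "F5 b c eX zX eN = bind_pmf ?S (F6 b c eX zX eN)" for b c eX zX eN
  define F4 where "F4 b c eX zX = bind_pmf (?NE b) (F5 b c eX zX)" for b c eX zX
  define F3 where "F3 b c eX = bind_pmf (?PZ b) (F4 b c eX)" for b c eX
  define F2 where "F2 b c = bind_pmf (?PE b) (F3 b c)" for b c
  define F1 where "F1 b = bind_pmf ?C (F2 b)" for b
  have gen: "gen = bind_pmf (Pi_pmf A False (\<lambda>_. bernoulli_pmf p0)) F1"
    unfolding gen_def F1_def[abs_def] F2_def[abs_def] F3_def[abs_def] F4_def[abs_def] F5_def[abs_def] F6_def[abs_def] by (rule refl)
  have nn: "?Ez \<ge> 0" "?ES \<ge> 0" "?EN \<ge> 0" "?EX1 \<ge> 0" "?EX2 \<ge> 0" "?Ec \<ge> 0"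
    using p1 p2 lam \<theta> by (auto intro!: add_nonneg_nonneg sum_nonneg mult_nonneg_nonneg divide_nonneg_nonneg)
  have n4: "?ES + ?Ez \<ge> 0" and n3: "?EN + (?ES + ?Ez) \<ge> 0" and n2: "?EX2 + (?EN + (?ES + ?Ez)) \<ge> 0"
    and n1: "?EX1 + (?EX2 + (?EN + (?ES + ?Ez))) \<ge> 0" and n0: "?Ec + (?EX1 + (?EX2 + (?EN + (?ES + ?Ez)))) \<ge> 0"
    using nn by (auto intro!: add_nonneg_nonneg simp del: of_nat_add of_nat_Suc)
  have inner: "measure_pmf.prob (F4 b c eX zX) E \<le> ?EN + (?ES + ?Ez)"
    if b: "typical_b x l d dm b" and c: "c \<in> set_pmf ?C"
      and nc: "\<exists>M. (\<forall>v\<in>V - bare b. M v \<in> V - {v} \<and> b (M v, v)) \<and> inj_on (\<lambda>v. c (M v, v)) (V - bare b)"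
      and eX: "eX \<in> set_pmf (?PE b)"
        "\<not> (\<exists>a\<in>arcs_into (bare b). \<exists>a'\<in>arcs_into (bare b). a \<noteq> a' \<and> eX a \<noteq> None \<and> eX a = eX a')"
        "\<not> (\<exists>a\<in>{a\<in>arcs_into (bare b). fst a \<in> bare b}. eX a \<noteq> None)"
      and zX: "zX \<in> set_pmf (?PZ b)"
        "\<not> (\<exists>a\<in>arcs_into (bare b). \<exists>a'\<in>arcs_into (bare b). a \<noteq> a' \<and> zX a \<noteq> None \<and> zX a = zX a')"
        "\<not> (\<exists>a\<in>{a\<in>arcs_into (bare b). fst a \<in> bare b}. zX a \<noteq> None)"
    for b c eX zX
  proof -
    obtain M where M: "\<forall>v\<in>V - bare b. M v \<in> V - {v} \<and> b (M v, v)" "inj_on (\<lambda>v. c (M v, v)) (V - bare b)"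
      using nc by (elim exE conjE)
    let ?X = "bare b"
    let ?noarc = "\<lambda>v. \<forall>u\<in>V - {v}. eX (u, v) = None \<and> zX (u, v) = None"
    let ?aX = "\<lambda>v. SOME u. u \<in> V - {v} \<and> (eX (u, v) \<noteq> None \<or> zX (u, v) \<noteq> None)"
    have XV: "?X \<subseteq> V" by (rule bare_V)
    have fX: "finite ?X" using XV finV finite_subset by blast
    have cX: "card ?X \<le> x" using b by (simp add: typical_b_def)
    \<comment> \<open>The root is a bare vertex without arcs in the small layers if there is one,
      since such a vertex can have no parent; otherwise any vertex will do.\<close>
    have "\<exists>r. r \<in> V \<and> (\<forall>v. v \<in> ?X \<longrightarrow> ?noarc v \<longrightarrow> r \<in> ?X \<and> ?noarc r)"
    proof (cases "\<exists>v\<in>?X. ?noarc v")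
      case True
      then obtain v where v: "v \<in> ?X" "?noarc v" by (elim bexE)
      then have "v \<in> V" using XV by blast
      then show ?thesis using v by (intro exI[of _ v] conjI allI impI)
    next
      case False
      have "V \<noteq> {}" using cardV by auto
      then obtain v where "v \<in> V" by auto
      then show ?thesis using False by (intro exI[of _ v] conjI allI impI) blast+
    qed
    then obtain r where r: "r \<in> V" "\<forall>v. v \<in> ?X \<longrightarrow> ?noarc v \<longrightarrow> r \<in> ?X \<and> ?noarc r" by (elim exE conjE)
    have r2: "r \<in> ?X \<and> ?noarc r" if "v \<in> ?X" "?noarc v" for v
      by (rule mp[OF mp[OF spec[OF r(2)] that(1)] that(2)])
    let ?live = "{v\<in>?X - {r}. \<not> ?noarc v}"
    define C0 where "C0 = {k. \<exists>v\<in>?X - {r}. eX (?aX v, v) = Some k}"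
    define H where "H = ?aX ` ?live"
    have H: "finite H" "card H \<le> x"
    proof -
      have l: "finite ?live" "card ?live \<le> card ?X" using fX by (auto intro: card_mono)
      then show "finite H" unfolding H_def by (intro finite_imageI)
      have "card H \<le> card ?live" unfolding H_def by (rule card_image_le[OF l(1)])
      then show "card H \<le> x" using l(2) cX by linarith
    qed
    have cC0: "card (C0 \<inter> U1) \<le> x"
    proof -
      have "C0 \<subseteq> (\<lambda>v. the (eX (?aX v, v))) ` ?X"
      proof
        fix k assume "k \<in> C0"
        then obtain v where v: "v \<in> ?X - {r}" "eX (?aX v, v) = Some k" unfolding C0_def by (elim CollectE bexE)
        show "k \<in> (\<lambda>v. the (eX (?aX v, v))) ` ?X"
          by (rule image_eqI[of _ _ v]) (use v in \<open>simp_all only: option.sel Diff_iff\<close>)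
      qed
      then have "C0 \<inter> U1 \<subseteq> (\<lambda>v. the (eX (?aX v, v))) ` ?X" by (rule order.trans[OF Int_lower1])
      then have "card (C0 \<inter> U1) \<le> card ((\<lambda>v. the (eX (?aX v, v))) ` ?X)" by (rule card_mono[OF finite_imageI[OF fX]])
      also have "\<dots> \<le> card ?X" by (rule card_image_le[OF fX])
      finally show ?thesis using cX by linarith
    qed
    show ?thesis unfolding F4_def
    proof (rule prob_bind_le_add[where B = "\<lambda>e. \<not> (\<exists>S g. good_tree V ?X r C0 e S g \<and> card S = K) \<or> (\<exists>v\<in>V. D < card {u\<in>V. e (u, v) \<noteq> None})"])
      show "measure_pmf.prob (?NE b) {e. \<not> (\<exists>S g. good_tree V ?X r C0 e S g \<and> card S = K) \<or> (\<exists>v\<in>V. D < card {u\<in>V. e (u, v) \<noteq> None})} \<le> ?EN"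
        by (rule prob_stage_N[OF p1 fin(3,4) XV cX r(1) cC0 Kx \<theta>])
      show "?ES + ?Ez \<ge> 0" by (rule n4)
      fix eN assume eN: "eN \<in> set_pmf (?NE b)"
        and "\<not> (\<not> (\<exists>S g. good_tree V ?X r C0 eN S g \<and> card S = K) \<or> (\<exists>v\<in>V. D < card {u\<in>V. eN (u, v) \<noteq> None}))"
      then have ex: "\<exists>S g. good_tree V ?X r C0 eN S g \<and> card S = K" and nD: "\<not> (\<exists>v\<in>V. D < card {u\<in>V. eN (u, v) \<noteq> None})" by simp_all
      obtain S g where Sg: "good_tree V ?X r C0 eN S g" "card S = K" using ex by (elim exE conjE)
      have D: "card {u\<in>V. eN (u, v) \<noteq> None} \<le> D" if "v \<in> V" for v
        using nD that by (metis (no_types, lifting) not_le)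
      let ?f = "\<lambda>s v. \<rho> v (s v) (M v)" and ?Bad = "\<lambda>v. {u\<in>V. eN (u, v) \<noteq> None}"
      define W where "W = V - S - ?X"
      have WV: "W \<subseteq> V - ?X" by (auto simp: W_def)
      have SV: "S \<subseteq> V" using Sg(1) by (simp add: good_tree_def)
      have "card W \<le> card (V - S)" unfolding W_def by (rule card_mono) (use finV in auto)
      also have "card (V - S) = card V - K" using Sg(2) SV card_Diff_subset[of S V] finite_subset[OF SV finV] by simp
      finally have "card W \<le> card V - K" .
      moreover have "K \<le> card V" using Sg(2) card_mono[OF finV SV] by simp
      ultimately have cW: "real (card W) \<le> real (card V) - real K" by linarith
      \<comment> \<open>At least \<open>K\<close> vertices lie outside \<open>W\<close>, so one step
        of the random mapping stays in \<open>W\<close> with probability at most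
        \<open>1 - 1 / lam\<close>.\<close>
      have "real (card V - 1) / lam \<le> real K" using lam by (simp add: field_simps)
      moreover have "real (card V - 1) = real (card V) - 1" using cardV by simp
      moreover have "(1 - 1 / lam) * real (card V - 1) = real (card V - 1) - real (card V - 1) / lam" by (simp add: algebra_simps)
      ultimately have lamW: "real (card W) - 1 \<le> (1 - 1 / lam) * real (card V - 1)" using cW by linarith
      show "measure_pmf.prob (F5 b c eX zX eN) E \<le> ?ES + ?Ez" unfolding F5_def
      proof (rule prob_bind_le_add[where B = "\<lambda>s. real (z + 1) \<le> card {v\<in>W. \<not> good_path (?f s) W ?Bad v} \<or>
         (real (t + 1) \<le> card {v\<in>W. \<not> good_path (?f s) W (\<lambda>v. ?Bad v \<union> ?X) v} \<or>
         (\<exists>u\<in>H \<inter> W. \<not> good_path (?f s) W (\<lambda>v. ?Bad v \<union> ?X) u))"])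
        show "measure_pmf.prob ?S {s. real (z + 1) \<le> card {v\<in>W. \<not> good_path (?f s) W ?Bad v} \<or>
         (real (t + 1) \<le> card {v\<in>W. \<not> good_path (?f s) W (\<lambda>v. ?Bad v \<union> ?X) v} \<or>
         (\<exists>u\<in>H \<inter> W. \<not> good_path (?f s) W (\<lambda>v. ?Bad v \<union> ?X) u))} \<le> ?ES"
        proof (rule prob_stage_S[OF WV _ _ fX cX lam(1) lamW _ _ H])
          show "M v \<in> V - {v}" if "v \<in> V - ?X" for v using M(1) that by blast
          show "finite (?Bad v) \<and> card (?Bad v) \<le> D" if "v \<in> W" for v
            using D[of v] that WV finV by (intro conjI) auto
        qed simp_all
        show "?Ez \<ge> 0" by (rule nn)
        fix s assume s: "s \<in> set_pmf ?S" and ns: "\<not> (real (z + 1) \<le> card {v\<in>W. \<not> good_path (?f s) W ?Bad v} \<or>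
         (real (t + 1) \<le> card {v\<in>W. \<not> good_path (?f s) W (\<lambda>v. ?Bad v \<union> ?X) v} \<or>
         (\<exists>u\<in>H \<inter> W. \<not> good_path (?f s) W (\<lambda>v. ?Bad v \<union> ?X) u)))"
        have s1: "card {v\<in>W. \<not> good_path (?f s) W ?Bad v} \<le> z" and s2: "card {v\<in>W. \<not> good_path (?f s) W (\<lambda>v. ?Bad v \<union> ?X) v} \<le> t"
          and s3: "\<not> (\<exists>u\<in>H \<inter> W. \<not> good_path (?f s) W (\<lambda>v. ?Bad v \<union> ?X) u)"
          using ns by simp_all
        have s4: "good_path (?f s) W (\<lambda>v. ?Bad v \<union> ?X) u" if "u \<in> H \<inter> W" for u using s3 that by blast
        have "measure_pmf.prob (F6 b c eX zX eN s) E = measure_pmf.prob (?NZ b)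
           {zN. \<not> rainbow_tree V (assemble b c eX zX eN s zN) \<and> card (no_in_arc V (assemble b c eX zX eN s zN)) \<le> 1}"
          unfolding F6_def map_pmf_def[symmetric] measure_map_pmf E_def vimage_Collect_eq by (rule refl)
        also have "\<dots> \<le> ?Ez"
          by (rule prob_stage_final[where M = M and r = r and S = S and g = g and eN = eN and s = s and eX = eX and zX = zX and c = c and b = b and D = D and dm = dm and x = x and t = t and z = z,
                OF p2 fin b c M eX zX r(1) r2 eN Sg(1)[unfolded C0_def] D s s1[unfolded W_def] s2[unfolded W_def] s4[unfolded W_def H_def]])
        finally show "measure_pmf.prob (F6 b c eX zX eN s) E \<le> ?Ez" .
      qed
    qed
  qed
  show ?thesis unfolding gen E_def[symmetric]
  proof (rule prob_bind_le_add[where B = "\<lambda>b. \<not> typical_b x l d dm b"])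
    show "0 \<le> ?Ec + (?EX1 + (?EX2 + (?EN + (?ES + ?Ez))))" by (rule n0)
    fix b assume "\<not> \<not> typical_b x l d dm b"
    then have b: "typical_b x l d dm b" by (rule notnotD)
    have XV: "bare b \<subseteq> V" by (rule bare_V)
    have cX: "card (bare b) \<le> x" using b by (simp add: typical_b_def)
    show "measure_pmf.prob (F1 b) E \<le> ?Ec + (?EX1 + (?EX2 + (?EN + (?ES + ?Ez))))" unfolding F1_def
    proof (rule prob_bind_le_add[OF prob_stage_c[OF b fin(1,2) Q] _ n1])
      fix c assume c: "c \<in> set_pmf ?C"
        and "\<not> \<not> (\<exists>M. (\<forall>v\<in>V - bare b. M v \<in> V - {v} \<and> b (M v, v)) \<and> inj_on (\<lambda>v. c (M v, v)) (V - bare b))"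
      then have nc: "\<exists>M. (\<forall>v\<in>V - bare b. M v \<in> V - {v} \<and> b (M v, v)) \<and> inj_on (\<lambda>v. c (M v, v)) (V - bare b)" by (elim notnotD)
      show "measure_pmf.prob (F2 b c) E \<le> ?EX1 + (?EX2 + (?EN + (?ES + ?Ez)))" unfolding F2_def
      proof (rule prob_bind_le_add[OF prob_stage_X[OF p1 fin(3,4) XV cX] _ n2])
        fix eX assume eX: "eX \<in> set_pmf (?PE b)"
          and "\<not> ((\<exists>a\<in>arcs_into (bare b). \<exists>a'\<in>arcs_into (bare b). a \<noteq> a' \<and> eX a \<noteq> None \<and> eX a = eX a') \<or> (\<exists>a\<in>{a\<in>arcs_into (bare b). fst a \<in> bare b}. eX a \<noteq> None))"
        note eX2 = this(2)[unfolded de_Morgan_disj]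
        show "measure_pmf.prob (F3 b c eX) E \<le> ?EX2 + (?EN + (?ES + ?Ez))" unfolding F3_def
        proof (rule prob_bind_le_add[OF prob_stage_X[OF p2 fin(5,6) XV cX] _ n3])
          fix zX assume zX: "zX \<in> set_pmf (?PZ b)"
            and "\<not> ((\<exists>a\<in>arcs_into (bare b). \<exists>a'\<in>arcs_into (bare b). a \<noteq> a' \<and> zX a \<noteq> None \<and> zX a = zX a') \<or> (\<exists>a\<in>{a\<in>arcs_into (bare b). fst a \<in> bare b}. zX a \<noteq> None))"
          note zX2 = this(2)[unfolded de_Morgan_disj]
          show "measure_pmf.prob (F4 b c eX zX) E \<le> ?EN + (?ES + ?Ez)"
            by (rule inner[OF b c nc eX conjunct1[OF eX2] conjunct2[OF eX2] zX conjunct1[OF zX2] conjunct2[OF zX2]])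
        qed
      qed
    qed
  qed (rule order.refl)
qed

end

section \<open>Asymptotics of the failure probability\<close>

text \<open>
  The summands bound the failure of, in this order: typicality of the \<open>Q0\<close>-layer, Hall's
  condition, the two layers on bare heads, the growth of the tree, the random mapping, and the
  attachment of exceptional vertices.
\<close>

definition bad_bound :: "nat \<Rightarrow> nat \<Rightarrow> nat \<Rightarrow> real \<Rightarrow> real \<Rightarrow> real \<Rightarrow> nat \<Rightarrow> nat \<Rightarrow> nat \<Rightarrow> nat \<Rightarrow> nat \<Rightarrow> nat \<Rightarrow> nat \<Rightarrow> nat \<Rightarrow> real \<Rightarrow> real" where
  "bad_bound n q0 u p0 p1 p2 x l d dm K D z t lam =
    (n * (1 - p0) ^ (n - 1) / real (x + 1) + (n * (exp (p0 * (exp (- 2) - 1) * real (n - 1)) / exp (- 2) ^ d) / real (l + 1)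
      + n * (exp (p0 * (exp 1 - 1) * real (n - 1)) / exp 1 ^ dm))) +
    ((real l)\<^sup>2 / q0 + (\<Sum>k=1..n. real (n choose k) * real (q0 choose k) * (real (k + l) / real q0) ^ (k * d)) +
    ((real x * n * p1)\<^sup>2 / u + (real x)\<^sup>2 * p1 +
    ((real x * n * p2)\<^sup>2 / u + (real x)\<^sup>2 * p2 +
    ((\<Sum>s=1..<K. real (n choose (s - 1)) * real s ^ (s - 1) * p1 ^ (s - 1) * (1 - p1 / 2) ^ (s * (n div 2)))
      + n * (exp (p1 * (exp 3 - 1) * n) / exp 3 ^ D) +
    (n * (lam * (real D + 1 + lam) / real (n - 1)) / real (z + 1)
      + (n * (lam * (real (D + x) + 1 + lam) / real (n - 1)) / real (t + 1) + x * (lam * (real (D + x) + 1 + lam) / real (n - 1))) +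
    (z * (1 - p2) ^ (n - (x + t + 1 + D + dm)) + (real z * n * p2)\<^sup>2 / u + real z * n * (p2 * x / u)))))))"

section \<open>Estimates of powers, binomial coefficients and the two sums in the bound\<close>

lemma one_minus_power_le_exp:
  fixes y :: real
  assumes "y \<le> 1"
  shows "(1 - y) ^ k \<le> exp (- (y * k))"
proof -
  have "(1 - y) ^ k \<le> exp (- y) ^ k"
    using assms exp_ge_add_one_self[of "- y"] by (intro power_mono) auto
  then show ?thesis by (simp add: exp_of_nat_mult[symmetric] mult.commute)
qed

text \<open>A single term of the exponential series of \<open>k\<close>.\<close>

lemma power_self_le_exp_fact: "real k ^ k \<le> exp (real k) * fact k"
proof -
  have "(\<Sum>i\<in>{k}. real k ^ i /\<^sub>R fact i) \<le> (\<Sum>i. real k ^ i /\<^sub>R fact i)"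
    by (rule sum_le_suminf[OF summable_exp_generic]) auto
  then have "real k ^ k / fact k \<le> exp (real k)" by (simp add: exp_def divide_inverse mult.commute)
  then show ?thesis by (simp add: field_simps)
qed

lemma binomial_le_exp_power:
  assumes "k \<ge> 1"
  shows "real (n choose k) \<le> (exp 1 * n / k) ^ k"
proof -
  have "real (n choose k) * fact k \<le> real n ^ k"
    using binomial_fact_pow[of n k] by (metis of_nat_fact of_nat_le_iff of_nat_mult of_nat_power)
  then have "real (n choose k) * fact k * exp (real k) \<le> real n ^ k * exp (real k)" by (rule mult_right_mono) simp
  moreover have "real (n choose k) * real k ^ k \<le> real (n choose k) * (exp (real k) * fact k)"
    by (rule mult_left_mono[OF power_self_le_exp_fact]) simp
  ultimately have "real (n choose k) * real k ^ k \<le> exp (real k) * real n ^ k" by (simp only: mult_ac)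
  then have "real (n choose k) \<le> exp (real k) * real n ^ k / real k ^ k" using assms by (simp add: field_simps)
  also have "exp (real k) = exp 1 ^ k" by (simp add: exp_of_nat_mult[symmetric])
  finally show ?thesis by (simp add: power_mult_distrib power_divide)
qed

lemma sum_power_le:
  fixes r :: real
  assumes "0 \<le> r" "r \<le> 1 / 2"
  shows "(\<Sum>k=1..n. r ^ k) \<le> 2 * r"
proof -
  have s: "(\<Sum>k=1..n. r ^ k) = r * (\<Sum>k<n. r ^ k)"
    unfolding sum_distrib_left by (rule sum.reindex_bij_witness[of _ Suc "\<lambda>k. k - 1"]) (auto simp: power_eq_if)
  have "(\<Sum>k<n. r ^ k) \<le> (\<Sum>k. r ^ k)"
    by (rule sum_le_suminf) (use assms in \<open>auto intro!: summable_geometric\<close>)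
  also have "\<dots> = 1 / (1 - r)" using assms by (intro suminf_geometric) auto
  also have "\<dots> \<le> 2" using assms by (simp add: field_simps)
  finally have "(\<Sum>k<n. r ^ k) \<le> 2" .
  from mult_left_mono[OF this assms(1)] show ?thesis using s by linarith
qed

text \<open>Two ranges with geometric sums. For \<open>k \<le> l\<close> crude binomial bounds
  suffice because \<open>l / q0\<close> will be a negative power of \<open>n\<close>. For
  \<open>k > l\<close>, two of the \<open>d\<close> factors \<open>(k + l) / q0\<close> cancel the
  \<open>1 / k ^ 2\<close> left by the binomials; the other \<open>d - 2\<close> are at most
  \<open>(n + l) / q0\<close>, so the surplus of colours is what makes this range small.\<close>

lemma hall_sum_le:
  fixes r1 r2 :: real and n q0 l d :: nat
  assumes n: "n \<ge> 1" "n \<le> q0" "q0 \<le> 2 * n" and d: "d \<ge> 2"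
    and r1: "2 * real n ^ 2 * (2 * real l / real q0) ^ d \<le> r1"
    and r2: "4 * exp 1 ^ 2 * ((real n + real l) / real q0) ^ (d - 2) \<le> r2"
    and r: "r1 + r2 \<le> 1 / 2"
  shows "(\<Sum>k=1..n. real (n choose k) * real (q0 choose k) * (real (k + l) / real q0) ^ (k * d)) \<le> 2 * (r1 + r2)"
proof -
  have q: "real q0 > 0" using n by simp
  have nn: "0 \<le> r1" "0 \<le> r2"
    by (rule order.trans[OF _ r1], simp, rule order.trans[OF _ r2], simp)
  have tm: "real (n choose k) * real (q0 choose k) * (real (k + l) / real q0) ^ (k * d) \<le> (r1 + r2) ^ k" if k: "k \<in> {1..n}" for k
  proof (cases "k \<le> l")
    case True
    have c: "real (n choose k) \<le> real n ^ k" "real (q0 choose k) \<le> (2 * real n) ^ k"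
    proof -
      have b: "real (m choose k) \<le> real m ^ k" for m
      proof (cases "k \<le> m")
        case True
        then show ?thesis using binomial_le_pow[of k m] by (metis of_nat_le_iff of_nat_power)
      qed (simp add: binomial_eq_0)
      show "real (n choose k) \<le> real n ^ k" by (rule b)
      have "real q0 ^ k \<le> (2 * real n) ^ k" using n by (intro power_mono) auto
      then show "real (q0 choose k) \<le> (2 * real n) ^ k" using b[of q0] by linarith
    qed
    have y: "(real (k + l) / real q0) ^ (k * d) \<le> (2 * real l / real q0) ^ (k * d)"
      using True q by (intro power_mono divide_right_mono) auto
    have "real (n choose k) * real (q0 choose k) * (real (k + l) / real q0) ^ (k * d)
       \<le> real n ^ k * (2 * real n) ^ k * (2 * real l / real q0) ^ (k * d)"
      using c y by (intro mult_mono) auto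
    also have "\<dots> = (2 * real n ^ 2 * (2 * real l / real q0) ^ d) ^ k"
      by (simp add: power_mult_distrib power_mult[symmetric] mult.commute power2_eq_square)
    also have "\<dots> \<le> (r1 + r2) ^ k" using r1 nn by (intro power_mono) auto
    finally show ?thesis .
  next
    case False
    define y where "y = real (k + l) / real q0"
    have k1: "k \<ge> 1" "real k > 0" using k by auto
    have y0: "y \<ge> 0" by (simp add: y_def)
    have "real (n choose k) * real (q0 choose k) * y ^ (k * d) \<le> (exp 1 * n / k) ^ k * (exp 1 * q0 / k) ^ k * y ^ (k * d)"
      using y0 by (intro mult_right_mono mult_mono binomial_le_exp_power k1) auto
    also have "\<dots> = (exp 1 * n / k * (exp 1 * q0 / k) * y ^ d) ^ k"
      by (simp only: power_mult_distrib power_mult mult.commute[of k d])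
    also have "\<dots> \<le> (r1 + r2) ^ k"
    proof (rule power_mono)
      have "y ^ d = y ^ 2 * y ^ (d - 2)" using d by (simp only: power_add[symmetric] le_add_diff_inverse)
      moreover have "exp 1 * n / k * (exp 1 * q0 / k) * (y ^ 2 * Y) = exp 1 ^ 2 * (real n / q0) * (real (k + l) / k) ^ 2 * Y" for Y
        using q k1 by (simp add: y_def power2_eq_square divide_simps)
      ultimately have "exp 1 * n / k * (exp 1 * q0 / k) * y ^ d = exp 1 ^ 2 * (real n / q0) * (real (k + l) / k) ^ 2 * y ^ (d - 2)"
        by simp
      also have "\<dots> \<le> exp 1 ^ 2 * 1 * 2 ^ 2 * ((real n + real l) / real q0) ^ (d - 2)"
      proof (intro mult_mono power_mono mult_nonneg_nonneg zero_le_power)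
        show "real n / real q0 \<le> 1" using n q by simp
        show "real (k + l) / real k \<le> 2" using False k1 by (simp add: field_simps)
        show "y \<le> (real n + real l) / real q0" using k q unfolding y_def by (intro divide_right_mono) auto
      qed (use y0 in auto)
      also have "\<dots> \<le> r1 + r2" using r2 nn by simp
      finally show "exp 1 * n / k * (exp 1 * q0 / k) * y ^ d \<le> r1 + r2" .
      show "0 \<le> exp 1 * n / k * (exp 1 * q0 / k) * y ^ d" using y0 by simp
    qed
    finally show ?thesis unfolding y_def .
  qed
  have "(\<Sum>k=1..n. real (n choose k) * real (q0 choose k) * (real (k + l) / real q0) ^ (k * d)) \<le> (\<Sum>k=1..n. (r1 + r2) ^ k)"
    by (rule sum_mono) (rule tm)
  also have "\<dots> \<le> 2 * (r1 + r2)" by (rule sum_power_le) (use nn r in auto)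
  finally show ?thesis .
qed

text \<open>The number of trees is tamed by \<open>s ^ (s - 1) \<le> exp s * fact (s - 1)\<close>:
  together with the binomial it is at most \<open>n ^ (s - 1) * exp s\<close>, which leaves a
  geometric sum of ratio \<open>exp 1 * B * G\<close>.\<close>

lemma growth_sum_le:
  fixes p1 G B :: real
  assumes p1: "0 \<le> p1" "p1 \<le> 1" and B: "n * p1 \<le> B" and G: "(1 - p1 / 2) ^ (n div 2) \<le> G" and r: "exp 1 * B * G \<le> 1 / 2" "B \<ge> 0"
  shows "(\<Sum>s=1..<K. real (n choose (s - 1)) * real s ^ (s - 1) * p1 ^ (s - 1) * (1 - p1 / 2) ^ (s * (n div 2))) \<le> 2 * exp 1 * G"
proof -
  have G0: "G \<ge> 0" by (rule order.trans[OF _ G]) (use p1 in simp)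
  have tm: "real (n choose (s - 1)) * real s ^ (s - 1) * p1 ^ (s - 1) * (1 - p1 / 2) ^ (s * (n div 2)) \<le> exp 1 * G * (exp 1 * B * G) ^ (s - 1)"
    if s: "s \<ge> 1" for s
  proof -
    have f: "fact s = real s * fact (s - 1)" using s by (simp add: fact_reduce)
    have "real s ^ s = real s * real s ^ (s - 1)" using s by (simp add: power_eq_if)
    then have "real s ^ (s - 1) \<le> exp (real s) * fact (s - 1)" using power_self_le_exp_fact[of s] s unfolding f by simp
    then have "real (n choose (s - 1)) * real s ^ (s - 1) \<le> real (n choose (s - 1)) * (exp (real s) * fact (s - 1))" by (rule mult_left_mono) simp
    also have "\<dots> = (real (n choose (s - 1)) * fact (s - 1)) * exp (real s)" by simp
    also have "\<dots> \<le> real n ^ (s - 1) * exp (real s)"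
      using binomial_fact_pow[of n "s - 1"] by (intro mult_right_mono) (metis of_nat_fact of_nat_le_iff of_nat_mult of_nat_power, simp)
    finally have 1: "real (n choose (s - 1)) * real s ^ (s - 1) \<le> real n ^ (s - 1) * exp (real s)" .
    have 2: "(1 - p1 / 2) ^ (s * (n div 2)) \<le> G ^ s"
      unfolding mult.commute[of s] power_mult by (rule power_mono[OF G]) (use p1 in simp)
    have "real (n choose (s - 1)) * real s ^ (s - 1) * p1 ^ (s - 1) * (1 - p1 / 2) ^ (s * (n div 2))
      \<le> real n ^ (s - 1) * exp (real s) * p1 ^ (s - 1) * G ^ s"
      by (intro mult_mono[OF mult_right_mono[OF 1] 2]) (use p1 in auto)
    also have "\<dots> = (n * p1) ^ (s - 1) * (exp (real s) * G ^ s)" by (simp add: power_mult_distrib)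
    also have "\<dots> \<le> B ^ (s - 1) * (exp (real s) * G ^ s)" using B p1 G0 by (intro mult_right_mono power_mono) auto
    also have "\<dots> = exp 1 * G * (exp 1 * B * G) ^ (s - 1)"
    proof -
      have e: "exp (real s) = exp 1 * exp 1 ^ (s - 1)" using s by (simp add: exp_of_nat_mult[symmetric] exp_add[symmetric])
      have g: "G ^ s = G * G ^ (s - 1)" using s by (simp add: power_eq_if)
      show ?thesis unfolding e g by (simp add: power_mult_distrib)
    qed
    finally show ?thesis .
  qed
  have "(\<Sum>s=1..<K. real (n choose (s - 1)) * real s ^ (s - 1) * p1 ^ (s - 1) * (1 - p1 / 2) ^ (s * (n div 2)))
     \<le> (\<Sum>s=1..<K. exp 1 * G * (exp 1 * B * G) ^ (s - 1))"
    by (rule sum_mono) (use tm in simp)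
  also have "\<dots> = exp 1 * G * (\<Sum>s<K - 1. (exp 1 * B * G) ^ s)"
    unfolding sum_distrib_left by (rule sum.reindex_bij_witness[of _ Suc "\<lambda>k. k - 1"]) auto
  also have "\<dots> \<le> exp 1 * G * 2"
  proof (rule mult_left_mono)
    have "(\<Sum>s<K - 1. (exp 1 * B * G) ^ s) \<le> (\<Sum>s. (exp 1 * B * G) ^ s)"
      by (rule sum_le_suminf) (use r G0 in \<open>auto intro!: summable_geometric\<close>)
    also have "\<dots> = 1 / (1 - exp 1 * B * G)" using r G0 by (intro suminf_geometric) auto
    also have "\<dots> \<le> 2" using r by (simp add: field_simps)
    finally show "(\<Sum>s<K - 1. (exp 1 * B * G) ^ s) \<le> 2" .
  qed (use G0 in simp)
  finally show ?thesis by simp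
qed

text \<open>Markov's inequality for the two counts and a union bound for the cap. The in-degree
  deviations come from \<open>chernoff_card\<close> with base below 1 for low and above 1 for high
  degrees.\<close>

lemma (in layers) prob_bare:
  assumes p0: "0 \<le> p0" "p0 \<le> 1" and \<theta>: "0 < \<theta>1" "\<theta>1 \<le> 1" "1 \<le> \<theta>2" and x: "0 < x" "0 < l"
  shows "measure_pmf.prob (Pi_pmf A False (\<lambda>_. bernoulli_pmf p0))
      {b. real x \<le> card (bare b) \<or> (real l \<le> card {v\<in>V. card {a\<in>col_arcs V v. b a} < d} \<or> (\<exists>v\<in>V. dm < card {a\<in>col_arcs V v. b a}))}
    \<le> card V * (1 - p0) ^ (card V - 1) / x + (card V * (exp (p0 * (\<theta>1 - 1) * real (card V - 1)) / \<theta>1 ^ d) / l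
      + card V * (exp (p0 * (\<theta>2 - 1) * real (card V - 1)) / \<theta>2 ^ dm))"
proof -
  let ?M = "Pi_pmf A False (\<lambda>_. bernoulli_pmf p0)"
  have CA: "col_arcs V v \<subseteq> A" if "v \<in> V" for v using that by (auto simp: col_arcs_Un)
  have Tset: "{y. y} = {True}" and Fset: "{y. \<not> y} = {False}" by auto
  have T: "measure_pmf.prob (bernoulli_pmf p0) {y. y} = p0" using p0 measure_pmf_single[of "bernoulli_pmf p0" True]
    by (simp add: Tset)
  have F: "measure_pmf.prob (bernoulli_pmf p0) {y. \<not> y} = 1 - p0" using p0 measure_pmf_single[of "bernoulli_pmf p0" False]
    by (simp add: Fset)
  have 1: "measure_pmf.prob ?M {b. real x \<le> card (bare b)} \<le> card V * (1 - p0) ^ (card V - 1) / x"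
  proof -
    have "bare b = {v\<in>V. \<forall>a\<in>col_arcs V v. \<not> b a}" for b by (auto simp: bare_def col_arcs_def)
    then have "measure_pmf.prob ?M {b. real x \<le> card (bare b)} = measure_pmf.prob ?M {b. real x \<le> card {v\<in>V. \<forall>a\<in>col_arcs V v. \<not> b a}}"
      by (simp only:)
    also have "\<dots> \<le> (\<Sum>v\<in>V. measure_pmf.prob ?M {b. \<forall>a\<in>col_arcs V v. \<not> b a}) / x"
      by (rule prob_card_markov[OF finV]) (use x in simp)
    also have "\<dots> = (\<Sum>v\<in>V. (1 - p0) ^ (card V - 1)) / x"
    proof (rule arg_cong[where f = "\<lambda>y. y / real x"], rule sum.cong[OF refl])
      fix v assume v: "v \<in> V"
      show "measure_pmf.prob ?M {b. \<forall>a\<in>col_arcs V v. \<not> b a} = (1 - p0) ^ (card V - 1)"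
        using prob_Pi_pmf_all[OF finA CA[OF v], of False "\<lambda>_. bernoulli_pmf p0" "\<lambda>_ y. \<not> y"] card_col_arcs[OF finV v]
        by (simp only: F prod_constant)
    qed
    finally show ?thesis by simp
  qed
  have 2: "measure_pmf.prob ?M {b. real l \<le> card {v\<in>V. card {a\<in>col_arcs V v. b a} < d}}
    \<le> card V * (exp (p0 * (\<theta>1 - 1) * real (card V - 1)) / \<theta>1 ^ d) / l"
  proof -
    have "measure_pmf.prob ?M {b. card {a\<in>col_arcs V v. b a} < d} \<le> exp (p0 * (\<theta>1 - 1) * real (card V - 1)) / \<theta>1 ^ d" if v: "v \<in> V" for v
    proof -
      have "measure_pmf.prob ?M {b. card {a\<in>col_arcs V v. b a} < d} \<le> exp (measure_pmf.prob (bernoulli_pmf p0) {y. y} * (\<theta>1 - 1) * card (col_arcs V v)) / \<theta>1 ^ d"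
        by (rule chernoff_card[OF finA CA[OF v], where R = "\<lambda>y. y" and P = "\<lambda>k. k < d"]) (use \<theta> in \<open>auto intro: power_decreasing\<close>)
      then show ?thesis by (simp only: T card_col_arcs[OF finV v])
    qed
    then have s: "(\<Sum>v\<in>V. measure_pmf.prob ?M {b. card {a\<in>col_arcs V v. b a} < d}) \<le> card V * (exp (p0 * (\<theta>1 - 1) * real (card V - 1)) / \<theta>1 ^ d)"
      by (rule sum_bounded_above)
    show ?thesis
      by (rule order.trans[OF prob_card_markov[OF finV] divide_right_mono[OF s]]) (use x in simp_all)
  qed
  have 3: "measure_pmf.prob ?M {b. \<exists>v\<in>V. dm < card {a\<in>col_arcs V v. b a}}
    \<le> card V * (exp (p0 * (\<theta>2 - 1) * real (card V - 1)) / \<theta>2 ^ dm)"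
  proof -
    have "measure_pmf.prob ?M {b. dm < card {a\<in>col_arcs V v. b a}} \<le> exp (p0 * (\<theta>2 - 1) * real (card V - 1)) / \<theta>2 ^ dm" if v: "v \<in> V" for v
    proof -
      have "measure_pmf.prob ?M {b. dm < card {a\<in>col_arcs V v. b a}} \<le> exp (measure_pmf.prob (bernoulli_pmf p0) {y. y} * (\<theta>2 - 1) * card (col_arcs V v)) / \<theta>2 ^ dm"
        by (rule chernoff_card[OF finA CA[OF v], where R = "\<lambda>y. y" and P = "\<lambda>k. dm < k"]) (use \<theta> in \<open>auto intro: power_increasing\<close>)
      then show ?thesis by (simp only: T card_col_arcs[OF finV v])
    qed
    then have s: "(\<Sum>v\<in>V. measure_pmf.prob ?M {b. dm < card {a\<in>col_arcs V v. b a}}) \<le> card V * (exp (p0 * (\<theta>2 - 1) * real (card V - 1)) / \<theta>2 ^ dm)"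
      by (rule sum_bounded_above)
    show ?thesis by (rule order.trans[OF prob_union_le[OF finV] s])
  qed
  show ?thesis
    by (rule order.trans[OF prob_disj_le add_mono[OF 1 order.trans[OF prob_disj_le add_mono[OF 2 3]]]])
qed

lemma (in layers_inv) prob_not_typical_b:
  assumes p0: "0 \<le> p0" "p0 \<le> 1" and \<theta>: "0 < \<theta>1" "\<theta>1 \<le> 1" "1 \<le> \<theta>2"
  shows "measure_pmf.prob (Pi_pmf A False (\<lambda>_. bernoulli_pmf p0)) {b. \<not> typical_b x l d dm b}
    \<le> card V * (1 - p0) ^ (card V - 1) / real (x + 1) + (card V * (exp (p0 * (\<theta>1 - 1) * real (card V - 1)) / \<theta>1 ^ d) / real (l + 1)
      + card V * (exp (p0 * (\<theta>2 - 1) * real (card V - 1)) / \<theta>2 ^ dm))"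
proof -
  have "measure_pmf.prob (Pi_pmf A False (\<lambda>_. bernoulli_pmf p0)) {b. \<not> typical_b x l d dm b} \<le> measure_pmf.prob (Pi_pmf A False (\<lambda>_. bernoulli_pmf p0))
      {b. real (x + 1) \<le> card (bare b) \<or> (real (l + 1) \<le> card {v\<in>V. card {a\<in>col_arcs V v. b a} < d} \<or> (\<exists>v\<in>V. dm < card {a\<in>col_arcs V v. b a}))}"
  proof (rule prob_mono)
    fix b assume nt: "\<not> typical_b x l d dm b"
    have "card {v\<in>V - bare b. card {a\<in>col_arcs V v. b a} < d} \<le> card {v\<in>V. card {a\<in>col_arcs V v. b a} < d}"
      by (rule card_mono) (use finV in auto)
    then show "real (x + 1) \<le> card (bare b) \<or> (real (l + 1) \<le> card {v\<in>V. card {a\<in>col_arcs V v. b a} < d} \<or> (\<exists>v\<in>V. dm < card {a\<in>col_arcs V v. b a}))"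
      using nt unfolding typical_b_def of_nat_le_iff by (auto simp: not_le)
  qed
  from order.trans[OF this prob_bare[OF p0 \<theta>, of "x + 1" "l + 1" d dm]] show ?thesis by simp
qed

lemma (in layers_inv) prob_rainbow_tree_gen:
  assumes \<zeta>: "do {x \<leftarrow> opt_pmf p1 U1; y \<leftarrow> \<xi>; return_pmf (merge_opt x y)} = \<zeta>"
      "do {x \<leftarrow> opt_pmf p0 Q0; y \<leftarrow> opt_pmf p2 U2; return_pmf (merge_opt x y)} = \<xi>"
    and p: "0 \<le> p0" "p0 \<le> 1" "0 \<le> p1" "p1 \<le> 1" "0 \<le> p2" "p2 \<le> 1"
    and fin: "finite Q0" "Q0 \<noteq> {}" "finite U1" "U1 \<noteq> {}" "finite U2" "U2 \<noteq> {}"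
    and c: "card U1 = u" "card U2 = u" "card Q0 = q0" and q0: "card V \<le> q0"
    and Kx: "2 * (K + x) \<le> u" "1 \<le> K" "2 * (K + x) \<le> card V" and lam: "lam \<ge> 1" "real (card V - 1) \<le> lam * real K"
  shows "measure_pmf.prob (Pi_pmf A None (\<lambda>_. \<zeta>)) {w. card (no_in_arc V w) \<le> 1}
    \<le> measure_pmf.prob (Pi_pmf A None (\<lambda>_. \<zeta>)) {w. rainbow_tree V w} + bad_bound (card V) q0 u p0 p1 p2 x l d dm K D z t lam"
proof -
  have gen: "gen = Pi_pmf A None (\<lambda>_. \<zeta>)" by (rule gen_eq[OF \<zeta>])
  have bad: "measure_pmf.prob gen {w. \<not> rainbow_tree V w \<and> card (no_in_arc V w) \<le> 1} \<le> bad_bound (card V) q0 u p0 p1 p2 x l d dm K D z t lam"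
  proof -
    have t: "measure_pmf.prob (Pi_pmf A False (\<lambda>_. bernoulli_pmf p0)) {b. \<not> typical_b x l d dm b}
      \<le> card V * (1 - p0) ^ (card V - 1) / real (x + 1) + (card V * (exp (p0 * (exp (- 2) - 1) * real (card V - 1)) / exp (- 2) ^ d) / real (l + 1)
      + card V * (exp (p0 * (exp 1 - 1) * real (card V - 1)) / exp 1 ^ dm))"
      by (rule prob_not_typical_b) (use p in auto)
    have "measure_pmf.prob gen {w. \<not> rainbow_tree V w \<and> card (no_in_arc V w) \<le> 1} \<le>
       measure_pmf.prob (Pi_pmf A False (\<lambda>_. bernoulli_pmf p0)) {b. \<not> typical_b x l d dm b} +
       (bad_bound (card V) q0 u p0 p1 p2 x l d dm K D z t lam - (card V * (1 - p0) ^ (card V - 1) / real (x + 1) + (card V * (exp (p0 * (exp (- 2) - 1) * real (card V - 1)) / exp (- 2) ^ d) / real (l + 1)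
      + card V * (exp (p0 * (exp 1 - 1) * real (card V - 1)) / exp 1 ^ dm))))"
      unfolding bad_bound_def add_diff_cancel_left'
      \<comment> \<open>With base \<open>exp 3\<close> an in-degree cap of at least log n costs a
        factor \<open>n ^ (- 3)\<close>, enough for the union bound over all vertices.\<close>
      by (rule prob_gen_bad[where \<theta> = "exp 3" and K = K and x = x and l = l and d = d and dm = dm and D = D and z = z and t = t and lam = lam, unfolded c])
        (use p fin q0 c Kx lam in auto)
    then show ?thesis using t by linarith
  qed
  have "measure_pmf.prob gen {w. card (no_in_arc V w) \<le> 1} \<le> measure_pmf.prob gen {w. rainbow_tree V w \<or> \<not> rainbow_tree V w \<and> card (no_in_arc V w) \<le> 1}"
    by (rule prob_mono) simp
  from order.trans[OF this order.trans[OF prob_disj_le add_left_mono[OF bad]]] show ?thesis unfolding gen .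
qed

text \<open>The densities are forced by the superposition: each colour must have total weight
  \<open>p / (q0 + 2 * u)\<close>, and a layer shows only where the earlier ones are absent. Hence
  \<open>(1 - p1) * (1 - p0) * p2 = p1\<close>, the common share of the two small layers.\<close>

lemma prob_rainbow_tree_ge:
  fixes V :: "'a set" and p p0 p1 p2 :: real and q0 u :: nat
  defines "p1 \<equiv> p * real u / (real q0 + 2 * real u)"
  defines "p0 \<equiv> p * real q0 / ((real q0 + 2 * real u) * (1 - p1))"
  defines "p2 \<equiv> p1 / ((1 - p1) * (1 - p0))"
  assumes V: "finite V" "card V \<ge> 2" and p: "0 \<le> p" "p < 1" and u: "1 \<le> u" "card V \<le> q0"
    and Kx: "2 * (K + x) \<le> u" "1 \<le> K" "2 * (K + x) \<le> card V" and lam: "lam \<ge> 1" "real (card V - 1) \<le> lam * real K"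
  shows "measure_pmf.prob (Pi_pmf (all_arcs V) None (\<lambda>_. opt_pmf p {1..q0 + 2 * u})) {w. card (no_in_arc V w) \<le> 1}
    \<le> measure_pmf.prob (Pi_pmf (all_arcs V) None (\<lambda>_. opt_pmf p {1..q0 + 2 * u})) {w. rainbow_tree V w}
      + bad_bound (card V) q0 u p0 p1 p2 x l d dm K D z t lam"
proof -
  let ?q = "real q0 + 2 * real u"
  have q0: "q0 > 0" using u V by simp
  have q: "?q > 0" using q0 by simp
  \<comment> \<open>\<open>p'\<close> is the joint density of the \<open>Q0\<close>- and
    \<open>U2\<close>-layers where the \<open>U1\<close>-layer has no arc.\<close>
  define p' where "p' = p * (q0 + u) / (?q * (1 - p1))"
  have p1: "0 \<le> p1" "p1 \<le> p" "p1 < 1"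
  proof -
    show "0 \<le> p1" using p q by (simp add: p1_def)
    have "p * u \<le> p * ?q" using p by (intro mult_left_mono) auto
    then show "p1 \<le> p" using q unfolding p1_def by (simp add: field_simps)
    then show "p1 < 1" using p by simp
  qed
  have p': "0 \<le> p'" "p' \<le> 1"
  proof -
    show "0 \<le> p'" using p p1 q by (auto simp: p'_def)
    have "p * (q0 + u) = p * ?q - p1 * ?q" using q by (simp add: p1_def field_simps)
    also have "\<dots> \<le> 1 * ?q - p1 * ?q" using p q by (intro diff_mono mult_right_mono) auto
    also have "\<dots> = ?q * (1 - p1)" by (simp add: algebra_simps)
    finally show "p' \<le> 1" using p1 q unfolding p'_def by simp
  qed
  have p0': "p0 = p' * q0 / (real q0 + real u)" using q0 p1 q by (simp add: p0_def p'_def)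
  have p0: "0 \<le> p0" "p0 < 1"
  proof -
    show "0 \<le> p0" using p' by (simp add: p0')
    have "p' * q0 \<le> 1 * real q0" using p' by (intro mult_right_mono) auto
    then have "p' * q0 < real q0 + real u" using u by linarith
    then show "p0 < 1" using q0 by (simp add: p0')
  qed
  have p2': "(1 - p0) * p2 = p' * u / (real q0 + real u)"
    using p0 p1 q0 q by (simp add: p2_def p'_def p1_def)
  have p2: "0 \<le> p2" "p2 \<le> 1"
  proof -
    show "0 \<le> p2" using p1 p0 by (simp add: p2_def)
    have e: "p' * u / (real q0 + real u) + p0 = p'" using q0 by (simp add: p0' add_divide_distrib[symmetric] distrib_left[symmetric] add.commute)
    then have "p' * u / (real q0 + real u) = p' - p0" by simp
    then have "(1 - p0) * p2 \<le> (1 - p0) * 1" using p' p2' by simp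
    then show "p2 \<le> 1" using p0 by (simp add: mult_le_cancel_left)
  qed
  let ?Q0 = "{1..q0}" and ?U1 = "{q0 + 1..q0 + u}" and ?U2 = "{q0 + u + 1..q0 + 2 * u}"
  have un: "?U1 \<union> (?Q0 \<union> ?U2) = {1..q0 + 2 * u}" by auto
  have "\<forall>v. \<exists>\<rho>. (\<forall>s\<in>V - {v}. \<forall>u\<in>V - {v}. \<rho> s u \<in> V - {v} \<and> \<rho> s (\<rho> s u) = u) \<and> (\<forall>u\<in>V - {v}. \<forall>w\<in>V - {v}. \<exists>!s. s \<in> V - {v} \<and> \<rho> s u = w)"
    by (intro allI ex_transitive_involutions) (use V in simp)
  from choice[OF this] obtain \<rho> where \<rho>': "\<forall>v. (\<forall>s\<in>V - {v}. \<forall>u\<in>V - {v}. \<rho> v s u \<in> V - {v} \<and> \<rho> v s (\<rho> v s u) = u) \<and> (\<forall>u\<in>V - {v}. \<forall>w\<in>V - {v}. \<exists>!s. s \<in> V - {v} \<and> \<rho> v s u = w)"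
    by (elim exE)
  have \<rho>: "\<rho> v s u \<in> V - {v} \<and> \<rho> v s (\<rho> v s u) = u" if "s \<in> V - {v}" "u \<in> V - {v}" for v s u
    by (rule bspec[OF bspec[OF conjunct1[OF spec[OF \<rho>']] that(1)] that(2)])
  have \<rho>2: "\<exists>!s. s \<in> V - {v} \<and> \<rho> v s u = w" if "u \<in> V - {v}" "w \<in> V - {v}" for v u w
    by (rule bspec[OF bspec[OF conjunct2[OF spec[OF \<rho>']] that(1)] that(2)])
  have ax: "layers_inv V ?Q0 ?U1 ?U2 \<rho>"
  proof (intro layers_inv.intro layers.intro layers_inv_axioms.intro)
    show "finite V" "2 \<le> card V" by (rule V)+
    show "bij_betw (\<rho> v s) (V - {v}) (V - {v})" if "s \<in> V - {v}" for v s
      by (rule bij_betwI[where g = "\<rho> v s"]) (use \<rho>[OF that] in auto)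
    show "\<rho> v s u \<in> V - {v} \<and> \<rho> v s (\<rho> v s u) = u" if "s \<in> V - {v}" "u \<in> V - {v}" for v s u by (rule \<rho>[OF that])
    show "\<exists>!s. s \<in> V - {v} \<and> \<rho> v s u = w" if "u \<in> V - {v}" "w \<in> V - {v}" for v u w by (rule \<rho>2[OF that])
    show "?Q0 \<inter> ?U1 = {}" by auto
    show "?Q0 \<inter> ?U2 = {}" by auto
    show "?U1 \<inter> ?U2 = {}" by auto
  qed
  have m2: "(do {x \<leftarrow> opt_pmf p0 ?Q0; y \<leftarrow> opt_pmf p2 ?U2; return_pmf (merge_opt x y)}) = opt_pmf p' (?Q0 \<union> ?U2)"
  proof (rule opt_pmf_merge)
    have c: "card (?Q0 \<union> ?U2) = q0 + u" by (subst card_Un_disjoint) auto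
    show "p0 = p' * card ?Q0 / card (?Q0 \<union> ?U2)" using p0' unfolding c by simp
    show "(1 - p0) * p2 = p' * card ?U2 / card (?Q0 \<union> ?U2)" using p2' unfolding c by simp
  qed (use p' p0 p2 u q0 in auto)
  have m1: "(do {x \<leftarrow> opt_pmf p1 ?U1; y \<leftarrow> opt_pmf p' (?Q0 \<union> ?U2); return_pmf (merge_opt x y)}) = opt_pmf p (?U1 \<union> (?Q0 \<union> ?U2))"
  proof (rule opt_pmf_merge)
    have c: "card (?Q0 \<union> ?U2) = q0 + u" by (subst card_Un_disjoint) auto
    show "p1 = p * card ?U1 / card (?U1 \<union> (?Q0 \<union> ?U2))" unfolding un by (simp add: p1_def)
    show "(1 - p1) * p' = p * card (?Q0 \<union> ?U2) / card (?U1 \<union> (?Q0 \<union> ?U2))" unfolding un c using p1 by (simp add: p'_def)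
  qed (use p p' p1 u q0 in auto)
  show ?thesis
    by (rule layers_inv.prob_rainbow_tree_gen[OF ax m1[unfolded un] m2]) (use p0 p1 p2 u q0 Kx lam in auto)
qed

text \<open>The summands of \<open>bad_bound\<close>, one by one, after inserting the estimates of
  the parameters: \<open>N\<close> stands for n, \<open>L\<close> for log n, \<open>M\<close> for
  log log n, \<open>B\<close> for the scale of \<open>l\<close>, and \<open>2 * r\<close> bounds the
  sum from Hall's condition.\<close>

definition error_bound :: "real \<Rightarrow> real \<Rightarrow> real \<Rightarrow> real \<Rightarrow> real \<Rightarrow> real" where
  "error_bound N L M B r =
    (N * exp (- (L - 21 * M)) / L ^ 30 + (N * (exp (- (4 / 5 * (L - 21 * M))) * exp (2 * (L / 50 + 1))) / B
      + N * (exp (6 * L) / exp (N / 8 - 1)))) +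
    ((2 * B)\<^sup>2 / N + 2 * r +
    ((2 * L ^ 30 * (12 * M))\<^sup>2 * L / N + (2 * L ^ 30)\<^sup>2 * (12 * M) / N +
    ((2 * L ^ 30 * (12 * M))\<^sup>2 * L / N + (2 * L ^ 30)\<^sup>2 * (12 * M) / N +
    (2 * exp 1 * exp (- (9 / 4 * M)) + N * (exp (26 * (12 * M)) / exp (3 * L)) +
    (2 * (L * (3 * L + 1)) / L ^ 3
      + (2 * (L * (3 * L + 1 + 2 * L ^ 30)) / (N / 8) + 2 * L ^ 30 * (2 * (L * (3 * L + 1 + 2 * L ^ 30))) / N) +
    (2 * L ^ 3 * exp (- (6.3 * M)) + (2 * L ^ 3 * (12 * M))\<^sup>2 * L / N + 2 * L ^ 3 * (12 * M) * (2 * L ^ 30) * L / N))))))"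

lemma bad_bound_le:
  fixes L M p0 p1 p2 r1 r2 :: real and n q0 u x l d dm K D z t :: nat
  defines "N \<equiv> real n"
  assumes n: "n \<ge> 2" and LM: "1 \<le> L" "0 \<le> M"
    and u: "N / L \<le> real u" and q0: "n \<le> q0" "q0 \<le> 2 * n"
    and p0: "0 \<le> p0" "p0 \<le> 1" "L - 21 * M \<le> p0 * real (n - 1)" "p0 * real (n - 1) \<le> 3 * L" "0 \<le> L - 21 * M"
    and p1: "0 \<le> p1" "p1 \<le> 1" "9 * M \<le> p1 * real (n - 1)" "p1 * N \<le> 12 * M"
    and p2: "p1 \<le> p2" "p2 \<le> 1" "p2 * N \<le> 12 * M"
    and x: "L ^ 30 \<le> real x" "real x \<le> 2 * L ^ 30" and l: "B \<le> real l" "real l \<le> 2 * B" "B > 0"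
    and d: "d \<ge> 2" "real d \<le> L / 50 + 1" and D: "L \<le> real D" "real D \<le> 2 * L"
    and z: "L ^ 3 \<le> real z" "real z \<le> 2 * L ^ 3" and dm: "N / 8 - 1 \<le> real dm" "N / 8 - 1 \<le> real t"
    and exp: "real (x + t + 1 + D + dm) \<le> 0.3 * N"
    and r1: "2 * N ^ 2 * (2 * real l / real q0) ^ d \<le> r1"
    and r2: "4 * exp 1 ^ 2 * ((N + real l) / real q0) ^ (d - 2) \<le> r2"
    and r: "r1 + r2 \<le> 1 / 2" and G: "exp 1 * (12 * M) * exp (- (9 / 4 * M)) \<le> 1 / 2"
  shows "bad_bound n q0 u p0 p1 p2 x l d dm K D z t L \<le> error_bound N L M B (r1 + r2)"
proof -
  have N: "N \<ge> 2" "N > 0" using n by (auto simp: N_def)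
  have n1: "real (n - 1) = N - 1" "real (n - 1) > 0" using n by (auto simp: N_def)
  have L0: "L > 0" using LM by simp
  have p2n: "0 \<le> p2" using p1 p2 by simp
  have q: "real q0 \<ge> N" "real q0 > 0" using q0 N by (auto simp: N_def)
  have e3: "exp (3::real) \<le> 27"
  proof -
    have "exp (3::real) = exp 1 ^ 3" by (simp add: exp_of_nat_mult[symmetric])
    also have "\<dots> \<le> 3 ^ 3" using exp_le by (intro power_mono) auto
    finally show ?thesis by simp
  qed
  \<comment> \<open>Gives the rate \<open>1 - exp (- 2) \<ge> 4 / 5\<close> of the lower tail of
    in-degrees. The price is \<open>exp (2 * d)\<close>, which is cheap for \<open>d\<close> near
    \<open>L / 50\<close>.\<close>
  have e2: "exp (- 2::real) \<le> 1 / 5"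
    using exp_lower_Taylor_quadratic[of "2::real"] by (simp add: exp_minus field_simps)
  have u': "1 / real u \<le> L / N" "real u > 0"
  proof -
    have "0 < N / L" using N L0 by simp
    then show "real u > 0" using u by linarith
    then show "1 / real u \<le> L / N" using u N L0 by (simp add: field_simps)
  qed
  have N1: "N / real (n - 1) \<le> 2" using n1 N by (simp add: field_simps)
  have T1: "N * (1 - p0) ^ (n - 1) / real (x + 1) \<le> N * exp (- (L - 21 * M)) / L ^ 30"
  proof (intro frac_le mult_left_mono)
    have "(1 - p0) ^ (n - 1) \<le> exp (- (p0 * real (n - 1)))" by (rule one_minus_power_le_exp[OF p0(2)])
    also have "\<dots> \<le> exp (- (L - 21 * M))" using p0(3) by simp
    finally show "(1 - p0) ^ (n - 1) \<le> exp (- (L - 21 * M))" .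
  qed (use N L0 x in auto)
  have T2: "N * (exp (p0 * (exp (- 2) - 1) * real (n - 1)) / exp (- 2) ^ d) / real (l + 1)
    \<le> N * (exp (- (4 / 5 * (L - 21 * M))) * exp (2 * (L / 50 + 1))) / B"
  proof (intro frac_le mult_left_mono)
    have "p0 * (exp (- 2) - 1) * real (n - 1) = - ((1 - exp (- 2)) * (p0 * real (n - 1)))" by (simp add: algebra_simps)
    also have "\<dots> \<le> - (4 / 5 * (L - 21 * M))"
      using e2 p0 by (simp only: neg_le_iff_le) (intro mult_mono, auto)
    finally have a: "exp (p0 * (exp (- 2) - 1) * real (n - 1)) \<le> exp (- (4 / 5 * (L - 21 * M)))" by simp
    have "1 / exp (- 2 :: real) ^ d = exp (2 * real d)" by (simp add: exp_of_nat_mult[symmetric] exp_minus field_simps)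
    also have "\<dots> \<le> exp (2 * (L / 50 + 1))" using d by simp
    finally have b: "1 / exp (- 2 :: real) ^ d \<le> exp (2 * (L / 50 + 1))" .
    have "exp (p0 * (exp (- 2) - 1) * real (n - 1)) * (1 / exp (- 2) ^ d) \<le> exp (- (4 / 5 * (L - 21 * M))) * exp (2 * (L / 50 + 1))"
      using a b by (intro mult_mono) auto
    then show "exp (p0 * (exp (- 2) - 1) * real (n - 1)) / exp (- 2) ^ d \<le> exp (- (4 / 5 * (L - 21 * M))) * exp (2 * (L / 50 + 1))" by simp
  qed (use N l in auto)
  have T3: "N * (exp (p0 * (exp 1 - 1) * real (n - 1)) / exp 1 ^ dm) \<le> N * (exp (6 * L) / exp (N / 8 - 1))"
  proof (intro frac_le mult_left_mono)
    have "p0 * (exp 1 - 1) * real (n - 1) = (exp 1 - 1) * (p0 * real (n - 1))" by simp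
    also have "\<dots> \<le> 2 * (3 * L)" by (rule mult_mono[OF _ p0(4)]) (use exp_le p0 in auto)
    finally show "exp (p0 * (exp 1 - 1) * real (n - 1)) \<le> exp (6 * L)" by simp
    have "exp (1::real) ^ dm = exp (real dm)" by (simp add: exp_of_nat_mult[symmetric])
    then show "exp (N / 8 - 1) \<le> exp (1::real) ^ dm" using dm by simp
  qed (use N in auto)
  have T4: "(real l)\<^sup>2 / real q0 \<le> (2 * B)\<^sup>2 / N" using l q N by (intro frac_le power_mono) auto
  have T5: "(\<Sum>k=1..n. real (n choose k) * real (q0 choose k) * (real (k + l) / real q0) ^ (k * d)) \<le> 2 * (r1 + r2)"
    by (rule hall_sum_le[OF _ q0 d(1) r1[unfolded N_def] r2[unfolded N_def] r]) (use n in simp)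
  have X: "(real x * N * p)\<^sup>2 / real u \<le> (2 * L ^ 30 * (12 * M))\<^sup>2 * L / N" "(real x)\<^sup>2 * p \<le> (2 * L ^ 30)\<^sup>2 * (12 * M) / N"
    if p: "0 \<le> p" "p * N \<le> 12 * M" for p
  proof -
    have "(real x * N * p)\<^sup>2 \<le> (2 * L ^ 30 * (12 * M))\<^sup>2"
    proof (rule power_mono)
      have "real x * (p * N) \<le> 2 * L ^ 30 * (12 * M)" by (rule mult_mono[OF x(2) p(2)]) (use p N L0 in auto)
      then show "real x * N * p \<le> 2 * L ^ 30 * (12 * M)" by (simp add: mult_ac)
    qed (use p N in auto)
    then have "(real x * N * p)\<^sup>2 * (1 / real u) \<le> (2 * L ^ 30 * (12 * M))\<^sup>2 * (L / N)"
      using u' by (intro mult_mono) auto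
    then show "(real x * N * p)\<^sup>2 / real u \<le> (2 * L ^ 30 * (12 * M))\<^sup>2 * L / N" by simp
    have "p \<le> 12 * M / N" using p N by (simp add: field_simps)
    then have "(real x)\<^sup>2 * p \<le> (2 * L ^ 30)\<^sup>2 * (12 * M / N)" using x p by (intro mult_mono power_mono) auto
    then show "(real x)\<^sup>2 * p \<le> (2 * L ^ 30)\<^sup>2 * (12 * M) / N" by simp
  qed
  note X1 = X[OF p1(1,4)] and X2 = X[OF p2n p2(3)]
  have T8: "(\<Sum>s=1..<K. real (n choose (s - 1)) * real s ^ (s - 1) * p1 ^ (s - 1) * (1 - p1 / 2) ^ (s * (n div 2))) \<le> 2 * exp 1 * exp (- (9 / 4 * M))"
  proof (rule growth_sum_le[OF p1(1,2) _ _ G])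
    show "real n * p1 \<le> 12 * M" using p1(4) by (simp add: N_def mult.commute)
    \<comment> \<open>Half of the colours and half of the vertices reduce the in-degree
      \<open>9 * M\<close> by a factor 4.\<close>
    have "(1 - p1 / 2) ^ (n div 2) \<le> exp (- (p1 / 2 * real (n div 2)))" by (rule one_minus_power_le_exp) (use p1 in simp)
    also have "\<dots> \<le> exp (- (9 / 4 * M))"
    proof -
      have "n - 1 \<le> 2 * (n div 2)" by presburger
      then have "real (n - 1) \<le> 2 * real (n div 2)" by linarith
      then have "p1 * real (n - 1) \<le> p1 * (2 * real (n div 2))" using p1 by (intro mult_left_mono) auto
      then have "9 / 4 * M \<le> p1 / 2 * real (n div 2)" using p1(3) by simp
      then show ?thesis by simp
    qed
    finally show "(1 - p1 / 2) ^ (n div 2) \<le> exp (- (9 / 4 * M))" .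
  qed (use LM in simp)
  have T9: "N * (exp (p1 * (exp 3 - 1) * N) / exp 3 ^ D) \<le> N * (exp (26 * (12 * M)) / exp (3 * L))"
  proof (intro frac_le mult_left_mono)
    have "p1 * (exp 3 - 1) * N = (exp 3 - 1) * (p1 * N)" by simp
    also have "\<dots> \<le> 26 * (12 * M)" by (rule mult_mono[OF _ p1(4)]) (use e3 p1 N in auto)
    finally show "exp (p1 * (exp 3 - 1) * N) \<le> exp (26 * (12 * M))" by simp
    have "exp (3::real) ^ D = exp (3 * real D)" by (simp add: exp_of_nat_mult[symmetric] mult.commute)
    then show "exp (3 * L) \<le> exp (3::real) ^ D" using D by simp
  qed (use N in auto)
  have S: "N * (L * (real k + 1 + L) / real (n - 1)) \<le> 2 * (L * (R + 1 + L))" if "real k \<le> R" for k R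
  proof -
    have R: "0 \<le> R" by (rule order.trans[OF _ that]) simp
    have "N * (L * (real k + 1 + L) / real (n - 1)) = N / real (n - 1) * (L * (real k + 1 + L))" by simp
    also have "\<dots> \<le> 2 * (L * (R + 1 + L))" using that N1 L0 R by (intro mult_mono mult_left_mono) auto
    finally show ?thesis .
  qed
  have T10: "N * (L * (real D + 1 + L) / real (n - 1)) / real (z + 1) \<le> 2 * (L * (3 * L + 1)) / L ^ 3"
  proof (intro frac_le)
    show "N * (L * (real D + 1 + L) / real (n - 1)) \<le> 2 * (L * (3 * L + 1))" using S[OF D(2)] by simp
  qed (use z L0 in auto)
  have Sx: "N * (L * (real (D + x) + 1 + L) / real (n - 1)) \<le> 2 * (L * (3 * L + 1 + 2 * L ^ 30))"
    using S[of "D + x" "2 * L + 2 * L ^ 30"] D x by (simp add: algebra_simps)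
  have T11: "N * (L * (real (D + x) + 1 + L) / real (n - 1)) / real (t + 1) \<le> 2 * (L * (3 * L + 1 + 2 * L ^ 30)) / (N / 8)"
    using Sx by (intro frac_le) (use dm N L0 in auto)
  have T12: "x * (L * (real (D + x) + 1 + L) / real (n - 1)) \<le> 2 * L ^ 30 * (2 * (L * (3 * L + 1 + 2 * L ^ 30))) / N"
  proof -
    have "L * (real (D + x) + 1 + L) / real (n - 1) \<le> 2 * (L * (3 * L + 1 + 2 * L ^ 30)) / N"
      using Sx N by (simp add: pos_le_divide_eq mult.commute)
    then have "x * (L * (real (D + x) + 1 + L) / real (n - 1)) \<le> 2 * L ^ 30 * (2 * (L * (3 * L + 1 + 2 * L ^ 30)) / N)"
      using x L0 by (intro mult_mono) auto
    then show ?thesis by simp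
  qed
  have T13: "z * (1 - p2) ^ (n - (x + t + 1 + D + dm)) \<le> 2 * L ^ 3 * exp (- (6.3 * M))"
  proof (intro mult_mono)
    have "(1 - p2) ^ (n - (x + t + 1 + D + dm)) \<le> exp (- (p2 * real (n - (x + t + 1 + D + dm))))" by (rule one_minus_power_le_exp[OF p2(2)])
    also have "\<dots> \<le> exp (- (6.3 * M))"
    proof -
      \<comment> \<open>At least 0.7 n candidate tails remain, and 0.7 * 9 = 6.3.\<close>
      have "0.7 * N \<le> real (n - (x + t + 1 + D + dm))" using exp by (simp add: N_def)
      then have "p2 * (0.7 * N) \<le> p2 * real (n - (x + t + 1 + D + dm))" using p2n by (rule mult_left_mono)
      moreover have "p1 * real (n - 1) \<le> p2 * N" using p1 p2 n1 p2n by (intro mult_mono) auto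
      ultimately have "6.3 * M \<le> p2 * real (n - (x + t + 1 + D + dm))" using p1(3) by linarith
      then show ?thesis by simp
    qed
    finally show "(1 - p2) ^ (n - (x + t + 1 + D + dm)) \<le> exp (- (6.3 * M))" .
  qed (use z L0 p2 in auto)
  have zp: "real z * N * p2 \<le> 2 * L ^ 3 * (12 * M)"
  proof -
    have "real z * (p2 * N) \<le> 2 * L ^ 3 * (12 * M)" by (rule mult_mono[OF z(2) p2(3)]) (use p2n N L0 in auto)
    then show ?thesis by (simp add: mult_ac)
  qed
  have T14: "(real z * N * p2)\<^sup>2 / real u \<le> (2 * L ^ 3 * (12 * M))\<^sup>2 * L / N"
  proof -
    have "(real z * N * p2)\<^sup>2 * (1 / real u) \<le> (2 * L ^ 3 * (12 * M))\<^sup>2 * (L / N)"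
      by (rule mult_mono[OF power_mono[OF zp] u'(1)]) (use p2n N in auto)
    then show ?thesis by simp
  qed
  have T15: "real z * N * (p2 * x / u) \<le> 2 * L ^ 3 * (12 * M) * (2 * L ^ 30) * L / N"
  proof -
    have "real z * N * p2 * real x * (1 / real u) \<le> 2 * L ^ 3 * (12 * M) * (2 * L ^ 30) * (L / N)"
      by (rule mult_mono[OF mult_mono[OF zp x(2)] u'(1)]) (use p2n N L0 LM in auto)
    then show ?thesis by simp
  qed
  show ?thesis unfolding bad_bound_def error_bound_def N_def[symmetric]
    by (intro add_mono T1 T2 T3 T4 T5 X1 X2 T8 T9 T10 T11 T12 T13 T14 T15)
qed

text \<open>
  The parameters are \<open>x = L^30\<close>, \<open>l = n^(3/10)\<close>, \<open>d = L / 50\<close>, \<open>K = n / L\<close>, \<open>D = L\<close>, \<open>z = L^3\<close> and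
  \<open>t = dm = n / 8\<close>, where \<open>L = log n\<close> and \<open>M = log log n\<close>.
\<close>

lemma asymp_ineqs:
  fixes C :: real and L M e B :: "nat \<Rightarrow> real"
  defines "L \<equiv> \<lambda>n::nat. ln (real n)" and "M \<equiv> \<lambda>n::nat. ln (ln (real n))"
  defines "e \<equiv> \<lambda>n::nat. ln (ln (real n)) / ln (real n)" and "B \<equiv> \<lambda>n::nat. real n powr (3 / 10)"
  shows "eventually (\<lambda>n. L n \<ge> 300) sequentially"
    and "eventually (\<lambda>n. M n \<ge> 1) sequentially"
    and "eventually (\<lambda>n. n / L n \<le> 10 * e n * n - 1) sequentially"
    and "eventually (\<lambda>n. 1 \<le> e n * n) sequentially"
    and "eventually (\<lambda>n. (1 + 50 * e n) * n + 1 \<le> 2 * n) sequentially"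
    and "eventually (\<lambda>n. L n + C < real n - 1) sequentially"
    and "eventually (\<lambda>n. 0 < L n - C) sequentially"
    and "eventually (\<lambda>n. 9 * M n \<le> (L n - C) * ((10 * e n * n - 1) / ((1 + 50 * e n) * n + 1))) sequentially"
    and "eventually (\<lambda>n. (L n + C) * (10 * e n * n / ((1 + 50 * e n) * n - 1)) * (n / (real n - 1)) \<le> 11 * M n) sequentially"
    and "eventually (\<lambda>n. 11 * M n / ((1 - 11 * M n / n) * (1 - 3 * L n / (real n - 1))) \<le> 12 * M n) sequentially"
    and "eventually (\<lambda>n. 11 * M n / n < 1) sequentially"
    and "eventually (\<lambda>n. 3 * L n / (real n - 1) < 1) sequentially"
    and "eventually (\<lambda>n. L n - 21 * M n \<le> (L n - C) * (1 - 20 * e n * n / ((1 + 50 * e n) * n - 1))) sequentially"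
    and "eventually (\<lambda>n. 20 * e n * n / ((1 + 50 * e n) * n - 1) < 1) sequentially"
    and "eventually (\<lambda>n. (L n + C) / (1 - 11 * M n / n) \<le> 3 * L n) sequentially"
    and "eventually (\<lambda>n. 0 \<le> L n - 21 * M n) sequentially"
    and "eventually (\<lambda>n. 2 * (n / L n + 1 + 2 * L n ^ 30) \<le> 10 * e n * n - 1) sequentially"
    and "eventually (\<lambda>n. 2 * (n / L n + 1 + 2 * L n ^ 30) \<le> n) sequentially"
    and "eventually (\<lambda>n. 2 * L n ^ 30 + n / 8 + 1 + 2 * L n + n / 8 \<le> 0.3 * n) sequentially"
    and "eventually (\<lambda>n. 4 * B n / n \<le> 1) sequentially"
    and "eventually (\<lambda>n. 1 \<le> B n) sequentially"
    and "eventually (\<lambda>n. (n + 2 * B n) / ((1 + 29 * e n) * n) \<le> exp (- (26 * e n))) sequentially"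
    and "eventually (\<lambda>n. 2 * real n ^ 2 * (4 * B n / n) ^ 6 + 4 * exp 1 ^ 2 * exp (- (26 * e n * (L n / 50 - 2))) \<le> 1 / 2) sequentially"
    and "eventually (\<lambda>n. exp 1 * (12 * M n) * exp (- (9 / 4 * M n)) \<le> 1 / 2) sequentially"
  unfolding L_def M_def e_def B_def by real_asymp+

text \<open>The critical orders, up to constants: bare vertices \<open>L ^ (21 - 30)\<close>; low
  in-degree n to the power 1 - 4/5 + 1/25 - 3/10 = -3/50, times a power of L; large sets in Hall's
  condition \<open>L ^ (- 26 / 50)\<close>; tree growth \<open>L ^ (- 9 / 4)\<close>; exceptional
  vertices \<open>1 / L\<close>; their attachment \<open>L ^ (3 - 6.3)\<close>.\<close>

lemma err_tendsto:
  fixes L M e B :: "nat \<Rightarrow> real"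
  defines "L \<equiv> \<lambda>n::nat. ln (real n)" and "M \<equiv> \<lambda>n::nat. ln (ln (real n))"
  defines "e \<equiv> \<lambda>n::nat. ln (ln (real n)) / ln (real n)" and "B \<equiv> \<lambda>n::nat. real n powr (3 / 10)"
  shows "(\<lambda>n. real n * exp (- (L n - 21 * M n)) / L n ^ 30) \<longlonglongrightarrow> 0"
    and "(\<lambda>n. real n * (exp (- (4 / 5 * (L n - 21 * M n))) * exp (2 * (L n / 50 + 1))) / B n) \<longlonglongrightarrow> 0"
    and "(\<lambda>n. real n * (exp (6 * L n) / exp (real n / 8 - 1))) \<longlonglongrightarrow> 0"
    and "(\<lambda>n. (2 * B n)\<^sup>2 / real n) \<longlonglongrightarrow> 0"
    and "(\<lambda>n. 2 * (2 * real n ^ 2 * (4 * B n / n) ^ 6 + 4 * exp 1 ^ 2 * exp (- (26 * e n * (L n / 50 - 2))))) \<longlonglongrightarrow> 0"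
    and "(\<lambda>n. (2 * L n ^ 30 * (12 * M n))\<^sup>2 * L n / real n) \<longlonglongrightarrow> 0"
    and "(\<lambda>n. (2 * L n ^ 30)\<^sup>2 * (12 * M n) / real n) \<longlonglongrightarrow> 0"
    and "(\<lambda>n. 2 * exp 1 * exp (- (9 / 4 * M n))) \<longlonglongrightarrow> 0"
    and "(\<lambda>n. real n * (exp (26 * (12 * M n)) / exp (3 * L n))) \<longlonglongrightarrow> 0"
    and "(\<lambda>n. 2 * (L n * (3 * L n + 1)) / L n ^ 3) \<longlonglongrightarrow> 0"
    and "(\<lambda>n. 2 * (L n * (3 * L n + 1 + 2 * L n ^ 30)) / (real n / 8)) \<longlonglongrightarrow> 0"
    and "(\<lambda>n. 2 * L n ^ 30 * (2 * (L n * (3 * L n + 1 + 2 * L n ^ 30))) / real n) \<longlonglongrightarrow> 0"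
    and "(\<lambda>n. 2 * L n ^ 3 * exp (- (6.3 * M n))) \<longlonglongrightarrow> 0"
    and "(\<lambda>n. (2 * L n ^ 3 * (12 * M n))\<^sup>2 * L n / real n) \<longlonglongrightarrow> 0"
    and "(\<lambda>n. 2 * L n ^ 3 * (12 * M n) * (2 * L n ^ 30) * L n / real n) \<longlonglongrightarrow> 0"
  unfolding L_def M_def e_def B_def by real_asymp+

text \<open>The coefficients of \<open>M\<close> leave room for rounding and for the shift
  \<open>C\<close>: the in-degree \<open>10 * e * L = 10 * M\<close> of a small layer is weakened to
  9 below and 11 above, division by \<open>(1 - p1) * (1 - p0)\<close> raises 11 to 12, and the loss
  \<open>20 * M\<close> of the large layer becomes 21.\<close>

lemma bad_bound_instance:
  fixes C L M e B p :: real and n q :: nat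
  assumes n: "n \<ge> 2" and eLM: "e * L = M"
    and p: "L - C \<le> real (n - 1) * p" "real (n - 1) * p \<le> L + C"
    and q: "\<bar>real q - (1 + 50 * e) * n\<bar> \<le> 1"
    and h1: "L \<ge> 300" and h2: "M \<ge> 1" and h3: "n / L \<le> 10 * e * n - 1" and h4: "1 \<le> e * n"
    and h5: "(1 + 50 * e) * n + 1 \<le> 2 * n" and h6: "L + C < real n - 1" and h7: "0 < L - C"
    and h8: "9 * M \<le> (L - C) * ((10 * e * n - 1) / ((1 + 50 * e) * n + 1))"
    and h9: "(L + C) * (10 * e * n / ((1 + 50 * e) * n - 1)) * (n / (real n - 1)) \<le> 11 * M"
    and h10: "11 * M / ((1 - 11 * M / n) * (1 - 3 * L / (real n - 1))) \<le> 12 * M"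
    and h11: "11 * M / n < 1" and h12: "3 * L / (real n - 1) < 1"
    and h13: "L - 21 * M \<le> (L - C) * (1 - 20 * e * n / ((1 + 50 * e) * n - 1))"
    and h14: "20 * e * n / ((1 + 50 * e) * n - 1) < 1"
    and h15: "(L + C) / (1 - 11 * M / n) \<le> 3 * L" and h16: "0 \<le> L - 21 * M"
    and h17: "2 * (n / L + 1 + 2 * L ^ 30) \<le> 10 * e * n - 1" and h18: "2 * (n / L + 1 + 2 * L ^ 30) \<le> n"
    and h19: "2 * L ^ 30 + n / 8 + 1 + 2 * L + n / 8 \<le> 0.3 * n"
    and h20: "4 * B / n \<le> 1" and h21: "1 \<le> B"
    and h22: "(n + 2 * B) / ((1 + 29 * e) * n) \<le> exp (- (26 * e))"
    and h23: "2 * real n ^ 2 * (4 * B / n) ^ 6 + 4 * exp 1 ^ 2 * exp (- (26 * e * (L / 50 - 2))) \<le> 1 / 2"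
    and h24: "exp 1 * (12 * M) * exp (- (9 / 4 * M)) \<le> 1 / 2"
  shows "\<exists>q0 u x l d dm K D z t. q = q0 + 2 * u \<and> 0 \<le> p \<and> p < 1 \<and> 1 \<le> u \<and> n \<le> q0 \<and> 2 * (K + x) \<le> u \<and> 1 \<le> K \<and> 2 * (K + x) \<le> n \<and>
    1 \<le> L \<and> real (n - 1) \<le> L * real K \<and> (\<forall>p0 p1 p2. p1 = p * real u / (real q0 + 2 * real u) \<longrightarrow> p0 = p * real q0 / ((real q0 + 2 * real u) * (1 - p1)) \<longrightarrow>
     p2 = p1 / ((1 - p1) * (1 - p0)) \<longrightarrow> bad_bound n q0 u p0 p1 p2 x l d dm K D z t L \<le>
      error_bound n L M B (2 * real n ^ 2 * (4 * B / n) ^ 6 + 4 * exp 1 ^ 2 * exp (- (26 * e * (L / 50 - 2)))))"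
proof -
  define N where "N = real n"
  have N: "N \<ge> 2" "real (n - 1) = N - 1" using n by (auto simp: N_def)
  have L0: "L > 0" "L \<ge> 1" using h1 by auto
  have e0: "e > 0"
    using eLM h2 L0 by (metis less_le_trans zero_less_mult_pos2 zero_less_one)
  have eN: "e * N \<ge> 1" "e * N > 0" using h4 by (auto simp: N_def)
  have L30: "1 \<le> L ^ 30" "1 \<le> L ^ 3" using L0 by (auto intro: one_le_power)
  define u where "u = nat \<lfloor>10 * e * N\<rfloor>"
  have u: "10 * e * N - 1 \<le> real u" "real u \<le> 10 * e * N" using eN unfolding u_def by linarith+
  have q': "real q \<le> (1 + 50 * e) * N + 1" "(1 + 50 * e) * N - 1 \<le> real q" using q unfolding N_def by linarith+
  have q2: "N + 50 * (e * N) - 1 \<le> real q" "real q \<le> N + 50 * (e * N) + 1" using q' by (auto simp: algebra_simps)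
  have u2: "2 * real u \<le> 20 * (e * N)" using u(2) by linarith
  \<comment> \<open>\<open>Q0\<close> absorbs all rounding: 50 - 2 * 10 = 30, and the error of at
    most 1 in \<open>q\<close> costs at most one further \<open>e * N\<close>, leaving 29.\<close>
  define q0 where "q0 = q - 2 * u"
  have "real (2 * u) \<le> real q" using q2 u2 N eN by linarith
  then have qq: "q = q0 + 2 * u" unfolding q0_def by linarith
  then have rq: "real q = real q0 + 2 * real u" by simp
  have q0a: "N + 29 * (e * N) \<le> real q0" using rq q2 u2 eN by linarith
  have q0b: "real q0 \<le> 2 * N" using rq q'(1) h5 unfolding N_def by linarith
  have nq0: "n \<le> q0" using q0a eN unfolding N_def by linarith
  have q0c: "q0 \<le> 2 * n" using q0b unfolding N_def by linarith
  have qpos: "real q > 0" "(1 + 50 * e) * N - 1 > 0" "(1 + 50 * e) * N + 1 > 0"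
  proof -
    show "(1 + 50 * e) * N - 1 > 0" using N eN by (simp add: algebra_simps)
    then show "real q > 0" "(1 + 50 * e) * N + 1 > 0" using q'(2) by linarith+
  qed
  have p': "L - C \<le> (N - 1) * p" "(N - 1) * p \<le> L + C" using p unfolding N(2) by simp_all
  have p0p: "p > 0" "p < 1"
  proof -
    have "0 < (N - 1) * p" using p'(1) h7 by linarith
    then show "p > 0" using N by (simp add: zero_less_mult_iff)
    have "(N - 1) * p < (N - 1) * 1" using order.strict_trans1[OF p'(2) h6[folded N_def]] by simp
    then show "p < 1" using N by (simp add: mult_less_cancel_left)
  qed
  define pi where "pi = (N - 1) * p"
  have pi: "L - C \<le> pi" "pi \<le> L + C" "0 < pi" using p' h7 unfolding pi_def by linarith+
  define p1 where "p1 = p * real u / (real q0 + 2 * real u)"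
  define p0 where "p0 = p * real q0 / ((real q0 + 2 * real u) * (1 - p1))"
  define p2 where "p2 = p1 / ((1 - p1) * (1 - p0))"
  have p1': "p1 * (N - 1) = pi * (real u / real q)" by (simp add: p1_def pi_def rq)
  have p1a: "9 * M \<le> p1 * (N - 1)"
  proof -
    have "(10 * e * N - 1) / ((1 + 50 * e) * N + 1) \<le> real u / real q"
      by (rule frac_le) (use u q' qpos eN in auto)
    then have "(L - C) * ((10 * e * N - 1) / ((1 + 50 * e) * N + 1)) \<le> pi * (real u / real q)"
      by (rule mult_mono[OF pi(1)]) (use pi eN qpos in auto)
    then show ?thesis using h8[folded N_def] unfolding p1' by linarith
  qed
  have p1b: "p1 * N \<le> 11 * M"
  proof -
    have r: "real u / real q \<le> 10 * e * N / ((1 + 50 * e) * N - 1)"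
      by (rule frac_le) (use u q' qpos eN in \<open>auto simp: mult_ac\<close>)
    have "pi * (real u / real q) \<le> (L + C) * (10 * e * N / ((1 + 50 * e) * N - 1))"
      by (rule mult_mono[OF pi(2) r]) (use pi qpos in auto)
    then have "p1 * (N - 1) * (N / (N - 1)) \<le> (L + C) * (10 * e * N / ((1 + 50 * e) * N - 1)) * (N / (N - 1))"
      unfolding p1' by (rule mult_right_mono) (use N in auto)
    then show ?thesis using h9 N unfolding N_def[symmetric] by simp
  qed
  have p1n: "0 \<le> p1" using p0p qpos by (simp add: p1_def)
  have p1c: "p1 \<le> 11 * M / N" using p1b N by (simp add: field_simps)
  have d1: "1 - p1 > 0" "1 - 11 * M / N > 0" using p1c h11 unfolding N_def by linarith+
  have p0': "p0 * (N - 1) = pi * (real q0 / real q) / (1 - p1)" by (simp add: p0_def pi_def rq)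
  have q0q: "0 \<le> real q0 / real q" "real q0 / real q \<le> 1" using rq qpos by auto
  have p0a: "L - 21 * M \<le> p0 * (N - 1)"
  proof -
    have "real q0 / real q = 1 - 2 * real u / real q" using rq qpos by (simp add: field_simps)
    moreover have "2 * real u / real q \<le> 20 * e * N / ((1 + 50 * e) * N - 1)"
      by (rule frac_le) (use u q' qpos eN in \<open>auto simp: mult_ac\<close>)
    ultimately have "1 - 20 * e * N / ((1 + 50 * e) * N - 1) \<le> real q0 / real q" by linarith
    then have "(L - C) * (1 - 20 * e * N / ((1 + 50 * e) * N - 1)) \<le> pi * (real q0 / real q)"
      by (rule mult_mono[OF pi(1)]) (use pi h14 in \<open>auto simp: N_def\<close>)
    moreover have "y \<le> y / (1 - p1)" if "0 \<le> y" for y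
      using d1 p1n that by (simp add: pos_le_divide_eq mult_left_le)
    from this[of "pi * (real q0 / real q)"] have "pi * (real q0 / real q) \<le> pi * (real q0 / real q) / (1 - p1)"
      using pi q0q by simp
    ultimately show ?thesis using h13[folded N_def] unfolding p0' by linarith
  qed
  have p0b: "p0 * (N - 1) \<le> 3 * L"
  proof -
    have "pi * (real q0 / real q) \<le> (L + C) * 1" by (rule mult_mono[OF pi(2) q0q(2)]) (use pi q0q in auto)
    then have "pi * (real q0 / real q) / (1 - p1) \<le> (L + C) / (1 - 11 * M / N)"
      by (intro frac_le) (use d1 p1c pi in auto)
    then show ?thesis using h15[folded N_def] unfolding p0' by linarith
  qed
  have p0n: "0 \<le> p0" using p0p d1 by (simp add: p0_def)
  have p0c: "p0 \<le> 3 * L / (N - 1)" using p0b N by (simp add: field_simps)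
  have d0: "1 - p0 > 0" "1 - 3 * L / (N - 1) > 0" using p0c h12 unfolding N_def by linarith+
  have p2a: "p1 \<le> p2"
  proof -
    have "(1 - p1) * (1 - p0) \<le> 1" using d0 d1 p0n p1n by (intro mult_le_one) auto
    then have "p1 * ((1 - p1) * (1 - p0)) \<le> p1" using p1n by (rule mult_left_le)
    then show ?thesis using d0 d1 unfolding p2_def by (simp add: pos_le_divide_eq)
  qed
  have p2b: "p2 * N \<le> 12 * M"
  proof -
    have "p1 * N / ((1 - p1) * (1 - p0)) \<le> 11 * M / ((1 - 11 * M / N) * (1 - 3 * L / (N - 1)))"
      by (rule frac_le[OF _ p1b mult_pos_pos[OF d1(2) d0(2)] mult_mono]) (use p1c p0c d0 d1 h2 in auto)
    then show ?thesis using h10 by (simp add: p2_def N_def)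
  qed
  have "p2 * N \<le> 1 * N"
  proof -
    have "24 * M \<le> N"
    proof -
      have 1: "L \<le> L ^ 30" using L0 by (intro self_le_power) auto
      have 2: "0 \<le> real n / L" using L0 by simp
      have 3: "2 * L \<le> real n" 
      proof -
        have "2 * (L + 0) \<le> 2 * (2 * L ^ 30 + (real n / L + 1))" using 1 2 L0 by (intro mult_left_mono add_mono) auto
        then show ?thesis using h18 by (simp add: algebra_simps)
      qed
      have "24 * M \<le> 2 * L" using h16 h2 by linarith
      with 3 show ?thesis unfolding N_def by linarith
    qed
    then show ?thesis using p2b h2 by linarith
  qed
  then have p2c: "p2 \<le> 1" using N by (simp add: mult_le_cancel_right)
  define x where "x = nat \<lceil>L ^ 30\<rceil>"
  have x: "L ^ 30 \<le> real x" "real x \<le> 2 * L ^ 30" using L30 unfolding x_def by linarith+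
  define z where "z = nat \<lceil>L ^ 3\<rceil>"
  have z: "L ^ 3 \<le> real z" "real z \<le> 2 * L ^ 3" using L30 unfolding z_def by linarith+
  define D where "D = nat \<lceil>L\<rceil>"
  have D: "L \<le> real D" "real D \<le> 2 * L" using h1 unfolding D_def by linarith+
  \<comment> \<open>\<open>L \<ge> 300\<close> gives \<open>d \<ge> 6\<close>. This suffices for
    small sets, where \<open>n ^ 2 * (B / n) ^ 6\<close> has exponent 2 - 6 * 7/10 < 0.\<close>
  define d where "d = nat \<lceil>L / 50\<rceil>"
  have d: "L / 50 \<le> real d" "real d \<le> L / 50 + 1" "d \<ge> 6" using h1 unfolding d_def by linarith+
  define l where "l = nat \<lceil>B\<rceil>"
  have l: "B \<le> real l" "real l \<le> 2 * B" using h21 unfolding l_def by linarith+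
  define K where "K = nat \<lceil>N / L\<rceil>"
  have NL: "N / L > 0" using N L0 by simp
  have K: "N / L \<le> real K" "real K \<le> N / L + 1" "K \<ge> 1" using NL unfolding K_def by linarith+
  \<comment> \<open>The same value serves as \<open>t\<close> and as \<open>dm\<close>: together
    they exclude a quarter of the vertices, within the allowed 0.3 n.\<close>
  define t where "t = n div 8"
  have t: "N / 8 - 1 \<le> real t" "real t \<le> N / 8" unfolding t_def N_def by linarith+
  have NLu: "N / L \<le> real u" using h3 u(1) unfolding N_def by linarith
  have "real (2 * (K + x)) \<le> real u" using K x h17 u(1) unfolding N_def by (simp del: of_nat_mult)
  then have Ku: "2 * (K + x) \<le> u" by linarith
  have "real (2 * (K + x)) \<le> real n" using K x h18 unfolding N_def by (simp del: of_nat_mult)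
  then have Kn: "2 * (K + x) \<le> n" by linarith
  have u1: "1 \<le> u" using Ku K(3) by (cases u) auto
  have lamK: "real (n - 1) \<le> L * real K"
  proof -
    have "N \<le> L * real K" using K(1) L0 by (simp add: field_simps)
    then show ?thesis using N by linarith
  qed
  have bb: "bad_bound n q0 u p0 p1 p2 x l d t K D z t L \<le>
      error_bound n L M B (2 * real n ^ 2 * (4 * B / n) ^ 6 + 4 * exp 1 ^ 2 * exp (- (26 * e * (L / 50 - 2))))"
  proof (rule bad_bound_le[OF n L0(2)])
    show "0 \<le> M" "B > 0" using h2 h21 by auto
    show "real n / L \<le> real u" using NLu by (simp add: N_def)
    show "n \<le> q0" "q0 \<le> 2 * n" by (rule nq0 q0c)+
    show "0 \<le> p0" "p0 \<le> 1" using p0n d0 by auto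
    show "L - 21 * M \<le> p0 * real (n - 1)" "p0 * real (n - 1) \<le> 3 * L" unfolding N by (rule p0a p0b)+
    show "0 \<le> p1" "p1 \<le> 1" using p1n d1 by auto
    show "9 * M \<le> p1 * real (n - 1)" unfolding N by (rule p1a)
    show "p1 * real n \<le> 12 * M" using p1b h2 unfolding N_def by linarith
    show "p1 \<le> p2" "p2 \<le> 1" by (rule p2a p2c)+
    show "p2 * real n \<le> 12 * M" using p2b by (simp add: N_def)
    show "2 \<le> d" using d by simp
    show "real n / 8 - 1 \<le> real t" "real n / 8 - 1 \<le> real t" using t by (simp_all add: N_def)
    show "real (x + t + 1 + D + t) \<le> 0.3 * real n" using x t D h19 unfolding N_def by simp
    show "2 * (real n)\<^sup>2 * (2 * real l / real q0) ^ d \<le> 2 * real n ^ 2 * (4 * B / n) ^ 6"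
    proof (rule mult_left_mono)
      have "2 * real l / real q0 \<le> 4 * B / real n"
        by (rule frac_le) (use l h21 n nq0 in auto)
      then have "(2 * real l / real q0) ^ d \<le> (4 * B / real n) ^ d" by (rule power_mono) simp
      also have "\<dots> \<le> (4 * B / real n) ^ 6" by (rule power_decreasing[OF d(3)]) (use h20 h21 in auto)
      finally show "(2 * real l / real q0) ^ d \<le> (4 * B / real n) ^ 6" .
    qed simp
    show "4 * exp 1 ^ 2 * ((real n + real l) / real q0) ^ (d - 2) \<le> 4 * exp 1 ^ 2 * exp (- (26 * e * (L / 50 - 2)))"
    proof (rule mult_left_mono)
      \<comment> \<open>Passing from 29 to 26 in the exponent absorbs \<open>l\<close> and the
        second-order term of the logarithm.\<close>
      have "(real n + real l) / real q0 \<le> (n + 2 * B) / ((1 + 29 * e) * n)"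
      proof (rule frac_le)
        show "(1 + 29 * e) * real n \<le> real q0" using q0a by (simp add: N_def algebra_simps)
        show "0 < (1 + 29 * e) * real n" using e0 n by simp
      qed (use l h21 in auto)
      then have "(real n + real l) / real q0 \<le> exp (- (26 * e))" using h22 by linarith
      then have "((real n + real l) / real q0) ^ (d - 2) \<le> exp (- (26 * e)) ^ (d - 2)" by (rule power_mono) simp
      also have "\<dots> = exp (- (26 * e * real (d - 2)))" by (simp add: exp_of_nat_mult[symmetric] mult.commute)
      also have "\<dots> \<le> exp (- (26 * e * (L / 50 - 2)))"
      proof -
        have "L / 50 - 2 \<le> real (d - 2)" using d by simp
        then have "26 * e * (L / 50 - 2) \<le> 26 * e * real (d - 2)" using e0 by (intro mult_left_mono) auto
        then show ?thesis by simp
      qed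
      finally show "((real n + real l) / real q0) ^ (d - 2) \<le> exp (- (26 * e * (L / 50 - 2)))" .
    qed simp
  qed (fact h16 x l d D z h23 h24)+
  show ?thesis
    by (rule exI[of _ q0], rule exI[of _ u], rule exI[of _ x], rule exI[of _ l], rule exI[of _ d], rule exI[of _ t], rule exI[of _ K], rule exI[of _ D], rule exI[of _ z], rule exI[of _ t])
      (intro conjI allI impI qq less_imp_le[OF p0p(1)] p0p(2) u1 nq0 Ku K(3) Kn L0(2) lamK, simp only: bb[unfolded p2_def p0_def p1_def])
qed

section \<open>Poisson limit for the number of vertices without incoming arc\<close>

lemma one_minus_power_ge_exp:
  fixes y :: real
  assumes "0 \<le> y" "y < 1"
  shows "exp (- (y * k / (1 - y))) \<le> (1 - y) ^ k"
proof -
  have "exp (- (y / (1 - y))) \<le> 1 - y"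
  proof -
    have "1 / (1 - y) = 1 + y / (1 - y)" using assms by (simp add: field_simps)
    also have "\<dots> \<le> exp (y / (1 - y))" by (rule exp_ge_add_one_self)
    finally show ?thesis using assms by (simp add: exp_minus field_simps)
  qed
  then have "exp (- (y / (1 - y))) ^ k \<le> (1 - y) ^ k" by (rule power_mono) simp
  then show ?thesis by (simp add: exp_of_nat_mult[symmetric] mult.commute)
qed

lemma tendsto_one_minus_power:
  fixes s :: "nat \<Rightarrow> real" and k :: "nat \<Rightarrow> nat"
  assumes k: "(\<lambda>n. real (k n) * s n) \<longlonglongrightarrow> a" and s: "s \<longlonglongrightarrow> 0" "eventually (\<lambda>n. 0 \<le> s n) sequentially"
  shows "(\<lambda>n. (1 - s n) ^ k n) \<longlonglongrightarrow> exp (- a)"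
proof (rule tendsto_sandwich)
  have s1: "eventually (\<lambda>n. s n < 1) sequentially" using order_tendstoD(2)[OF s(1), of 1] by simp
  show "eventually (\<lambda>n. exp (- (s n * k n / (1 - s n))) \<le> (1 - s n) ^ k n) sequentially"
    using s(2) s1 by eventually_elim (rule one_minus_power_ge_exp)
  show "eventually (\<lambda>n. (1 - s n) ^ k n \<le> exp (- (s n * k n))) sequentially"
    using s1 by eventually_elim (simp add: one_minus_power_le_exp)
  have ks: "(\<lambda>n. s n * k n) \<longlonglongrightarrow> a" using k by (simp add: mult.commute)
  have "(\<lambda>n. s n * k n / (1 - s n)) \<longlonglongrightarrow> a / (1 - 0)" by (intro tendsto_intros ks s) simp
  then show "(\<lambda>n. exp (- (s n * k n / (1 - s n)))) \<longlonglongrightarrow> exp (- a)" by (intro tendsto_exp tendsto_minus) simp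
  show "(\<lambda>n. exp (- (s n * k n))) \<longlonglongrightarrow> exp (- a)" by (intro tendsto_exp tendsto_minus ks)
qed

text \<open>The limit of \<open>(n - 1) * p ^ 2\<close> controls the error made when
  \<open>(1 - p) ^ (n - 1)\<close> is replaced by an exponential.\<close>

lemma edge_probability_tendsto:
  fixes p :: "nat \<Rightarrow> real"
  assumes "(\<lambda>n. real (n - 1) * p n - ln (real n)) \<longlonglongrightarrow> c"
  shows "p \<longlonglongrightarrow> 0" "(\<lambda>n. real (n - 1) * p n ^ 2) \<longlonglongrightarrow> 0" "eventually (\<lambda>n. 0 < p n \<and> p n < 1) sequentially"
proof -
  define r where "r = (\<lambda>n. real (n - 1) * p n - ln (real n))"
  have r: "r \<longlonglongrightarrow> c" using assms by (simp add: r_def)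
  have a: "(\<lambda>n::nat. 1 / (real n - 1)) \<longlonglongrightarrow> 0" "(\<lambda>n::nat. ln (real n) / (real n - 1)) \<longlonglongrightarrow> 0" "(\<lambda>n::nat. ln (real n) ^ 2 / (real n - 1)) \<longlonglongrightarrow> 0"
    by real_asymp+
  have "(\<lambda>n. r n * (1 / (real n - 1)) + ln (real n) / (real n - 1)) \<longlonglongrightarrow> c * 0 + 0" by (intro tendsto_intros r a)
  moreover have e1: "eventually (\<lambda>n. r n * (1 / (real n - 1)) + ln (real n) / (real n - 1) = p n) sequentially"
    using eventually_ge_at_top[of "2::nat"]
  proof eventually_elim
    case (elim n)
    have n: "real (n - 1) = real n - 1" "real n - 1 \<noteq> 0" using elim by auto
    have "r n * (1 / (real n - 1)) + ln (real n) / (real n - 1) = (r n + ln (real n)) / (real n - 1)" by (simp add: add_divide_distrib)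
    also have "r n + ln (real n) = p n * (real n - 1)" by (simp only: r_def n(1)) simp
    finally show ?case using n(2) by simp
  qed
  ultimately show p0: "p \<longlonglongrightarrow> 0" by (simp add: Lim_transform_eventually)
  have "(\<lambda>n. r n ^ 2 * (1 / (real n - 1)) + 2 * r n * (ln (real n) / (real n - 1)) + ln (real n) ^ 2 / (real n - 1)) \<longlonglongrightarrow> c ^ 2 * 0 + 2 * c * 0 + 0"
    by (intro tendsto_intros r a)
  moreover have "eventually (\<lambda>n. r n ^ 2 * (1 / (real n - 1)) + 2 * r n * (ln (real n) / (real n - 1)) + ln (real n) ^ 2 / (real n - 1) = real (n - 1) * p n ^ 2) sequentially"
    using eventually_ge_at_top[of "2::nat"] e1
  proof eventually_elim
    case (elim n)
    have n: "real (n - 1) = real n - 1" "real n - 1 > 0" using elim by auto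
    have "r n ^ 2 * (1 / (real n - 1)) + 2 * r n * (ln (real n) / (real n - 1)) + ln (real n) ^ 2 / (real n - 1) = (real n - 1) * (r n * (1 / (real n - 1)) + ln (real n) / (real n - 1)) ^ 2"
      using n by (simp add: power2_eq_square divide_simps) (simp add: algebra_simps)
    then show ?case using elim n by simp
  qed
  ultimately show "(\<lambda>n. real (n - 1) * p n ^ 2) \<longlonglongrightarrow> 0" by (simp add: Lim_transform_eventually)
  have "eventually (\<lambda>n. r n > c - 1) sequentially" using order_tendstoD(1)[OF r] by simp
  moreover have "eventually (\<lambda>n::nat. ln (real n) + (c - 1) > 0) sequentially" by real_asymp
  moreover have "eventually (\<lambda>n. p n < 1) sequentially" using order_tendstoD(2)[OF p0] by simp
  ultimately show "eventually (\<lambda>n. 0 < p n \<and> p n < 1) sequentially"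
  proof eventually_elim
    case (elim n)
    then have "real (n - 1) * p n > 0" unfolding r_def by linarith
    then show ?case using elim by (simp add: zero_less_mult_iff)
  qed
qed

text \<open>With \<open>s = (1 - p) ^ (n - 1)\<close> the mean number \<open>n * s\<close> of such
  vertices tends to \<open>exp (- c)\<close>, and the exact binomial formula of
  \<open>prob_empties\<close> tends to the Poisson probability of at most one.\<close>

lemma prob_at_most_one_source_tendsto:
  fixes p :: "nat \<Rightarrow> real" and q :: "nat \<Rightarrow> nat"
  assumes p: "(\<lambda>n. real (n - 1) * p n - ln (real n)) \<longlonglongrightarrow> c" and q: "eventually (\<lambda>n. q n \<ge> 1) sequentially"
  shows "(\<lambda>n. measure_pmf.prob (Pi_pmf (all_arcs {1..n}) None (\<lambda>_. opt_pmf (p n) {1..q n})) {w. card (no_in_arc {1..n} w) \<le> 1})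
    \<longlonglongrightarrow> (1 + exp (- c)) * exp (- exp (- c))"
proof -
  note P = edge_probability_tendsto[OF p]
  define s where "s n = (1 - p n) ^ (n - 1)" for n
  have ns: "(\<lambda>n. real n * s n) \<longlonglongrightarrow> exp (- c)"
  proof (rule tendsto_sandwich)
    show "eventually (\<lambda>n. exp (- (real (n - 1) * p n - ln (real n)) - real (n - 1) * p n ^ 2 / (1 - p n)) \<le> real n * s n) sequentially"
      using eventually_ge_at_top[of "2::nat"] P(3)
    proof eventually_elim
      case (elim n)
      have "exp (- (real (n - 1) * p n - ln (real n)) - real (n - 1) * p n ^ 2 / (1 - p n)) = real n * exp (- (p n * real (n - 1) / (1 - p n)))"
      proof -
        have "- (real (n - 1) * p n - ln (real n)) - real (n - 1) * p n ^ 2 / (1 - p n) = ln (real n) + - (p n * real (n - 1) / (1 - p n))"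
          using elim by (simp add: power2_eq_square divide_simps) (simp add: algebra_simps)
        then show ?thesis using elim by (simp only: exp_add) simp
      qed
      also have "\<dots> \<le> real n * s n" unfolding s_def using elim by (intro mult_left_mono one_minus_power_ge_exp) auto
      finally show ?case .
    qed
    show "eventually (\<lambda>n. real n * s n \<le> exp (- (real (n - 1) * p n - ln (real n)))) sequentially"
      using eventually_ge_at_top[of "2::nat"] P(3)
    proof eventually_elim
      case (elim n)
      have "real n * s n \<le> real n * exp (- (p n * real (n - 1)))" unfolding s_def using elim by (intro mult_left_mono one_minus_power_le_exp) auto
      also have "\<dots> = exp (- (real (n - 1) * p n - ln (real n)))" using elim by (simp add: exp_diff exp_add exp_minus field_simps)
      finally show ?case .
    qed
    have "(\<lambda>n. exp (- (real (n - 1) * p n - ln (real n)) - real (n - 1) * p n ^ 2 / (1 - p n))) \<longlonglongrightarrow> exp (- c - 0 / (1 - 0))"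
      by (intro tendsto_intros p P) simp
    then show "(\<lambda>n. exp (- (real (n - 1) * p n - ln (real n)) - real (n - 1) * p n ^ 2 / (1 - p n))) \<longlonglongrightarrow> exp (- c)" by simp
    show "(\<lambda>n. exp (- (real (n - 1) * p n - ln (real n)))) \<longlonglongrightarrow> exp (- c)" by (intro tendsto_intros p)
  qed
  have inv: "(\<lambda>n::nat. 1 / real n) \<longlonglongrightarrow> 0" by real_asymp
  have s0: "s \<longlonglongrightarrow> 0"
  proof -
    have "(\<lambda>n. real n * s n * (1 / real n)) \<longlonglongrightarrow> exp (- c) * 0" by (intro tendsto_intros ns inv)
    moreover have "eventually (\<lambda>n. real n * s n * (1 / real n) = s n) sequentially"
      using eventually_ge_at_top[of "1::nat"] by eventually_elim simp
    ultimately show ?thesis by (simp add: Lim_transform_eventually)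
  qed
  have s1: "eventually (\<lambda>n. 0 \<le> s n) sequentially" using P(3) by eventually_elim (simp add: s_def)
  have n1s: "(\<lambda>n. real (n - 1) * s n) \<longlonglongrightarrow> exp (- c)"
  proof -
    have "(\<lambda>n. real n * s n - s n) \<longlonglongrightarrow> exp (- c) - 0" by (intro tendsto_intros ns s0)
    moreover have "eventually (\<lambda>n. real n * s n - s n = real (n - 1) * s n) sequentially"
      using eventually_ge_at_top[of "1::nat"] by eventually_elim (simp add: algebra_simps)
    ultimately show ?thesis by (simp add: Lim_transform_eventually)
  qed
  have "(\<lambda>n. (1 - s n) ^ n + real n * s n * (1 - s n) ^ (n - 1)) \<longlonglongrightarrow> exp (- exp (- c)) + exp (- c) * exp (- exp (- c))"
    by (intro tendsto_add tendsto_mult ns tendsto_one_minus_power n1s s0 s1)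
  moreover have "eventually (\<lambda>n. (1 - s n) ^ n + real n * s n * (1 - s n) ^ (n - 1) = measure_pmf.prob (Pi_pmf (all_arcs {1..n}) None (\<lambda>_. opt_pmf (p n) {1..q n})) {w. card (no_in_arc {1..n} w) \<le> 1}) sequentially"
    using P(3) q
  proof eventually_elim
    case (elim n)
    show ?case by (subst prob_empties) (use elim in \<open>auto simp: s_def\<close>)
  qed
  ultimately show ?thesis by (simp add: Lim_transform_eventually distrib_right)
qed

lemma prob_rainbow_tree_gap:
  fixes p :: "nat \<Rightarrow> real" and q :: "nat \<Rightarrow> nat"
  assumes p: "(\<lambda>n. real (n - 1) * p n - ln (real n)) \<longlonglongrightarrow> c"
    and q: "eventually (\<lambda>n. \<bar>real (q n) - (1 + 50 * eps n) * real n\<bar> \<le> 1) sequentially"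
  obtains E where "E \<longlonglongrightarrow> 0"
    "eventually (\<lambda>n. measure_pmf.prob (Pi_pmf (all_arcs {1..n}) None (\<lambda>_. opt_pmf (p n) {1..q n})) {w. card (no_in_arc {1..n} w) \<le> 1}
      \<le> measure_pmf.prob (Pi_pmf (all_arcs {1..n}) None (\<lambda>_. opt_pmf (p n) {1..q n})) {w. rainbow_tree {1..n} w} + E n) sequentially"
proof -
  define L where "L n = ln (real n)" for n :: nat
  define M where "M n = ln (L n)" for n :: nat
  define e where "e n = M n / L n" for n :: nat
  define B where "B n = real n powr (3 / 10)" for n :: nat
  \<comment> \<open>Any constant above the modulus of \<open>c\<close> eventually bounds the
    distance between \<open>(n - 1) * p n\<close> and \<open>L n\<close>.\<close>
  define C where "C = \<bar>c\<bar> + 1"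
  note A' = asymp_ineqs(1-5) asymp_ineqs(6-9)[of C] asymp_ineqs(10-12) asymp_ineqs(13)[of C] asymp_ineqs(14) asymp_ineqs(15)[of C] asymp_ineqs(16-24)
  note A = A'[folded L_def, folded M_def, folded e_def, folded B_def]
  note T = err_tendsto[folded L_def, folded M_def, folded e_def, folded B_def]
  have pC: "eventually (\<lambda>n. L n - C \<le> real (n - 1) * p n) sequentially" "eventually (\<lambda>n. real (n - 1) * p n \<le> L n + C) sequentially"
  proof -
    have "eventually (\<lambda>n. real (n - 1) * p n - ln (real n) > - C) sequentially" by (rule order_tendstoD(1)[OF p]) (simp add: C_def)
    then show "eventually (\<lambda>n. L n - C \<le> real (n - 1) * p n) sequentially" by eventually_elim (simp add: L_def)
    have "eventually (\<lambda>n. real (n - 1) * p n - ln (real n) < C) sequentially" by (rule order_tendstoD(2)[OF p]) (simp add: C_def)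
    then show "eventually (\<lambda>n. real (n - 1) * p n \<le> L n + C) sequentially" by eventually_elim (simp add: L_def)
  qed
  define E where "E n = error_bound n (L n) (M n) (B n)
      (2 * real n ^ 2 * (4 * B n / n) ^ 6 + 4 * exp 1 ^ 2 * exp (- (26 * e n * (L n / 50 - 2))))" for n
  have "E \<longlonglongrightarrow> 0" unfolding E_def[abs_def] error_bound_def by (intro tendsto_add_zero T)
  moreover have "eventually (\<lambda>n. measure_pmf.prob (Pi_pmf (all_arcs {1..n}) None (\<lambda>_. opt_pmf (p n) {1..q n})) {w. card (no_in_arc {1..n} w) \<le> 1}
      \<le> measure_pmf.prob (Pi_pmf (all_arcs {1..n}) None (\<lambda>_. opt_pmf (p n) {1..q n})) {w. rainbow_tree {1..n} w} + E n) sequentially"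
    using eventually_ge_at_top[of "2::nat"] pC A q
  proof eventually_elim
    case (elim n)
    have eLM: "e n * L n = M n" using elim(4) by (simp add: e_def L_def M_def)
    have qn: "\<bar>real (q n) - (1 + 50 * e n) * real n\<bar> \<le> 1" using elim(28) by (simp add: eps_def e_def M_def L_def)
    obtain q0 u x l d dm K D z t where I: "q n = q0 + 2 * u" "0 \<le> p n" "p n < 1" "1 \<le> u" "n \<le> q0" "2 * (K + x) \<le> u" "1 \<le> K" "2 * (K + x) \<le> n"
      "1 \<le> L n" "real (n - 1) \<le> L n * real K"
      and b: "\<forall>p0 p1 p2. p1 = p n * real u / (real q0 + 2 * real u) \<longrightarrow> p0 = p n * real q0 / ((real q0 + 2 * real u) * (1 - p1)) \<longrightarrow>
        p2 = p1 / ((1 - p1) * (1 - p0)) \<longrightarrow> bad_bound n q0 u p0 p1 p2 x l d dm K D z t (L n) \<le> E n"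
      using bad_bound_instance[OF elim(1) eLM elim(2,3) qn elim(4-27), folded E_def] by (elim exE conjE)
    have c: "card {1..n} = n" by simp
    show ?case unfolding I(1)
      by (rule order.trans[OF prob_rainbow_tree_ge[where V = "{1..n}" and K = K and x = x and lam = "L n" and l = l and d = d and dm = dm and D = D and z = z and t = t, unfolded c,
             OF _ elim(1) I(2-5) I(6-8) I(9,10)] add_left_mono[OF b[rule_format]]]) simp_all
  qed
  ultimately show ?thesis by (rule that)
qed

section \<open>Transfer to the uniform model\<close>

lemma measure_bernoulli_True:
  assumes "0 \<le> p" "p \<le> 1"
  shows "measure_pmf.prob (bernoulli_pmf p) {y. y} = p"
proof -
  have "{y. y} = {True}" by auto
  then show ?thesis using assms measure_pmf_single[of "bernoulli_pmf p" True] by simp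
qed

context
  fixes n m q :: nat and p :: real
  assumes p: "0 < p" "p < 1" and m: "m \<le> card (all_arcs {1..n})"
begin

abbreviation (input) "V \<equiv> {1..n}"
abbreviation (input) "col_pmf \<equiv> pmf_of_set {1..q}"

lemma subset_prob_arcs: "subset_prob (all_arcs V)"
  by unfold_locales simp

lemma pair_digraph_sub: "B \<subseteq> all_arcs V \<Longrightarrow> pair_digraph \<lparr>pverts = V, parcs = B\<rparr>"
proof unfold_locales
  assume B: "B \<subseteq> all_arcs V"
  show "finite (parcs \<lparr>pverts = V, parcs = B\<rparr>)" using finite_subset[OF B] by simp
qed (auto simp: all_arcs_def)

lemma h_eq:
  assumes "B \<subseteq> all_arcs V"
  shows "subset_prob.h col_pmf Q B = measure_pmf.prob (Pi_pmf B 0 (\<lambda>_. col_pmf)) {f. Q (\<lambda>a. if a \<in> B then Some (f a) else None)}"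
proof -
  have "finite B" using assms by (rule finite_subset) simp
  then show ?thesis
    unfolding subset_prob.h_def[OF subset_prob_arcs] by (subst Pi_map_Some[where d = 0]) (simp_all add: vimage_def)
qed

lemma avg_le:
  assumes "\<And>B. B \<subseteq> all_arcs V \<Longrightarrow> f B \<le> g B"
  shows "subset_prob.avg (all_arcs V) f k \<le> subset_prob.avg (all_arcs V) g k"
  unfolding subset_prob.avg_def[OF subset_prob_arcs] using assms by (intro divide_right_mono sum_mono) auto

lemma prob_digraph_ge:
  "measure_pmf.prob (Pi_pmf (all_arcs V) None (\<lambda>_. opt_pmf p {1..q})) {w. rainbow_tree V w}
    \<le> measure_pmf.prob (random_coloured_digraph n m q) {(G, col). has_rainbow_arborescence G col}
      + measure_pmf.prob (Pi_pmf (all_arcs V) False (\<lambda>_. bernoulli_pmf p)) {b. card {a\<in>all_arcs V. b a} > m}"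
proof -
  let ?Q = "\<lambda>w :: nat \<times> nat \<Rightarrow> nat option. rainbow_tree V w"
  have "subset_prob.h col_pmf ?Q B \<le> measure_pmf.prob (Pi_pmf B 0 (\<lambda>_. col_pmf)) {col. has_rainbow_arborescence \<lparr>pverts = V, parcs = B\<rparr> col}"
    if B: "B \<subseteq> all_arcs V" for B
    unfolding h_eq[OF B]
  proof (rule prob_mono)
    fix col :: "nat \<times> nat \<Rightarrow> nat" assume rt: "rainbow_tree V (\<lambda>a. if a \<in> B then Some (col a) else None)"
    have "pair_wf_digraph \<lparr>pverts = V, parcs = B\<rparr>"
      by unfold_locales (use B in \<open>auto simp: all_arcs_def\<close>)
    then show "has_rainbow_arborescence \<lparr>pverts = V, parcs = B\<rparr> col"
      by (rule has_rainbow_arborescence_if_rainbow_tree) (use rt in simp_all)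
  qed
  then have a: "subset_prob.avg (all_arcs V) (subset_prob.h col_pmf ?Q) m \<le> measure_pmf.prob (random_coloured_digraph n m q) {(G, col). has_rainbow_arborescence G col}"
    unfolding prob_random_coloured_digraph[OF m] by (rule avg_le)
  have t: "measure_pmf.expectation (subset_prob.sub_pmf (all_arcs V) p) (subset_prob.h col_pmf ?Q) \<le> subset_prob.avg (all_arcs V) (subset_prob.h col_pmf ?Q) m +
     measure_pmf.prob (Pi_pmf (all_arcs V) False (\<lambda>_. bernoulli_pmf p)) {b. card {a\<in>all_arcs V. b a} > m}"
    by (rule subset_prob.transfer_lower[OF subset_prob_arcs p m]) (rule rainbow_tree_mono)
  show ?thesis unfolding subset_prob.prob_Pi_opt[OF subset_prob_arcs refl]
    by (rule order.trans[OF t add_right_mono[OF a]])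
qed

lemma prob_digraph_le:
  "measure_pmf.prob (random_coloured_digraph n m q) {(G, col). has_rainbow_arborescence G col}
    \<le> measure_pmf.prob (Pi_pmf (all_arcs V) None (\<lambda>_. opt_pmf p {1..q})) {w. card (no_in_arc V w) \<le> 1}
      + measure_pmf.prob (Pi_pmf (all_arcs V) False (\<lambda>_. bernoulli_pmf p)) {b. card {a\<in>all_arcs V. b a} < m}"
proof -
  let ?Q = "\<lambda>w :: nat \<times> nat \<Rightarrow> nat option. card (no_in_arc V w) \<le> 1"
  have "measure_pmf.prob (Pi_pmf B 0 (\<lambda>_. col_pmf)) {col. has_rainbow_arborescence \<lparr>pverts = V, parcs = B\<rparr> col} \<le> subset_prob.h col_pmf ?Q B"
    if B: "B \<subseteq> all_arcs V" for B
    unfolding h_eq[OF B]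
  proof (rule prob_mono)
    fix col :: "nat \<times> nat \<Rightarrow> nat" assume "has_rainbow_arborescence \<lparr>pverts = V, parcs = B\<rparr> col"
    from card_no_in_arc_le_1[OF pair_digraph_sub[OF B] this]
    show "card (no_in_arc V (\<lambda>a. if a \<in> B then Some (col a) else None)) \<le> 1" by simp
  qed
  then have a: "measure_pmf.prob (random_coloured_digraph n m q) {(G, col). has_rainbow_arborescence G col} \<le> subset_prob.avg (all_arcs V) (subset_prob.h col_pmf ?Q) m"
    unfolding prob_random_coloured_digraph[OF m] by (rule avg_le)
  have t: "subset_prob.avg (all_arcs V) (subset_prob.h col_pmf ?Q) m \<le> measure_pmf.expectation (subset_prob.sub_pmf (all_arcs V) p) (subset_prob.h col_pmf ?Q) +
     measure_pmf.prob (Pi_pmf (all_arcs V) False (\<lambda>_. bernoulli_pmf p)) {b. card {a\<in>all_arcs V. b a} < m}"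
    by (rule subset_prob.transfer_upper[OF subset_prob_arcs p m]) (rule card_no_in_arc_mono, simp)
  show ?thesis unfolding subset_prob.prob_Pi_opt[OF subset_prob_arcs refl]
    by (rule order.trans[OF a t])
qed

text \<open>Chernoff with base \<open>1 + \<delta>\<close>. The mean lies \<open>r\<close> below
  \<open>m\<close>, which gives the linear gain \<open>r * \<delta>\<close>; the quadratic loss
  comes from expanding the logarithm, with the factor 2 so that the same bound serves the other
  tail.\<close>

lemma prob_card_gt:
  fixes \<delta> r :: real
  assumes \<delta>: "0 < \<delta>" "\<delta> \<le> 1" and \<mu>: "p * card (all_arcs V) = m - r"
  shows "measure_pmf.prob (Pi_pmf (all_arcs V) False (\<lambda>_. bernoulli_pmf p)) {b. card {a\<in>all_arcs V. b a} > m} \<le> exp (- (r * \<delta>) + 2 * real m * \<delta>\<^sup>2)"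
proof -
  have "measure_pmf.prob (Pi_pmf (all_arcs V) False (\<lambda>_. bernoulli_pmf p)) {b. card {a\<in>all_arcs V. b a} > m}
     \<le> exp (measure_pmf.prob (bernoulli_pmf p) {y. y} * (1 + \<delta> - 1) * card (all_arcs V)) / (1 + \<delta>) ^ m"
    by (rule chernoff_card[where R = "\<lambda>y. y" and P = "\<lambda>k. m < k"]) (use \<delta> in \<open>auto intro: power_increasing\<close>)
  also have "\<dots> = exp ((m - r) * \<delta>) / exp (m * ln (1 + \<delta>))"
  proof -
    have "(1 + \<delta>) ^ m = exp (m * ln (1 + \<delta>))" using \<delta> by (simp add: exp_of_nat_mult)
    moreover have "p * (1 + \<delta> - 1) * card (all_arcs V) = (m - r) * \<delta>" unfolding \<mu>[symmetric] by simp
    ultimately show ?thesis using measure_bernoulli_True[of p] p by simp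
  qed
  also have "\<dots> = exp ((m - r) * \<delta> - m * ln (1 + \<delta>))" by (simp only: exp_diff)
  also have "\<dots> \<le> exp (- (r * \<delta>) + 2 * real m * \<delta>\<^sup>2)"
  proof -
    have "\<delta> - \<delta>\<^sup>2 \<le> ln (1 + \<delta>)" using ln_one_plus_pos_lower_bound[of \<delta>] \<delta> by simp
    then have "real m * (\<delta> - \<delta>\<^sup>2) \<le> m * ln (1 + \<delta>)" by (rule mult_left_mono) simp
    then have "real m * \<delta> \<le> real m * ln (1 + \<delta>) + real m * \<delta>\<^sup>2" by (simp add: algebra_simps)
    also have "\<dots> \<le> real m * ln (1 + \<delta>) + real m * (2 * \<delta>\<^sup>2)" by (intro add_left_mono mult_left_mono) auto
    finally show ?thesis by (simp add: algebra_simps)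
  qed
  finally show ?thesis .
qed

lemma prob_card_less:
  fixes \<delta> r :: real
  assumes \<delta>: "0 < \<delta>" "\<delta> \<le> 1 / 2" and \<mu>: "p * card (all_arcs V) = m + r"
  shows "measure_pmf.prob (Pi_pmf (all_arcs V) False (\<lambda>_. bernoulli_pmf p)) {b. card {a\<in>all_arcs V. b a} < m} \<le> exp (- (r * \<delta>) + 2 * real m * \<delta>\<^sup>2)"
proof -
  have "measure_pmf.prob (Pi_pmf (all_arcs V) False (\<lambda>_. bernoulli_pmf p)) {b. card {a\<in>all_arcs V. b a} < m}
     \<le> exp (measure_pmf.prob (bernoulli_pmf p) {y. y} * (1 - \<delta> - 1) * card (all_arcs V)) / (1 - \<delta>) ^ m"
    by (rule chernoff_card[where R = "\<lambda>y. y" and P = "\<lambda>k. k < m"]) (use \<delta> in \<open>auto intro: power_decreasing\<close>)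
  also have "\<dots> = exp (- ((m + r) * \<delta>)) / exp (m * ln (1 - \<delta>))"
  proof -
    have "(1 - \<delta>) ^ m = exp (m * ln (1 - \<delta>))" using \<delta> by (simp add: exp_of_nat_mult)
    moreover have "p * (1 - \<delta> - 1) * card (all_arcs V) = - ((m + r) * \<delta>)" unfolding \<mu>[symmetric] by simp
    ultimately show ?thesis using measure_bernoulli_True[of p] p by simp
  qed
  also have "\<dots> = exp (- ((m + r) * \<delta>) - m * ln (1 - \<delta>))" by (simp only: exp_diff)
  also have "\<dots> \<le> exp (- (r * \<delta>) + 2 * real m * \<delta>\<^sup>2)"
  proof -
    have "- \<delta> - 2 * \<delta>\<^sup>2 \<le> ln (1 - \<delta>)" using ln_one_minus_pos_lower_bound[of \<delta>] \<delta> by simp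
    then have "real m * (- \<delta> - 2 * \<delta>\<^sup>2) \<le> m * ln (1 - \<delta>)" by (rule mult_left_mono) simp
    then show ?thesis by (simp add: algebra_simps)
  qed
  finally show ?thesis .
qed

end

theorem corollary1p2:
  fixes c :: real and m q :: "nat \<Rightarrow> nat"
  assumes "\<And>n. m n = nat \<lfloor>real n * (ln (real n) + c)\<rfloor> \<or>
               m n = nat \<lceil>real n * (ln (real n) + c)\<rceil>"
    and "\<And>n. q n = nat \<lfloor>(1 + 50 * eps n) * real n\<rfloor> \<or>
             q n = nat \<lceil>(1 + 50 * eps n) * real n\<rceil>"
  shows "(\<lambda>n. measure_pmf.prob (random_coloured_digraph n (m n) (q n))
                {(G, col). has_rainbow_arborescence G col})
           \<longlonglongrightarrow> (1 + exp (- c)) * exp (- exp (- c))"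
proof -
  have m: "eventually (\<lambda>n. \<bar>real (m n) - real n * (ln (real n) + c)\<bar> \<le> 1) sequentially"
  proof -
    have "eventually (\<lambda>n. real n * (ln (real n) + c) \<ge> 0) sequentially" by real_asymp
    then show ?thesis
    proof eventually_elim
      case (elim n)
      then show ?case using assms(1)[of n] by linarith
    qed
  qed
  have q: "eventually (\<lambda>n. \<bar>real (q n) - (1 + 50 * eps n) * real n\<bar> \<le> 1) sequentially"
    and q1: "eventually (\<lambda>n. q n \<ge> 1) sequentially"
  proof -
    have "eventually (\<lambda>n. (1 + 50 * eps n) * real n \<ge> 2) sequentially" unfolding eps_def by real_asymp
    then have "eventually (\<lambda>n. \<bar>real (q n) - (1 + 50 * eps n) * real n\<bar> \<le> 1 \<and> q n \<ge> 1) sequentially"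
    proof eventually_elim
      case (elim n)
      then have "\<bar>real (q n) - (1 + 50 * eps n) * real n\<bar> \<le> 1" using assms(2)[of n] by linarith
      then show ?case using elim by linarith
    qed
    then show "eventually (\<lambda>n. \<bar>real (q n) - (1 + 50 * eps n) * real n\<bar> \<le> 1) sequentially"
      and "eventually (\<lambda>n. q n \<ge> 1) sequentially" by (auto elim: eventually_mono)
  qed
  \<comment> \<open>The number of arcs fluctuates by about the square root of n log n. So a shift by
    \<open>n ^ (2/3)\<close> is safe, yet small enough not to move the limit \<open>c\<close>. With
    this \<open>\<delta>\<close> the gain \<open>r * \<delta> = n ^ (1/4)\<close> beats the loss
    \<open>2 * m * \<delta>\<^sup>2\<close>, which is of order
    \<open>n ^ (1/6) * ln n\<close>.\<close>
  define r where "r n = real n powr (2 / 3)" for n :: nat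
  define \<delta> where "\<delta> n = real n powr (- 5 / 12)" for n :: nat
  \<comment> \<open>\<open>\<sigma> = - 1\<close> puts the mean number of arcs below
    \<open>m\<close>, for the lower bound; \<open>\<sigma> = 1\<close> puts it above, for the upper
    bound.\<close>
  define p where "p \<sigma> n = (real (m n) + \<sigma> * r n) / (real n * real (n - 1))" for \<sigma> :: real and n
  have lim: "(\<lambda>n. real (n - 1) * p \<sigma> n - ln (real n)) \<longlonglongrightarrow> c" for \<sigma>
  proof -
    have "(\<lambda>n. (real (m n) - real n * (ln (real n) + c)) * (1 / real n)) \<longlonglongrightarrow> 0"
    proof (rule Lim_null_comparison)
      show "eventually (\<lambda>n. norm ((real (m n) - real n * (ln (real n) + c)) * (1 / real n)) \<le> 1 / real n) sequentially"
        using m by eventually_elim (simp add: abs_mult divide_right_mono)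
      show "(\<lambda>n. 1 / real n) \<longlonglongrightarrow> 0" by real_asymp
    qed
    moreover have "(\<lambda>n. c + \<sigma> * (r n / real n)) \<longlonglongrightarrow> c + \<sigma> * 0"
    proof (intro tendsto_intros)
      show "(\<lambda>n. r n / real n) \<longlonglongrightarrow> 0" unfolding r_def by real_asymp
    qed
    ultimately have "(\<lambda>n. (real (m n) - real n * (ln (real n) + c)) * (1 / real n) + (c + \<sigma> * (r n / real n))) \<longlonglongrightarrow> 0 + (c + \<sigma> * 0)"
      by (rule tendsto_add)
    moreover have "eventually (\<lambda>n. (real (m n) - real n * (ln (real n) + c)) * (1 / real n) + (c + \<sigma> * (r n / real n))
        = real (n - 1) * p \<sigma> n - ln (real n)) sequentially"
      using eventually_ge_at_top[of "2::nat"]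
    proof eventually_elim
      case (elim n)
      have "real (n - 1) * p \<sigma> n = (real (m n) + \<sigma> * r n) / real n" using elim by (simp add: p_def)
      then show ?case using elim by (simp add: field_simps)
    qed
    ultimately show ?thesis by (simp add: Lim_transform_eventually)
  qed
  have m_le: "eventually (\<lambda>n. m n \<le> card (all_arcs {1..n})) sequentially"
  proof -
    have "eventually (\<lambda>n. real n * (ln (real n) + c) + 1 \<le> real n * (real n - 1)) sequentially" by real_asymp
    then show ?thesis using m eventually_ge_at_top[of "2::nat"]
    proof eventually_elim
      case (elim n)
      have "card (all_arcs {1..n}) = n * (n - 1)" by (simp add: card_all_arcs)
      moreover have "real (n * (n - 1)) = real n * (real n - 1)" using elim by simp
      ultimately show ?case using elim by linarith
    qed
  qed
  have card: "p \<sigma> n * card (all_arcs {1..n}) = real (m n) + \<sigma> * r n" if "n \<ge> 2" for \<sigma> n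
    using that by (simp add: p_def card_all_arcs)
  have \<delta>: "eventually (\<lambda>n. 0 < \<delta> n \<and> \<delta> n \<le> 1 / 2) sequentially"
    using eventually_gt_at_top[of "0::nat"]
  proof -
    have "eventually (\<lambda>n. 0 < \<delta> n) sequentially" "eventually (\<lambda>n. \<delta> n \<le> 1 / 2) sequentially" unfolding \<delta>_def by real_asymp+
    then show ?thesis by eventually_elim simp
  qed
  define dev where "dev n = exp (- (r n * \<delta> n) + 2 * real (m n) * (\<delta> n)\<^sup>2)" for n
  have dev: "dev \<longlonglongrightarrow> 0"
  proof (rule Lim_null_comparison)
    show "eventually (\<lambda>n. norm (dev n) \<le> exp (- (r n * \<delta> n) + 2 * (real n * (ln (real n) + c) + 1) * (\<delta> n)\<^sup>2)) sequentially"
      using m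
    proof eventually_elim
      case (elim n)
      have "2 * real (m n) * (\<delta> n)\<^sup>2 \<le> 2 * (real n * (ln (real n) + c) + 1) * (\<delta> n)\<^sup>2"
      proof (rule mult_right_mono)
        show "2 * real (m n) \<le> 2 * (real n * (ln (real n) + c) + 1)"
          using abs_le_D1[OF elim] by (simp only: mult_le_cancel_left_pos zero_less_numeral diff_le_eq add.commute)
      qed simp
      then show ?case by (simp add: dev_def)
    qed
    show "(\<lambda>n. exp (- (r n * \<delta> n) + 2 * (real n * (ln (real n) + c) + 1) * (\<delta> n)\<^sup>2)) \<longlonglongrightarrow> 0"
      unfolding r_def \<delta>_def by real_asymp
  qed
  define src where "src \<sigma> n = measure_pmf.prob (Pi_pmf (all_arcs {1..n}) None (\<lambda>_. opt_pmf (p \<sigma> n) {1..q n})) {w. card (no_in_arc {1..n} w) \<le> 1}" for \<sigma> n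
  have src: "src \<sigma> \<longlonglongrightarrow> (1 + exp (- c)) * exp (- exp (- c))" for \<sigma>
    unfolding src_def by (rule prob_at_most_one_source_tendsto[OF lim q1])
  obtain E where E: "E \<longlonglongrightarrow> 0" "eventually (\<lambda>n. src (- 1) n
      \<le> measure_pmf.prob (Pi_pmf (all_arcs {1..n}) None (\<lambda>_. opt_pmf (p (- 1) n) {1..q n})) {w. rainbow_tree {1..n} w} + E n) sequentially"
    unfolding src_def by (rule prob_rainbow_tree_gap[OF lim q])
  let ?D = "\<lambda>n. measure_pmf.prob (random_coloured_digraph n (m n) (q n)) {(G, col). has_rainbow_arborescence G col}"
  show ?thesis
  proof (rule tendsto_sandwich)
    show "eventually (\<lambda>n. src (- 1) n - E n - dev n \<le> ?D n) sequentially"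
      using E(2) edge_probability_tendsto(3)[OF lim[of "- 1"]] m_le \<delta> eventually_ge_at_top[of "2::nat"]
    proof eventually_elim
      case (elim n)
      have p: "0 < p (- 1) n" "p (- 1) n < 1" using elim(2) by auto
      have \<mu>: "p (- 1) n * card (all_arcs {1..n}) = real (m n) - r n" using card[OF elim(5), of "- 1"] by simp
      have dv: "measure_pmf.prob (Pi_pmf (all_arcs {1..n}) False (\<lambda>_. bernoulli_pmf (p (- 1) n))) {b. card {a\<in>all_arcs {1..n}. b a} > m n} \<le> dev n"
        unfolding dev_def by (rule prob_card_gt[OF p elim(3) _ _ \<mu>]) (use elim(4) in auto)
      have "src (- 1) n \<le> (?D n + dev n) + E n"
        by (rule order.trans[OF elim(1) add_right_mono[OF order.trans[OF prob_digraph_ge[OF p elim(3)] add_left_mono[OF dv]]]])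
      then show ?case by (simp add: algebra_simps)
    qed
    show "eventually (\<lambda>n. ?D n \<le> src 1 n + dev n) sequentially"
      using edge_probability_tendsto(3)[OF lim[of 1]] m_le \<delta> eventually_ge_at_top[of "2::nat"]
    proof eventually_elim
      case (elim n)
      have p: "0 < p 1 n" "p 1 n < 1" using elim(1) by auto
      have \<mu>: "p 1 n * card (all_arcs {1..n}) = real (m n) + r n" using card[OF elim(4), of 1] by simp
      have dv: "measure_pmf.prob (Pi_pmf (all_arcs {1..n}) False (\<lambda>_. bernoulli_pmf (p 1 n))) {b. card {a\<in>all_arcs {1..n}. b a} < m n} \<le> dev n"
        unfolding dev_def by (rule prob_card_less[OF p elim(2) _ _ \<mu>]) (use elim(3) in auto)
      show ?case unfolding src_def
        by (rule order.trans[OF prob_digraph_le[OF p elim(2)] add_left_mono[OF dv]])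
    qed
    have "(\<lambda>n. src (- 1) n - E n - dev n) \<longlonglongrightarrow> (1 + exp (- c)) * exp (- exp (- c)) - 0 - 0"
      by (intro tendsto_diff src E dev)
    then show "(\<lambda>n. src (- 1) n - E n - dev n) \<longlonglongrightarrow> (1 + exp (- c)) * exp (- exp (- c))" by simp
    have "(\<lambda>n. src 1 n + dev n) \<longlonglongrightarrow> (1 + exp (- c)) * exp (- exp (- c)) + 0"
      by (intro tendsto_add src dev)
    then show "(\<lambda>n. src 1 n + dev n) \<longlonglongrightarrow> (1 + exp (- c)) * exp (- exp (- c))" by simp
  qed
qed

end
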